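(* Let $1\le p,q\le\infty$. For any $T\in\mathbb{R}^{d\times d}$ with corresponding Cohen-type matrix $A=A_T\in\mathrm{GL}(2d,\mathbb{R})$, and any symbol $\sigma\in M^{\infty,1}(\mathbb{R}^{2d})$, the operator $\mathrm{op}_A(\sigma)$ is bounded on $W(\mathcal{F}L^p,L^q)(\mathbb{R}^d)$ with $$\|\mathrm{op}_A(\sigma)\|_{W(\mathcal{F}L^p,L^q)\to W(\mathcal{F}L^p,L^q)}\le C_A\,\|\sigma\|_{M^{\infty,1}}$$ for a suitable constant $C_A>0$ (independent of $\sigma$).
   Context: For a fixed nonzero Schwartz window $g$ on $\mathbb{R}^n$, $V_gf(x,\omega)=\langle f,e^{2\pi i\omega\cdot(\,\cdot\,)}g(\cdot-x)\rangle$ is the short-time Fourier transform. The spaces $M^{p,q}(\mathbb{R}^n)$ and $W(\mathcal{F}L^p,L^q)(\mathbb{R}^n)$ consist of the tempered distributions with finite norm, respectively, $$\|f\|_{M^{p,q}}=\Big(\int\Big(\int|V_gf(x,\omega)|^p\,dx\Big)^{q/p}d\omega\Big)^{1/q},\qquad \|f\|_{W(\mathcal{F}L^p,L^q)}=\Big(\int\Big(\int|V_gf(x,\omega)|^p\,d\omega\Big)^{q/p}dx\Big)^{1/q}$$ (usual modifications for infinite indices); $M^p=M^{p,p}$, $M^\infty=(M^1)'$. The space $M^{\infty,1}$ is the Sjöstrand class. For $T\in\mathbb{R}^{d\times d}$ the Cohen-type matrix is $A_T=\begin{pmatrix} I & T \\ I & -(I-T) \end{pmatrix}$, with associated distribution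 $$\mathcal{B}_{A_T}(f,g)(x,\omega)=\int_{\mathbb{R}^d}e^{-2\pi i\omega\cdot y}f(x+Ty)\,\overline{g(x-(I-T)y)}\,dy .$$ For $\sigma\in M^\infty(\mathbb{R}^{2d})$, the operator $\mathrm{op}_A(\sigma)=\sigma^A:M^1(\mathbb{R}^d)\to M^\infty(\mathbb{R}^d)$ is defined by $\langle\sigma^Af,g\rangle=\langle\sigma,\mathcal{B}_A(g,f)\rangle$ for $f,g\in M^1(\mathbb{R}^d)$, with $\langle\cdot,\cdot\rangle$ extending the $L^2$ inner product (conjugate-linear in the second argument). Boundedness means that $\sigma^A$, initially defined on $M^1(\mathbb{R}^d)$, extends to a bounded operator on the stated space with the stated norm bound. *)

theory Defs
  imports "HOL-Analysis.Analysis" "HOL-Probability.Essential_Supremum"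
begin

section \<open>Schwartz functions and tempered distributions\<close>

fun iter_deriv :: "'a list \<Rightarrow> ('a::euclidean_space \<Rightarrow> complex) \<Rightarrow> 'a \<Rightarrow> complex" where
  "iter_deriv [] f = f"
| "iter_deriv (b # bs) f = (\<lambda>x. frechet_derivative (iter_deriv bs f) (at x) b)"

definition schwartz :: "('a::euclidean_space \<Rightarrow> complex) set" where
  "schwartz = {f. \<forall>bs. set bs \<subseteq> Basis \<longrightarrow>
     (\<forall>x. iter_deriv bs f differentiable (at x)) \<and>
     (\<forall>k::nat. bounded (range (\<lambda>x. norm x ^ k *\<^sub>R iter_deriv bs f x)))}"

definition schwartz_seminorm :: "nat \<Rightarrow> ('a::euclidean_space \<Rightarrow> complex) \<Rightarrow> real" where
  "schwartz_seminorm N f =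
     (\<Sum>k\<le>N. \<Sum>bs\<in>{bs. set bs \<subseteq> Basis \<and> length bs \<le> N}.
        SUP x. norm x ^ k * norm (iter_deriv bs f x))"

text \<open>
  A distribution \<open>u\<close> is encoded by \<open>\<phi> \<mapsto> \<langle>u, \<phi>\<rangle>\<close>, where the bracket extends the \<open>L\<^sup>2\<close> inner
  product; it is therefore conjugate-linear in \<open>\<phi>\<close>. Outside the Schwartz space the value is
  fixed to be 0, so that equality in HOL is equality of distributions.
\<close>

type_synonym 'a distr = "('a \<Rightarrow> complex) \<Rightarrow> complex"

definition tempered :: "'a::euclidean_space distr \<Rightarrow> bool" where
  "tempered u \<longleftrightarrow>
     (\<forall>\<phi>. \<phi> \<notin> schwartz \<longrightarrow> u \<phi> = 0) \<and>
     (\<forall>\<phi>\<in>schwartz. \<forall>\<psi>\<in>schwartz. \<forall>a b.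
        u (\<lambda>x. a * \<phi> x + b * \<psi> x) = cnj a * u \<phi> + cnj b * u \<psi>) \<and>
     (\<exists>N C. \<forall>\<phi>\<in>schwartz. norm (u \<phi>) \<le> C * schwartz_seminorm N \<phi>)"

definition distr_of_fun :: "('a::euclidean_space \<Rightarrow> complex) \<Rightarrow> 'a distr" where
  "distr_of_fun f = (\<lambda>\<phi>. if \<phi> \<in> schwartz then LINT t|lborel. f t * cnj (\<phi> t) else 0)"


section \<open>Modulation and Wiener amalgam spaces\<close>

definition stft :: "('a::euclidean_space \<Rightarrow> complex) \<Rightarrow> 'a distr \<Rightarrow> 'a \<Rightarrow> 'a \<Rightarrow> complex" where
  "stft g u x \<omega> = u (\<lambda>t. cis (2 * pi * (\<omega> \<bullet> t)) * g (t - x))"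

definition ennreal_powr :: "ennreal \<Rightarrow> real \<Rightarrow> ennreal" where
  "ennreal_powr a r = (if a = \<infinity> then \<infinity> else ennreal (enn2real a powr r))"

definition Lp_norm :: "ennreal \<Rightarrow> ('a::euclidean_space \<Rightarrow> ennreal) \<Rightarrow> ennreal" where
  "Lp_norm p h =
     (if p = \<infinity> then esssup lborel h
      else ennreal_powr (\<integral>\<^sup>+x. ennreal_powr (h x) (enn2real p) \<partial>lborel) (1 / enn2real p))"

definition modulation_norm ::
  "('a::euclidean_space \<Rightarrow> complex) \<Rightarrow> ennreal \<Rightarrow> ennreal \<Rightarrow> 'a distr \<Rightarrow> ennreal" where
  "modulation_norm g p q u =
     Lp_norm q (\<lambda>\<omega>. Lp_norm p (\<lambda>x. ennreal (norm (stft g u x \<omega>))))"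

definition modulation_space ::
  "('a::euclidean_space \<Rightarrow> complex) \<Rightarrow> ennreal \<Rightarrow> ennreal \<Rightarrow> 'a distr set" where
  "modulation_space g p q = {u. tempered u \<and> modulation_norm g p q u < \<infinity>}"

definition wiener_norm ::
  "('a::euclidean_space \<Rightarrow> complex) \<Rightarrow> ennreal \<Rightarrow> ennreal \<Rightarrow> 'a distr \<Rightarrow> ennreal" where
  "wiener_norm g p q u =
     Lp_norm q (\<lambda>x. Lp_norm p (\<lambda>\<omega>. ennreal (norm (stft g u x \<omega>))))"

definition wiener_space ::
  "('a::euclidean_space \<Rightarrow> complex) \<Rightarrow> ennreal \<Rightarrow> ennreal \<Rightarrow> 'a distr set" where
  "wiener_space g p q = {u. tempered u \<and> wiener_norm g p q u < \<infinity>}"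

text \<open>
  The space \<open>M\<^sup>1\<close> embeds into \<open>L\<^sup>1\<close> and into the continuous functions. Since its elements have to
  be evaluated pointwise below, each of them is represented by its unique continuous integrable
  representative.
\<close>

definition M1 :: "('a::euclidean_space \<Rightarrow> complex) \<Rightarrow> ('a \<Rightarrow> complex) set" where
  "M1 g = {f. continuous_on UNIV f \<and> integrable lborel f \<and>
              distr_of_fun f \<in> modulation_space g 1 1}"

text \<open>
  The duality between \<open>M\<^sup>\<infinity> = (M\<^sup>1)'\<close> and \<open>M\<^sup>1\<close>: an element \<open>u\<close> of \<open>M\<^sup>\<infinity>\<close> is bounded in
  the \<open>M\<^sup>1\<close>-norm on the Schwartz space, which is dense in \<open>M\<^sup>1\<close>, and \<open>\<langle>u, F\<rangle>\<close> is its extension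
  by continuity.
\<close>

definition duality :: "('a::euclidean_space \<Rightarrow> complex) \<Rightarrow> 'a distr \<Rightarrow> ('a \<Rightarrow> complex) \<Rightarrow> complex" where
  "duality g u F =
     (THE c. \<forall>\<phi>. (\<forall>n::nat. \<phi> n \<in> schwartz) \<and>
        (\<lambda>n. modulation_norm g 1 1 (distr_of_fun (\<lambda>t. \<phi> n t - F t))) \<longlonglongrightarrow> 0
        \<longrightarrow> (\<lambda>n. u (\<phi> n)) \<longlonglongrightarrow> c)"


section \<open>Matrix-Wigner distributions and the associated operators\<close>

text \<open>
  Square matrices of size \<open>2d\<close> are indexed by \<open>'d + 'd\<close>, phase space is \<open>real^'d \<times> real^'d\<close>.
\<close>

definition join_vec :: "real^'d \<Rightarrow> real^'d \<Rightarrow> real^('d + 'd)" where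
  "join_vec x y = (\<chi> i. case i of Inl j \<Rightarrow> x $ j | Inr j \<Rightarrow> y $ j)"

definition upper_vec :: "real^('d + 'd) \<Rightarrow> real^'d" where
  "upper_vec z = (\<chi> j. z $ Inl j)"

definition lower_vec :: "real^('d + 'd) \<Rightarrow> real^'d" where
  "lower_vec z = (\<chi> j. z $ Inr j)"

definition block_matrix ::
  "real^'d^'d \<Rightarrow> real^'d^'d \<Rightarrow> real^'d^'d \<Rightarrow> real^'d^'d \<Rightarrow> real^('d + 'd)^('d + 'd)" where
  "block_matrix P Q R S =
     (\<chi> i j. case (i, j) of
        (Inl k, Inl l) \<Rightarrow> P $ k $ l
      | (Inl k, Inr l) \<Rightarrow> Q $ k $ l
      | (Inr k, Inl l) \<Rightarrow> R $ k $ l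
      | (Inr k, Inr l) \<Rightarrow> S $ k $ l)"

definition cohen_matrix :: "real^'d^'d \<Rightarrow> real^('d + 'd)^('d + 'd)" where
  "cohen_matrix T = block_matrix (mat 1) T (mat 1) (- (mat 1 - T))"

text \<open>
  For an arbitrary matrix \<open>A\<close> this is the partial Fourier transform, in the second variable, of
  \<open>(f \<otimes> cnj g) \<circ> A\<close>; the lemma \<open>matrix_wigner_cohen\<close> below gives its form for \<open>A\<^sub>T\<close>.
\<close>

definition matrix_wigner ::
  "real^('d + 'd)^('d + 'd) \<Rightarrow> (real^'d \<Rightarrow> complex) \<Rightarrow> (real^'d \<Rightarrow> complex) \<Rightarrow>
   (real^'d) \<times> (real^'d) \<Rightarrow> complex" where
  "matrix_wigner A f g = (\<lambda>(x, \<omega>).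
     LINT y|lborel. cis (- 2 * pi * (\<omega> \<bullet> y)) *
       f (upper_vec (A *v join_vec x y)) * cnj (g (lower_vec (A *v join_vec x y))))"

lemma block_matrix_vec:
  "block_matrix P Q R S *v join_vec x y = join_vec (P *v x + Q *v y) (R *v x + S *v y)"
proof -
  have "sum h UNIV = (\<Sum>k\<in>UNIV. h (Inl k)) + (\<Sum>k\<in>UNIV. h (Inr k))"
    for h :: "'a + 'a \<Rightarrow> real"
    unfolding UNIV_Plus_UNIV[symmetric] by (subst sum.Plus) (auto simp: comp_def)
  then show ?thesis
    by (simp add: vec_eq_iff matrix_vector_mult_def block_matrix_def join_vec_def split: sum.split)
qed

lemma upper_join [simp]: "upper_vec (join_vec x y) = x"
  and lower_join [simp]: "lower_vec (join_vec x y) = y"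
  by (simp_all add: upper_vec_def lower_vec_def join_vec_def vec_eq_iff)

lemma join_upper_lower: "join_vec (upper_vec z) (lower_vec z) = z"
  by (simp add: upper_vec_def lower_vec_def join_vec_def vec_eq_iff split: sum.split)

lemma matrix_wigner_cohen:
  "matrix_wigner (cohen_matrix T) f g (x, \<omega>) =
     (LINT y|lborel. cis (- 2 * pi * (\<omega> \<bullet> y)) *
        f (x + T *v y) * cnj (g (x - (mat 1 - T) *v y)))"
proof -
  have "(T - mat 1) *v y = - ((mat 1 - T) *v y)" for y
    by (simp add: matrix_vector_mult_diff_rdistrib)
  then show ?thesis
    by (simp add: matrix_wigner_def cohen_matrix_def block_matrix_vec)
qed

lemma invertible_cohen_matrix: "invertible (cohen_matrix T)"
proof -
  have "z = 0" if "cohen_matrix T *v z = 0" for z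
  proof -
    define x y where "x = upper_vec z" and "y = lower_vec z"
    have z: "z = join_vec x y" by (simp add: x_def y_def join_upper_lower)
    have zero: "upper_vec 0 = (0 :: real^'a)" "lower_vec 0 = (0 :: real^'a)"
      by (simp_all add: upper_vec_def lower_vec_def vec_eq_iff)
    have "join_vec (x + T *v y) (x + (- (mat 1 - T)) *v y) = 0"
      using that by (simp add: z cohen_matrix_def block_matrix_vec)
    then have "x + T *v y = 0" "x + (- (mat 1 - T)) *v y = 0"
      by (metis upper_join zero(1), metis lower_join zero(2))
    moreover have "(- (mat 1 - T)) *v y = T *v y - y"
      by (simp add: matrix_vector_mult_diff_rdistrib)
    ultimately have "y = 0" "x = 0" by (auto simp: algebra_simps)
    then show ?thesis by (simp add: z join_vec_def vec_eq_iff split: sum.split)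
  qed
  then show ?thesis
    by (simp add: invertible_left_inverse matrix_left_invertible_ker)
qed

text \<open>
  For \<open>f \<in> M\<^sup>1\<close>, the distribution \<open>op_A g G A \<sigma> f \<in> M\<^sup>\<infinity>\<close> is characterised by
  \<open>\<langle>op_A g G A \<sigma> f, \<phi>\<rangle> = \<langle>\<sigma>, matrix_wigner A \<phi> f\<rangle>\<close> for all \<open>\<phi> \<in> M\<^sup>1\<close>. The windows \<open>g\<close> and \<open>G\<close>
  are those used in the norms over \<open>real^'d\<close> and over phase space.
\<close>

definition op_A ::
  "(real^'d \<Rightarrow> complex) \<Rightarrow> ((real^'d) \<times> (real^'d) \<Rightarrow> complex) \<Rightarrow> real^('d + 'd)^('d + 'd) \<Rightarrow>
   ((real^'d) \<times> (real^'d)) distr \<Rightarrow> (real^'d \<Rightarrow> complex) \<Rightarrow> (real^'d) distr" where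
  "op_A g G A \<sigma> f =
     (THE h. h \<in> modulation_space g \<infinity> \<infinity> \<and>
        (\<forall>\<phi>\<in>M1 g. duality g h \<phi> = duality G \<sigma> (matrix_wigner A \<phi> f)))"

definition linear_map_on :: "'a::euclidean_space distr set \<Rightarrow> ('a distr \<Rightarrow> 'a distr) \<Rightarrow> bool" where
  "linear_map_on X S \<longleftrightarrow>
     (\<forall>u\<in>X. S u \<in> X) \<and>
     (\<forall>u\<in>X. \<forall>v\<in>X. \<forall>a b. S (\<lambda>\<phi>. a * u \<phi> + b * v \<phi>) = (\<lambda>\<phi>. a * S u \<phi> + b * S v \<phi>))"

definition wiener_op_norm ::
  "('a::euclidean_space \<Rightarrow> complex) \<Rightarrow> ennreal \<Rightarrow> ennreal \<Rightarrow> ('a distr \<Rightarrow> 'a distr) \<Rightarrow> ennreal" where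
  "wiener_op_norm g p q S =
     (SUP u\<in>{u \<in> wiener_space g p q. wiener_norm g p q u \<le> 1}. wiener_norm g p q (S u))"

end

theory Submission
  imports Defs "HOL-Probability.Characteristic_Functions" "HOL-Probability.Sinc_Integral"
begin

text \<open>
  Write \<open>\<pi>(z) g\<close> for the time-frequency shift \<open>tfs z g\<close>. A distribution \<open>u\<close> is recovered from its
  short-time Fourier transform by \<open>\<parallel>g\<parallel>\<^sup>2 \<langle>u, \<phi>\<rangle> = \<integral> \<langle>u, \<pi>(z) g\<rangle> cnj (V\<^sub>g \<phi> (z)) dz\<close>, so an operator is
  described by its matrix with respect to the shifts of \<open>g\<close>. The matrix-Wigner distribution of
  \<open>(\<pi>(w) g, \<pi>(z) g)\<close> is, up to a phase, a time-frequency shift of the Schwartz function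
  \<open>\<Phi> = B\<^sub>A (g, g)\<close> whose frequency part depends on \<open>w - z\<close> only. Hence the matrix entries of \<open>op\<^sub>A \<sigma>\<close>
  are values of \<open>V\<^sub>\<Phi> \<sigma>\<close>, and they are dominated by \<open>H (w - z)\<close>, where \<open>H\<close> is integrable with norm
  at most a constant times the norm of \<open>\<sigma>\<close> in \<open>M\<^sup>\<infinity>\<^sup>,\<^sup>1\<close>. Therefore \<open>V\<^sub>g (op\<^sub>A \<sigma> u)\<close> is dominated by the
  convolution of \<open>V\<^sub>g u\<close> with an integrable function, and Minkowski's integral inequality in the
  mixed norm gives the claim. The same matrix defines the operator on all of \<open>W(F L\<^sup>p, L\<^sup>q)\<close>, also
  when \<open>M\<^sup>1\<close> is not dense in it.
\<close>

section \<open>Schwartz functions\<close>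

text \<open>The estimate alone would not suffice, because \<open>op_A\<close> is given by a
  description: it is the unique solution of an identity between pairings, and each pairing is itself
  a limit along Schwartz functions. Hence density of the Schwartz functions in \<open>M1\<close>, an
  absolutely convergent integral for the pairing, and uniqueness of the solution have to be proved
  as well. The latter two rest on \<open>tempered_integral\<close>: a tempered distribution may be
  moved inside an integral although only its seminorm bound is available; Riemann sums achieve this.
  The symbol norm takes a supremum over positions and an integral over frequencies. This is why only
  the frequency part of the shift has to be a function of w - z: the position part, which carries T,
  disappears in the supremum. Passing from the window \<Phi> to the window G of the norm costs a
  further convolution. The constant obtained is ||g||^-4 ||V_g g||_1 ||G||^-2 ||V_G \<Phi>||_1 plus
  1, with L^2 norms of windows and L^1 norms of transforms; it depends on T through \<Phi> only, and
  not on p or q.\<close>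

definition dird :: "'a \<Rightarrow> ('a::euclidean_space \<Rightarrow> complex) \<Rightarrow> 'a \<Rightarrow> complex" where
  "dird b f = (\<lambda>x. frechet_derivative f (at x) b)"

lemma iter_deriv_Cons: "iter_deriv (b # bs) f = dird b (iter_deriv bs f)"
  by (simp add: dird_def)

declare iter_deriv.simps(2) [simp del]

lemma iter_deriv_append: "iter_deriv (as @ bs) f = iter_deriv as (iter_deriv bs f)"
  by (induction as) (simp_all add: iter_deriv_Cons)

lemma iter_deriv_dird: "iter_deriv bs (dird b f) = iter_deriv (bs @ [b]) f"
  by (simp add: iter_deriv_append iter_deriv_Cons)

lemma dird_eq: "(f has_derivative F') (at x) \<Longrightarrow> dird b f x = F' b"
  unfolding dird_def by (metis frechet_derivative_at)

lemma schwartz_differentiable: "f \<in> schwartz \<Longrightarrow> f differentiable (at x)"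
  unfolding schwartz_def by (auto dest!: spec[of _ "[]"])

lemma schwartz_dird:
  assumes "f \<in> schwartz" "b \<in> Basis" shows "dird b f \<in> schwartz"
  unfolding schwartz_def
proof (intro CollectI allI impI)
  fix bs :: "'a list" assume "set bs \<subseteq> Basis"
  with assms have *: "set (bs @ [b]) \<subseteq> Basis" by simp
  from assms(1) this show "(\<forall>x. iter_deriv bs (dird b f) differentiable at x) \<and>
       (\<forall>k. bounded (range (\<lambda>x. norm x ^ k *\<^sub>R iter_deriv bs (dird b f) x)))"
    unfolding iter_deriv_dird schwartz_def by blast
qed

text \<open>Writing the derivative as a finite combination of partial derivatives keeps every
  directional derivative inside the Schwartz space, which is the form that
  \<open>schwartz_coinduct\<close> asks for.\<close>

lemma schwartz_has_derivative:
  assumes "f \<in> schwartz"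
  shows "(f has_derivative (\<lambda>h. \<Sum>b\<in>Basis. of_real (h \<bullet> b) * dird b f x)) (at x)"
proof -
  let ?D = "frechet_derivative f (at x)"
  have D: "(f has_derivative ?D) (at x)"
    using schwartz_differentiable[OF assms] frechet_derivative_works by blast
  then interpret bounded_linear ?D by (rule has_derivative_bounded_linear)
  have "?D = (\<lambda>h. \<Sum>b\<in>Basis. of_real (h \<bullet> b) * dird b f x)"
  proof
    fix h
    have "?D h = ?D (\<Sum>b\<in>Basis. (h \<bullet> b) *\<^sub>R b)" by (simp add: euclidean_representation)
    also have "\<dots> = (\<Sum>b\<in>Basis. of_real (h \<bullet> b) * dird b f x)"
      by (simp add: sum scaleR dird_def scaleR_conv_of_real)
    finally show "?D h = (\<Sum>b\<in>Basis. of_real (h \<bullet> b) * dird b f x)" .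
  qed
  with D show ?thesis by simp
qed

lemma schwartz_power_bound:
  assumes "f \<in> schwartz" obtains C where "\<And>x. norm x ^ k * norm (f x) \<le> C"
proof -
  from assms have "bounded (range (\<lambda>x. norm x ^ k *\<^sub>R iter_deriv [] f x))"
    unfolding schwartz_def by (auto dest!: spec[of _ "[]"])
  then show ?thesis using that unfolding bounded_iff by auto
qed

section \<open>Finite complex spans and a closure criterion for Schwartz functions\<close>

inductive_set cspan :: "('a \<Rightarrow> complex) set \<Rightarrow> ('a \<Rightarrow> complex) set" for P where
  zero: "(\<lambda>_. 0) \<in> cspan P"
| step: "f \<in> P \<Longrightarrow> h \<in> cspan P \<Longrightarrow> (\<lambda>x. c * f x + h x) \<in> cspan P"

lemma cspan_base: assumes "f \<in> P" shows "f \<in> cspan P"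
  using cspan.step[OF assms cspan.zero, of 1] by simp

lemma cspan_add: "f \<in> cspan P \<Longrightarrow> h \<in> cspan P \<Longrightarrow> (\<lambda>x. f x + h x) \<in> cspan P"
proof (induction rule: cspan.induct)
  case (step f h' c)
  then have "(\<lambda>x. c * f x + (h' x + h x)) \<in> cspan P" by (intro cspan.step) auto
  then show ?case by (simp add: add.assoc)
qed simp

lemma cspan_scale: "f \<in> cspan P \<Longrightarrow> (\<lambda>x. a * f x) \<in> cspan P"
proof (induction rule: cspan.induct)
  case (step f h c)
  then have "(\<lambda>x. (a * c) * f x + a * h x) \<in> cspan P" by (intro cspan.step)
  then show ?case by (simp add: algebra_simps)
qed (simp add: cspan.zero)

lemma cspan_sum:
  "finite I \<Longrightarrow> (\<And>i. i \<in> I \<Longrightarrow> F i \<in> cspan P) \<Longrightarrow> (\<lambda>x. \<Sum>i\<in>I. c i * F i x) \<in> cspan P"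
  by (induction I rule: finite_induct) (auto intro!: cspan.zero cspan_add cspan_scale)

text \<open>Multiplication by \<open>m\<close> is linear, so only generators need to be
  checked.\<close>

lemma cspan_map:
  assumes "f \<in> cspan P" "\<And>f. f \<in> P \<Longrightarrow> (\<lambda>x. m x * f x) \<in> cspan Q"
  shows "(\<lambda>x. m x * f x) \<in> cspan Q"
  using assms(1)
proof induction
  case (step f h c)
  have "(\<lambda>x. c * (m x * f x) + m x * h x) \<in> cspan Q"
    using step assms(2)[of f] by (intro cspan_add cspan_scale) auto
  then show ?case by (simp add: algebra_simps)
qed (simp add: cspan.zero)

text \<open>Proves membership in the Schwartz space without ever computing an iterated derivative.\<close>

theorem schwartz_coinduct:
  fixes P :: "('a::euclidean_space \<Rightarrow> complex) set"
  assumes bdd: "\<And>F. F \<in> P \<Longrightarrow> bounded (range F)"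
    and der: "\<And>F. F \<in> P \<Longrightarrow> \<exists>F'. (\<forall>x. (F has_derivative F' x) (at x)) \<and>
                 (\<forall>b\<in>Basis. (\<lambda>x. F' x b) \<in> cspan P)"
    and coord: "\<And>F b. F \<in> P \<Longrightarrow> b \<in> Basis \<Longrightarrow> (\<lambda>x. of_real (x \<bullet> b) * F x) \<in> cspan P"
    and F: "F \<in> cspan P"
  shows "F \<in> schwartz"
proof -
  have bdd': "\<exists>C. \<forall>x. norm (F x) \<le> C" if "F \<in> cspan P" for F
    using that
  proof induction
    case (step f h c)
    from bdd[OF step(1)] obtain C1 where "\<And>x. norm (f x) \<le> C1" unfolding bounded_iff by auto
    moreover from step obtain C2 where "\<And>x. norm (h x) \<le> C2" by blast
    ultimately have "norm (c * f x + h x) \<le> norm c * C1 + C2" for x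
      by (intro order_trans[OF norm_triangle_ineq] add_mono) (auto simp: norm_mult mult_left_mono)
    then show ?case by blast
  qed auto
  have der': "\<exists>F'. (\<forall>x. (F has_derivative F' x) (at x)) \<and> (\<forall>b\<in>Basis. (\<lambda>x. F' x b) \<in> cspan P)"
    if "F \<in> cspan P" for F
    using that
  proof induction
    case zero
    show ?case by (rule exI[of _ "\<lambda>x h. 0"]) (auto intro: cspan.zero)
  next
    case (step f h c)
    from der[OF step(1)] obtain f' where f': "\<And>x. (f has_derivative f' x) (at x)"
      "\<And>b. b \<in> Basis \<Longrightarrow> (\<lambda>x. f' x b) \<in> cspan P" by blast
    from step obtain h' where h': "\<And>x. (h has_derivative h' x) (at x)"
      "\<And>b. b \<in> Basis \<Longrightarrow> (\<lambda>x. h' x b) \<in> cspan P" by blast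
    show ?case
      by (rule exI[of _ "\<lambda>x v. c * f' x v + h' x v"])
         (auto intro!: derivative_eq_intros f' h' cspan_add cspan_scale)
  qed
  have coord': "(\<lambda>x. of_real (x \<bullet> b) * F x) \<in> cspan P" if "F \<in> cspan P" "b \<in> Basis" for F b
    using cspan_map[OF that(1) coord] that(2) by blast
  \<comment> \<open>Only boundedness is assumed of the generators; decay comes from the coordinates.
    Since \<open>norm x\<close> is at most the sum of the absolute coordinates, one more power of
    \<open>norm x\<close> on \<open>F\<close> is paid for by the functions x_b F, which lie in the
    span again.\<close>
  have pow: "\<exists>C. \<forall>x. norm x ^ k * norm (F x) \<le> C" if "F \<in> cspan P" for F k
    using that
  proof (induction k arbitrary: F)
    case (Suc k)
    then have "\<forall>b\<in>Basis. \<exists>C. \<forall>x. norm x ^ k * norm (of_real (x \<bullet> b) * F x) \<le> C"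
      using coord' by blast
    then obtain C where C: "\<And>b x. b \<in> Basis \<Longrightarrow> norm x ^ k * norm (of_real (x \<bullet> b) * F x) \<le> C b"
      by metis
    have "norm x ^ Suc k * norm (F x) \<le> (\<Sum>b\<in>Basis. C b)" for x
    proof -
      have "norm x ^ Suc k * norm (F x) = norm x * (norm x ^ k * norm (F x))" by simp
      also have "\<dots> \<le> (\<Sum>b\<in>Basis. \<bar>x \<bullet> b\<bar>) * (norm x ^ k * norm (F x))"
        by (intro mult_right_mono norm_le_l1) auto
      also have "\<dots> = (\<Sum>b\<in>Basis. norm x ^ k * norm (of_real (x \<bullet> b) * F x))"
        by (simp add: sum_distrib_right sum_distrib_left norm_mult mult_ac)
      also have "\<dots> \<le> (\<Sum>b\<in>Basis. C b)" by (intro sum_mono C)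
      finally show ?thesis .
    qed
    then show ?case by blast
  qed (use bdd' in auto)
  have it: "iter_deriv bs F \<in> cspan P" if "set bs \<subseteq> Basis" for bs
    using that
  proof (induction bs)
    case (Cons b bs)
    then have "iter_deriv bs F \<in> cspan P" "b \<in> Basis" by auto
    from der'[OF this(1)] this(2) obtain F' where F': "\<And>x. (iter_deriv bs F has_derivative F' x) (at x)"
      "(\<lambda>x. F' x b) \<in> cspan P" by blast
    have "iter_deriv (b # bs) F = (\<lambda>x. F' x b)"
      unfolding iter_deriv_Cons by (intro ext dird_eq F')
    with F' show ?case by simp
  qed (simp add: F)
  show ?thesis
    unfolding schwartz_def
  proof (intro CollectI allI impI conjI)
    fix bs :: "'a list" and x assume "set bs \<subseteq> Basis"
    from der'[OF it[OF this]] show "iter_deriv bs F differentiable at x"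
      unfolding differentiable_def by blast
  next
    fix bs :: "'a list" and k :: nat assume "set bs \<subseteq> Basis"
    from pow[OF it[OF this], of k] show "bounded (range (\<lambda>x. norm x ^ k *\<^sub>R iter_deriv bs F x))"
      unfolding bounded_iff by auto
  qed
qed

section \<open>Closure properties of the Schwartz space\<close>

lemma schwartz_bounded: assumes "f \<in> schwartz" shows "bounded (range f)"
  using schwartz_power_bound[OF assms, of 0] unfolding bounded_iff by (metis mult_1 power_0 rangeE)

text \<open>The set \<open>schwartz\<close> cannot itself serve as the family in
  \<open>schwartz_coinduct\<close>, because its closure under coordinate multiplication is what has
  to be shown. Closing it formally under coordinates gives a family to which the criterion
  applies.\<close>

inductive_set schwartz_mono :: "('a::euclidean_space \<Rightarrow> complex) set" where
  base: "f \<in> schwartz \<Longrightarrow> f \<in> schwartz_mono"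
| coord: "f \<in> schwartz_mono \<Longrightarrow> b \<in> Basis \<Longrightarrow> (\<lambda>x. of_real (x \<bullet> b) * f x) \<in> schwartz_mono"

lemma schwartz_mono_subset: "cspan schwartz_mono \<subseteq> (schwartz :: ('a::euclidean_space \<Rightarrow> complex) set)"
proof
  fix F :: "'a \<Rightarrow> complex" assume "F \<in> cspan schwartz_mono"
  then show "F \<in> schwartz"
  proof (rule schwartz_coinduct[rotated 3])
    fix F :: "'a \<Rightarrow> complex" assume "F \<in> schwartz_mono"
    \<comment> \<open>All powers are treated at once: multiplying by a coordinate costs one power of
      \<open>norm x\<close>, so boundedness alone would not pass through the induction.\<close>
    then have "\<forall>k. \<exists>C. \<forall>x. norm x ^ k * norm (F x) \<le> C"
    proof induction
      case (base f)
      then show ?case using schwartz_power_bound by metis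
    next
      case (coord f b)
      show ?case
      proof
        fix k
        from coord obtain C where C: "\<And>x. norm x ^ Suc k * norm (f x) \<le> C" by blast
        have "norm x ^ k * norm (of_real (x \<bullet> b) * f x) \<le> C" for x
        proof -
          have "norm x ^ k * norm (of_real (x \<bullet> b) * f x) = \<bar>x \<bullet> b\<bar> * (norm x ^ k * norm (f x))"
            by (simp add: norm_mult)
          also have "\<dots> \<le> norm x * (norm x ^ k * norm (f x))"
            using coord(2) by (intro mult_right_mono Basis_le_norm) auto
          finally show ?thesis using C[of x] by simp
        qed
        then show "\<exists>C. \<forall>x. norm x ^ k * norm (of_real (x \<bullet> b) * f x) \<le> C" by blast
      qed
    qed
    then have "\<exists>C. \<forall>x. norm x ^ 0 * norm (F x) \<le> C" by blast
    then show "bounded (range F)" unfolding bounded_iff by auto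
  next
    fix F :: "'a \<Rightarrow> complex" assume "F \<in> schwartz_mono"
    then show "\<exists>F'. (\<forall>x. (F has_derivative F' x) (at x)) \<and> (\<forall>b\<in>Basis. (\<lambda>x. F' x b) \<in> cspan schwartz_mono)"
    proof induction
      case (base f)
      have "(\<lambda>x. \<Sum>c\<in>Basis. of_real (b \<bullet> c) * dird c f x) \<in> cspan schwartz_mono" for b
        by (intro cspan_sum cspan_base schwartz_mono.base schwartz_dird base) auto
      then show ?case
        by (intro exI[of _ "\<lambda>x h. \<Sum>c\<in>Basis. of_real (h \<bullet> c) * dird c f x"])
           (auto intro: schwartz_has_derivative base)
    next
      case (coord f b)
      then obtain f' where f': "\<And>x. (f has_derivative f' x) (at x)"
        "\<And>b. b \<in> Basis \<Longrightarrow> (\<lambda>x. f' x b) \<in> cspan schwartz_mono" by blast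
      show ?case
      proof (intro exI conjI allI ballI)
        show "((\<lambda>x. of_real (x \<bullet> b) * f x) has_derivative
                 (\<lambda>h. of_real (h \<bullet> b) * f x + of_real (x \<bullet> b) * f' x h)) (at x)" for x
          by (auto intro!: derivative_eq_intros f')
      next
        fix c :: 'a assume "c \<in> Basis"
        with coord f' show "(\<lambda>x. of_real (c \<bullet> b) * f x + of_real (x \<bullet> b) * f' x c) \<in> cspan schwartz_mono"
          by (intro cspan_add cspan_scale cspan_base cspan_map[OF f'(2)] schwartz_mono.coord)
      qed
    qed
  qed (auto intro: cspan_base schwartz_mono.coord)
qed

lemma schwartz_cspan: assumes "F \<in> cspan schwartz" shows "F \<in> schwartz"
proof -
  from assms have "F \<in> cspan schwartz_mono"
    by induction (auto intro: cspan.intros schwartz_mono.base)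
  then show ?thesis using schwartz_mono_subset by blast
qed

lemma schwartz_coord:
  "f \<in> schwartz \<Longrightarrow> b \<in> Basis \<Longrightarrow> (\<lambda>x. of_real (x \<bullet> b) * f x) \<in> schwartz"
  by (rule subsetD[OF schwartz_mono_subset]) (intro cspan_base schwartz_mono.intros)

lemma schwartz_zero: "(\<lambda>_. 0) \<in> schwartz"
  by (rule schwartz_cspan) (intro cspan.zero)

lemma schwartz_add: "f \<in> schwartz \<Longrightarrow> h \<in> schwartz \<Longrightarrow> (\<lambda>x. f x + h x) \<in> schwartz"
  by (rule schwartz_cspan) (intro cspan_add cspan_base)

lemma schwartz_scale: "f \<in> schwartz \<Longrightarrow> (\<lambda>x. c * f x) \<in> schwartz"
  by (rule schwartz_cspan) (intro cspan_scale cspan_base)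

lemma schwartz_sum:
  "finite I \<Longrightarrow> (\<And>i. i \<in> I \<Longrightarrow> F i \<in> schwartz) \<Longrightarrow> (\<lambda>x. \<Sum>i\<in>I. c i * F i x) \<in> schwartz"
  by (rule schwartz_cspan) (intro cspan_sum cspan_base)

lemma schwartz_diff: assumes "f \<in> schwartz" "h \<in> schwartz" shows "(\<lambda>x. f x - h x) \<in> schwartz"
  using schwartz_add[OF assms(1) schwartz_scale[OF assms(2), of "-1"]] by simp

text \<open>The family of all products is closed: the Leibniz rule yields two products, and a
  coordinate can be moved onto the first factor. The closure lemmas that follow use the same pattern
  with other families.\<close>

lemma schwartz_mult: assumes "f \<in> schwartz" "h \<in> schwartz" shows "(\<lambda>x. f x * h x) \<in> schwartz"
proof -
  let ?P = "{\<lambda>x. f x * h x | f h. f \<in> schwartz \<and> h \<in> schwartz} :: ('a \<Rightarrow> complex) set"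
  have I: "(\<lambda>x. f x * h x) \<in> cspan ?P" if "f \<in> schwartz" "h \<in> schwartz" for f h
    using that by (intro cspan_base) blast
  show ?thesis
  proof (rule schwartz_coinduct[OF _ _ _ I[OF assms]])
    fix F assume "F \<in> ?P"
    then obtain f h where F: "F = (\<lambda>x. f x * h x)" and fh: "f \<in> schwartz" "h \<in> schwartz" by blast
    from schwartz_bounded[OF fh(1)] schwartz_bounded[OF fh(2)] obtain C1 C2
      where C: "\<And>x. norm (f x) \<le> C1" "\<And>x. norm (h x) \<le> C2" unfolding bounded_iff by auto
    have "norm (F x) \<le> C1 * C2" for x
      unfolding F norm_mult using C(1)[of x] C(2)[of x] by (intro mult_mono) (auto intro: order_trans[OF norm_ge_zero])
    then show "bounded (range F)" unfolding bounded_iff by auto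
    show "(\<lambda>x. of_real (x \<bullet> b) * F x) \<in> cspan ?P" if "b \<in> Basis" for b
      using I[OF schwartz_coord[OF fh(1) that] fh(2)] by (simp add: F mult_ac)
    let ?D = "\<lambda>f x v. \<Sum>c\<in>Basis. of_real (v \<bullet> c) * dird c f x"
    have D: "?D f \<in> UNIV" "(\<lambda>x. ?D f x b) \<in> schwartz" if "f \<in> schwartz" for f and b :: 'a
      using that by (auto intro!: schwartz_sum schwartz_dird)
    show "\<exists>F'. (\<forall>x. (F has_derivative F' x) (at x)) \<and> (\<forall>b\<in>Basis. (\<lambda>x. F' x b) \<in> cspan ?P)"
    proof (intro exI conjI allI ballI)
      show "(F has_derivative (\<lambda>v. ?D f x v * h x + f x * ?D h x v)) (at x)" for x
        unfolding F
        by (rule has_derivative_eq_rhs[OF has_derivative_mult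
              [OF schwartz_has_derivative[OF fh(1)] schwartz_has_derivative[OF fh(2)]]]) (simp add: algebra_simps)
      show "(\<lambda>x. ?D f x b * h x + f x * ?D h x b) \<in> cspan ?P" for b
        using I D fh by (intro cspan_add) blast+
    qed
  qed
qed

lemma schwartz_cnj: assumes "f \<in> schwartz" shows "(\<lambda>x. cnj (f x)) \<in> schwartz"
proof -
  let ?P = "{\<lambda>x. cnj (f x) | f. f \<in> schwartz} :: ('a \<Rightarrow> complex) set"
  have I: "(\<lambda>x. cnj (f x)) \<in> cspan ?P" if "f \<in> schwartz" for f
    using that by (intro cspan_base) blast
  show ?thesis
  proof (rule schwartz_coinduct[OF _ _ _ I[OF assms]])
    fix F assume "F \<in> ?P"
    then obtain f where F: "F = (\<lambda>x. cnj (f x))" and f: "f \<in> schwartz" by blast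
    show "bounded (range F)" using schwartz_bounded[OF f] unfolding F bounded_iff by auto
    show "(\<lambda>x. of_real (x \<bullet> b) * F x) \<in> cspan ?P" if "b \<in> Basis" for b
      using I[OF schwartz_coord[OF f that]] by (simp add: F)
    let ?D = "\<lambda>x v. \<Sum>c\<in>Basis. of_real (v \<bullet> c) * dird c f x"
    show "\<exists>F'. (\<forall>x. (F has_derivative F' x) (at x)) \<and> (\<forall>b\<in>Basis. (\<lambda>x. F' x b) \<in> cspan ?P)"
    proof (intro exI conjI allI ballI)
      show "(F has_derivative (\<lambda>v. cnj (?D x v))) (at x)" for x
        unfolding F by (intro has_derivative_cnj schwartz_has_derivative f)
      show "(\<lambda>x. cnj (?D x b)) \<in> cspan ?P" for b
        by (intro I schwartz_sum schwartz_dird f) auto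
    qed
  qed
qed

text \<open>A linear left inverse suffices: through \<open>L'\<close> each coordinate of x is an
  affine function of the coordinates of L x + a, so polynomial factors can be moved into
  \<open>f\<close>. Asking for no more than injectivity covers restrictions to slices.\<close>

lemma schwartz_affine:
  fixes f :: "'b::euclidean_space \<Rightarrow> complex" and L :: "'a::euclidean_space \<Rightarrow> 'b"
  assumes f: "f \<in> schwartz" and L: "linear L" and L': "linear L'" and inv: "\<And>x. L' (L x) = x"
  shows "(\<lambda>x. f (L x + a)) \<in> schwartz"
proof -
  let ?P = "{\<lambda>x. f (L x + a) | f. f \<in> schwartz} :: ('a \<Rightarrow> complex) set"
  have I: "(\<lambda>x. f (L x + a)) \<in> cspan ?P" if "f \<in> schwartz" for f
    using that by (intro cspan_base) blast
  show ?thesis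
  proof (rule schwartz_coinduct[OF _ _ _ I[OF f]])
    fix F assume "F \<in> ?P"
    then obtain f where F: "F = (\<lambda>x. f (L x + a))" and f: "f \<in> schwartz" by blast
    show "bounded (range F)" using schwartz_bounded[OF f] unfolding F bounded_iff by auto
    show "(\<lambda>x. of_real (x \<bullet> b) * F x) \<in> cspan ?P" if "b \<in> Basis" for b
    proof -
      have x: "x \<bullet> b = (\<Sum>c\<in>Basis. (L' c \<bullet> b) * ((L x + a) \<bullet> c)) - L' a \<bullet> b" for x
      proof -
        have lin: "L' y = (\<Sum>c\<in>Basis. (y \<bullet> c) *\<^sub>R L' c)" for y
          by (subst euclidean_representation[symmetric, of y])
             (simp add: linear_sum[OF L'] linear_cmul[OF L'])
        have "L' (L x + a) \<bullet> b = (\<Sum>c\<in>Basis. (L' c \<bullet> b) * ((L x + a) \<bullet> c))"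
          by (subst lin) (simp add: inner_sum_left mult_ac)
        then show ?thesis by (simp add: linear_add[OF L'] inv inner_add_left)
      qed
      have "(\<lambda>y. (\<Sum>c\<in>Basis. of_real (L' c \<bullet> b) * (of_real (y \<bullet> c) * f y)) + of_real (- (L' a \<bullet> b)) * f y) \<in> schwartz"
        by (intro schwartz_add schwartz_sum schwartz_scale schwartz_coord f) auto
      moreover have "(\<Sum>c\<in>Basis. of_real (L' c \<bullet> b) * (of_real ((L x + a) \<bullet> c) * f (L x + a)))
          + of_real (- (L' a \<bullet> b)) * f (L x + a) = of_real (x \<bullet> b) * F x" for x
        unfolding F by (subst x[of x]) (simp add: left_diff_distrib sum_distrib_right mult.assoc)
      ultimately show ?thesis using I by fastforce
    qed
    let ?D = "\<lambda>x v. \<Sum>c\<in>Basis. of_real (v \<bullet> c) * dird c f x"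
    show "\<exists>F'. (\<forall>x. (F has_derivative F' x) (at x)) \<and> (\<forall>b\<in>Basis. (\<lambda>x. F' x b) \<in> cspan ?P)"
    proof (intro exI conjI allI ballI)
      have "((\<lambda>x. L x + a) has_derivative L) (at x)" for x
        using has_derivative_add[OF linear_imp_has_derivative[OF L] has_derivative_const] by simp
      from has_derivative_compose[OF this schwartz_has_derivative[OF f]]
      show "(F has_derivative (\<lambda>v. ?D (L x + a) (L v))) (at x)" for x
        unfolding F .
      show "(\<lambda>x. ?D (L x + a) (L b)) \<in> cspan ?P" for b
        by (rule I) (intro schwartz_sum schwartz_dird f, auto)
    qed
  qed
qed

lemma schwartz_translate: "f \<in> schwartz \<Longrightarrow> (\<lambda>x. f (x - a)) \<in> schwartz"
  using schwartz_affine[of f "\<lambda>x. x" "\<lambda>x. x" "- a"] by (simp add: linear_id[unfolded id_def])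

lemma schwartz_slice:
  assumes "F \<in> schwartz" shows "(\<lambda>y. F (x, y)) \<in> schwartz"
proof -
  have "(\<lambda>y. F ((0, y) + (x, 0))) \<in> schwartz"
    by (rule schwartz_affine[OF assms, where L' = snd])
       (auto intro!: linearI simp: linear_snd)
  then show ?thesis by simp
qed

text \<open>A basis vector of the product space lies in one of the two factors, so multiplication by
  a coordinate affects only one of the two functions.\<close>

lemma schwartz_tensor:
  fixes f :: "'a::euclidean_space \<Rightarrow> complex" and h :: "'b::euclidean_space \<Rightarrow> complex"
  assumes "f \<in> schwartz" "h \<in> schwartz" shows "(\<lambda>x. f (fst x) * h (snd x)) \<in> schwartz"
proof -
  let ?P = "{\<lambda>x. f (fst x) * h (snd x) | f h. f \<in> schwartz \<and> h \<in> schwartz} :: ('a \<times> 'b \<Rightarrow> complex) set"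
  have I: "(\<lambda>x. f (fst x) * h (snd x)) \<in> cspan ?P" if "f \<in> schwartz" "h \<in> schwartz" for f h
    using that by (intro cspan_base) blast
  show ?thesis
  proof (rule schwartz_coinduct[OF _ _ _ I[OF assms]])
    fix F assume "F \<in> ?P"
    then obtain f h where F: "F = (\<lambda>x. f (fst x) * h (snd x))" and fh: "f \<in> schwartz" "h \<in> schwartz" by blast
    from schwartz_bounded[OF fh(1)] schwartz_bounded[OF fh(2)] obtain C1 C2
      where C: "\<And>x. norm (f x) \<le> C1" "\<And>x. norm (h x) \<le> C2" unfolding bounded_iff by auto
    have "norm (F x) \<le> C1 * C2" for x
      unfolding F norm_mult using C(1)[of "fst x"] C(2)[of "snd x"]
      by (intro mult_mono) (auto intro: order_trans[OF norm_ge_zero])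
    then show "bounded (range F)" unfolding bounded_iff by auto
    show "(\<lambda>x. of_real (x \<bullet> b) * F x) \<in> cspan ?P" if "b \<in> Basis" for b
    proof -
      from that consider u where "b = (u, 0)" "u \<in> Basis" | v where "b = (0, v)" "v \<in> Basis"
        unfolding Basis_prod_def by auto
      then show ?thesis
      proof cases
        case 1
        from I[OF schwartz_coord[OF fh(1) 1(2)] fh(2)] show ?thesis by (simp add: F 1 inner_prod_def mult_ac)
      next
        case 2
        from I[OF fh(1) schwartz_coord[OF fh(2) 2(2)]] show ?thesis by (simp add: F 2 inner_prod_def mult_ac)
      qed
    qed
    let ?D = "\<lambda>f x v. \<Sum>c\<in>Basis. of_real (v \<bullet> c) * dird c f x"
    show "\<exists>F'. (\<forall>x. (F has_derivative F' x) (at x)) \<and> (\<forall>b\<in>Basis. (\<lambda>x. F' x b) \<in> cspan ?P)"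
    proof (intro exI conjI allI ballI)
      have 1: "((\<lambda>x. f (fst x)) has_derivative (\<lambda>v. ?D f (fst x) (fst v))) (at x)" for x :: "'a \<times> 'b"
        by (rule has_derivative_compose[OF has_derivative_fst[OF has_derivative_ident] schwartz_has_derivative[OF fh(1)]])
      have 2: "((\<lambda>x. h (snd x)) has_derivative (\<lambda>v. ?D h (snd x) (snd v))) (at x)" for x :: "'a \<times> 'b"
        by (rule has_derivative_compose[OF has_derivative_snd[OF has_derivative_ident] schwartz_has_derivative[OF fh(2)]])
      show "(F has_derivative (\<lambda>v. ?D f (fst x) (fst v) * h (snd x) + f (fst x) * ?D h (snd x) (snd v))) (at x)" for x
        unfolding F
        by (rule has_derivative_eq_rhs[OF has_derivative_mult[OF 1 2]]) (auto simp: algebra_simps)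
      show "(\<lambda>x. ?D f (fst x) (fst b) * h (snd x) + f (fst x) * ?D h (snd x) (snd b)) \<in> cspan ?P" for b
        by (intro cspan_add I schwartz_sum schwartz_dird fh) auto
    qed
  qed
qed

lemma cis_inner_has_derivative:
  "((\<lambda>x::'a::euclidean_space. cis (r * (\<omega> \<bullet> x))) has_derivative
      (\<lambda>v. of_real (\<omega> \<bullet> v) * (\<i> * of_real r * cis (r * (\<omega> \<bullet> x))))) (at x within A)"
proof -
  have 2: "((\<lambda>x::'a. r * (\<omega> \<bullet> x)) has_derivative (\<lambda>v. r * (\<omega> \<bullet> v))) (at x within A)"
    by (auto intro!: derivative_eq_intros)
  show ?thesis
    by (rule has_derivative_eq_rhs[OF has_derivative_cis[OF 2]]) (simp add: scaleR_conv_of_real algebra_simps)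
qed

text \<open>Differentiating the character contributes only a constant factor in each direction, so
  the functions carrying one fixed character form a closed family.\<close>

lemma schwartz_modulate:
  fixes f :: "'a::euclidean_space \<Rightarrow> complex"
  assumes "f \<in> schwartz" shows "(\<lambda>x. cis (r * (\<omega> \<bullet> x)) * f x) \<in> schwartz"
proof -
  let ?P = "{\<lambda>x. cis (r * (\<omega> \<bullet> x)) * f x | f. f \<in> schwartz} :: ('a \<Rightarrow> complex) set"
  have I: "(\<lambda>x. cis (r * (\<omega> \<bullet> x)) * f x) \<in> cspan ?P" if "f \<in> schwartz" for f
    using that by (intro cspan_base) blast
  show ?thesis
  proof (rule schwartz_coinduct[OF _ _ _ I[OF assms]])
    fix F assume "F \<in> ?P"
    then obtain f where F: "F = (\<lambda>x. cis (r * (\<omega> \<bullet> x)) * f x)" and f: "f \<in> schwartz" by blast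
    show "bounded (range F)" using schwartz_bounded[OF f] unfolding F bounded_iff by (auto simp: norm_mult)
    show "(\<lambda>x. of_real (x \<bullet> b) * F x) \<in> cspan ?P" if "b \<in> Basis" for b
      using I[OF schwartz_coord[OF f that]] by (simp add: F mult_ac)
    let ?D = "\<lambda>x v. \<Sum>c\<in>Basis. of_real (v \<bullet> c) * dird c f x"
    show "\<exists>F'. (\<forall>x. (F has_derivative F' x) (at x)) \<and> (\<forall>b\<in>Basis. (\<lambda>x. F' x b) \<in> cspan ?P)"
    proof (intro exI conjI allI ballI)
      show "(F has_derivative (\<lambda>v. cis (r * (\<omega> \<bullet> x)) * ((\<i> * of_real r * of_real (\<omega> \<bullet> v)) * f x + ?D x v))) (at x)" for x
        unfolding F
        by (rule has_derivative_eq_rhs[OF has_derivative_mult[OF cis_inner_has_derivative schwartz_has_derivative[OF f]]])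
           (auto simp: algebra_simps)
      show "(\<lambda>x. cis (r * (\<omega> \<bullet> x)) * ((\<i> * of_real r * of_real (\<omega> \<bullet> b)) * f x + ?D x b)) \<in> cspan ?P" for b
        by (intro I schwartz_add schwartz_scale schwartz_sum schwartz_dird f) auto
    qed
  qed
qed

lemma schwartz_continuous: assumes "f \<in> schwartz" shows "continuous_on A f"
  using schwartz_differentiable[OF assms]
  by (meson continuous_at_imp_continuous_on differentiable_imp_continuous_within)

lemma schwartz_measurable [measurable_dest]: "f \<in> schwartz \<Longrightarrow> f \<in> borel_measurable borel"
  by (intro borel_measurable_continuous_onI schwartz_continuous)

lemma schwartz_decay:
  assumes "f \<in> schwartz" obtains C where "\<And>x. (1 + norm x) ^ k * norm (f x) \<le> C"
proof -
  obtain C1 where C1: "\<And>x. norm x ^ 0 * norm (f x) \<le> C1" using schwartz_power_bound[OF assms] by metis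
  obtain C2 where C2: "\<And>x. norm x ^ k * norm (f x) \<le> C2" using schwartz_power_bound[OF assms] by metis
  have "(1 + norm x) ^ k * norm (f x) \<le> 2 ^ k * (C1 + C2)" for x
  proof -
    have "(1 + norm x) ^ k \<le> (2 * max 1 (norm x)) ^ k" by (intro power_mono) auto
    also have "\<dots> \<le> 2 ^ k * (1 + norm x ^ k)" by (auto simp: power_mult_distrib max_def)
    finally have "(1 + norm x) ^ k * norm (f x) \<le> 2 ^ k * (1 + norm x ^ k) * norm (f x)"
      by (intro mult_right_mono) auto
    also have "\<dots> = 2 ^ k * (norm x ^ 0 * norm (f x) + norm x ^ k * norm (f x))" by (simp add: algebra_simps)
    also have "\<dots> \<le> 2 ^ k * (C1 + C2)" using C1[of x] C2[of x] by (intro mult_left_mono add_mono) auto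
    finally show ?thesis .
  qed
  then show ?thesis using that by blast
qed

section \<open>Integration\<close>

lemma lborel_distr_translate: "distr lborel borel (\<lambda>x. x + a) = (lborel :: 'a::euclidean_space measure)"
proof -
  have "(+) a = (\<lambda>x. x + a)" by (auto simp: add.commute)
  with lborel_distr_plus[of a] show ?thesis by simp
qed

lemma lborel_distr_reflect: "distr lborel borel (\<lambda>x. a - x) = (lborel :: 'a::euclidean_space measure)"
  by (subst lborel_affine[of "-1" a]) (auto simp: density_1)

lemma nn_integral_translate:
  fixes f :: "'a::euclidean_space \<Rightarrow> ennreal"
  assumes [measurable]: "f \<in> borel_measurable borel"
  shows "(\<integral>\<^sup>+x. f (x + a) \<partial>lborel) = (\<integral>\<^sup>+x. f x \<partial>lborel)"
    and "(\<integral>\<^sup>+x. f (x - a) \<partial>lborel) = (\<integral>\<^sup>+x. f x \<partial>lborel)"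
    and "(\<integral>\<^sup>+x. f (a - x) \<partial>lborel) = (\<integral>\<^sup>+x. f x \<partial>lborel)"
proof -
  show "(\<integral>\<^sup>+x. f (x + a) \<partial>lborel) = (\<integral>\<^sup>+x. f x \<partial>lborel)" for a
    by (subst (2) lborel_distr_translate[of a, symmetric]) (simp add: nn_integral_distr)
  from this[of "- a"] show "(\<integral>\<^sup>+x. f (x - a) \<partial>lborel) = (\<integral>\<^sup>+x. f x \<partial>lborel)" by simp
  show "(\<integral>\<^sup>+x. f (a - x) \<partial>lborel) = (\<integral>\<^sup>+x. f x \<partial>lborel)"
    by (subst (2) lborel_distr_reflect[of a, symmetric]) (simp add: nn_integral_distr)
qed

lemma integral_translate:
  fixes f :: "'a::euclidean_space \<Rightarrow> complex"
  assumes [measurable]: "f \<in> borel_measurable borel"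
  shows "(LINT x|lborel. f (x + a)) = (LINT x|lborel. f x)"
    and "(LINT x|lborel. f (x - a)) = (LINT x|lborel. f x)"
    and "(LINT x|lborel. f (a - x)) = (LINT x|lborel. f x)"
proof -
  show "(LINT x|lborel. f (x + a)) = (LINT x|lborel. f x)" for a
    by (subst (2) lborel_distr_translate[of a, symmetric]) (simp add: integral_distr)
  from this[of "- a"] show "(LINT x|lborel. f (x - a)) = (LINT x|lborel. f x)" by simp
  show "(LINT x|lborel. f (a - x)) = (LINT x|lborel. f x)"
    by (subst (2) lborel_distr_reflect[of a, symmetric]) (simp add: integral_distr)
qed

lemma integrable_translate:
  fixes f :: "'a::euclidean_space \<Rightarrow> 'b::{banach, second_countable_topology}"
  assumes "integrable lborel f"
  shows "integrable lborel (\<lambda>x. f (x + a))" "integrable lborel (\<lambda>x. f (x - a))"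
    "integrable lborel (\<lambda>x. f (a - x))"
proof -
  have 1: "integrable lborel (\<lambda>x. f (x + a))" for a
    using integrable_distr[of "\<lambda>x. x + a" lborel borel f] assms
    by (simp add: lborel_distr_translate)
  then show "integrable lborel (\<lambda>x. f (x + a))" .
  from 1[of "- a"] show "integrable lborel (\<lambda>x. f (x - a))" by simp
  show "integrable lborel (\<lambda>x. f (a - x))"
    using integrable_distr[of "\<lambda>x. a - x" lborel borel f] assms
    by (simp add: lborel_distr_reflect)
qed

text \<open>Integrability of \<open>f\<close> is not assumed: otherwise its Bochner integral is 0 by
  convention, and the bound holds because \<open>w\<close> is nonnegative.\<close>

lemma norm_integral_le:
  fixes f :: "'a \<Rightarrow> 'b::{banach, second_countable_topology}"
  assumes "integrable M w" "\<And>x. x \<in> space M \<Longrightarrow> norm (f x) \<le> w x"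
  shows "norm (integral\<^sup>L M f) \<le> (LINT x|M. w x)"
proof (cases "integrable M f")
  case True
  have "norm (integral\<^sup>L M f) \<le> (LINT x|M. norm (f x))" by (rule integral_norm_bound)
  also have "\<dots> \<le> (LINT x|M. w x)" using assms True by (intro integral_mono) auto
  finally show ?thesis .
next
  case False
  then show ?thesis
    using assms by (auto simp: not_integrable_integral_eq intro!: Bochner_Integration.integral_nonneg intro: order_trans[OF norm_ge_zero])
qed

section \<open>Integrable polynomial weights\<close>

definition wgt :: "'a::euclidean_space \<Rightarrow> real" where
  "wgt x = inverse ((1 + norm x) ^ (2 * DIM('a)))"

lemma one_plus_norm_pos: "0 < 1 + norm x"
  by (simp add: add_pos_nonneg)

lemma wgt_pos: "0 < wgt x"
  by (simp add: wgt_def one_plus_norm_pos)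

lemma wgt_nonneg: "0 \<le> wgt x"
  using wgt_pos[of x] by simp

lemma wgt_le_1: "wgt x \<le> 1"
  unfolding wgt_def by (intro inverse_le_1_iff[THEN iffD2] disjI2 one_le_power) auto

lemma wgt_measurable [measurable]: "wgt \<in> borel_measurable borel"
  unfolding wgt_def[abs_def] by measurable

lemma integrable_inverse_one_plus_square: "integrable lborel (\<lambda>x::real. inverse (1 + x\<^sup>2))"
  using integrable_inverse_1_plus_square by (simp add: set_integrable_def)

text \<open>The exponent 2 n in dimension n gives each coordinate the factor (1 + norm x)^2, which
  dominates 1 + x_b^2. The weight is therefore below a product of one-dimensional functions 1 / (1 +
  x_b^2), whose integral factors.\<close>

lemma wgt_integrable: "integrable lborel (wgt :: 'a::euclidean_space \<Rightarrow> real)"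
proof (rule Bochner_Integration.integrable_bound)
  let ?f = "\<lambda>x::'a. \<Prod>b\<in>Basis. inverse (1 + (x \<bullet> b)\<^sup>2)"
  have "(\<integral>\<^sup>+x. ennreal (inverse (1 + x\<^sup>2)) \<partial>lborel) < \<infinity>"
    using integrable_inverse_one_plus_square unfolding integrable_iff_bounded by simp
  moreover have "(\<integral>\<^sup>+x. ennreal (?f x) \<partial>lborel) = (\<Prod>b\<in>(Basis :: 'a set). \<integral>\<^sup>+x. ennreal (inverse (1 + x\<^sup>2)) \<partial>lborel)"
    by (subst nn_integral_lborel_prod[symmetric]) (auto simp: prod_ennreal)
  ultimately have "(\<integral>\<^sup>+x. ennreal (?f x) \<partial>lborel) < \<infinity>"
    by (simp add: power_less_top_ennreal)
  then show "integrable lborel ?f"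
    by (intro integrableI_nonneg) (auto intro!: prod_nonneg)
  show "AE x in lborel. norm (wgt x :: real) \<le> norm (?f x)"
  proof (rule AE_I2)
    fix x :: 'a
    have "(\<Prod>b\<in>Basis. 1 + (x \<bullet> b)\<^sup>2) \<le> (\<Prod>b\<in>(Basis :: 'a set). (1 + norm x)\<^sup>2)"
    proof (rule prod_mono, safe)
      fix b :: 'a assume "b \<in> Basis"
      then have "(x \<bullet> b)\<^sup>2 \<le> (norm x)\<^sup>2" using Basis_le_norm[of b x] by (simp add: abs_le_square_iff[symmetric])
      then show "1 + (x \<bullet> b)\<^sup>2 \<le> (1 + norm x)\<^sup>2" using norm_ge_zero[of x] by (simp add: power2_sum del: norm_ge_zero)
    qed auto
    also have "\<dots> = (1 + norm x) ^ (2 * DIM('a))" by (simp add: power_mult)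
    finally have "inverse ((1 + norm x) ^ (2 * DIM('a))) \<le> inverse (\<Prod>b\<in>Basis. 1 + (x \<bullet> b)\<^sup>2)"
      by (intro le_imp_inverse_le prod_pos) (auto intro: add_pos_nonneg)
    then show "norm (wgt x) \<le> norm (?f x)"
      using wgt_nonneg[of x] unfolding wgt_def prod_inversef[symmetric] comp_def by simp
  qed
qed auto

text \<open>The point \<open>v\<close> that supplies the decay may be larger than the point
  \<open>u\<close> whose weight is wanted. With a pair for \<open>v\<close> and one component for
  \<open>u\<close>, this produces a weight in each component.\<close>

lemma wgt_bound:
  assumes "norm u \<le> norm v"
  shows "(1 + norm v) ^ (2 * DIM('a)) * t \<le> C \<Longrightarrow> t \<ge> 0 \<Longrightarrow> t \<le> C * wgt (u :: 'a::euclidean_space)"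
proof -
  assume *: "(1 + norm v) ^ (2 * DIM('a)) * t \<le> C" "t \<ge> 0"
  have "t * (1 + norm u) ^ (2 * DIM('a)) \<le> t * (1 + norm v) ^ (2 * DIM('a))"
    using assms * by (intro mult_left_mono power_mono) auto
  also have "\<dots> \<le> C" using * by (simp add: mult.commute)
  finally show "t \<le> C * wgt u"
    by (simp add: wgt_def field_simps one_plus_norm_pos)
qed

lemma schwartz_wgt:
  fixes f :: "'a::euclidean_space \<Rightarrow> complex"
  assumes "f \<in> schwartz" obtains C where "C \<ge> 0" "\<And>x. (1 + norm x) ^ k * norm (f x) \<le> C * wgt x"
proof -
  obtain C where C: "\<And>x. (1 + norm x) ^ (2 * DIM('a) + k) * norm (f x) \<le> C"
    using schwartz_decay[OF assms] by metis
  have "(1 + norm x) ^ k * norm (f x) \<le> C * wgt x" for x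
    using C[of x] by (intro wgt_bound[OF order_refl]) (simp_all add: power_add mult.assoc)
  moreover have "C \<ge> 0" using C[of 0] by (rule order_trans[rotated]) simp
  ultimately show ?thesis using that by blast
qed

text \<open>The norm of a pair dominates the norms of both components, so a single large power of it
  can be spent in four portions: the two weights and the two explicit powers.\<close>

lemma schwartz_wgt_prod:
  fixes F :: "'a::euclidean_space \<times> 'b::euclidean_space \<Rightarrow> complex"
  assumes "F \<in> schwartz"
  obtains C where "C \<ge> 0" "\<And>x y. (1 + norm x) ^ k * (1 + norm y) ^ l * norm (F (x, y)) \<le> C * wgt x * wgt y"
proof -
  obtain C where C: "\<And>x. (1 + norm x) ^ (2 * DIM('a) + 2 * DIM('b) + k + l) * norm (F x) \<le> C"
    using schwartz_decay[OF assms] by metis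
  have "(1 + norm x) ^ k * (1 + norm y) ^ l * norm (F (x, y)) \<le> C * wgt x * wgt y" for x y
  proof (rule wgt_bound[OF norm_snd_le[of y x]])
    show "(1 + norm (x, y)) ^ (2 * DIM('b)) * ((1 + norm x) ^ k * (1 + norm y) ^ l * norm (F (x, y))) \<le> C * wgt x"
    proof (rule wgt_bound[OF norm_fst_le[of x y]])
      have "(1 + norm x) ^ k * (1 + norm y) ^ l \<le> (1 + norm (x, y)) ^ k * (1 + norm (x, y)) ^ l"
        by (intro mult_mono power_mono add_left_mono norm_fst_le norm_snd_le) auto
      then have "(1 + norm (x, y)) ^ (2 * DIM('a)) * ((1 + norm (x, y)) ^ (2 * DIM('b)) *
          ((1 + norm x) ^ k * (1 + norm y) ^ l * norm (F (x, y)))) \<le>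
          (1 + norm (x, y)) ^ (2 * DIM('a)) * ((1 + norm (x, y)) ^ (2 * DIM('b)) *
          ((1 + norm (x, y)) ^ k * (1 + norm (x, y)) ^ l * norm (F (x, y))))"
        by (intro mult_left_mono mult_right_mono) auto
      also have "\<dots> \<le> C" using C[of "(x, y)"] by (simp add: power_add mult_ac)
      finally show "(1 + norm (x, y)) ^ (2 * DIM('a)) * ((1 + norm (x, y)) ^ (2 * DIM('b)) *
          ((1 + norm x) ^ k * (1 + norm y) ^ l * norm (F (x, y)))) \<le> C" .
    qed auto
  qed auto
  moreover have "C \<ge> 0" using C[of 0] by (rule order_trans[rotated]) simp
  ultimately show ?thesis using that by blast
qed

lemma schwartz_integrable:
  fixes f :: "'a::euclidean_space \<Rightarrow> complex"
  assumes "f \<in> schwartz" shows "integrable lborel f"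
proof -
  obtain C where C: "\<And>x. (1 + norm x) ^ 0 * norm (f x) \<le> C * wgt x"
    using schwartz_wgt[OF assms] by metis
  have "C * wgt x \<le> \<bar>C * wgt x\<bar>" for x :: 'a by simp
  with C show ?thesis
    using assms by (intro Bochner_Integration.integrable_bound[OF integrable_mult_right[OF wgt_integrable, of C]])
       (auto simp: schwartz_measurable intro: order_trans)
qed

text \<open>The mean value inequality turns the bound on the derivative into a Lipschitz bound with
  constant \<open>w c\<close>; the normalised remainders are then dominated by 2 \<open>w c\<close>,
  and dominated convergence applies along every sequence tending to \<open>x0\<close>.\<close>

lemma has_derivative_integral:
  fixes F :: "'a::euclidean_space \<Rightarrow> 'c \<Rightarrow> complex" and F' :: "'a \<Rightarrow> 'c \<Rightarrow> 'a \<Rightarrow> complex"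
  assumes r: "r > 0"
    and int: "\<And>x. x \<in> ball x0 r \<Longrightarrow> integrable M (F x)"
    and der: "\<And>x c. x \<in> ball x0 r \<Longrightarrow> c \<in> space M \<Longrightarrow> ((\<lambda>x. F x c) has_derivative F' x c) (at x)"
    and bnd: "\<And>x c h. x \<in> ball x0 r \<Longrightarrow> c \<in> space M \<Longrightarrow> norm (F' x c h) \<le> w c * norm h"
    and w: "integrable M w"
    and meas: "\<And>h. (\<lambda>c. F' x0 c h) \<in> borel_measurable M"
  shows "((\<lambda>x. LINT c|M. F x c) has_derivative (\<lambda>h. LINT c|M. F' x0 c h)) (at x0)"
proof -
  have x0: "x0 \<in> ball x0 r" using r by simp
  have w0: "w c \<ge> 0" if c: "c \<in> space M" for c
  proof -
    obtain b :: 'a where b: "b \<in> Basis" using nonempty_Basis by blast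
    have "0 \<le> norm (F' x0 c b)" by simp
    also have "\<dots> \<le> w c * norm b" by (rule bnd[OF x0 c])
    finally show ?thesis using b by simp
  qed
  have lin: "bounded_linear (F' x0 c)" if "c \<in> space M" for c
    using der[OF x0 that] by (rule has_derivative_bounded_linear)
  have int': "integrable M (\<lambda>c. F' x0 c h)" for h
    using bnd[OF x0] w0
    by (intro Bochner_Integration.integrable_bound[OF integrable_mult_left[OF w, of "norm h"]] meas) (auto intro!: AE_I2)
  have lip: "norm (F x c - F x0 c) \<le> w c * norm (x - x0)" if x: "x \<in> ball x0 r" and c: "c \<in> space M" for x c
  proof (rule differentiable_bound[of "ball x0 r"])
    show "((\<lambda>x. F x c) has_derivative F' x c) (at x within ball x0 r)" if "x \<in> ball x0 r" for x
      using der[OF that c] by (rule has_derivative_at_withinI)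
    show "onorm (F' x c) \<le> w c" if "x \<in> ball x0 r" for x
      by (rule onorm_bound) (use w0[OF c] bnd[OF that c] in auto)
  qed (use x x0 in auto)
  show ?thesis
    unfolding has_derivative_iff_norm
  proof
    show "bounded_linear (\<lambda>h. LINT c|M. F' x0 c h)"
    proof (rule bounded_linear_intro[where K = "LINT c|M. w c"])
      fix h k :: 'a and a :: real
      have "(LINT c|M. F' x0 c (h + k)) = (LINT c|M. F' x0 c h + F' x0 c k)"
        by (intro Bochner_Integration.integral_cong refl) (simp add: linear_add bounded_linear.linear[OF lin])
      then show "(LINT c|M. F' x0 c (h + k)) = (LINT c|M. F' x0 c h) + (LINT c|M. F' x0 c k)"
        using int' by simp
      have "(LINT c|M. F' x0 c (a *\<^sub>R h)) = (LINT c|M. a *\<^sub>R F' x0 c h)"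
        by (intro Bochner_Integration.integral_cong refl) (simp add: linear_cmul bounded_linear.linear[OF lin])
      then show "(LINT c|M. F' x0 c (a *\<^sub>R h)) = a *\<^sub>R (LINT c|M. F' x0 c h)" by simp
      have "norm (LINT c|M. F' x0 c h) \<le> (LINT c|M. w c * norm h)"
        using bnd[OF x0] by (intro norm_integral_le integrable_mult_left w) auto
      then show "norm (LINT c|M. F' x0 c h) \<le> norm h * (LINT c|M. w c)" by (simp add: mult.commute)
    qed
    show "((\<lambda>y. norm ((LINT c|M. F y c) - (LINT c|M. F x0 c) - (LINT c|M. F' x0 c (y - x0))) / norm (y - x0)) \<longlongrightarrow> 0) (at x0)"
      unfolding tendsto_at_iff_sequentially comp_def
    proof (intro allI impI)
      fix X assume X: "\<forall>i. X i \<in> UNIV - {x0}" "X \<longlonglongrightarrow> x0"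
      \<comment> \<open>A sequence converging to \<open>x0\<close> may start outside the ball, where
        no bound is available. Putting 0 there changes only finitely many terms.\<close>
      define s where "s n c = (if X n \<in> ball x0 r then
          (F (X n) c - F x0 c - F' x0 c (X n - x0)) /\<^sub>R norm (X n - x0) else 0)" for n c
      have ev: "eventually (\<lambda>n. X n \<in> ball x0 r) sequentially"
        by (rule topological_tendstoD[OF X(2) open_ball x0])
      have [measurable]: "F x \<in> borel_measurable M" if "x \<in> ball x0 r" for x
        using int[OF that] by auto
      have s_int: "integrable M (s n)" for n
        unfolding s_def using int x0 int' by (cases "X n \<in> ball x0 r") auto
      have "(\<lambda>n. integral\<^sup>L M (s n)) \<longlonglongrightarrow> integral\<^sup>L M (\<lambda>_. 0)"
      proof (rule integral_dominated_convergence[where w = "\<lambda>c. 2 * w c"])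
        show "AE c in M. (\<lambda>n. s n c) \<longlonglongrightarrow> 0"
        proof (rule AE_I2)
          fix c assume c: "c \<in> space M"
          have "((\<lambda>y. norm (F y c - F x0 c - F' x0 c (y - x0)) / norm (y - x0)) \<longlongrightarrow> 0) (at x0)"
            using der[OF x0 c] unfolding has_derivative_iff_norm by blast
          with X have "(\<lambda>n. norm (F (X n) c - F x0 c - F' x0 c (X n - x0)) / norm (X n - x0)) \<longlonglongrightarrow> 0"
            unfolding tendsto_at_iff_sequentially comp_def by blast
          then have "(\<lambda>n. norm (s n c)) \<longlonglongrightarrow> 0"
            by (rule Lim_transform_eventually)
               (rule eventually_mono[OF ev], simp add: s_def divide_inverse mult.commute)
          then show "(\<lambda>n. s n c) \<longlonglongrightarrow> 0" by (rule tendsto_norm_zero_cancel)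
        qed
        show "AE c in M. norm (s n c) \<le> 2 * w c" for n
        proof (rule AE_I2)
          fix c assume c: "c \<in> space M"
          show "norm (s n c) \<le> 2 * w c"
          proof (cases "X n \<in> ball x0 r")
            case True
            have "norm (F (X n) c - F x0 c - F' x0 c (X n - x0)) \<le> w c * norm (X n - x0) + w c * norm (X n - x0)"
              by (rule order_trans[OF norm_triangle_ineq4 add_mono[OF lip[OF True c] bnd[OF x0 c]]])
            moreover have "norm (X n - x0) > 0" using X(1) by auto
            ultimately show ?thesis using True by (simp add: s_def divide_inverse[symmetric] pos_divide_le_eq mult.commute[of "inverse _"])
          qed (use w0[OF c] in \<open>simp add: s_def\<close>)
        qed
      qed (use w s_int in auto)
      then have "(\<lambda>n. norm (integral\<^sup>L M (s n))) \<longlonglongrightarrow> 0" by (simp add: tendsto_norm_zero)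
      then show "(\<lambda>n. norm ((LINT c|M. F (X n) c) - (LINT c|M. F x0 c) - (LINT c|M. F' x0 c (X n - x0)))
                   / norm (X n - x0)) \<longlonglongrightarrow> 0"
      proof (rule Lim_transform_eventually)
        show "\<forall>\<^sub>F n in sequentially. norm (integral\<^sup>L M (s n)) =
          norm ((LINT c|M. F (X n) c) - (LINT c|M. F x0 c) - (LINT c|M. F' x0 c (X n - x0))) / norm (X n - x0)"
          using ev
        proof eventually_elim
          case (elim n)
          have "integral\<^sup>L M (s n) = ((LINT c|M. F (X n) c) - (LINT c|M. F x0 c) - (LINT c|M. F' x0 c (X n - x0)))
                   /\<^sub>R norm (X n - x0)"
            using elim int x0 int' by (simp add: s_def[abs_def])
          then show ?case by (simp add: divide_inverse mult.commute)
        qed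
      qed
    qed
  qed
qed

text \<open>For a shift of length at most 1 the quantity 1 + norm x changes at most by a factor 2.
  This gives one integrable majorant for all small translates of a Schwartz function.\<close>

lemma wgt_shift:
  assumes "norm h \<le> 1" shows "wgt (x + h) \<le> 2 ^ (2 * DIM('a)) * wgt (x :: 'a::euclidean_space)"
proof -
  have "norm x \<le> norm (x + h) + norm h" using norm_triangle_ineq4[of "x + h" h] by simp
  with assms have "1 + norm x \<le> 2 * (1 + norm (x + h))" using norm_ge_zero[of "x + h"] by argo
  then have "(1 + norm x) ^ (2 * DIM('a)) \<le> (2 * (1 + norm (x + h))) ^ (2 * DIM('a))"
    by (intro power_mono) auto
  then show ?thesis
    using one_plus_norm_pos[of x] one_plus_norm_pos[of "x + h"]
    unfolding power_mult_distrib by (simp add: wgt_def field_simps del: mult_2)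
qed

text \<open>The integral of \<open>f (x + h b)\<close> does not depend on \<open>h\<close>; differentiate at \<open>h = 0\<close>.\<close>

lemma integral_dird_eq_0:
  fixes f :: "'a::euclidean_space \<Rightarrow> complex"
  assumes f: "f \<in> schwartz" and b: "b \<in> Basis" shows "(LINT x|lborel. dird b f x) = 0"
proof -
  have df: "dird b f \<in> schwartz" by (rule schwartz_dird[OF f b])
  obtain C where C: "C \<ge> 0" "\<And>x. (1 + norm x) ^ 0 * norm (dird b f x) \<le> C * wgt x"
    using schwartz_wgt[OF df] by metis
  have der: "((\<lambda>h. f (x + h *\<^sub>R b)) has_derivative (\<lambda>k. of_real k * dird b f (x + h *\<^sub>R b))) (at h)" for x h
  proof -
    have 1: "((\<lambda>h. x + h *\<^sub>R b) has_derivative (\<lambda>k. k *\<^sub>R b)) (at h)"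
      by (auto intro!: derivative_eq_intros)
    have "(\<Sum>c\<in>Basis. of_real ((k *\<^sub>R b) \<bullet> c) * dird c f y) = of_real k * dird b f y" for k y
    proof -
      have "(\<Sum>c\<in>Basis. of_real ((k *\<^sub>R b) \<bullet> c) * dird c f y) = (\<Sum>c\<in>Basis. if c = b then of_real k * dird b f y else 0)"
        using b by (intro sum.cong) (auto simp: inner_Basis)
      also have "\<dots> = of_real k * dird b f y" using b by simp
      finally show ?thesis .
    qed
    then show ?thesis
      using has_derivative_compose[OF 1 schwartz_has_derivative[OF f]] by simp
  qed
  have "((\<lambda>h. LINT x|lborel. f (x + h *\<^sub>R b)) has_derivative
      (\<lambda>k. LINT x|lborel. of_real k * dird b f (x + 0 *\<^sub>R b))) (at 0)"
  proof (rule has_derivative_integral[where r = 1 and w = "\<lambda>x. C * (2 ^ (2 * DIM('a)) * wgt x)"])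
    show "((\<lambda>h. f (x + h *\<^sub>R b)) has_derivative (\<lambda>k. of_real k * dird b f (x + h *\<^sub>R b))) (at h)" for h x
      by (rule der)
    show "norm (of_real k * dird b f (x + h *\<^sub>R b)) \<le> C * (2 ^ (2 * DIM('a)) * wgt x) * norm k"
      if "h \<in> ball 0 1" for h k x
    proof -
      have "norm (dird b f (x + h *\<^sub>R b)) \<le> C * wgt (x + h *\<^sub>R b)" using C(2)[of "x + h *\<^sub>R b"] by simp
      also have "\<dots> \<le> C * (2 ^ (2 * DIM('a)) * wgt x)"
        using that b C(1) by (intro mult_left_mono wgt_shift) auto
      finally show ?thesis by (simp add: norm_mult mult.commute mult_left_mono)
    qed
  qed (use schwartz_measurable[OF df] schwartz_integrable[OF f] in \<open>auto intro!: integrable_translate wgt_integrable\<close>)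
  moreover have "(LINT x|lborel. f (x + h *\<^sub>R b)) = (LINT x|lborel. f x)" for h
    using schwartz_measurable[OF f] by (intro integral_translate)
  ultimately have "((\<lambda>h::real. LINT x|lborel. f x) has_derivative (\<lambda>k. of_real k * (LINT x|lborel. dird b f x))) (at 0)"
    by simp
  then have "(\<lambda>k. of_real k * (LINT x|lborel. dird b f x)) = (\<lambda>_. 0)"
    by (rule has_derivative_unique[OF _ has_derivative_const])
  from fun_cong[OF this, of 1] show ?thesis by simp
qed

lemma dird_slice:
  fixes F :: "'a::euclidean_space \<times> 'b::euclidean_space \<Rightarrow> complex"
  assumes F: "F \<in> schwartz"
  shows "dird b (\<lambda>y. F (x, y)) = (\<lambda>y. dird (0, b) F (x, y))"
    and "dird a (\<lambda>x. F (x, y)) = (\<lambda>x. dird (a, 0) F (x, y))"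
proof -
  show "dird b (\<lambda>y. F (x, y)) = (\<lambda>y. dird (0, b) F (x, y))"
  proof
    fix y :: 'b
    let ?F' = "\<lambda>x h. \<Sum>b\<in>Basis. of_real (h \<bullet> b) * dird b F x"
    have 1: "((\<lambda>y. (x, y)) has_derivative (\<lambda>h. (0, h))) (at y)"
      by (auto intro!: derivative_eq_intros)
    have "dird (0, b) F (x, y) = ?F' (x, y) (0, b)" by (intro dird_eq schwartz_has_derivative F)
    moreover have "dird b (\<lambda>y. F (x, y)) y = ?F' (x, y) (0, b)"
      using has_derivative_compose[OF 1 schwartz_has_derivative[OF F]] by (rule dird_eq)
    ultimately show "dird b (\<lambda>y. F (x, y)) y = dird (0, b) F (x, y)" by simp
  qed
  show "dird a (\<lambda>x. F (x, y)) = (\<lambda>x. dird (a, 0) F (x, y))"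
  proof
    fix x :: 'a
    let ?F' = "\<lambda>x h. \<Sum>b\<in>Basis. of_real (h \<bullet> b) * dird b F x"
    have 1: "((\<lambda>x. (x, y)) has_derivative (\<lambda>h. (h, 0))) (at x)"
      by (auto intro!: derivative_eq_intros)
    have "dird (a, 0) F (x, y) = ?F' (x, y) (a, 0)" by (intro dird_eq schwartz_has_derivative F)
    moreover have "dird a (\<lambda>x. F (x, y)) x = ?F' (x, y) (a, 0)"
      using has_derivative_compose[OF 1 schwartz_has_derivative[OF F]] by (rule dird_eq)
    ultimately show "dird a (\<lambda>x. F (x, y)) x = dird (a, 0) F (x, y)" by simp
  qed
qed

lemma schwartz_slice_fst:
  assumes "F \<in> schwartz" shows "(\<lambda>x. F (x, y)) \<in> schwartz"
proof -
  have "(\<lambda>x. F ((x, 0) + (0, y))) \<in> schwartz"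
    by (rule schwartz_affine[OF assms, where L' = fst])
       (auto intro!: linearI simp: linear_fst)
  then show ?thesis by simp
qed

section \<open>Integration by parts and partial Fourier transforms\<close>

lemma cis_measurable [measurable]: "cis \<in> borel_measurable borel"
  by (intro borel_measurable_continuous_onI continuous_intros)

text \<open>Integration by parts: the derivative of the modulated function has integral 0, and the
  product rule splits it into the two sides.\<close>

lemma integral_modulated_dird:
  fixes f :: "'a::euclidean_space \<Rightarrow> complex"
  assumes f: "f \<in> schwartz" and b: "b \<in> Basis"
  shows "of_real (\<omega> \<bullet> b) * (LINT y|lborel. cis (r * (\<omega> \<bullet> y)) * f y) * (\<i> * of_real r) =
           - (LINT y|lborel. cis (r * (\<omega> \<bullet> y)) * dird b f y)"
proof -
  let ?f = "\<lambda>y. cis (r * (\<omega> \<bullet> y)) * f y"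
  let ?g = "\<lambda>y. cis (r * (\<omega> \<bullet> y)) * dird b f y"
  have S: "?f \<in> schwartz" "?g \<in> schwartz"
    by (intro schwartz_modulate schwartz_dird f b)+
  have e: "(\<Sum>c\<in>Basis. of_real (b \<bullet> c) * dird c f y) = dird b f y" for y
    by (rule dird_eq[OF schwartz_has_derivative[OF f], symmetric])
  have "dird b ?f y = (\<i> * of_real r * of_real (\<omega> \<bullet> b)) * ?f y + ?g y" for y
    using has_derivative_mult[OF cis_inner_has_derivative[of r \<omega> y UNIV] schwartz_has_derivative[OF f, of y]]
    by (subst dird_eq, assumption) (simp only: e, simp add: mult_ac)
  then have "(LINT y|lborel. (\<i> * of_real r * of_real (\<omega> \<bullet> b)) * ?f y + ?g y) = 0"
    using integral_dird_eq_0[OF S(1) b] by simp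
  moreover have "(LINT y|lborel. (\<i> * of_real r * of_real (\<omega> \<bullet> b)) * ?f y + ?g y) =
      (\<i> * of_real r * of_real (\<omega> \<bullet> b)) * (LINT y|lborel. ?f y) + (LINT y|lborel. ?g y)"
    using schwartz_integrable[OF S(1)] schwartz_integrable[OF S(2)]
    by (subst Bochner_Integration.integral_add) simp_all
  ultimately have "(\<i> * of_real r * of_real (\<omega> \<bullet> b)) * (LINT y|lborel. ?f y) = - (LINT y|lborel. ?g y)"
    by (simp only: eq_neg_iff_add_eq_0)
  then show ?thesis by (simp add: mult_ac)
qed

text \<open>The family of all partial transforms of Schwartz functions is closed. Differentiation in
  position and multiplication by a position coordinate act on \<open>F\<close> directly;
  differentiation in frequency becomes multiplication by y, and multiplication by a frequency
  coordinate becomes differentiation in y by parts.\<close>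

theorem schwartz_partial_fourier:
  fixes F :: "'a::euclidean_space \<times> 'b::euclidean_space \<Rightarrow> complex"
  assumes "F \<in> schwartz"
  shows "(\<lambda>(x, \<omega>). LINT y|lborel. cis (- 2 * pi * (\<omega> \<bullet> y)) * F (x, y)) \<in> schwartz"
proof -
  define I where "I F = (\<lambda>p. LINT y|lborel. cis (- 2 * pi * (snd p \<bullet> y)) * F (fst p, y))"
    for F :: "'a \<times> 'b \<Rightarrow> complex"
  let ?P = "I ` schwartz"
  have I: "I F \<in> cspan ?P" if "F \<in> schwartz" for F
    using that by (intro cspan_base imageI)
  have meas: "(\<lambda>y. cis (- 2 * pi * (\<omega> \<bullet> y)) * F (x, y)) \<in> borel_measurable lborel"
    if "F \<in> schwartz" for F :: "'a \<times> 'b \<Rightarrow> complex" and x \<omega>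
    using schwartz_measurable[OF schwartz_slice[OF that, of x]] by simp
  have int: "integrable lborel (\<lambda>y. cis (- 2 * pi * (\<omega> \<bullet> y)) * F (x, y))"
    if "F \<in> schwartz" for F :: "'a \<times> 'b \<Rightarrow> complex" and x \<omega>
    by (intro schwartz_integrable schwartz_modulate schwartz_slice that)
  have "I F \<in> schwartz"
  proof (rule schwartz_coinduct[OF _ _ _ I[OF assms]])
    fix G assume "G \<in> ?P"
    then obtain F where G: "G = I F" and F: "F \<in> schwartz" by blast
    \<comment> \<open>The extra power of 1 + norm y pays for the factor y that differentiation in
      frequency creates.\<close>
    obtain C where C: "C \<ge> 0" "\<And>x y. (1 + norm x) ^ 0 * (1 + norm y) ^ 1 * norm (F (x, y)) \<le> C * wgt x * wgt y"
      using schwartz_wgt_prod[OF F] by metis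
    have C1: "(1 + norm y) * norm (F (x, y)) \<le> C * wgt y" for x y
    proof -
      have "(1 + norm y) * norm (F (x, y)) \<le> wgt x * (C * wgt y)" using C(2)[of x y] by (simp add: mult_ac)
      also have "\<dots> \<le> 1 * (C * wgt y)"
        using C(1) wgt_nonneg[of y] by (intro mult_right_mono wgt_le_1) auto
      finally show ?thesis by simp
    qed
    have C2: "norm (F (x, y)) \<le> C * wgt y" for x y
      using C1[of y x] mult_right_mono[of 1 "1 + norm y" "norm (F (x, y))"] by simp
    have "norm (G p) \<le> (LINT y|lborel. C * wgt (y::'b))" for p
      unfolding G I_def using C2
      by (intro norm_integral_le integrable_mult_right wgt_integrable) (auto simp: norm_mult)
    then show "bounded (range G)" unfolding bounded_iff by auto
    \<comment> \<open>This is the Schwartz function whose partial transform is the derivative of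
      \<open>G\<close> in direction \<open>h\<close>: the frequency part of \<open>h\<close> brings
      down -2 pi i y, and the position part differentiates \<open>F\<close>.\<close>
    let ?H = "\<lambda>h v. (- 2 * pi * \<i>) * (\<Sum>c\<in>Basis. of_real (snd h \<bullet> c) * (of_real (snd v \<bullet> c) * F v)) +
                (\<Sum>b\<in>Basis. of_real ((fst h, 0) \<bullet> b) * dird b F v)"
    have sc: "(\<lambda>v. of_real (snd v \<bullet> c) * F v) \<in> schwartz" if "c \<in> Basis" for c
      using schwartz_coord[OF F, of "(0, c)"] that by (simp add: inner_prod_def Basis_prod_def)
    have H: "?H h \<in> schwartz" for h
      by (intro schwartz_add schwartz_scale schwartz_sum sc schwartz_dird F) auto
    have H_eq: "?H h v = (- 2 * pi * \<i>) * of_real (snd h \<bullet> snd v) * F v + (\<Sum>b\<in>Basis. of_real ((fst h, 0) \<bullet> b) * dird b F v)" for h v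
      by (subst (3) euclidean_inner) (simp add: sum_distrib_right mult.assoc)
    show "\<exists>G'. (\<forall>p. (G has_derivative G' p) (at p)) \<and> (\<forall>b\<in>Basis. (\<lambda>p. G' p b) \<in> cspan ?P)"
    proof (intro exI conjI allI ballI)
      show "(\<lambda>p. I (?H b) p) \<in> cspan ?P" for b
        using I[OF H] by simp
      have "\<exists>D. D \<ge> 0 \<and> (\<forall>x y. norm (dird b F (x, y)) \<le> D * wgt y)" if bB: "b \<in> Basis" for b
      proof -
        obtain D where D: "D \<ge> 0" "\<And>x y. (1 + norm x) ^ 0 * (1 + norm y) ^ 0 * norm (dird b F (x, y)) \<le> D * wgt x * wgt y"
          using schwartz_wgt_prod[OF schwartz_dird[OF F bB]] by metis
        have "norm (dird b F (x, y)) \<le> D * wgt y" for x y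
        proof -
          have "norm (dird b F (x, y)) \<le> wgt x * (D * wgt y)" using D(2)[of x y] by (simp add: mult_ac)
          also have "\<dots> \<le> 1 * (D * wgt y)"
            using D(1) wgt_nonneg[of y] by (intro mult_right_mono wgt_le_1) auto
          finally show ?thesis by simp
        qed
        with D show ?thesis by blast
      qed
      then obtain D where D: "\<And>b. b \<in> Basis \<Longrightarrow> D b \<ge> 0"
          "\<And>b x y. b \<in> Basis \<Longrightarrow> norm (dird b F (x, y)) \<le> D b * wgt y" by metis
      define w where "w y = 2 * pi * (C * wgt y) + (\<Sum>b\<in>Basis. D b * wgt y)" for y :: 'b
      have Hb: "norm (?H h (x, y)) \<le> w y * norm h" for h x y
      proof -
        have "norm ((- 2 * pi * \<i>) * of_real (snd h \<bullet> y) * F (x, y)) \<le> 2 * pi * (norm h * ((1 + norm y) * norm (F (x, y))))"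
        proof -
          have "\<bar>snd h \<bullet> y\<bar> \<le> norm (snd h) * norm y" by (rule Cauchy_Schwarz_ineq2)
          also have "\<dots> \<le> norm h * (1 + norm y)"
            by (intro mult_mono) (auto simp: norm_snd_le[of "snd h" "fst h", simplified])
          finally have "\<bar>snd h \<bullet> y\<bar> * norm (F (x, y)) \<le> norm h * (1 + norm y) * norm (F (x, y))"
            by (rule mult_right_mono) auto
          then show ?thesis by (simp add: norm_mult mult.assoc)
        qed
        also have "\<dots> \<le> 2 * pi * (norm h * (C * wgt y))"
          by (intro mult_left_mono C1) auto
        finally have A: "norm ((- 2 * pi * \<i>) * of_real (snd h \<bullet> y) * F (x, y)) \<le> 2 * pi * (C * wgt y) * norm h"
          by (simp add: mult_ac)
        have "norm (of_real ((fst h, 0) \<bullet> b) * dird b F (x, y)) \<le> (D b * wgt y) * norm h" if "b \<in> Basis" for b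
        proof -
          have "\<bar>(fst h, 0) \<bullet> b\<bar> \<le> norm (fst h, 0::'b)" using that by (rule Basis_le_norm)
          also have "\<dots> \<le> norm h" using norm_fst_le[of "fst h" "snd h"] by (simp add: norm_Pair)
          finally show ?thesis
            using D(2)[OF that, of x y] unfolding norm_mult norm_of_real
            by (subst mult.commute) (intro mult_mono, auto intro: order_trans[OF norm_ge_zero])
        qed
        then have B: "norm (\<Sum>b\<in>Basis. of_real ((fst h, 0) \<bullet> b) * dird b F (x, y)) \<le> (\<Sum>b\<in>Basis. D b * wgt y) * norm h"
          unfolding sum_distrib_right by (intro order_trans[OF norm_sum] sum_mono)
        show ?thesis
          unfolding H_eq w_def distrib_right unfolding snd_conv by (rule order_trans[OF norm_triangle_ineq add_mono[OF A B]])
      qed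
      show "(G has_derivative (\<lambda>h. I (?H h) p)) (at p)" for p
        unfolding G I_def
      proof (rule has_derivative_integral[where r = 1 and w = w
            and F' = "\<lambda>p y h. cis (- 2 * pi * (snd p \<bullet> y)) * ?H h (fst p, y)"])
        fix q :: "'a \<times> 'b" and y :: 'b
        let ?F' = "\<lambda>x h. \<Sum>b\<in>Basis. of_real (h \<bullet> b) * dird b F x"
        have 1: "((\<lambda>q. (fst q, y)) has_derivative (\<lambda>h. (fst h, 0))) (at q)"
          by (auto intro!: derivative_eq_intros)
        have 2: "((\<lambda>q. F (fst q, y)) has_derivative (\<lambda>h. ?F' (fst q, y) (fst h, 0))) (at q)"
          by (rule has_derivative_compose[OF 1 schwartz_has_derivative[OF F]])
        have 3: "((\<lambda>q. cis (- 2 * pi * (snd q \<bullet> y))) has_derivative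
              (\<lambda>h. of_real (snd h \<bullet> y) * (- 2 * pi * \<i> * cis (- 2 * pi * (snd q \<bullet> y))))) (at q)"
          by (auto intro!: derivative_eq_intros simp: scaleR_conv_of_real algebra_simps)
        show "((\<lambda>q. cis (- 2 * pi * (snd q \<bullet> y)) * F (fst q, y)) has_derivative
               (\<lambda>h. cis (- 2 * pi * (snd q \<bullet> y)) * ?H h (fst q, y))) (at q)"
          unfolding H_eq
          by (rule has_derivative_eq_rhs[OF has_derivative_mult[OF 3 2]]) (simp add: algebra_simps)
        show "norm (cis (- 2 * pi * (snd q \<bullet> y)) * ?H h (fst q, y)) \<le> w y * norm h" for h
          using Hb[of h "fst q" y] by (simp only: norm_mult norm_cis mult_1)
      next
        show "integrable lborel w"
          unfolding w_def by (intro Bochner_Integration.integrable_add integrable_mult_right Bochner_Integration.integrable_sum wgt_integrable)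
        show "(\<lambda>y. cis (- 2 * pi * (snd p \<bullet> y)) * ?H h (fst p, y)) \<in> borel_measurable lborel" for h
          by (rule meas[OF H])
      qed (use int[OF F] in auto)
    qed
    show "(\<lambda>p. of_real (p \<bullet> b) * G p) \<in> cspan ?P" if "b \<in> Basis" for b
    proof -
      from that consider u where "b = (u, 0)" "u \<in> Basis" | v where "b = (0, v)" "v \<in> Basis"
        unfolding Basis_prod_def by auto
      then show ?thesis
      proof cases
        case 1
        have "I (\<lambda>v. of_real (v \<bullet> b) * F v) = (\<lambda>p. of_real (p \<bullet> b) * G p)"
          by (rule ext) (simp add: I_def G 1 inner_prod_def mult.left_commute)
        with I[OF schwartz_coord[OF F that]] show ?thesis by simp
      next
        case 2
        have "of_real (p \<bullet> b) * G p = (1 / (2 * pi * \<i>)) * I (dird b F) p" for p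
        proof -
          have "of_real (snd p \<bullet> v) * G p * (\<i> * of_real (- 2 * pi)) = - I (dird b F) p"
            using integral_modulated_dird[OF schwartz_slice[OF F, of "fst p"] 2(2), of "snd p" "- 2 * pi"]
            by (simp add: G I_def dird_slice(1)[OF F] 2)
          then show ?thesis by (simp add: 2 inner_prod_def field_simps)
        qed
        then show ?thesis
          using cspan_scale[OF I[OF schwartz_dird[OF F that]]] by presburger
      qed
    qed
  qed
  then show ?thesis by (simp add: I_def case_prod_unfold)
qed

text \<open>Integrating out a variable is the partial Fourier transform at frequency 0.\<close>

lemma schwartz_integral_snd:
  fixes F :: "'a::euclidean_space \<times> 'b::euclidean_space \<Rightarrow> complex"
  assumes "F \<in> schwartz" shows "(\<lambda>x. LINT y|lborel. F (x, y)) \<in> schwartz"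
  using schwartz_slice_fst[OF schwartz_partial_fourier[OF assms], of 0] by (simp add: cis_zero)

section \<open>Product integrands, dilations and integrability on product spaces\<close>

lemma lborel_PiM_prod:
  fixes f :: "'a::euclidean_space \<Rightarrow> real \<Rightarrow> complex"
  assumes f: "\<And>b. b \<in> Basis \<Longrightarrow> integrable lborel (f b)"
  shows "integrable lborel (\<lambda>x. \<Prod>b\<in>Basis. f b (x \<bullet> b))"
    and "(LINT x|lborel. (\<Prod>b\<in>Basis. f b (x \<bullet> b))) = (\<Prod>b\<in>Basis. (LINT t|lborel. f b t))"
proof -
  interpret product_sigma_finite "\<lambda>_::'a. lborel :: real measure" ..
  let ?P = "\<Pi>\<^sub>M b\<in>(Basis :: 'a set). (lborel :: real measure)"
  let ?e = "\<lambda>u::'a \<Rightarrow> real. (\<Sum>b\<in>Basis. u b *\<^sub>R b)"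
  have [measurable]: "f b \<in> borel_measurable borel" if "b \<in> Basis" for b
    using f[OF that] by auto
  have e: "?e \<in> ?P \<rightarrow>\<^sub>M borel" by measurable
  have m: "(\<lambda>x. \<Prod>b\<in>Basis. f b (x \<bullet> b)) \<in> borel_measurable borel" by measurable
  have eq: "(\<Prod>b\<in>Basis. f b (?e u \<bullet> b)) = (\<Prod>b\<in>Basis. f b (u b))" for u
    by (intro prod.cong refl) (simp add: inner_sum_left_Basis)
  have "integrable ?P (\<lambda>u. \<Prod>b\<in>Basis. f b (u b))"
    by (intro product_integrable_prod f) auto
  then show "integrable lborel (\<lambda>x. \<Prod>b\<in>Basis. f b (x \<bullet> b))"
    by (subst lborel_eq) (simp add: integrable_distr_eq[OF e m] eq)
  show "(LINT x|lborel. (\<Prod>b\<in>Basis. f b (x \<bullet> b))) = (\<Prod>b\<in>Basis. (LINT t|lborel. f b t))"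
    by (subst lborel_eq) (simp add: integral_distr[OF e m] eq product_integral_prod f)
qed

lemma integral_scaleR:
  fixes f :: "'a::euclidean_space \<Rightarrow> complex"
  assumes [measurable]: "f \<in> borel_measurable borel" and c: "c > 0"
  shows "(LINT x|lborel. f x) = of_real (c ^ DIM('a)) * (LINT x|lborel. f (c *\<^sub>R x))"
proof -
  have "(LINT x|lborel. f x) = (LINT x|density (distr lborel borel (\<lambda>x. 0 + c *\<^sub>R x)) (\<lambda>_. \<bar>c\<bar> ^ DIM('a)). f x)"
    using c by (subst lborel_affine[of c 0]) auto
  also have "\<dots> = of_real (c ^ DIM('a)) * (LINT x|lborel. f (c *\<^sub>R x))"
    using c by (subst integral_density) (auto simp: integral_distr scaleR_conv_of_real)
  finally show ?thesis .
qed

lemma integrable_scaleR: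
  fixes f :: "'a::euclidean_space \<Rightarrow> real"
  assumes f: "integrable lborel f" and c: "c > 0"
  shows "integrable lborel (\<lambda>x. f (c *\<^sub>R x))"
proof -
  have [measurable]: "f \<in> borel_measurable borel" using f by auto
  have "integrable (density (distr lborel borel (\<lambda>x::'a. 0 + c *\<^sub>R x)) (\<lambda>_. ennreal (\<bar>c\<bar> ^ DIM('a)))) f"
    using f c lborel_affine[of c "0::'a"] by simp
  then have "integrable lborel (\<lambda>x. \<bar>c\<bar> ^ DIM('a) *\<^sub>R f (c *\<^sub>R x))"
    by (simp add: integrable_density integrable_distr_eq)
  from integrable_mult_right[OF this, of "inverse (\<bar>c\<bar> ^ DIM('a))"] show ?thesis
    using c by simp
qed

lemma integrable_pair_bound:
  fixes F :: "'a::euclidean_space \<Rightarrow> 'b::euclidean_space \<Rightarrow> complex"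
  assumes [measurable]: "case_prod F \<in> borel_measurable (borel \<Otimes>\<^sub>M borel)"
    and f: "integrable lborel f" and h: "integrable lborel h"
    and le: "\<And>x y. norm (F x y) \<le> f x * h y"
  shows "integrable (lborel \<Otimes>\<^sub>M lborel) (case_prod F)"
proof (rule integrableI_bounded)
  have "(\<integral>\<^sup>+z. ennreal (norm (case_prod F z)) \<partial>(lborel \<Otimes>\<^sub>M lborel)) =
      (\<integral>\<^sup>+x. \<integral>\<^sup>+y. ennreal (norm (F x y)) \<partial>lborel \<partial>lborel)"
    by (subst lborel.nn_integral_fst[symmetric]) (auto simp: case_prod_unfold)
  also have "\<dots> \<le> (\<integral>\<^sup>+x. \<integral>\<^sup>+y. ennreal (norm (f x)) * ennreal (norm (h y)) \<partial>lborel \<partial>lborel)"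
  proof (intro nn_integral_mono)
    fix x y
    have "norm (F x y) \<le> norm (f x) * norm (h y)"
      using le[of x y] by (metis abs_mult abs_ge_self order_trans real_norm_def)
    then show "ennreal (norm (F x y)) \<le> ennreal (norm (f x)) * ennreal (norm (h y))"
      by (simp add: ennreal_mult[symmetric] ennreal_leI)
  qed
  also have "\<dots> = (\<integral>\<^sup>+x. ennreal (norm (f x)) \<partial>lborel) * (\<integral>\<^sup>+y. ennreal (norm (h y)) \<partial>lborel)"
    using f h by (simp add: nn_integral_cmult nn_integral_multc)
  also have "\<dots> < \<infinity>"
    using f h unfolding integrable_iff_bounded by (auto simp: ennreal_mult_less_top)
  finally show "(\<integral>\<^sup>+z. ennreal (norm (case_prod F z)) \<partial>(lborel \<Otimes>\<^sub>M lborel)) < \<infinity>" .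
qed measurable

section \<open>Fourier inversion\<close>

definition gauss :: "'a::euclidean_space \<Rightarrow> real" where
  "gauss x = exp (- (norm x)\<^sup>2 / 2)"

lemma gauss_nonneg: "0 \<le> gauss x" and gauss_le_1: "gauss x \<le> 1"
  by (simp_all add: gauss_def)

lemma gauss_measurable [measurable]: "gauss \<in> borel_measurable borel"
  unfolding gauss_def[abs_def] by measurable

lemma gauss_prod: "gauss (x :: 'a::euclidean_space) = (\<Prod>b\<in>Basis. exp (- (x \<bullet> b)\<^sup>2 / 2))"
  unfolding gauss_def power2_norm_eq_inner
  by (subst euclidean_inner) (simp add: exp_sum[symmetric] sum_negf sum_divide_distrib power2_eq_square)

text \<open>Up to the normalising factor sqrt (2 pi) this is the characteristic function of the
  standard normal distribution.\<close>

lemma gauss_fourier_real: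
  "integrable lborel (\<lambda>x. complex_of_real (exp (- x\<^sup>2 / 2)) * cis (a * x))"
  "(LINT x|lborel. complex_of_real (exp (- x\<^sup>2 / 2)) * cis (a * x)) = of_real (sqrt (2 * pi) * exp (- a\<^sup>2 / 2))"
proof -
  have i: "integrable lborel (\<lambda>x. std_normal_density x *\<^sub>R cis (a * x))"
  proof (rule Bochner_Integration.integrable_bound)
    show "integrable lborel (\<lambda>x. std_normal_density x)"
      using integrable_std_normal_moment[of 0] by simp
  qed auto
  have e: "complex_of_real (exp (- x\<^sup>2 / 2)) * cis (a * x) = of_real (sqrt (2 * pi)) * (std_normal_density x *\<^sub>R cis (a * x))" for x
    by (simp add: std_normal_density_def scaleR_conv_of_real)
  show "integrable lborel (\<lambda>x. complex_of_real (exp (- x\<^sup>2 / 2)) * cis (a * x))"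
    unfolding e by (intro integrable_mult_right i)
  have "(LINT x|lborel. std_normal_density x *\<^sub>R cis (a * x)) = char std_normal_distribution a"
    unfolding char_def by (subst integral_density) (auto simp: cis_conv_exp normal_density_nonneg)
  also have "\<dots> = exp (- a\<^sup>2 / 2)" by (simp add: char_std_normal_distribution)
  finally show "(LINT x|lborel. complex_of_real (exp (- x\<^sup>2 / 2)) * cis (a * x)) = of_real (sqrt (2 * pi) * exp (- a\<^sup>2 / 2))"
    unfolding e integral_mult_right_zero by simp
qed

text \<open>Both the Gaussian and the character are products over the coordinates, which reduces the
  claim to one dimension.\<close>

lemma gauss_fourier:
  fixes s :: "'a::euclidean_space"
  shows "integrable lborel (\<lambda>x. complex_of_real (gauss x) * cis (s \<bullet> x))"
    and "(LINT x|lborel. complex_of_real (gauss x) * cis (s \<bullet> x)) = of_real (sqrt (2 * pi) ^ DIM('a) * gauss s)"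
proof -
  have e: "complex_of_real (gauss x) * cis (s \<bullet> x) =
      (\<Prod>b\<in>Basis. complex_of_real (exp (- (x \<bullet> b)\<^sup>2 / 2)) * cis ((s \<bullet> b) * (x \<bullet> b)))" for x
  proof -
    have "cis (s \<bullet> x) = (\<Prod>b\<in>Basis. cis ((s \<bullet> b) * (x \<bullet> b)))"
      by (subst euclidean_inner) (simp add: cis_conv_exp sum_distrib_left exp_sum)
    then show ?thesis by (simp add: gauss_prod prod.distrib)
  qed
  show "integrable lborel (\<lambda>x. complex_of_real (gauss x) * cis (s \<bullet> x))"
    unfolding e by (intro lborel_PiM_prod gauss_fourier_real)
  show "(LINT x|lborel. complex_of_real (gauss x) * cis (s \<bullet> x)) = of_real (sqrt (2 * pi) ^ DIM('a) * gauss s)"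
    unfolding e unfolding lborel_PiM_prod(2)[OF gauss_fourier_real(1)] gauss_fourier_real(2) unfolding gauss_prod
    by (simp add: prod.distrib)
qed

lemma gauss_integrable: "integrable lborel (gauss :: 'a::euclidean_space \<Rightarrow> real)"
  using gauss_fourier(1)[of "0 :: 'a"] by (simp add: complex_of_real_integrable_eq)

lemma integral_gauss: "(LINT x|lborel. complex_of_real (gauss (x :: 'a::euclidean_space))) = of_real (sqrt (2 * pi) ^ DIM('a))"
  using gauss_fourier(2)[of "0 :: 'a"] by (simp add: gauss_def)

text \<open>Gaussian summation: a wide Gaussian is inserted in the frequency integral, and Fubini
  moves it onto \<open>f\<close> as the concentrating kernel m^n k (m t) of mass 1. Since
  \<open>f\<close> need not be bounded, the unit ball, where continuity gives a bound, is separated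
  from its complement, where the kernel is uniformly small.\<close>

lemma fourier_inversion_0:
  fixes f :: "'a::euclidean_space \<Rightarrow> complex"
  assumes cont: "continuous_on UNIV f" and f: "integrable lborel f"
    and fh: "integrable lborel (\<lambda>\<omega>. LINT t|lborel. cis (- 2 * pi * (\<omega> \<bullet> t)) * f t)"
  shows "(LINT \<omega>|lborel. LINT t|lborel. cis (- 2 * pi * (\<omega> \<bullet> t)) * f t) = f 0"
proof -
  define h where "h \<omega> = (LINT t|lborel. cis (- 2 * pi * (\<omega> \<bullet> t)) * f t)" for \<omega>
  have h: "integrable lborel h" using fh unfolding h_def .
  have [measurable]: "f \<in> borel_measurable borel" "h \<in> borel_measurable borel" using f h by auto
  let ?n = "DIM('a)"
  \<comment> \<open>The Fourier transform of the Gaussian in the normalisation with 2 pi in the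
    exponent; in this normalisation it has integral 1.\<close>
  define k :: "'a \<Rightarrow> real" where "k s = sqrt (2 * pi) ^ ?n * gauss ((2 * pi) *\<^sub>R s)" for s
  have [measurable]: "k \<in> borel_measurable borel" unfolding k_def by measurable
  have k0: "k s \<ge> 0" for s by (simp add: k_def gauss_nonneg)
  have k1: "(LINT s|lborel. complex_of_real (k s)) = 1"
  proof -
    have "(LINT s|lborel. complex_of_real (k s)) = of_real (sqrt (2 * pi) ^ ?n) * (LINT s|lborel. of_real (gauss ((2 * pi) *\<^sub>R (s :: 'a))))"
      by (simp add: k_def)
    then have "of_real ((2 * pi) ^ ?n) * (LINT s|lborel. complex_of_real (k s)) =
        of_real (sqrt (2 * pi) ^ ?n) * (of_real ((2 * pi) ^ ?n) * (LINT s|lborel. of_real (gauss ((2 * pi) *\<^sub>R (s :: 'a)))))"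
      by simp
    also have "of_real ((2 * pi) ^ ?n) * (LINT s|lborel. of_real (gauss ((2 * pi) *\<^sub>R (s :: 'a)))) = complex_of_real (sqrt (2 * pi) ^ ?n)"
      by (rule trans[OF integral_scaleR[symmetric] integral_gauss]) auto
    also have "complex_of_real (sqrt (2 * pi) ^ ?n) * of_real (sqrt (2 * pi) ^ ?n) = of_real ((2 * pi) ^ ?n)"
      unfolding of_real_mult[symmetric] power_mult_distrib[symmetric] by simp
    finally show ?thesis by simp
  qed
  \<comment> \<open>A function that is not integrable would have integral 0, while the integral was
    just found to be 1.\<close>
  have ki: "integrable lborel k"
  proof (rule ccontr)
    assume "\<not> integrable lborel k"
    then have "\<not> integrable lborel (\<lambda>s. complex_of_real (k s))" by (simp add: complex_of_real_integrable_eq)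
    from not_integrable_integral_eq[OF this] k1 show False by simp
  qed
  have step: "(LINT \<omega>|lborel. h \<omega> * of_real (gauss ((1 / real m) *\<^sub>R \<omega>))) =
      (LINT t|lborel. f t * of_real (real m ^ ?n * k (real m *\<^sub>R t)))" if m: "m > 0" for m :: nat
  proof -
    have g: "integrable lborel (\<lambda>\<omega>::'a. gauss ((1 / real m) *\<^sub>R \<omega>))"
      using m by (intro integrable_scaleR gauss_integrable) auto
    have "(LINT \<omega>|lborel. h \<omega> * of_real (gauss ((1 / real m) *\<^sub>R \<omega>))) =
      (LINT \<omega>|lborel. LINT t|lborel. cis (- 2 * pi * (\<omega> \<bullet> t)) * f t * of_real (gauss ((1 / real m) *\<^sub>R \<omega>)))"
      by (simp add: h_def)
    also have "\<dots> = (LINT t|lborel. LINT \<omega>|lborel. cis (- 2 * pi * (\<omega> \<bullet> t)) * f t * of_real (gauss ((1 / real m) *\<^sub>R \<omega>)))"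
    proof (rule lborel_pair.Fubini_integral[symmetric])
      show "integrable (lborel \<Otimes>\<^sub>M lborel) (\<lambda>(\<omega>, t). cis (- 2 * pi * (\<omega> \<bullet> t)) * f t * complex_of_real (gauss ((1 / real m) *\<^sub>R \<omega>)))"
        by (rule integrable_pair_bound[OF _ g integrable_norm[OF f]])
           (auto simp: norm_mult gauss_nonneg)
    qed
    also have "\<dots> = (LINT t|lborel. f t * of_real (real m ^ ?n * k (real m *\<^sub>R t)))"
    proof (rule Bochner_Integration.integral_cong[OF refl])
      fix t
      have "(LINT \<omega>|lborel. cis (- 2 * pi * (\<omega> \<bullet> t)) * f t * of_real (gauss ((1 / real m) *\<^sub>R \<omega>))) =
          f t * (LINT \<omega>|lborel. of_real (gauss ((1 / real m) *\<^sub>R \<omega>)) * cis ((- (2 * pi) *\<^sub>R t) \<bullet> \<omega>))"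
        by (subst integral_mult_right_zero[symmetric]) (simp add: mult_ac inner_commute)
      also have "(LINT \<omega>|lborel. complex_of_real (gauss ((1 / real m) *\<^sub>R \<omega>)) * cis ((- (2 * pi) *\<^sub>R t) \<bullet> \<omega>)) =
          of_real (real m ^ ?n) * (LINT \<omega>|lborel. of_real (gauss \<omega>) * cis ((- (2 * pi * real m) *\<^sub>R t) \<bullet> \<omega>))"
        using m by (subst integral_scaleR[where c = "real m"]) (auto simp: mult_ac)
      also have "(LINT \<omega>|lborel. complex_of_real (gauss \<omega>) * cis ((- (2 * pi * real m) *\<^sub>R t) \<bullet> \<omega>)) = of_real (k (real m *\<^sub>R t))"
        unfolding gauss_fourier(2) k_def by (simp add: gauss_def)
      finally show "(LINT \<omega>|lborel. cis (- 2 * pi * (\<omega> \<bullet> t)) * f t * of_real (gauss ((1 / real m) *\<^sub>R \<omega>))) =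
          f t * of_real (real m ^ ?n * k (real m *\<^sub>R t))" by simp
    qed
    finally show ?thesis .
  qed
  have L: "(\<lambda>m. LINT \<omega>|lborel. h \<omega> * of_real (gauss ((1 / real m) *\<^sub>R \<omega>))) \<longlonglongrightarrow> (LINT \<omega>|lborel. h \<omega>)"
  proof (rule integral_dominated_convergence[where w = "\<lambda>\<omega>. norm (h \<omega>)"])
    show "AE \<omega> in lborel. (\<lambda>m. h \<omega> * of_real (gauss ((1 / real m) *\<^sub>R \<omega>))) \<longlonglongrightarrow> h \<omega>"
    proof (rule AE_I2)
      fix \<omega> :: 'a
      have "(\<lambda>m. exp (- (norm ((1 / real m) *\<^sub>R \<omega>))\<^sup>2 / 2)) \<longlonglongrightarrow> exp (- (norm (0 *\<^sub>R \<omega>))\<^sup>2 / 2)"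
        by (intro tendsto_intros lim_const_over_n) simp
      then have "(\<lambda>m. gauss ((1 / real m) *\<^sub>R \<omega>)) \<longlonglongrightarrow> 1" by (simp add: gauss_def)
      then have "(\<lambda>m. h \<omega> * of_real (gauss ((1 / real m) *\<^sub>R \<omega>))) \<longlonglongrightarrow> h \<omega> * of_real 1"
        by (intro tendsto_intros)
      then show "(\<lambda>m. h \<omega> * of_real (gauss ((1 / real m) *\<^sub>R \<omega>))) \<longlonglongrightarrow> h \<omega>" by simp
    qed
    show "AE \<omega> in lborel. norm (h \<omega> * complex_of_real (gauss ((1 / real m) *\<^sub>R \<omega>))) \<le> norm (h \<omega>)" for m
      by (simp add: norm_mult gauss_nonneg gauss_le_1 mult_left_le)
  qed (use h in auto)
  \<comment> \<open>The part over the unit ball after the substitution t = s / m: the domain grows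
    to the whole space while the argument of \<open>f\<close> shrinks to 0, and the bound of
    \<open>f\<close> on the unit ball gives the majorant.\<close>
  have inner: "(\<lambda>m. LINT s|lborel. indicator (cball 0 (real m)) s *\<^sub>R (f ((1 / real m) *\<^sub>R s) * of_real (k s))) \<longlonglongrightarrow> (LINT s|lborel. f 0 * of_real (k s))"
  proof -
    have "compact (f ` cball 0 1)"
      by (intro compact_continuous_image continuous_on_subset[OF cont]) auto
    from compact_imp_bounded[OF this] obtain B where B: "\<And>t. t \<in> cball 0 1 \<Longrightarrow> norm (f t) \<le> B"
      unfolding bounded_iff by blast
    show ?thesis
    proof (rule integral_dominated_convergence[where w = "\<lambda>s. B * k s"])
      show "AE s in lborel. (\<lambda>m. indicator (cball 0 (real m)) s *\<^sub>R (f ((1 / real m) *\<^sub>R s) * of_real (k s))) \<longlonglongrightarrow> f 0 * of_real (k s)"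
      proof (rule AE_I2)
        fix s :: 'a
        have "(\<lambda>m. (1 / real m) *\<^sub>R s) \<longlonglongrightarrow> 0 *\<^sub>R s"
          by (intro tendsto_intros lim_const_over_n)
        then have "(\<lambda>m. f ((1 / real m) *\<^sub>R s)) \<longlonglongrightarrow> f 0"
          using cont by (intro isCont_tendsto_compose[of 0 f]) (auto simp: continuous_on_eq_continuous_at)
        then have "(\<lambda>m. f ((1 / real m) *\<^sub>R s) * of_real (k s)) \<longlonglongrightarrow> f 0 * of_real (k s)"
          by (intro tendsto_intros)
        then show "(\<lambda>m. indicator (cball 0 (real m)) s *\<^sub>R (f ((1 / real m) *\<^sub>R s) * of_real (k s))) \<longlonglongrightarrow> f 0 * of_real (k s)"
        proof (rule Lim_transform_eventually)
          obtain N :: nat where "norm s \<le> real N" using real_arch_simple by blast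
          then show "\<forall>\<^sub>F m in sequentially. f ((1 / real m) *\<^sub>R s) * of_real (k s) =
              indicator (cball 0 (real m)) s *\<^sub>R (f ((1 / real m) *\<^sub>R s) * of_real (k s))"
            by (intro eventually_sequentiallyI[of N]) (auto simp: indicator_def)
        qed
      qed
      show "AE s in lborel. norm (indicator (cball 0 (real m)) s *\<^sub>R (f ((1 / real m) *\<^sub>R s) * complex_of_real (k s))) \<le> B * k s" for m
      proof (rule AE_I2)
        fix s :: 'a
        have "B \<ge> 0" using B[of 0] by (simp, meson norm_ge_zero order_trans)
        moreover have "norm (f ((1 / real m) *\<^sub>R s)) \<le> B" if "norm s \<le> real m"
          using that by (intro B) (auto simp: divide_simps)
        ultimately show "norm (indicator (cball 0 (real m)) s *\<^sub>R (f ((1 / real m) *\<^sub>R s) * complex_of_real (k s))) \<le> B * k s"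
          using k0[of s] by (auto simp: indicator_def norm_mult intro: mult_right_mono)
      qed
      show "integrable lborel (\<lambda>s. B * k s)" using ki by simp
      have [measurable]: "cball 0 r \<in> sets (borel :: 'a measure)" for r by simp
      show "(\<lambda>s. indicator (cball 0 (real m)) s *\<^sub>R (f ((1 / real m) *\<^sub>R s) * complex_of_real (k s))) \<in> borel_measurable lborel" for m
        by measurable
    qed measurable
  qed
  \<comment> \<open>For norm t > 1 the Gaussian exponent (2 pi m norm t)^2 / 2 exceeds m. Hence the
    kernel is at most a constant times m^n / exp m, and integrability of \<open>f\<close>
    suffices.\<close>
  have outer: "(\<lambda>m. LINT t|lborel. indicator (- cball 0 1) t *\<^sub>R (f t * of_real (real m ^ ?n * k (real m *\<^sub>R t)))) \<longlonglongrightarrow> 0"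
  proof (rule Lim_null_comparison)
    let ?c = "sqrt (2 * pi) ^ ?n * (LINT t|lborel. norm (f t))"
    show "(\<lambda>m. ?c * (real m ^ ?n / exp (real m))) \<longlonglongrightarrow> 0"
      using filterlim_compose[OF tendsto_power_div_exp_0 filterlim_real_sequentially, of ?n]
      by (intro tendsto_mult_right_zero) simp
    show "\<forall>\<^sub>F m in sequentially. norm (LINT t|lborel. indicator (- cball 0 1) t *\<^sub>R (f t * of_real (real m ^ ?n * k (real m *\<^sub>R t))))
            \<le> ?c * (real m ^ ?n / exp (real m))"
    proof (rule eventually_sequentiallyI[of 1])
      fix m :: nat assume m: "m \<ge> 1"
      have "norm (LINT t|lborel. indicator (- cball 0 1) t *\<^sub>R (f t * of_real (real m ^ ?n * k (real m *\<^sub>R t))))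
        \<le> (LINT t|lborel. norm (f t) * (sqrt (2 * pi) ^ ?n * (real m ^ ?n / exp (real m))))"
      proof (intro norm_integral_le integrable_mult_left integrable_norm f)
        fix t :: 'a
        show "norm (indicator (- cball 0 1) t *\<^sub>R (f t * complex_of_real (real m ^ ?n * k (real m *\<^sub>R t)))) \<le>
            norm (f t) * (sqrt (2 * pi) ^ ?n * (real m ^ ?n / exp (real m)))"
        proof (cases "norm t \<le> 1")
          case False
          have 1: "real m * 1 \<le> real m * norm t" using False by (intro mult_left_mono) auto
          have "1 \<le> real m" using m by simp
          with 1 have 2: "1 \<le> real m * norm t" by linarith
          have "real m \<le> (real m * norm t)\<^sup>2"
            using mult_mono[of "real m" "real m * norm t" 1 "real m * norm t"] 1 2 by (simp add: power2_eq_square)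
          also have "\<dots> \<le> (2 * pi * (real m * norm t))\<^sup>2 / 2"
          proof -
            have "2 \<le> 2 * pi * (2 * pi)" using pi_gt3 mult_mono[of 1 "2 * pi" 2 "2 * pi"] by simp
            then have "2 * (real m * norm t)\<^sup>2 \<le> (2 * pi * (2 * pi)) * (real m * norm t)\<^sup>2"
              by (rule mult_right_mono) simp
            then show ?thesis by (simp add: power2_eq_square mult_ac)
          qed
          finally have "gauss ((2 * pi) *\<^sub>R real m *\<^sub>R t) \<le> exp (- real m)"
            by (simp add: gauss_def mult_ac)
          then have "k (real m *\<^sub>R t) \<le> sqrt (2 * pi) ^ ?n * exp (- real m)"
            unfolding k_def by (intro mult_left_mono) auto
          then have "real m ^ ?n * k (real m *\<^sub>R t) \<le> real m ^ ?n * (sqrt (2 * pi) ^ ?n * exp (- real m))"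
            by (intro mult_left_mono) auto
          then have "norm (f t) * (real m ^ ?n * k (real m *\<^sub>R t)) \<le>
              norm (f t) * (real m ^ ?n * (sqrt (2 * pi) ^ ?n * exp (- real m)))"
            by (rule mult_left_mono) simp
          moreover have "norm (indicator (- cball 0 1) t *\<^sub>R (f t * complex_of_real (real m ^ ?n * k (real m *\<^sub>R t)))) =
              norm (f t) * (real m ^ ?n * k (real m *\<^sub>R t))"
            using False k0[of "real m *\<^sub>R t"] by (simp add: norm_mult norm_power indicator_def)
          ultimately show ?thesis
            by (simp add: exp_minus divide_inverse mult_ac)
        qed (auto simp: indicator_def)
      qed
      then show "norm (LINT t|lborel. indicator (- cball 0 1) t *\<^sub>R (f t * of_real (real m ^ ?n * k (real m *\<^sub>R t))))
        \<le> ?c * (real m ^ ?n / exp (real m))" by (simp add: mult_ac)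
    qed
  qed
  \<comment> \<open>Only the part over the unit ball is rescaled; the other part keeps its variable
    because its bound needs norm t > 1.\<close>
  have split: "(LINT t|lborel. f t * of_real (real m ^ ?n * k (real m *\<^sub>R t))) =
      (LINT s|lborel. indicator (cball 0 (real m)) s *\<^sub>R (f ((1 / real m) *\<^sub>R s) * of_real (k s)))
      + (LINT t|lborel. indicator (- cball 0 1) t *\<^sub>R (f t * of_real (real m ^ ?n * k (real m *\<^sub>R t))))" if m: "m > 0" for m :: nat
  proof -
    let ?u = "\<lambda>t. f t * of_real (real m ^ ?n * k (real m *\<^sub>R t))"
    have u: "integrable lborel ?u"
    proof (rule Bochner_Integration.integrable_bound)
      show "integrable lborel (\<lambda>t. norm (f t) * (real m ^ ?n * sqrt (2 * pi) ^ ?n))"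
        by (intro integrable_mult_left integrable_norm f)
      show "AE t in lborel. norm (?u t) \<le> norm (norm (f t) * (real m ^ ?n * sqrt (2 * pi) ^ ?n))"
      proof (rule AE_I2)
        fix t :: 'a
        have "real m ^ ?n * k (real m *\<^sub>R t) \<le> real m ^ ?n * (sqrt (2 * pi) ^ ?n)"
          unfolding k_def by (intro mult_left_mono mult_left_le gauss_le_1) auto
        then show "norm (?u t) \<le> norm (norm (f t) * (real m ^ ?n * sqrt (2 * pi) ^ ?n))"
          using k0[of "real m *\<^sub>R t"] by (simp add: norm_mult norm_power abs_mult mult_left_mono)
      qed
    qed auto
    have i: "integrable lborel (\<lambda>t. indicator (cball 0 1) t *\<^sub>R ?u t)"
      "integrable lborel (\<lambda>t. indicator (- cball 0 1) t *\<^sub>R ?u t)"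
      by (intro integrable_mult_indicator u; simp)+
    have "(LINT t|lborel. ?u t) = (LINT t|lborel. indicator (cball 0 1) t *\<^sub>R ?u t + indicator (- cball 0 1) t *\<^sub>R ?u t)"
      by (intro Bochner_Integration.integral_cong refl) (simp add: indicator_def)
    also have "\<dots> = (LINT t|lborel. indicator (cball 0 1) t *\<^sub>R ?u t) + (LINT t|lborel. indicator (- cball 0 1) t *\<^sub>R ?u t)"
      by (rule Bochner_Integration.integral_add[OF i])
    also have "(LINT t|lborel. indicator (cball 0 1) t *\<^sub>R ?u t) =
        (LINT s|lborel. indicator (cball 0 (real m)) s *\<^sub>R (f ((1 / real m) *\<^sub>R s) * of_real (k s)))"
      (is "_ = (LINT s|lborel. ?v s)")
    proof -
      have "(LINT s|lborel. ?v s) = of_real (real m ^ ?n) * (LINT s|lborel. ?v (real m *\<^sub>R s))"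
      proof (rule integral_scaleR)
        have [measurable]: "cball 0 (real m) \<in> sets (borel :: 'a measure)" by simp
        show "?v \<in> borel_measurable borel" by measurable
      qed (use m in simp)
      also have "\<dots> = (LINT t|lborel. indicator (cball 0 1) t *\<^sub>R ?u t)"
        by (subst integral_mult_right_zero[symmetric], rule Bochner_Integration.integral_cong)
           (use m in \<open>auto simp: indicator_def\<close>)
      finally show ?thesis ..
    qed
    finally show ?thesis .
  qed
  have "(\<lambda>m. LINT \<omega>|lborel. h \<omega> * of_real (gauss ((1 / real m) *\<^sub>R \<omega>))) \<longlonglongrightarrow> (LINT s|lborel. f 0 * of_real (k s)) + 0"
    by (rule Lim_transform_eventually[OF tendsto_add[OF inner outer]])
       (rule eventually_sequentiallyI[of 1], rule trans[OF split[symmetric] step[symmetric]], simp_all)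
  with L have "(LINT \<omega>|lborel. h \<omega>) = (LINT s|lborel. f 0 * of_real (k s)) + 0"
    by (rule LIMSEQ_unique)
  also have "\<dots> = f 0" using k1 by simp
  finally show ?thesis by (simp add: h_def)
qed

text \<open>Translating \<open>f\<close> by x multiplies its transform by a character, so inversion
  at x is inversion at 0 for the translate.\<close>

theorem fourier_inversion:
  fixes f :: "'a::euclidean_space \<Rightarrow> complex"
  assumes cont: "continuous_on UNIV f" and f: "integrable lborel f"
    and fh: "integrable lborel (\<lambda>\<omega>. LINT t|lborel. cis (- 2 * pi * (\<omega> \<bullet> t)) * f t)"
  shows "(LINT \<omega>|lborel. cis (2 * pi * (\<omega> \<bullet> x)) * (LINT t|lborel. cis (- 2 * pi * (\<omega> \<bullet> t)) * f t)) = f x"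
proof -
  define h where "h = (\<lambda>\<omega>. LINT t|lborel. cis (- 2 * pi * (\<omega> \<bullet> t)) * f t)"
  have h: "integrable lborel h" using fh by (simp add: h_def)
  then have [measurable]: "h \<in> borel_measurable borel" by auto
  have [measurable]: "f \<in> borel_measurable borel" using f by auto
  have e: "(LINT t|lborel. cis (- 2 * pi * (\<omega> \<bullet> t)) * f (t + x)) = cis (2 * pi * (\<omega> \<bullet> x)) * h \<omega>" for \<omega>
  proof -
    have "cis (2 * pi * (\<omega> \<bullet> x)) * h \<omega> = cis (2 * pi * (\<omega> \<bullet> x)) * (LINT t|lborel. cis (- 2 * pi * (\<omega> \<bullet> (t + x))) * f (t + x))"
      unfolding h_def
      by (subst integral_translate(1)[where a = x and f = "\<lambda>t. cis (- 2 * pi * (\<omega> \<bullet> t)) * f t"]) measurable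
    also have "\<dots> = (LINT t|lborel. cis (- 2 * pi * (\<omega> \<bullet> t)) * f (t + x))"
    proof -
      have "cis (2 * pi * (\<omega> \<bullet> x)) * cis (- 2 * pi * (\<omega> \<bullet> (t + x))) = cis (- 2 * pi * (\<omega> \<bullet> t))" for t
        by (simp add: cis_mult inner_add_right algebra_simps)
      then show ?thesis
        unfolding integral_mult_right_zero[symmetric] mult.assoc[symmetric] by simp
    qed
    finally show ?thesis ..
  qed
  have "(LINT \<omega>|lborel. LINT t|lborel. cis (- 2 * pi * (\<omega> \<bullet> t)) * f (t + x)) = f (0 + x)"
  proof (rule fourier_inversion_0)
    show "continuous_on UNIV (\<lambda>t. f (t + x))"
      by (intro continuous_on_compose2[OF cont] continuous_intros) auto
    show "integrable lborel (\<lambda>\<omega>. LINT t|lborel. cis (- 2 * pi * (\<omega> \<bullet> t)) * f (t + x))"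
      unfolding e
      by (rule Bochner_Integration.integrable_bound[OF h]) (auto simp: norm_mult)
  qed (intro integrable_translate f)
  then show ?thesis unfolding e unfolding h_def by simp
qed

section \<open>The short-time Fourier transform\<close>

definition tfs :: "'a \<times> 'a \<Rightarrow> ('a::euclidean_space \<Rightarrow> complex) \<Rightarrow> 'a \<Rightarrow> complex" where
  "tfs z g = (\<lambda>t. cis (2 * pi * (snd z \<bullet> t)) * g (t - fst z))"

text \<open>The transform of a function, with position and frequency merged into one point of phase
  space. For a Schwartz window it agrees with the values of \<open>distr_of_fun f\<close> on the
  shifts of the window.\<close>

definition stf :: "('a::euclidean_space \<Rightarrow> complex) \<Rightarrow> ('a \<Rightarrow> complex) \<Rightarrow> 'a \<times> 'a \<Rightarrow> complex" where
  "stf g f z = (LINT t|lborel. f t * cnj (tfs z g t))"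

lemma norm_tfs: "norm (tfs z g t) = norm (g (t - fst z))"
  by (simp add: tfs_def norm_mult)

lemma tfs_schwartz: "g \<in> schwartz \<Longrightarrow> tfs z g \<in> schwartz"
  unfolding tfs_def by (intro schwartz_modulate schwartz_translate)

lemma stft_tfs: "stft g u x \<omega> = u (tfs (x, \<omega>) g)"
  by (simp add: stft_def tfs_def)

lemma distr_of_fun_schwartz: "\<phi> \<in> schwartz \<Longrightarrow> distr_of_fun f \<phi> = (LINT t|lborel. f t * cnj (\<phi> t))"
  by (simp add: distr_of_fun_def)

lemma cnj_measurable [measurable]: "cnj \<in> borel_measurable borel"
  by (intro borel_measurable_continuous_onI continuous_intros)

lemma borel_measurable_fst [measurable (raw)]:
  fixes f :: "'c \<Rightarrow> 'a::topological_space \<times> 'b::topological_space"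
  shows "f \<in> borel_measurable M \<Longrightarrow> (\<lambda>x. fst (f x)) \<in> borel_measurable M"
  using measurable_compose[OF _ borel_measurable_continuous_onI[OF continuous_on_fst[OF continuous_on_id]]] by auto

lemma borel_measurable_snd [measurable (raw)]:
  fixes f :: "'c \<Rightarrow> 'a::topological_space \<times> 'b::topological_space"
  shows "f \<in> borel_measurable M \<Longrightarrow> (\<lambda>x. snd (f x)) \<in> borel_measurable M"
  using measurable_compose[OF _ borel_measurable_continuous_onI[OF continuous_on_snd[OF continuous_on_id]]] by auto

lemma tfs_measurable [measurable (raw)]:
  fixes g :: "'a::euclidean_space \<Rightarrow> complex"
  assumes [measurable]: "g \<in> borel_measurable borel" "Z \<in> borel_measurable M" "t \<in> borel_measurable M"
  shows "(\<lambda>x. tfs (Z x) g (t x)) \<in> borel_measurable M"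
  unfolding tfs_def by measurable

lemma stf_measurable [measurable]:
  fixes g f :: "'a::euclidean_space \<Rightarrow> complex"
  assumes [measurable]: "g \<in> borel_measurable borel" "f \<in> borel_measurable borel"
  shows "stf g f \<in> borel_measurable borel"
proof -
  have "(\<lambda>z. LINT t|lborel. f t * cnj (tfs z g t)) \<in> borel_measurable borel"
    by measurable
  then show ?thesis by (simp add: stf_def[abs_def])
qed

lemma schwartz_sup:
  assumes "g \<in> schwartz" obtains B where "B > 0" "\<And>x. norm (g x) \<le> B"
proof -
  obtain C where "\<And>x. norm (g x) \<le> C" using schwartz_bounded[OF assms] unfolding bounded_iff by auto
  then have "\<And>x. norm (g x) \<le> max 1 C" by (simp add: max.coboundedI2)
  then show ?thesis using that[of "max 1 C"] by simp
qed

lemma tfs_sup: "(\<And>x. norm (g x) \<le> B) \<Longrightarrow> norm (tfs z g t) \<le> B"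
  by (simp add: norm_tfs)

lemma integrable_mult_bounded:
  fixes f h :: "'a \<Rightarrow> complex"
  assumes "integrable M f" "h \<in> borel_measurable M" "\<And>x. norm (h x) \<le> B"
  shows "integrable M (\<lambda>x. f x * h x)"
proof (rule Bochner_Integration.integrable_bound)
  show "integrable M (\<lambda>x. norm (f x) * B)" using assms by simp
  have "norm (f x * h x) \<le> norm (norm (f x) * B)" for x
    using mult_left_mono[OF assms(3)[of x], of "norm (f x)"] by (simp add: norm_mult abs_mult, meson abs_ge_self mult_left_mono norm_ge_zero order_trans)
  then show "AE x in M. norm (f x * h x) \<le> norm (norm (f x) * B)" by simp
  show "(\<lambda>x. f x * h x) \<in> borel_measurable M" using assms by measurable
qed

lemma stf_integrand_integrable:
  assumes f: "integrable lborel f" and g: "g \<in> schwartz"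
  shows "integrable lborel (\<lambda>t. f t * cnj (tfs z g t))"
proof -
  obtain B where "\<And>x. norm (g x) \<le> B" using schwartz_sup[OF g] by metis
  then show ?thesis using f schwartz_measurable[OF g]
    by (intro integrable_mult_bounded[where B = B]) (auto simp: norm_tfs)
qed

lemma stf_bounded:
  assumes f: "integrable lborel f" and g: "g \<in> schwartz"
  obtains B where "B > 0" "\<And>z. norm (stf g f z) \<le> B"
proof -
  obtain B where B: "B > 0" "\<And>x. norm (g x) \<le> B" using schwartz_sup[OF g] by metis
  have "norm (stf g f z) \<le> (LINT t|lborel. norm (f t) * B)" for z
    unfolding stf_def using f B
    by (intro norm_integral_le) (auto simp: norm_mult norm_tfs intro: mult_left_mono)
  then have "norm (stf g f z) \<le> max 1 (LINT t|lborel. norm (f t) * B)" for z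
    by (simp add: max.coboundedI2)
  then show ?thesis using that[of "max 1 (LINT t|lborel. norm (f t) * B)"] by simp
qed

lemma stf_diff:
  assumes "integrable lborel f" "integrable lborel h" "g \<in> schwartz"
  shows "stf g (\<lambda>t. f t - h t) z = stf g f z - stf g h z"
  unfolding stf_def using stf_integrand_integrable[OF assms(1,3)] stf_integrand_integrable[OF assms(2,3)]
  by (subst Bochner_Integration.integral_diff[symmetric]) (auto simp: algebra_simps)

text \<open>\<open>V\<^sub>g \<phi>\<close> is a partial Fourier transform of \<open>(x, t) \<mapsto> \<phi>(t) cnj (g (t - x))\<close>.\<close>

lemma stf_schwartz:
  fixes g \<phi> :: "'a::euclidean_space \<Rightarrow> complex"
  assumes g: "g \<in> schwartz" and \<phi>: "\<phi> \<in> schwartz"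
  shows "stf g \<phi> \<in> schwartz"
proof -
  have "(\<lambda>p. \<phi> (fst p) * cnj (g (snd p))) \<in> schwartz"
    by (rule schwartz_tensor[OF \<phi> schwartz_cnj[OF g]])
  moreover have "linear (\<lambda>p::'a \<times> 'a. (snd p, snd p - fst p))" "linear (\<lambda>p::'a \<times> 'a. (fst p - snd p, fst p))"
    by (auto intro!: linearI simp: algebra_simps)
  ultimately have "(\<lambda>p. \<phi> (fst ((snd p, snd p - fst p) + 0)) * cnj (g (snd ((snd p, snd p - fst p) + 0)))) \<in> schwartz"
    by (rule schwartz_affine) simp
  then have "(\<lambda>p. \<phi> (snd p) * cnj (g (snd p - fst p))) \<in> schwartz" by simp
  from schwartz_partial_fourier[OF this] show ?thesis
    by (rule back_subst[of "\<lambda>f. f \<in> schwartz"])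
       (auto simp: stf_def tfs_def cis_cnj mult_ac)
qed

lemma stf_fourier:
  "stf g f (x, \<omega>) = (LINT t|lborel. cis (- 2 * pi * (\<omega> \<bullet> t)) * (f t * cnj (g (t - x))))"
  unfolding stf_def tfs_def by (simp add: cis_cnj mult_ac)

text \<open>The squared L^2 norm of the window, kept complex so that it can be cancelled directly in
  identities between complex integrals.\<close>

definition energy :: "('a::euclidean_space \<Rightarrow> complex) \<Rightarrow> complex" where
  "energy g = (LINT t|lborel. g t * cnj (g t))"

text \<open>If the integral of |g|^2 vanished, the open set where g is not 0 would be a null set; a
  nonempty open set contains a ball of positive measure.\<close>

lemma energy_pos:
  fixes g :: "'a::euclidean_space \<Rightarrow> complex"
  assumes g: "g \<in> schwartz" and nz: "g \<noteq> (\<lambda>_. 0)"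
  shows "energy g \<noteq> 0"
proof
  assume 0: "energy g = 0"
  have e: "g t * cnj (g t) = of_real ((norm (g t))\<^sup>2)" for t by (rule complex_norm_square[symmetric])
  have i: "integrable lborel (\<lambda>t. (norm (g t))\<^sup>2)"
    using schwartz_integrable[OF schwartz_mult[OF g schwartz_cnj[OF g]]]
    unfolding e complex_of_real_integrable_eq .
  have "(LINT t|lborel. (norm (g t))\<^sup>2) = 0"
    using 0 unfolding energy_def e integral_complex_of_real of_real_eq_0_iff .
  with i have "AE t in lborel. (norm (g t))\<^sup>2 = 0"
    by (subst (asm) integral_nonneg_eq_0_iff_AE) auto
  then have "AE t in lborel. t \<notin> {t. g t \<noteq> 0}" by simp
  moreover have op: "open {t. g t \<noteq> 0}"
    by (intro open_Collect_neq schwartz_continuous[OF g] continuous_intros)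
  ultimately have "emeasure lborel {t. g t \<noteq> 0} = 0"
    using AE_iff_measurable[of "{t. g t \<noteq> 0}" lborel "\<lambda>t. t \<notin> {t. g t \<noteq> 0}"] by auto
  moreover have "emeasure lborel {t. g t \<noteq> 0} > 0" if "g a \<noteq> 0" for a
  proof -
    have "a \<in> {t. g t \<noteq> 0}" using that by simp
    from openE[OF op this] obtain r where r: "r > 0" "ball a r \<subseteq> {t. g t \<noteq> 0}" .
    have "0 < emeasure lborel (ball a r)" using r by (simp add: emeasure_ball unit_ball_vol_pos)
    also have "\<dots> \<le> emeasure lborel {t. g t \<noteq> 0}"
      using r op by (intro emeasure_mono) auto
    finally show ?thesis .
  qed
  ultimately have "g a = 0" for a by (metis less_irrefl)
  with nz show False by auto
qed

lemma integrable_pair_of_lborel: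
  fixes f :: "'a::euclidean_space \<times> 'b::euclidean_space \<Rightarrow> 'c::{banach, second_countable_topology}"
  shows "integrable lborel f \<Longrightarrow> integrable (lborel \<Otimes>\<^sub>M lborel) f"
  by (simp add: lborel_prod)

text \<open>For almost every position x the slice of V_g f is the integrable Fourier transform of t
  -> f(t) cnj (g (t - x)), so Fourier inversion recovers that function at t. Multiplying by g (t -
  x) and integrating over x leaves f(t) times the energy. The exceptional positions are harmless, as
  x is integrated out.\<close>

theorem stf_inversion:
  fixes g f :: "'a::euclidean_space \<Rightarrow> complex"
  assumes g: "g \<in> schwartz" and cont: "continuous_on UNIV f" and f: "integrable lborel f"
    and V: "integrable lborel (stf g f)"
  shows "(LINT z|lborel. stf g f z * tfs z g t) = f t * energy g"
proof -
  have [measurable]: "g \<in> borel_measurable borel" "f \<in> borel_measurable borel"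
    using schwartz_measurable[OF g] f by auto
  obtain B where B: "\<And>x. norm (g x) \<le> B" using schwartz_sup[OF g] by metis
  have i: "integrable lborel (\<lambda>z. stf g f z * tfs z g t)"
    by (rule integrable_mult_bounded[OF V _ tfs_sup[OF B]]) measurable
  have "(LINT z|lborel. stf g f z * tfs z g t) =
      (LINT x|lborel. LINT \<omega>|lborel. stf g f (x, \<omega>) * tfs (x, \<omega>) g t)"
    using lborel_pair.integral_fst'[OF integrable_pair_of_lborel[OF i]] by (simp add: lborel_prod)
  also have "\<dots> = (LINT x|lborel. f t * (g (t - x) * cnj (g (t - x))))"
  proof (rule integral_cong_AE)
    show "(\<lambda>x. LINT \<omega>|lborel. stf g f (x, \<omega>) * tfs (x, \<omega>) g t) \<in> borel_measurable lborel"
      using lborel_pair.integrable_fst'[OF integrable_pair_of_lborel[OF i]] by auto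
    have "AE x in lborel. integrable lborel (\<lambda>\<omega>. stf g f (x, \<omega>))"
      by (rule lborel_pair.AE_integrable_fst'[OF integrable_pair_of_lborel[OF V]])
    then show "AE x in lborel. (LINT \<omega>|lborel. stf g f (x, \<omega>) * tfs (x, \<omega>) g t) = f t * (g (t - x) * cnj (g (t - x)))"
    proof eventually_elim
      case (elim x)
      let ?k = "\<lambda>t. f t * cnj (g (t - x))"
      have "(LINT \<omega>|lborel. cis (2 * pi * (\<omega> \<bullet> t)) * (LINT t|lborel. cis (- 2 * pi * (\<omega> \<bullet> t)) * ?k t)) = ?k t"
      proof (rule fourier_inversion)
        show "continuous_on UNIV ?k"
          by (intro continuous_intros cont continuous_on_compose2[OF schwartz_continuous[OF g, of UNIV]]) auto
        show "integrable lborel ?k"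
          by (rule integrable_mult_bounded[OF f, where B = B]) (auto simp: B)
      qed (use elim in \<open>simp add: stf_fourier\<close>)
      then have "(LINT \<omega>|lborel. cis (2 * pi * (\<omega> \<bullet> t)) * stf g f (x, \<omega>)) * g (t - x) = ?k t * g (t - x)"
        by (simp only: stf_fourier)
      then show ?case
        unfolding integral_mult_left_zero[symmetric] by (simp only: tfs_def fst_conv snd_conv mult_ac)
    qed
  qed measurable
  also have "\<dots> = f t * (LINT x|lborel. g (t - x) * cnj (g (t - x)))" by simp
  also have "(LINT x|lborel. g (t - x) * cnj (g (t - x))) = energy g"
    unfolding energy_def by (rule integral_translate(3)) measurable
  finally show ?thesis .
qed

lemma stf_inversion_schwartz:
  assumes "g \<in> schwartz" "\<phi> \<in> schwartz"
  shows "(LINT z|lborel. stf g \<phi> z * tfs z g t) = \<phi> t * energy g"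
  using assms by (intro stf_inversion schwartz_continuous schwartz_integrable stf_schwartz)

subsection \<open>Bounds in terms of the Schwartz seminorms\<close>

lemma schwartz_seminorm_index_finite: "finite {bs. set bs \<subseteq> (Basis :: 'a::euclidean_space set) \<and> length bs \<le> N}"
  by (intro finite_lists_length_le) auto

lemma schwartz_seminorm_bdd:
  assumes "f \<in> schwartz" "set bs \<subseteq> Basis"
  shows "bdd_above (range (\<lambda>x. norm x ^ k * norm (iter_deriv bs f x)))"
proof -
  from assms have "bounded (range (\<lambda>x. norm x ^ k *\<^sub>R iter_deriv bs f x))"
    unfolding schwartz_def by blast
  then show ?thesis unfolding bounded_iff bdd_above_def by auto
qed

lemma schwartz_seminorm_term:
  fixes f :: "'a::euclidean_space \<Rightarrow> complex"
  assumes f: "f \<in> schwartz" and "k \<le> N" "set bs \<subseteq> Basis" "length bs \<le> N"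
  shows "norm x ^ k * norm (iter_deriv bs f x) \<le> schwartz_seminorm N f"
proof -
  let ?I = "{bs. set bs \<subseteq> (Basis :: 'a set) \<and> length bs \<le> N}"
  let ?S = "\<lambda>k bs. SUP x. norm x ^ k * norm (iter_deriv bs f x)"
  have nn: "0 \<le> ?S k bs" if "bs \<in> ?I" for k bs
    using that by (intro cSUP_upper2[OF _ UNIV_I[of 0]] schwartz_seminorm_bdd f) auto
  have "norm x ^ k * norm (iter_deriv bs f x) \<le> ?S k bs"
    using assms by (intro cSUP_upper schwartz_seminorm_bdd) auto
  also have "\<dots> \<le> (\<Sum>bs\<in>?I. ?S k bs)"
    using assms nn by (intro member_le_sum schwartz_seminorm_index_finite) auto
  also have "\<dots> \<le> schwartz_seminorm N f"
    unfolding schwartz_seminorm_def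
    using assms nn by (intro member_le_sum[of k "{..N}" "\<lambda>k. \<Sum>bs\<in>?I. ?S k bs"]) (auto intro!: sum_nonneg)
  finally show ?thesis .
qed

text \<open>The number of summands in \<open>schwartz_seminorm\<close>; a uniform bound on the
  summands becomes a bound on the seminorm at the price of this factor.\<close>

definition seminorm_card :: "nat \<Rightarrow> 'a::euclidean_space itself \<Rightarrow> real" where
  "seminorm_card N _ = real (Suc N) * real (card {bs. set bs \<subseteq> (Basis :: 'a set) \<and> length bs \<le> N})"

lemma schwartz_seminorm_le:
  fixes f :: "'a::euclidean_space \<Rightarrow> complex"
  assumes "\<And>k bs x. k \<le> N \<Longrightarrow> set bs \<subseteq> Basis \<Longrightarrow> length bs \<le> N \<Longrightarrow> norm x ^ k * norm (iter_deriv bs f x) \<le> c"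
  shows "schwartz_seminorm N f \<le> seminorm_card N TYPE('a) * c"
proof -
  have "schwartz_seminorm N f \<le> (\<Sum>k\<le>N. \<Sum>bs\<in>{bs. set bs \<subseteq> (Basis :: 'a set) \<and> length bs \<le> N}. c)"
    unfolding schwartz_seminorm_def using assms by (intro sum_mono cSUP_least) auto
  also have "\<dots> = seminorm_card N TYPE('a) * c" by (simp add: seminorm_card_def)
  finally show ?thesis .
qed

lemma seminorm_card_nonneg: "0 \<le> seminorm_card N t"
  by (simp add: seminorm_card_def)

lemma schwartz_seminorm_nonneg: "f \<in> schwartz \<Longrightarrow> 0 \<le> schwartz_seminorm N f"
  using schwartz_seminorm_term[of f 0 N "[]" 0] by (rule order_trans[rotated]) auto

lemma schwartz_seminorm_mono:
  fixes f :: "'a::euclidean_space \<Rightarrow> complex"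
  assumes "f \<in> schwartz" "N \<le> N'"
  shows "schwartz_seminorm N f \<le> seminorm_card N TYPE('a) * schwartz_seminorm N' f"
  using assms by (intro schwartz_seminorm_le schwartz_seminorm_term) auto

lemma schwartz_seminorm_dird:
  fixes f :: "'a::euclidean_space \<Rightarrow> complex"
  assumes "f \<in> schwartz" "b \<in> Basis"
  shows "schwartz_seminorm N (dird b f) \<le> seminorm_card N TYPE('a) * schwartz_seminorm (Suc N) f"
proof (rule schwartz_seminorm_le)
  fix k bs x assume "k \<le> N" "set bs \<subseteq> (Basis :: 'a set)" "length bs \<le> N"
  then show "norm x ^ k * norm (iter_deriv bs (dird b f) x) \<le> schwartz_seminorm (Suc N) f"
    unfolding iter_deriv_dird using assms by (intro schwartz_seminorm_term) auto
qed

text \<open>Domination by some Schwartz seminorm, uniformly in the index. Order and constant are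
  hidden because derivatives and sums change both, and only their existence matters.\<close>

definition seminorm_bdd :: "(('a::euclidean_space \<Rightarrow> complex) \<Rightarrow> 'i \<Rightarrow> real) \<Rightarrow> bool" where
  "seminorm_bdd T \<longleftrightarrow> (\<exists>N C. C \<ge> 0 \<and> (\<forall>\<phi>\<in>schwartz. \<forall>i. T \<phi> i \<le> C * schwartz_seminorm N \<phi>))"

lemma seminorm_bddI: "C \<ge> 0 \<Longrightarrow> (\<And>\<phi> i. \<phi> \<in> schwartz \<Longrightarrow> T \<phi> i \<le> C * schwartz_seminorm N \<phi>) \<Longrightarrow> seminorm_bdd T"
  unfolding seminorm_bdd_def by blast

lemma seminorm_bdd_le:
  "seminorm_bdd T \<Longrightarrow> (\<And>\<phi> i. \<phi> \<in> schwartz \<Longrightarrow> T' \<phi> i \<le> T \<phi> (h i)) \<Longrightarrow> seminorm_bdd T'"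
  unfolding seminorm_bdd_def by (meson order_trans)

lemma seminorm_bdd_add:
  fixes T T' :: "('a::euclidean_space \<Rightarrow> complex) \<Rightarrow> 'i \<Rightarrow> real"
  assumes "seminorm_bdd T" "seminorm_bdd T'" shows "seminorm_bdd (\<lambda>\<phi> i. T \<phi> i + T' \<phi> i)"
proof -
  from assms obtain N C N' C' where *: "C \<ge> 0" "\<And>\<phi> i. \<phi> \<in> schwartz \<Longrightarrow> T \<phi> i \<le> C * schwartz_seminorm N \<phi>"
    "C' \<ge> 0" "\<And>\<phi> i. \<phi> \<in> schwartz \<Longrightarrow> T' \<phi> i \<le> C' * schwartz_seminorm N' \<phi>"
    unfolding seminorm_bdd_def by metis
  let ?K = "\<lambda>N. seminorm_card N TYPE('a)"
  show ?thesis
  proof (rule seminorm_bddI[where N = "max N N'" and C = "C * ?K N + C' * ?K N'"])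
    show "0 \<le> C * ?K N + C' * ?K N'" by (intro add_nonneg_nonneg mult_nonneg_nonneg * seminorm_card_nonneg)
    fix \<phi> :: "'a \<Rightarrow> complex" and i assume \<phi>: "\<phi> \<in> schwartz"
    have "T \<phi> i \<le> C * (?K N * schwartz_seminorm (max N N') \<phi>)"
      by (rule order_trans[OF *(2)[OF \<phi>]]) (intro mult_left_mono schwartz_seminorm_mono \<phi> *, simp)
    moreover have "T' \<phi> i \<le> C' * (?K N' * schwartz_seminorm (max N N') \<phi>)"
      by (rule order_trans[OF *(4)[OF \<phi>]]) (intro mult_left_mono schwartz_seminorm_mono \<phi> *, simp)
    ultimately show "T \<phi> i + T' \<phi> i \<le> (C * ?K N + C' * ?K N') * schwartz_seminorm (max N N') \<phi>"
      by (simp add: algebra_simps)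
  qed
qed

lemma seminorm_bdd_sum:
  "finite I \<Longrightarrow> (\<And>b. b \<in> I \<Longrightarrow> seminorm_bdd (T b)) \<Longrightarrow> seminorm_bdd (\<lambda>\<phi> i. \<Sum>b\<in>I. T b \<phi> i)"
proof (induction I rule: finite_induct)
  case empty
  show ?case by (rule seminorm_bddI[of 0 _ 0]) auto
next
  case (insert b I)
  then have "seminorm_bdd (\<lambda>\<phi> i. T b \<phi> i + (\<Sum>b\<in>I. T b \<phi> i))" by (intro seminorm_bdd_add) auto
  with insert show ?case by simp
qed

lemma seminorm_bdd_dird:
  fixes T :: "('a::euclidean_space \<Rightarrow> complex) \<Rightarrow> 'i \<Rightarrow> real"
  assumes "seminorm_bdd T" "b \<in> Basis" shows "seminorm_bdd (\<lambda>\<phi>. T (dird b \<phi>))"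
proof -
  from assms obtain N C where *: "C \<ge> 0" "\<And>\<phi> i. \<phi> \<in> schwartz \<Longrightarrow> T \<phi> i \<le> C * schwartz_seminorm N \<phi>"
    unfolding seminorm_bdd_def by metis
  show ?thesis
  proof (rule seminorm_bddI[where N = "Suc N" and C = "C * seminorm_card N TYPE('a)"])
    fix \<phi> :: "'a \<Rightarrow> complex" and i assume \<phi>: "\<phi> \<in> schwartz"
    have "T (dird b \<phi>) i \<le> C * schwartz_seminorm N (dird b \<phi>)"
      by (intro * schwartz_dird \<phi> assms)
    also have "\<dots> \<le> C * (seminorm_card N TYPE('a) * schwartz_seminorm (Suc N) \<phi>)"
      by (intro mult_left_mono * schwartz_seminorm_dird \<phi> assms)
    finally show "T (dird b \<phi>) i \<le> C * seminorm_card N TYPE('a) * schwartz_seminorm (Suc N) \<phi>"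
      by (simp add: mult.assoc)
  qed (intro mult_nonneg_nonneg * seminorm_card_nonneg)
qed

lemma seminorm_bdd_decay:
  "seminorm_bdd (\<lambda>\<phi> x. (1 + norm x) ^ k * norm (\<phi> (x :: 'a::euclidean_space)))"
proof (rule seminorm_bddI[where N = k and C = "2 ^ k * 2"])
  fix \<phi> :: "'a \<Rightarrow> complex" and x assume \<phi>: "\<phi> \<in> schwartz"
  have 1: "norm x ^ 0 * norm (iter_deriv [] \<phi> x) \<le> schwartz_seminorm k \<phi>"
    "norm x ^ k * norm (iter_deriv [] \<phi> x) \<le> schwartz_seminorm k \<phi>"
    by (rule schwartz_seminorm_term[OF \<phi>]; simp)+
  have "(1 + norm x) ^ k \<le> (2 * max 1 (norm x)) ^ k" by (intro power_mono) auto
  also have "\<dots> \<le> 2 ^ k * (1 + norm x ^ k)" by (auto simp: power_mult_distrib max_def)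
  finally have "(1 + norm x) ^ k * norm (\<phi> x) \<le> 2 ^ k * (1 + norm x ^ k) * norm (\<phi> x)"
    by (intro mult_right_mono) auto
  also have "\<dots> = 2 ^ k * (norm x ^ 0 * norm (\<phi> x) + norm x ^ k * norm (\<phi> x))" by (simp add: algebra_simps)
  also have "\<dots> \<le> 2 ^ k * (schwartz_seminorm k \<phi> + schwartz_seminorm k \<phi>)" using 1 by (intro mult_left_mono add_mono) auto
  finally show "(1 + norm x) ^ k * norm (\<phi> x) \<le> 2 ^ k * 2 * schwartz_seminorm k \<phi>" by simp
qed simp

text \<open>From 1 + norm x <= (1 + norm t) (1 + norm (t - x)) the decay in the position x is shared
  between the function at t and the window at t - x.\<close>

lemma stf_decay_fst:
  fixes g :: "'a::euclidean_space \<Rightarrow> complex"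
  assumes g: "g \<in> schwartz"
  shows "seminorm_bdd (\<lambda>\<phi> z. (1 + norm (fst z)) ^ k * norm (stf g \<phi> z))"
proof -
  obtain C where C: "C \<ge> 0" "\<And>x. (1 + norm x) ^ k * norm (g x) \<le> C * wgt x"
    using schwartz_wgt[OF g] by metis
  from seminorm_bdd_decay[of k] obtain N D where D: "D \<ge> 0"
    "\<And>\<phi> x. \<phi> \<in> schwartz \<Longrightarrow> (1 + norm x) ^ k * norm (\<phi> (x :: 'a)) \<le> D * schwartz_seminorm N \<phi>"
    unfolding seminorm_bdd_def by metis
  let ?W = "LINT x|lborel. wgt (x :: 'a)"
  show ?thesis
  proof (rule seminorm_bddI[where N = N and C = "D * C * ?W"])
    show "0 \<le> D * C * ?W" using D C wgt_nonneg by (intro mult_nonneg_nonneg Bochner_Integration.integral_nonneg) auto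
    fix \<phi> :: "'a \<Rightarrow> complex" and z :: "'a \<times> 'a" assume \<phi>: "\<phi> \<in> schwartz"
    let ?p = "schwartz_seminorm N \<phi>"
    have "(1 + norm (fst z)) ^ k * norm (stf g \<phi> z) = norm (LINT t|lborel. of_real ((1 + norm (fst z)) ^ k) * (\<phi> t * cnj (tfs z g t)))"
      unfolding stf_def integral_mult_right_zero norm_mult norm_of_real by simp
    also have "\<dots> \<le> (LINT t|lborel. D * ?p * C * wgt (t - fst z))"
    proof (intro norm_integral_le integrable_mult_right integrable_translate wgt_integrable)
      fix t
      have "1 + norm (fst z) \<le> (1 + norm t) * (1 + norm (t - fst z))"
      proof -
        have "norm (fst z) \<le> norm t + norm (t - fst z)" using norm_triangle_ineq4[of t "t - fst z"] by simp
        moreover have "0 \<le> norm t * norm (t - fst z)" by simp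
        moreover have "(1 + norm t) * (1 + norm (t - fst z)) = 1 + norm t + norm (t - fst z) + norm t * norm (t - fst z)"
          by (simp add: algebra_simps)
        ultimately show ?thesis by linarith
      qed
      then have "(1 + norm (fst z)) ^ k \<le> (1 + norm t) ^ k * (1 + norm (t - fst z)) ^ k"
        unfolding power_mult_distrib[symmetric] by (intro power_mono) auto
      then have "(1 + norm (fst z)) ^ k * (norm (\<phi> t) * norm (g (t - fst z))) \<le>
          (1 + norm t) ^ k * (1 + norm (t - fst z)) ^ k * (norm (\<phi> t) * norm (g (t - fst z)))"
        by (rule mult_right_mono) simp
      also have "\<dots> = ((1 + norm t) ^ k * norm (\<phi> t)) * ((1 + norm (t - fst z)) ^ k * norm (g (t - fst z)))"
        by (simp add: mult_ac)
      also have "\<dots> \<le> (D * ?p) * (C * wgt (t - fst z))"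
        using D(1) schwartz_seminorm_nonneg[OF \<phi>] by (intro mult_mono D(2)[OF \<phi>] C(2)) auto
      finally show "norm (of_real ((1 + norm (fst z)) ^ k) * (\<phi> t * cnj (tfs z g t))) \<le> D * ?p * C * wgt (t - fst z)"
        unfolding norm_mult norm_of_real by (simp add: norm_tfs mult_ac)
    qed
    also have "\<dots> = D * ?p * C * (LINT t|lborel. wgt (t - fst z))" by simp
    also have "(LINT t|lborel. wgt (t - fst z)) = ?W"
      using integral_translate(2)[of "\<lambda>x. complex_of_real (wgt x)" "fst z"] by simp
    finally show "(1 + norm (fst z)) ^ k * norm (stf g \<phi> z) \<le> D * C * ?W * ?p" by (simp add: mult_ac)
  qed
qed

lemma schwartz_dird_sum:
  "f \<in> schwartz \<Longrightarrow> (\<Sum>c\<in>Basis. of_real (b \<bullet> c) * dird c f x) = dird b f x"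
  by (rule dird_eq[OF schwartz_has_derivative, symmetric])

lemma dird_mult:
  assumes "f \<in> schwartz" "h \<in> schwartz"
  shows "dird b (\<lambda>x. f x * h x) x = f x * dird b h x + dird b f x * h x"
  using has_derivative_mult[OF schwartz_has_derivative[OF assms(1), of x] schwartz_has_derivative[OF assms(2), of x]]
  by (subst dird_eq, assumption) (simp only: schwartz_dird_sum assms)

lemma dird_cnj_translate:
  assumes "g \<in> schwartz"
  shows "dird b (\<lambda>t. cnj (g (t - x))) t = cnj (dird b g (t - x))"
proof -
  have 1: "((\<lambda>t. t - x) has_derivative (\<lambda>h. h)) (at t)" by (auto intro!: derivative_eq_intros)
  from has_derivative_cnj[OF has_derivative_compose[OF 1 schwartz_has_derivative[OF assms]]]
  show ?thesis by (subst dird_eq, assumption) (simp only: schwartz_dird_sum assms)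
qed

text \<open>Integration by parts trades a frequency coordinate for a derivative, which falls on the
  function or on the window. The factor 2 pi on the left is at least 1 and is dropped.\<close>

lemma stf_mult_frequency:
  fixes g :: "'a::euclidean_space \<Rightarrow> complex"
  assumes g: "g \<in> schwartz" and \<phi>: "\<phi> \<in> schwartz" and b: "b \<in> Basis"
  shows "\<bar>snd z \<bullet> b\<bar> * norm (stf g \<phi> z) \<le> norm (stf g (dird b \<phi>) z) + norm (stf (dird b g) \<phi> z)"
proof -
  obtain x \<omega> where z: "z = (x, \<omega>)" by (cases z)
  have gx: "(\<lambda>t. cnj (g (t - x))) \<in> schwartz" by (intro schwartz_cnj schwartz_translate g)
  have "of_real (\<omega> \<bullet> b) * stf g \<phi> z * (\<i> * of_real (- 2 * pi)) =
     - (LINT t|lborel. cis (- 2 * pi * (\<omega> \<bullet> t)) * dird b (\<lambda>t. \<phi> t * cnj (g (t - x))) t)"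
    unfolding z stf_fourier by (rule integral_modulated_dird[OF schwartz_mult[OF \<phi> gx] b])
  also have "(LINT t|lborel. cis (- 2 * pi * (\<omega> \<bullet> t)) * dird b (\<lambda>t. \<phi> t * cnj (g (t - x))) t) =
      stf (dird b g) \<phi> z + stf g (dird b \<phi>) z"
    unfolding z stf_fourier dird_mult[OF \<phi> gx] dird_cnj_translate[OF g]
    using schwartz_integrable[OF schwartz_modulate[OF schwartz_mult[OF \<phi> schwartz_cnj[OF schwartz_translate[OF schwartz_dird[OF g b]]]]], of "- 2 * pi" \<omega> x]
      schwartz_integrable[OF schwartz_modulate[OF schwartz_mult[OF schwartz_dird[OF \<phi> b] gx]], of "- 2 * pi" \<omega>]
    by (subst Bochner_Integration.integral_add[symmetric]) (simp_all add: distrib_left)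
  finally have "norm (of_real (\<omega> \<bullet> b) * stf g \<phi> z * (\<i> * of_real (- 2 * pi))) =
      norm (stf (dird b g) \<phi> z + stf g (dird b \<phi>) z)" by (simp only: norm_minus_cancel)
  also have "\<dots> \<le> norm (stf (dird b g) \<phi> z) + norm (stf g (dird b \<phi>) z)" by (rule norm_triangle_ineq)
  finally have 1: "\<bar>\<omega> \<bullet> b\<bar> * norm (stf g \<phi> z) * (2 * pi) \<le> norm (stf g (dird b \<phi>) z) + norm (stf (dird b g) \<phi> z)"
    by (simp add: norm_mult abs_mult)
  have "\<bar>\<omega> \<bullet> b\<bar> * norm (stf g \<phi> z) * 1 \<le> \<bar>\<omega> \<bullet> b\<bar> * norm (stf g \<phi> z) * (2 * pi)"
    using pi_gt3 by (intro mult_left_mono) auto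
  with 1 show ?thesis by (simp add: z)
qed

text \<open>Each power of the frequency is one integration by parts. The induction has to range over
  all windows, because the derivative may fall on the window.\<close>

lemma stf_decay:
  fixes g :: "'a::euclidean_space \<Rightarrow> complex"
  assumes g: "g \<in> schwartz"
  shows "seminorm_bdd (\<lambda>\<phi> z. (1 + norm (fst z)) ^ k * (1 + norm (snd z)) ^ l * norm (stf g \<phi> z))"
  using g
proof (induction l arbitrary: g)
  case 0
  then show ?case using stf_decay_fst[of g k] by simp
next
  case (Suc l)
  let ?T = "\<lambda>g \<phi> z. (1 + norm (fst z)) ^ k * (1 + norm (snd z)) ^ l * norm (stf g \<phi> z)"
  have "seminorm_bdd (\<lambda>\<phi> z. ?T g \<phi> z + (\<Sum>b\<in>Basis. ?T g (dird b \<phi>) z + ?T (dird b g) \<phi> z))"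
    by (intro seminorm_bdd_add seminorm_bdd_sum Suc.IH Suc.prems schwartz_dird seminorm_bdd_dird[of "?T g"]) auto
  then show ?case
  proof (rule seminorm_bdd_le[where h = "\<lambda>z. z"])
    fix \<phi> :: "'a \<Rightarrow> complex" and z :: "'a \<times> 'a" assume \<phi>: "\<phi> \<in> schwartz"
    let ?q = "(1 + norm (fst z)) ^ k * (1 + norm (snd z)) ^ l"
    have "(1 + norm (snd z)) * norm (stf g \<phi> z) \<le> (1 + (\<Sum>b\<in>Basis. \<bar>snd z \<bullet> b\<bar>)) * norm (stf g \<phi> z)"
      by (intro mult_right_mono add_left_mono norm_le_l1) auto
    also have "\<dots> = norm (stf g \<phi> z) + (\<Sum>b\<in>Basis. \<bar>snd z \<bullet> b\<bar> * norm (stf g \<phi> z))"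
      by (simp add: algebra_simps sum_distrib_left)
    also have "\<dots> \<le> norm (stf g \<phi> z) + (\<Sum>b\<in>Basis. norm (stf g (dird b \<phi>) z) + norm (stf (dird b g) \<phi> z))"
      by (intro add_left_mono sum_mono stf_mult_frequency Suc.prems \<phi>)
    finally have "?q * ((1 + norm (snd z)) * norm (stf g \<phi> z)) \<le>
        ?q * (norm (stf g \<phi> z) + (\<Sum>b\<in>Basis. norm (stf g (dird b \<phi>) z) + norm (stf (dird b g) \<phi> z)))"
      by (intro mult_left_mono) auto
    then show "(1 + norm (fst z)) ^ k * (1 + norm (snd z)) ^ Suc l * norm (stf g \<phi> z) \<le>
        ?T g \<phi> z + (\<Sum>b\<in>Basis. ?T g (dird b \<phi>) z + ?T (dird b g) \<phi> z)"
      by (simp add: distrib_left sum_distrib_left mult_ac)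
  qed
qed

text \<open>An integrable majorant of the transform whose size is a seminorm of \<phi>: with it,
  functionals given by integration against V_g \<phi> are seen to be tempered.\<close>

theorem stf_wgt_bound:
  fixes g :: "'a::euclidean_space \<Rightarrow> complex"
  assumes g: "g \<in> schwartz"
  obtains N C where "C \<ge> 0"
    "\<And>\<phi> x \<omega>. \<phi> \<in> schwartz \<Longrightarrow> norm (stf g \<phi> (x, \<omega>)) \<le> C * schwartz_seminorm N \<phi> * (wgt x * wgt \<omega>)"
proof -
  let ?n = "2 * DIM('a)"
  from stf_decay[OF g, of ?n ?n] obtain N C where C: "C \<ge> 0"
    "\<And>\<phi> z. \<phi> \<in> schwartz \<Longrightarrow> (1 + norm (fst z)) ^ ?n * (1 + norm (snd z)) ^ ?n * norm (stf g \<phi> z) \<le> C * schwartz_seminorm N \<phi>"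
    unfolding seminorm_bdd_def by metis
  have "norm (stf g \<phi> (x, \<omega>)) \<le> C * schwartz_seminorm N \<phi> * (wgt x * wgt \<omega>)" if "\<phi> \<in> schwartz" for \<phi> x \<omega>
    using C(2)[OF that, of "(x, \<omega>)"] one_plus_norm_pos[of x] one_plus_norm_pos[of \<omega>]
    by (simp add: wgt_def field_simps)
  with C(1) show ?thesis using that by blast
qed

section \<open>Tempered distributions\<close>

lemma tempered_lin:
  "tempered u \<Longrightarrow> \<phi> \<in> schwartz \<Longrightarrow> \<psi> \<in> schwartz \<Longrightarrow> u (\<lambda>x. a * \<phi> x + b * \<psi> x) = cnj a * u \<phi> + cnj b * u \<psi>"
  unfolding tempered_def by blast

lemma tempered_outside: "tempered u \<Longrightarrow> \<phi> \<notin> schwartz \<Longrightarrow> u \<phi> = 0"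
  unfolding tempered_def by blast

lemma tempered_zero: "tempered u \<Longrightarrow> u (\<lambda>_. 0) = 0"
  using tempered_lin[OF _ schwartz_zero schwartz_zero, of u 0 0] by simp

lemma tempered_scale: "tempered u \<Longrightarrow> \<phi> \<in> schwartz \<Longrightarrow> u (\<lambda>x. a * \<phi> x) = cnj a * u \<phi>"
  using tempered_lin[of u \<phi> \<phi> a 0] by simp

lemma tempered_diff: "tempered u \<Longrightarrow> \<phi> \<in> schwartz \<Longrightarrow> \<psi> \<in> schwartz \<Longrightarrow> u (\<lambda>x. \<phi> x - \<psi> x) = u \<phi> - u \<psi>"
  using tempered_lin[of u \<phi> \<psi> 1 "-1"] by simp

lemma tempered_sum:
  assumes "tempered u" "finite I" "\<And>i. i \<in> I \<Longrightarrow> F i \<in> schwartz"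
  shows "u (\<lambda>x. \<Sum>i\<in>I. c i * F i x) = (\<Sum>i\<in>I. cnj (c i) * u (F i))"
  using assms(2,3)
proof (induction I rule: finite_induct)
  case (insert i I)
  have "u (\<lambda>x. c i * F i x + 1 * (\<Sum>i\<in>I. c i * F i x)) = cnj (c i) * u (F i) + cnj 1 * u (\<lambda>x. \<Sum>i\<in>I. c i * F i x)"
    using insert by (intro tempered_lin[OF assms(1)] schwartz_sum) auto
  with insert show ?case by simp
qed (simp add: tempered_zero[OF assms(1)])

lemma tempered_bound:
  fixes u :: "'a::euclidean_space distr"
  assumes "tempered u"
  obtains N C where "C \<ge> 0" "\<And>\<phi>. \<phi> \<in> schwartz \<Longrightarrow> norm (u \<phi>) \<le> C * schwartz_seminorm N \<phi>"
proof -
  from assms obtain N C where C: "\<And>\<phi>. \<phi> \<in> schwartz \<Longrightarrow> norm (u \<phi>) \<le> C * schwartz_seminorm N \<phi>"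
    unfolding tempered_def by blast
  have "norm (u \<phi>) \<le> \<bar>C\<bar> * schwartz_seminorm N \<phi>" if "\<phi> \<in> schwartz" for \<phi>
    by (rule order_trans[OF C[OF that]]) (intro mult_right_mono schwartz_seminorm_nonneg that, simp)
  then show ?thesis using that[of "\<bar>C\<bar>" N] by simp
qed

subsection \<open>Interchanging a tempered distribution with an integral\<close>

abbreviation fst_dirs :: "'a list \<Rightarrow> ('a \<times> 'b::zero) list" where
  "fst_dirs bs \<equiv> map (\<lambda>b. (b, 0)) bs"

lemma fst_dirs_Basis: "set bs \<subseteq> Basis \<Longrightarrow> set (fst_dirs bs) \<subseteq> Basis"
  by (auto simp: Basis_prod_def)

lemma schwartz_iter_deriv: "f \<in> schwartz \<Longrightarrow> set bs \<subseteq> Basis \<Longrightarrow> iter_deriv bs f \<in> schwartz"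
  by (induction bs) (auto simp: iter_deriv_Cons schwartz_dird)

lemma iter_deriv_slice:
  fixes F :: "'a::euclidean_space \<times> 'b::euclidean_space \<Rightarrow> complex"
  assumes F: "F \<in> schwartz" and bs: "set bs \<subseteq> Basis"
  shows "iter_deriv bs (\<lambda>x. F (x, z)) = (\<lambda>x. iter_deriv (fst_dirs bs) F (x, z))"
  using bs
proof (induction bs)
  case (Cons b bs)
  then show ?case
    using dird_slice(2)[OF schwartz_iter_deriv[OF F fst_dirs_Basis], of bs b z]
    by (simp add: iter_deriv_Cons)
qed simp

lemma schwartz_iter_deriv_diff:
  fixes f h :: "'a::euclidean_space \<Rightarrow> complex"
  assumes "f \<in> schwartz" "h \<in> schwartz" "set bs \<subseteq> Basis"
  shows "iter_deriv bs (\<lambda>x. f x - h x) = (\<lambda>x. iter_deriv bs f x - iter_deriv bs h x)"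
  using assms(3)
proof (induction bs)
  case (Cons b bs)
  then have S: "iter_deriv bs f \<in> schwartz" "iter_deriv bs h \<in> schwartz"
    using assms by (auto intro: schwartz_iter_deriv)
  have "dird b (\<lambda>x. iter_deriv bs f x - iter_deriv bs h x) x = dird b (iter_deriv bs f) x - dird b (iter_deriv bs h) x" for x
    using has_derivative_diff[OF schwartz_has_derivative[OF S(1), of x] schwartz_has_derivative[OF S(2), of x]]
    by (subst dird_eq, assumption) (simp only: schwartz_dird_sum S)
  with Cons show ?case by (simp add: iter_deriv_Cons)
qed simp

text \<open>These are the two ingredients of a Riemann sum estimate in z, with a polynomial weight
  in x: decay controls the tail, and the Lipschitz bound controls the displacement of the nodes. The
  latter is the mean value inequality applied to the decay of the derivatives.\<close>

lemma schwartz_slice_bounds: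
  fixes E :: "'a::euclidean_space \<times> 'b::euclidean_space \<Rightarrow> complex"
  assumes E: "E \<in> schwartz"
  obtains C where "C \<ge> 0"
    "\<And>x z. norm x ^ k * norm (E (x, z)) \<le> C * wgt z"
    "\<And>x z z'. norm x ^ k * norm (E (x, z) - E (x, z')) \<le> C * norm (z - z')"
proof -
  have dec: "\<exists>C\<ge>0. \<forall>x z. norm x ^ k * norm (E (x, z)) \<le> C * wgt z" if E: "E \<in> schwartz"
    for E :: "'a \<times> 'b \<Rightarrow> complex"
  proof -
    obtain C where C: "C \<ge> 0" "\<And>x z. (1 + norm x) ^ k * (1 + norm z) ^ 0 * norm (E (x, z)) \<le> C * wgt x * wgt z"
      using schwartz_wgt_prod[OF E] by metis
    have "norm x ^ k * norm (E (x, z)) \<le> C * wgt z" for x z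
    proof -
      have "norm x ^ k * norm (E (x, z)) \<le> (1 + norm x) ^ k * (1 + norm z) ^ 0 * norm (E (x, z))"
        by (simp, intro mult_right_mono power_mono) auto
      also have "\<dots> \<le> C * wgt x * wgt z" by (rule C)
      also have "\<dots> \<le> C * 1 * wgt z" using C by (intro mult_right_mono mult_left_mono wgt_le_1 wgt_nonneg)
      finally show ?thesis by simp
    qed
    with C show ?thesis by blast
  qed
  from dec[OF E] obtain C where C: "C \<ge> 0" "\<And>x z. norm x ^ k * norm (E (x, z)) \<le> C * wgt z" by blast
  have "\<forall>b\<in>Basis. \<exists>C\<ge>0. \<forall>x z. norm x ^ k * norm (dird b E (x, z)) \<le> C * wgt z"
    using dec schwartz_dird[OF E] by blast
  then obtain D where D: "\<And>b. b \<in> Basis \<Longrightarrow> D b \<ge> 0"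
    "\<And>b x z. b \<in> Basis \<Longrightarrow> norm x ^ k * norm (dird b E (x, z)) \<le> D b * wgt z" by metis
  let ?D = "\<Sum>b\<in>Basis. D b"
  have D0: "?D \<ge> 0" using D by (intro sum_nonneg)
  have "norm x ^ k * norm (E (x, z) - E (x, z')) \<le> ?D * norm (z - z')" for x z z'
  proof -
    let ?E' = "\<lambda>z h. \<Sum>b\<in>Basis. of_real ((0, h) \<bullet> b) * dird b E (x, z)"
    have "norm (norm x ^ k *\<^sub>R E (x, z) - norm x ^ k *\<^sub>R E (x, z')) \<le> ?D * norm (z - z')"
    proof (rule differentiable_bound[of UNIV])
      fix z :: 'b
      have 1: "((\<lambda>z. (x, z)) has_derivative (\<lambda>h. (0, h))) (at z)"
        by (auto intro!: derivative_eq_intros)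
      show "((\<lambda>z. norm x ^ k *\<^sub>R E (x, z)) has_derivative (\<lambda>h. norm x ^ k *\<^sub>R ?E' z h)) (at z within UNIV)"
        by (intro has_derivative_scaleR_right has_derivative_compose[OF 1 schwartz_has_derivative[OF E]])
      show "onorm (\<lambda>h. norm x ^ k *\<^sub>R ?E' z h) \<le> ?D"
      proof (rule onorm_bound[OF D0])
        fix h
        have "norm (norm x ^ k *\<^sub>R ?E' z h) \<le> (\<Sum>b\<in>Basis. norm x ^ k * (\<bar>(0, h) \<bullet> b\<bar> * norm (dird b E (x, z))))"
          unfolding norm_scaleR sum_distrib_left[symmetric]
          by (simp add: mult_left_mono norm_mult order_trans[OF norm_sum])
        also have "\<dots> \<le> (\<Sum>b\<in>Basis. D b * norm h)"
        proof (rule sum_mono)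
          fix b :: "'a \<times> 'b" assume b: "b \<in> Basis"
          have "\<bar>(0, h) \<bullet> b\<bar> \<le> norm ((0, h) :: 'a \<times> 'b)" by (rule Basis_le_norm[OF b])
          then have 1: "\<bar>(0, h) \<bullet> b\<bar> \<le> norm h" by (simp add: norm_Pair)
          have "norm x ^ k * norm (dird b E (x, z)) \<le> D b * wgt z" by (rule D(2)[OF b])
          also have "\<dots> \<le> D b * 1" by (intro mult_left_mono wgt_le_1 D b)
          finally have 2: "norm x ^ k * norm (dird b E (x, z)) \<le> D b" by simp
          show "norm x ^ k * (\<bar>(0, h) \<bullet> b\<bar> * norm (dird b E (x, z))) \<le> D b * norm h"
            using mult_mono[OF 2 1] D(1)[OF b] by (simp add: mult_ac)
        qed
        finally show "norm (norm x ^ k *\<^sub>R ?E' z h) \<le> ?D * norm h" by (simp add: sum_distrib_right)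
      qed
    qed auto
    then show ?thesis by (simp add: scaleR_right_diff_distrib[symmetric])
  qed
  then have "norm x ^ k * norm (E (x, z) - E (x, z')) \<le> (C + ?D) * norm (z - z')" for x z z'
    by (rule order_trans) (use C(1) in \<open>intro mult_right_mono, auto\<close>)
  moreover have "norm x ^ k * norm (E (x, z)) \<le> (C + ?D) * wgt z" for x z
    by (rule order_trans[OF C(2)]) (use D0 wgt_nonneg in \<open>intro mult_right_mono, auto\<close>)
  ultimately show ?thesis using C D0 by (intro that[of "C + ?D"]) auto
qed

text \<open>A seminorm of order \<open>N\<close> involves finitely many powers and derivatives, and
  the sum of their nonnegative constants serves for all of them.\<close>

lemma schwartz_slice_bounds_uniform:
  fixes F :: "'a::euclidean_space \<times> 'b::euclidean_space \<Rightarrow> complex"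
  assumes F: "F \<in> schwartz"
  obtains C where "C \<ge> 0"
    "\<And>k bs x z. k \<le> N \<Longrightarrow> set bs \<subseteq> Basis \<Longrightarrow> length bs \<le> N \<Longrightarrow>
        norm x ^ k * norm (iter_deriv (fst_dirs bs) F (x, z)) \<le> C * wgt z"
    "\<And>k bs x z z'. k \<le> N \<Longrightarrow> set bs \<subseteq> Basis \<Longrightarrow> length bs \<le> N \<Longrightarrow>
        norm x ^ k * norm (iter_deriv (fst_dirs bs) F (x, z) - iter_deriv (fst_dirs bs) F (x, z')) \<le> C * norm (z - z')"
proof -
  let ?I = "{bs. set bs \<subseteq> (Basis :: 'a set) \<and> length bs \<le> N}"
  let ?E = "\<lambda>bs. iter_deriv (fst_dirs bs) F"
  define Q where "Q k bs C \<longleftrightarrow> C \<ge> 0 \<and> (\<forall>x z. norm x ^ k * norm (?E bs (x, z)) \<le> C * wgt z) \<and>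
      (\<forall>x z z'. norm x ^ k * norm (?E bs (x, z) - ?E bs (x, z')) \<le> C * norm (z - z'))" for k bs C
  have ex: "\<exists>C. Q k bs C" if "bs \<in> ?I" for k bs
  proof -
    from that have "?E bs \<in> schwartz" by (intro schwartz_iter_deriv F fst_dirs_Basis) auto
    then obtain C where "C \<ge> 0" "\<And>x z. norm x ^ k * norm (?E bs (x, z)) \<le> C * wgt z"
      "\<And>x z z'. norm x ^ k * norm (?E bs (x, z) - ?E bs (x, z')) \<le> C * norm (z - z')"
      by (rule schwartz_slice_bounds[of _ k]) (rule that)
    then show ?thesis unfolding Q_def by blast
  qed
  have Q: "Q k bs (SOME C. Q k bs C)" if "bs \<in> ?I" for k bs
    by (rule someI_ex[OF ex[OF that]])
  define C where "C k bs = (SOME C. Q k bs C)" for k bs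
  have C: "C k bs \<ge> 0" "norm x ^ k * norm (?E bs (x, z)) \<le> C k bs * wgt z"
    "norm x ^ k * norm (?E bs (x, z) - ?E bs (x, z')) \<le> C k bs * norm (z - z')" if "bs \<in> ?I" for k bs x z z'
    using Q[OF that, of k, folded C_def, unfolded Q_def] by blast+
  let ?C = "\<Sum>k\<le>N. \<Sum>bs\<in>?I. C k bs"
  have le: "C k bs \<le> ?C" if "k \<le> N" "bs \<in> ?I" for k bs
  proof -
    have "C k bs \<le> (\<Sum>bs\<in>?I. C k bs)" using that C(1) by (intro member_le_sum schwartz_seminorm_index_finite) auto
    also have "\<dots> \<le> ?C" using that C(1) by (intro member_le_sum[of k "{..N}" "\<lambda>k. \<Sum>bs\<in>?I. C k bs"]) (auto intro!: sum_nonneg)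
    finally show ?thesis .
  qed
  show ?thesis
  proof (rule that)
    show "0 \<le> ?C" using C(1) by (intro sum_nonneg) auto
    fix k bs and x :: 'a and z :: 'b assume *: "k \<le> N" "set bs \<subseteq> (Basis :: 'a set)" "length bs \<le> N"
    then have bs: "bs \<in> ?I" by simp
    have "C k bs * wgt z \<le> ?C * wgt z" by (intro mult_right_mono le * bs wgt_nonneg)
    with C(2)[OF bs, of x k z] show "norm x ^ k * norm (?E bs (x, z)) \<le> ?C * wgt z" by simp
    fix z' :: 'b
    have "C k bs * norm (z - z') \<le> ?C * norm (z - z')" by (intro mult_right_mono le * bs norm_ge_zero)
    with C(3)[OF bs, of x k z z'] show "norm x ^ k * norm (?E bs (x, z) - ?E bs (x, z')) \<le> ?C * norm (z - z')" by simp
  qed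
qed

text \<open>A simple \<open>s\<close> takes finitely many values, so the integral of the composite
  is a finite sum. No measurability of \<open>h\<close> is needed, and the sum is one to which a
  linear functional can be applied term by term.\<close>

lemma simple_function_integral_comp:
  fixes h :: "'b \<Rightarrow> complex"
  assumes s: "simple_function M s" and B: "B \<in> sets M" "emeasure M B < \<infinity>"
  shows "integrable M (\<lambda>z. indicator B z *\<^sub>R h (s z))"
    and "(LINT z|M. indicator B z *\<^sub>R h (s z)) =
      (\<Sum>v\<in>s ` space M. of_real (measure M (B \<inter> (s -` {v} \<inter> space M))) * h v)"
proof -
  have fin: "finite (s ` space M)" and meas: "s -` {v} \<inter> space M \<in> sets M" for v
    using s by (auto simp: simple_function_def simple_functionD(2)[OF s])
  have e: "indicator B z *\<^sub>R h (s z) = (\<Sum>v\<in>s ` space M. indicator (B \<inter> (s -` {v} \<inter> space M)) z *\<^sub>R h v)"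
    if "z \<in> space M" for z
  proof -
    have "(\<Sum>v\<in>s ` space M. indicator (B \<inter> (s -` {v} \<inter> space M)) z *\<^sub>R h v) =
        (\<Sum>v\<in>s ` space M. if v = s z then indicator B z *\<^sub>R h (s z) else 0)"
      using that by (intro sum.cong) (auto simp: indicator_def)
    also have "\<dots> = indicator B z *\<^sub>R h (s z)" using fin that by (simp add: sum.delta)
    finally show ?thesis ..
  qed
  have lt: "emeasure M (B \<inter> (s -` {v} \<inter> space M)) < \<infinity>" for v
    by (rule le_less_trans[OF emeasure_mono B(2)]) (use B in auto)
  have i: "integrable M (\<lambda>z. indicator (B \<inter> (s -` {v} \<inter> space M)) z *\<^sub>R h v)" for v
    using B meas lt by (intro integrable_scaleR_left integrable_real_indicator) auto
  have "integrable M (\<lambda>z. \<Sum>v\<in>s ` space M. indicator (B \<inter> (s -` {v} \<inter> space M)) z *\<^sub>R h v)"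
    by (intro Bochner_Integration.integrable_sum i)
  then show "integrable M (\<lambda>z. indicator B z *\<^sub>R h (s z))"
    by (subst Bochner_Integration.integrable_cong[OF refl e]) auto
  have "(LINT z|M. indicator B z *\<^sub>R h (s z)) = (LINT z|M. (\<Sum>v\<in>s ` space M. indicator (B \<inter> (s -` {v} \<inter> space M)) z *\<^sub>R h v))"
    by (intro Bochner_Integration.integral_cong refl e)
  also have "\<dots> = (\<Sum>v\<in>s ` space M. (LINT z|M. indicator (B \<inter> (s -` {v} \<inter> space M)) z *\<^sub>R h v))"
    by (intro Bochner_Integration.integral_sum i)
  also have "\<dots> = (\<Sum>v\<in>s ` space M. of_real (measure M (B \<inter> (s -` {v} \<inter> space M))) * h v)"
    using B meas lt by (intro sum.cong refl) (auto simp: scaleR_conv_of_real Int_absorb2 sets.sets_into_space)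
  finally show "(LINT z|M. indicator B z *\<^sub>R h (s z)) =
      (\<Sum>v\<in>s ` space M. of_real (measure M (B \<inter> (s -` {v} \<inter> space M))) * h v)" .
qed

section \<open>Riemann sums with simple nodes on a ball\<close>

locale riemann_approximation =
  fixes s :: "'b::euclidean_space \<Rightarrow> 'b" and R :: real
  assumes simple: "simple_function lborel s"
begin

abbreviation B where "B \<equiv> cball (0 :: 'b) R"

text \<open>The integral over z minus its Riemann sum with nodes \<open>s z\<close> on the ball, as
  a function of x. It is written as one integral so that it can be differentiated in x.\<close>

definition remainder :: "('a::euclidean_space \<times> 'b \<Rightarrow> complex) \<Rightarrow> 'a \<Rightarrow> complex" where
  "remainder E x = (LINT z|lborel. E (x, z) - indicator B z *\<^sub>R E (x, s z))"

text \<open>The two error sources independent of the integrand: displacement of the nodes on the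
  ball, and weight outside the ball.\<close>

definition err :: real where
  "err = (LINT z|lborel. indicator B z * norm (z - s z)) + (LINT z|lborel. indicator (- B) z * wgt z)"

lemma s_measurable [measurable]: "s \<in> borel_measurable borel"
  using borel_measurable_simple_function[OF simple] by simp

lemma B_measurable [measurable]: "B \<in> sets borel"
  by simp

lemma B_finite: "emeasure lborel B < \<infinity>"
  by (intro emeasure_bounded_finite) simp

lemma slice_integrable:
  fixes E :: "'a::euclidean_space \<times> 'b \<Rightarrow> complex"
  assumes "E \<in> schwartz"
  shows "integrable lborel (\<lambda>z. E (x, z))" "integrable lborel (\<lambda>z. indicator B z *\<^sub>R E (x, s z))"
  using schwartz_integrable[OF schwartz_slice[OF assms]]
    simple_function_integral_comp(1)[OF simple, of B "\<lambda>z. E (x, z)"] B_finite by auto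

lemma remainder_derivative:
  fixes E :: "'a::euclidean_space \<times> 'b \<Rightarrow> complex"
  assumes E: "E \<in> schwartz"
  shows "(remainder E has_derivative (\<lambda>h. remainder (\<lambda>v. \<Sum>b\<in>Basis. of_real ((h, 0) \<bullet> b) * dird b E v) x)) (at x)"
proof -
  let ?H = "\<lambda>h v. \<Sum>b\<in>Basis. of_real ((h, 0) \<bullet> b) * dird b E v"
  have H: "?H h \<in> schwartz" for h by (intro schwartz_sum schwartz_dird E) auto
  have "\<forall>b\<in>Basis. \<exists>C\<ge>0. \<forall>x z. norm (dird b E (x, z)) \<le> C * wgt z"
    using schwartz_slice_bounds[OF schwartz_dird[OF E], of _ 0] by (metis mult_1 power_0)
  then obtain D where D: "\<And>b. b \<in> Basis \<Longrightarrow> D b \<ge> 0"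
    "\<And>b x z. b \<in> Basis \<Longrightarrow> norm (dird b E (x, z)) \<le> D b * wgt z" by metis
  have Hb: "norm (?H h (x, z)) \<le> (\<Sum>b\<in>Basis. D b) * wgt z * norm h" for h x z
  proof -
    have "norm (?H h (x, z)) \<le> (\<Sum>b\<in>Basis. norm h * (D b * wgt z))"
    proof (intro order_trans[OF norm_sum] sum_mono)
      fix b :: "'a \<times> 'b" assume b: "b \<in> Basis"
      have "\<bar>(h, 0) \<bullet> b\<bar> \<le> norm ((h, 0) :: 'a \<times> 'b)" by (rule Basis_le_norm[OF b])
      then have "\<bar>(h, 0) \<bullet> b\<bar> \<le> norm h" by (simp add: norm_Pair)
      then show "norm (of_real ((h, 0) \<bullet> b) * dird b E (x, z)) \<le> norm h * (D b * wgt z)"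
        unfolding norm_mult norm_of_real by (intro mult_mono D b) auto
    qed
    then show ?thesis by (simp add: sum_distrib_left sum_distrib_right mult_ac)
  qed
  let ?D = "\<Sum>b\<in>Basis. D b"
  have D0: "?D \<ge> 0" using D by (intro sum_nonneg)
  show ?thesis
    unfolding remainder_def
  proof (rule has_derivative_integral[where r = 1 and w = "\<lambda>z. ?D * wgt z + indicator B z * ?D"
        and F' = "\<lambda>x z h. ?H h (x, z) - indicator B z *\<^sub>R ?H h (x, s z)"])
    fix y :: 'a and z :: 'b
    show "integrable lborel (\<lambda>z. E (y, z) - indicator B z *\<^sub>R E (y, s z))"
      by (intro Bochner_Integration.integrable_diff slice_integrable E)
    have 1: "((\<lambda>x. E (x, z)) has_derivative (\<lambda>h. ?H h (y, z))) (at y)" for z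
    proof -
      have 1: "((\<lambda>x. (x, z)) has_derivative (\<lambda>h. (h, 0))) (at y)"
        by (auto intro!: derivative_eq_intros)
      show ?thesis by (rule has_derivative_compose[OF 1 schwartz_has_derivative[OF E]])
    qed
    show "((\<lambda>x. E (x, z) - indicator B z *\<^sub>R E (x, s z)) has_derivative
        (\<lambda>h. ?H h (y, z) - indicator B z *\<^sub>R ?H h (y, s z))) (at y)"
      by (intro has_derivative_diff has_derivative_scaleR_right 1)
    fix h
    have "norm (indicator B z *\<^sub>R ?H h (y, s z)) \<le> indicator B z * ?D * norm h"
    proof -
      have "norm (?H h (y, s z)) \<le> ?D * wgt (s z) * norm h" by (rule Hb)
      also have "\<dots> \<le> ?D * 1 * norm h" by (intro mult_right_mono mult_left_mono wgt_le_1 D0) auto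
      finally show ?thesis by (simp add: indicator_def)
    qed
    then show "norm (?H h (y, z) - indicator B z *\<^sub>R ?H h (y, s z)) \<le> (?D * wgt z + indicator B z * ?D) * norm h"
      using Hb[of h y z] norm_triangle_ineq4[of "?H h (y, z)" "indicator B z *\<^sub>R ?H h (y, s z)"]
      by (simp add: distrib_right)
  next
    show "integrable lborel (\<lambda>z. ?D * wgt z + indicator B z * ?D)"
      using B_finite by (intro Bochner_Integration.integrable_add integrable_mult_right integrable_mult_left wgt_integrable integrable_real_indicator) auto
    show "(\<lambda>z. ?H h (x, z) - indicator B z *\<^sub>R ?H h (x, s z)) \<in> borel_measurable lborel" for h
      using slice_integrable[OF H[of h], of x] by (intro borel_measurable_diff borel_measurable_integrable)
  qed simp
qed

text \<open>Because differentiation passes under the integral, every term in a seminorm of the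
  remainder is the remainder of a derivative, and a pointwise bound on remainders is enough.\<close>

lemma iter_deriv_remainder:
  fixes F :: "'a::euclidean_space \<times> 'b \<Rightarrow> complex"
  assumes F: "F \<in> schwartz" and bs: "set bs \<subseteq> Basis"
  shows "iter_deriv bs (remainder F) = remainder (iter_deriv (fst_dirs bs) F)"
  using bs
proof (induction bs)
  case (Cons b bs)
  let ?E = "iter_deriv (fst_dirs bs) F"
  have E: "?E \<in> schwartz" using Cons by (intro schwartz_iter_deriv F fst_dirs_Basis) auto
  have "(\<lambda>v. \<Sum>c\<in>Basis. of_real ((b, 0) \<bullet> c) * dird c ?E v) = dird (b, 0) ?E"
    by (rule ext) (rule schwartz_dird_sum[OF E])
  then have "dird b (remainder ?E) x = remainder (dird (b, 0) ?E) x" for x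
    using dird_eq[OF remainder_derivative[OF E], of b x] by simp
  with Cons show ?case by (auto simp: iter_deriv_Cons)
qed simp

text \<open>On the ball the Lipschitz bound applies to z and its node; outside it the Riemann sum
  contributes nothing and the decay bound applies.\<close>

lemma split_bound:
  assumes C: "C \<ge> 0" and h: "integrable lborel h"
    and h1: "\<And>z. norm (h z) \<le> C * wgt z" and h2: "\<And>z z'. norm (h z - h z') \<le> C * norm (z - z')"
  shows "norm (LINT z|lborel. h z - indicator B z *\<^sub>R (h (s z) :: complex)) \<le> C * err"
proof -
  have i1: "integrable lborel (\<lambda>z. indicator B z * norm (z - s z))"
  proof -
    have "integrable lborel (\<lambda>z. indicator B z *\<^sub>R norm (s z))"
    proof -
      have "integrable lborel (\<lambda>z. indicator B z *\<^sub>R complex_of_real (norm (s z)))"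
        by (rule simple_function_integral_comp(1)[OF simple _ B_finite]) simp
      from integrable_norm[OF this] show ?thesis by simp
    qed
    moreover have "integrable lborel (\<lambda>z. indicator B z *\<^sub>R norm z)"
      by (intro borel_integrable_compact continuous_intros) auto
    ultimately have "integrable lborel (\<lambda>z. indicator B z *\<^sub>R norm z + indicator B z *\<^sub>R norm (s z))"
      by (intro Bochner_Integration.integrable_add)
    then show ?thesis
      by (rule Bochner_Integration.integrable_bound) (auto simp: indicator_def norm_triangle_ineq4)
  qed
  have i2: "integrable lborel (\<lambda>z. indicator (- B) z * wgt (z :: 'b))"
    using integrable_mult_indicator[OF _ wgt_integrable, of "- B"] by simp
  have "norm (LINT z|lborel. h z - indicator B z *\<^sub>R h (s z)) \<le>
      (LINT z|lborel. C * (indicator B z * norm (z - s z)) + C * (indicator (- B) z * wgt z))"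
  proof (rule norm_integral_le)
    show "integrable lborel (\<lambda>z. C * (indicator B z * norm (z - s z)) + C * (indicator (- B) z * wgt z))"
      using i1 i2 by (intro Bochner_Integration.integrable_add integrable_mult_right)
    show "norm (h z - indicator B z *\<^sub>R h (s z)) \<le> C * (indicator B z * norm (z - s z)) + C * (indicator (- B) z * wgt z)" for z
      using h1[of z] h2[of z "s z"] by (auto simp: indicator_def)
  qed
  also have "\<dots> = C * err"
    using i1 i2 by (simp add: err_def distrib_left)
  finally show ?thesis .
qed

lemma remainder_eq:
  fixes F :: "'a::euclidean_space \<times> 'b \<Rightarrow> complex"
  assumes F: "F \<in> schwartz"
  shows "remainder F x = (LINT z|lborel. F (x, z)) - (\<Sum>v\<in>range s. of_real (measure lborel (B \<inter> s -` {v})) * F (x, v))"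
proof -
  have "(LINT z|lborel. indicator B z *\<^sub>R F (x, s z)) = (\<Sum>v\<in>range s. of_real (measure lborel (B \<inter> s -` {v})) * F (x, v))"
    using simple_function_integral_comp(2)[OF simple _ B_finite, of "\<lambda>z. F (x, z)"] by simp
  then show ?thesis unfolding remainder_def using slice_integrable[OF F] by simp
qed

lemma remainder_seminorm:
  fixes F :: "'a::euclidean_space \<times> 'b \<Rightarrow> complex"
  assumes F: "F \<in> schwartz" and C: "C \<ge> 0"
    "\<And>k bs x z. k \<le> N \<Longrightarrow> set bs \<subseteq> Basis \<Longrightarrow> length bs \<le> N \<Longrightarrow>
        norm x ^ k * norm (iter_deriv (fst_dirs bs) F (x, z)) \<le> C * wgt z"
    "\<And>k bs x z z'. k \<le> N \<Longrightarrow> set bs \<subseteq> Basis \<Longrightarrow> length bs \<le> N \<Longrightarrow>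
        norm x ^ k * norm (iter_deriv (fst_dirs bs) F (x, z) - iter_deriv (fst_dirs bs) F (x, z')) \<le> C * norm (z - z')"
  shows "schwartz_seminorm N (remainder F) \<le> seminorm_card N TYPE('a) * (C * err)"
proof (rule schwartz_seminorm_le)
  fix k bs and x :: 'a assume *: "k \<le> N" "set bs \<subseteq> (Basis :: 'a set)" "length bs \<le> N"
  let ?E = "iter_deriv (fst_dirs bs) F"
  have E: "?E \<in> schwartz" using * by (intro schwartz_iter_deriv F fst_dirs_Basis) auto
  let ?h = "\<lambda>z. norm x ^ k *\<^sub>R ?E (x, z)"
  have "norm (LINT z|lborel. ?h z - indicator B z *\<^sub>R ?h (s z)) \<le> C * err"
    using C(2,3)[OF *, of x]
    by (intro split_bound C(1) integrable_scaleR_right slice_integrable E)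
       (auto simp: scaleR_right_diff_distrib[symmetric])
  also have "(LINT z|lborel. ?h z - indicator B z *\<^sub>R ?h (s z)) = norm x ^ k *\<^sub>R remainder ?E x"
    unfolding remainder_def integral_scaleR_right[symmetric]
    by (intro Bochner_Integration.integral_cong refl) (simp add: scaleR_right_diff_distrib scaleR_left_commute)
  finally show "norm x ^ k * norm (iter_deriv bs (remainder F) x) \<le> C * err"
    by (simp add: iter_deriv_remainder[OF F *(2)])
qed

end

text \<open>Applied to a finite Riemann sum of slices, \<open>u\<close> gives the Riemann sum of z
  -> u (F (., z)). The error of the first sum is small in the seminorm that controls
  \<open>u\<close>, and the error of the second is small because this function inherits decay and a
  Lipschitz bound. Both errors are at most \<open>D\<close> times \<open>err\<close>.\<close>

theorem tempered_integral:
  fixes u :: "'a::euclidean_space distr" and F :: "'a \<times> 'b::euclidean_space \<Rightarrow> complex"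
  assumes u: "tempered u" and F: "F \<in> schwartz"
  shows "continuous_on UNIV (\<lambda>z. u (\<lambda>x. F (x, z)))"
    and "integrable lborel (\<lambda>z. u (\<lambda>x. F (x, z)))"
    and "u (\<lambda>x. LINT z|lborel. F (x, z)) = (LINT z|lborel. u (\<lambda>x. F (x, z)))"
proof -
  obtain N K where K: "K \<ge> 0" "\<And>\<phi>. \<phi> \<in> schwartz \<Longrightarrow> norm (u \<phi>) \<le> K * schwartz_seminorm N \<phi>"
    using tempered_bound[OF u] by metis
  obtain C where C: "C \<ge> 0"
    "\<And>k bs x z. k \<le> N \<Longrightarrow> set bs \<subseteq> Basis \<Longrightarrow> length bs \<le> N \<Longrightarrow>
        norm x ^ k * norm (iter_deriv (fst_dirs bs) F (x, z)) \<le> C * wgt z"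
    "\<And>k bs x z z'. k \<le> N \<Longrightarrow> set bs \<subseteq> Basis \<Longrightarrow> length bs \<le> N \<Longrightarrow>
        norm x ^ k * norm (iter_deriv (fst_dirs bs) F (x, z) - iter_deriv (fst_dirs bs) F (x, z')) \<le> C * norm (z - z')"
    using schwartz_slice_bounds_uniform[OF F, of N] by blast
  \<comment> \<open>The continuity constant of \<open>u\<close>, the number of summands in the
    seminorm and the common slice constant, multiplied: the bound that u (F (., z))
    inherits.\<close>
  define D where "D = K * (seminorm_card N TYPE('a) * C)"
  have D0: "D \<ge> 0" unfolding D_def by (intro mult_nonneg_nonneg K C seminorm_card_nonneg)
  define h where "h z = u (\<lambda>x. F (x, z))" for z
  have S: "(\<lambda>x. F (x, z)) \<in> schwartz" for z by (rule schwartz_slice_fst[OF F])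
  have h1: "norm (h z) \<le> D * wgt z" for z
  proof -
    have "schwartz_seminorm N (\<lambda>x. F (x, z)) \<le> seminorm_card N TYPE('a) * (C * wgt z)"
      by (rule schwartz_seminorm_le) (simp add: iter_deriv_slice[OF F] C)
    then have "K * schwartz_seminorm N (\<lambda>x. F (x, z)) \<le> K * (seminorm_card N TYPE('a) * (C * wgt z))"
      by (rule mult_left_mono) (rule K)
    from order_trans[OF K(2)[OF S] this] show ?thesis by (simp add: h_def D_def mult.assoc)
  qed
  have h2: "norm (h z - h z') \<le> D * norm (z - z')" for z z'
  proof -
    have "schwartz_seminorm N (\<lambda>x. F (x, z) - F (x, z')) \<le> seminorm_card N TYPE('a) * (C * norm (z - z'))"
      by (rule schwartz_seminorm_le) (simp add: iter_deriv_slice[OF F] schwartz_iter_deriv_diff[OF S S] C)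
    then have "K * schwartz_seminorm N (\<lambda>x. F (x, z) - F (x, z')) \<le> K * (seminorm_card N TYPE('a) * (C * norm (z - z')))"
      by (rule mult_left_mono) (rule K)
    from order_trans[OF K(2)[OF schwartz_diff[OF S S]] this] show ?thesis
      by (simp add: h_def D_def mult.assoc tempered_diff[OF u S S])
  qed
  have hc: "continuous_on UNIV h"
  proof (rule lipschitz_on_continuous_on[where L = D], rule lipschitz_onI[OF _ D0])
    show "dist (h z) (h z') \<le> D * dist z z'" for z z' using h2[of z z'] by (simp add: dist_norm)
  qed
  then show "continuous_on UNIV (\<lambda>z. u (\<lambda>x. F (x, z)))" by (simp add: h_def[abs_def])
  have [measurable]: "h \<in> borel_measurable borel" by (rule borel_measurable_continuous_onI[OF hc])
  have hi: "integrable lborel h"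
    by (rule Bochner_Integration.integrable_bound[OF integrable_mult_right[OF wgt_integrable, of D]])
       (use h1 D0 in \<open>auto simp: abs_mult wgt_nonneg\<close>)
  then show "integrable lborel (\<lambda>z. u (\<lambda>x. F (x, z)))" by (simp add: h_def[abs_def])
  define \<Phi> where "\<Phi> = (\<lambda>x. LINT z|lborel. F (x, z))"
  have \<Phi>: "\<Phi> \<in> schwartz" unfolding \<Phi>_def by (rule schwartz_integral_snd[OF F])
  have est: "norm (u \<Phi> - (LINT z|lborel. h z)) \<le> 2 * D * riemann_approximation.err s R"
    if "simple_function lborel s" for s :: "'b \<Rightarrow> 'b" and R
  proof -
    interpret riemann_approximation s R by unfold_locales (rule that)
    let ?m = "\<lambda>v. complex_of_real (measure lborel (B \<inter> s -` {v}))"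
    have fin: "finite (range s)" using simple by (simp add: simple_function_def)
    have r: "remainder F = (\<lambda>x. \<Phi> x - (\<Sum>v\<in>range s. ?m v * F (x, v)))"
      by (rule ext) (simp add: remainder_eq[OF F] \<Phi>_def)
    have SS: "(\<lambda>x. \<Sum>v\<in>range s. ?m v * F (x, v)) \<in> schwartz" by (intro schwartz_sum fin S)
    have rS: "remainder F \<in> schwartz" unfolding r by (intro schwartz_diff \<Phi> SS)
    \<comment> \<open>The coefficients are measures and hence real, so the conjugation in the
      linearity of \<open>u\<close> has no effect.\<close>
    have "u (remainder F) = u \<Phi> - (\<Sum>v\<in>range s. ?m v * h v)"
      unfolding r tempered_diff[OF u \<Phi> SS] by (simp add: tempered_sum[OF u fin S] h_def)
    also have "(\<Sum>v\<in>range s. ?m v * h v) = (LINT z|lborel. indicator B z *\<^sub>R h (s z))"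
      using simple_function_integral_comp(2)[OF simple _ B_finite, of h] by simp
    finally have 1: "u \<Phi> - (LINT z|lborel. indicator B z *\<^sub>R h (s z)) = u (remainder F)" ..
    have "norm (u (remainder F)) \<le> K * (seminorm_card N TYPE('a) * (C * err))"
      by (rule order_trans[OF K(2)[OF rS]]) (intro mult_left_mono remainder_seminorm F C K)
    then have 2: "norm (u (remainder F)) \<le> D * err" by (simp add: D_def mult_ac)
    have 3: "norm (LINT z|lborel. h z - indicator B z *\<^sub>R h (s z)) \<le> D * err"
      by (rule split_bound[OF D0 hi h1 h2])
    have "integrable lborel (\<lambda>z. indicator B z *\<^sub>R h (s z))"
      by (rule simple_function_integral_comp(1)[OF simple _ B_finite]) simp
    then have 4: "(LINT z|lborel. h z - indicator B z *\<^sub>R h (s z)) = (LINT z|lborel. h z) - (LINT z|lborel. indicator B z *\<^sub>R h (s z))"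
      using hi by simp
    have "u \<Phi> - (LINT z|lborel. h z) = u (remainder F) - (LINT z|lborel. h z - indicator B z *\<^sub>R h (s z))"
      unfolding 4 1[symmetric] by simp
    then show ?thesis
      using norm_triangle_ineq4[of "u (remainder F)" "LINT z|lborel. h z - indicator B z *\<^sub>R h (s z)"] 2 3 by simp
  qed
  \<comment> \<open>With nodes of norm at most 2 norm z, the displacement is at most 3 norm z, an
    integrable majorant on each ball.\<close>
  obtain s :: "nat \<Rightarrow> 'b \<Rightarrow> 'b" where s: "\<And>i. simple_function lborel (s i)"
    "\<And>z. (\<lambda>i. s i z) \<longlonglongrightarrow> z" "\<And>i z. norm (s i z) \<le> 2 * norm z"
    using borel_measurable_implies_sequence_metric[of "\<lambda>z::'b. z" lborel 0] by auto
  let ?tail = "\<lambda>R. (LINT z|lborel. indicator (- cball 0 R) z * wgt (z :: 'b))"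
  have lim1: "(\<lambda>i. riemann_approximation.err (s i) R) \<longlonglongrightarrow> 0 + ?tail R" for R
  proof -
    have ra: "riemann_approximation (s i)" for i by unfold_locales (rule s)
    have [measurable]: "s i \<in> borel_measurable borel" for i
      using riemann_approximation.s_measurable[OF ra] .
    have [measurable]: "cball (0::'b) R \<in> sets borel" by simp
    have "(\<lambda>i. LINT z|lborel. indicator (cball 0 R) z * norm (z - s i z)) \<longlonglongrightarrow> (LINT z|(lborel :: 'b measure). (0::real))"
    proof (rule integral_dominated_convergence[where w = "\<lambda>z. indicator (cball 0 R) z *\<^sub>R (3 * norm z)"])
      show "AE z in lborel. (\<lambda>i. indicator (cball 0 R) z * norm (z - s i z)) \<longlonglongrightarrow> 0"
      proof (rule AE_I2)
        fix z :: 'b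
        have "(\<lambda>i. indicator (cball 0 R) z * norm (z - s i z)) \<longlonglongrightarrow> indicator (cball 0 R) z * norm (z - z)"
          by (intro tendsto_intros s)
        then show "(\<lambda>i. indicator (cball 0 R) z * norm (z - s i z)) \<longlonglongrightarrow> 0" by simp
      qed
      show "AE z in lborel. norm (indicator (cball 0 R) z * norm (z - s i z)) \<le> indicator (cball 0 R) z *\<^sub>R (3 * norm z)" for i
      proof (rule AE_I2)
        fix z :: 'b
        have "norm (z - s i z) \<le> 3 * norm z" using norm_triangle_ineq4[of z "s i z"] s(3)[of i z] by linarith
        then show "norm (indicator (cball 0 R) z * norm (z - s i z)) \<le> indicator (cball 0 R) z *\<^sub>R (3 * norm z)"
          by (simp add: indicator_def)
      qed
      show "integrable lborel (\<lambda>z::'b. indicator (cball 0 R) z *\<^sub>R (3 * norm z))"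
        by (intro borel_integrable_compact continuous_intros) auto
    qed measurable
    then show ?thesis
      unfolding riemann_approximation.err_def[OF ra] by (intro tendsto_intros) simp
  qed
  \<comment> \<open>First the nodes are refined at fixed radius, which leaves only the tail of the
    weight; then the radius tends to infinity.\<close>
  have est2: "norm (u \<Phi> - (LINT z|lborel. h z)) \<le> 2 * D * ?tail R" for R
  proof (rule LIMSEQ_le_const)
    show "(\<lambda>i. 2 * D * riemann_approximation.err (s i) R) \<longlonglongrightarrow> 2 * D * ?tail R"
      using tendsto_mult_left[OF lim1, of "2 * D"] by simp
    show "\<exists>n. \<forall>i\<ge>n. norm (u \<Phi> - (LINT z|lborel. h z)) \<le> 2 * D * riemann_approximation.err (s i) R"
      using est[OF s(1)] by blast
  qed
  have lim2: "(\<lambda>R::nat. ?tail (real R)) \<longlonglongrightarrow> (LINT z|(lborel :: 'b measure). 0)"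
  proof (rule integral_dominated_convergence[where w = wgt])
    show "AE z in lborel. (\<lambda>R::nat. indicator (- cball 0 (real R)) z * wgt (z :: 'b)) \<longlonglongrightarrow> 0"
    proof (rule AE_I2)
      fix z :: 'b
      obtain M :: nat where "norm z \<le> real M" using real_arch_simple by blast
      then show "(\<lambda>R::nat. indicator (- cball 0 (real R)) z * wgt z) \<longlonglongrightarrow> 0"
        by (intro tendsto_eventually eventually_sequentiallyI[of M]) (auto simp: indicator_def)
    qed
    show "AE z in lborel. norm (indicator (- cball 0 (real R)) z * wgt (z :: 'b)) \<le> wgt z" for R :: nat
      by (auto simp: indicator_def wgt_nonneg)
    have [measurable]: "- cball (0::'b) (real R) \<in> sets borel" for R :: nat by simp
    show "(\<lambda>z::'b. indicator (- cball 0 (real R)) z * wgt z) \<in> borel_measurable lborel" for R :: nat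
      by measurable
  qed (auto intro: wgt_integrable)
  have "norm (u \<Phi> - (LINT z|lborel. h z)) \<le> 2 * D * 0"
  proof (rule LIMSEQ_le_const)
    show "(\<lambda>R::nat. 2 * D * ?tail (real R)) \<longlonglongrightarrow> 2 * D * 0"
      using tendsto_mult_left[OF lim2, of "2 * D"] by simp
    show "\<exists>n. \<forall>R\<ge>n. norm (u \<Phi> - (LINT z|lborel. h z)) \<le> 2 * D * ?tail (real R)"
      using est2 by blast
  qed
  then show "u (\<lambda>x. LINT z|lborel. F (x, z)) = (LINT z|lborel. u (\<lambda>x. F (x, z)))"
    by (simp add: \<Phi>_def h_def[abs_def])
qed

text \<open>The derivatives of the phase grow, but only linearly in position and frequency; these
  factors are coordinates of the argument and are absorbed by the Schwartz function
  \<open>F\<close>.\<close>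

lemma schwartz_quadratic_phase:
  fixes F :: "'a::euclidean_space \<times> ('a \<times> 'a) \<Rightarrow> complex"
  assumes "F \<in> schwartz"
  shows "(\<lambda>p. cis (2 * pi * (snd (snd p) \<bullet> fst p)) * F p) \<in> schwartz"
proof -
  let ?q = "\<lambda>p::'a \<times> ('a \<times> 'a). cis (2 * pi * (snd (snd p) \<bullet> fst p))"
  let ?P = "{\<lambda>p. ?q p * F p | F. F \<in> schwartz}"
  have I: "(\<lambda>p. ?q p * F p) \<in> cspan ?P" if "F \<in> schwartz" for F
    using that by (intro cspan_base) blast
  show ?thesis
  proof (rule schwartz_coinduct[OF _ _ _ I[OF assms]])
    fix G assume "G \<in> ?P"
    then obtain F where G: "G = (\<lambda>p. ?q p * F p)" and F: "F \<in> schwartz" by blast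
    show "bounded (range G)" using schwartz_bounded[OF F] unfolding G bounded_iff by (auto simp: norm_mult)
    show "(\<lambda>p. of_real (p \<bullet> b) * G p) \<in> cspan ?P" if "b \<in> Basis" for b
      using I[OF schwartz_coord[OF F that]] by (simp add: G mult_ac)
    let ?D = "\<lambda>p v. \<Sum>c\<in>Basis. of_real (v \<bullet> c) * dird c F p"
    let ?H = "\<lambda>v p. (2 * pi * \<i>) * ((\<Sum>c\<in>Basis. of_real (snd (snd v) \<bullet> c) * (of_real (fst p \<bullet> c) * F p)) +
        (\<Sum>c\<in>Basis. of_real (fst v \<bullet> c) * (of_real (snd (snd p) \<bullet> c) * F p))) + ?D p v"
    have sc: "(\<lambda>p. of_real (fst p \<bullet> c) * F p) \<in> schwartz" "(\<lambda>p. of_real (snd (snd p) \<bullet> c) * F p) \<in> schwartz" if "c \<in> Basis" for c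
      using schwartz_coord[OF F, of "(c, 0)"] schwartz_coord[OF F, of "(0, (0, c))"] that
      by (simp_all add: inner_prod_def Basis_prod_def)
    have H: "?H v \<in> schwartz" for v
      by (intro schwartz_add schwartz_scale schwartz_sum sc schwartz_dird F) auto
    have H_eq: "?H v p = (2 * pi * \<i>) * of_real (snd (snd v) \<bullet> fst p + snd (snd p) \<bullet> fst v) * F p + ?D p v" for v p
    proof -
      have "(\<Sum>c\<in>Basis. of_real (a \<bullet> c) * (of_real (b \<bullet> c) * F p)) = of_real (a \<bullet> b) * F p" for a b :: 'a
        by (simp add: euclidean_inner[of a b] sum_distrib_right mult.assoc)
      note sum = this
      show ?thesis unfolding sum by (simp add: algebra_simps inner_commute)
    qed
    show "\<exists>G'. (\<forall>p. (G has_derivative G' p) (at p)) \<and> (\<forall>b\<in>Basis. (\<lambda>p. G' p b) \<in> cspan ?P)"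
    proof (intro exI conjI allI ballI)
      fix p :: "'a \<times> ('a \<times> 'a)"
      have 1: "(?q has_derivative (\<lambda>v. of_real (snd (snd v) \<bullet> fst p + snd (snd p) \<bullet> fst v) * (2 * pi * \<i> * ?q p))) (at p)"
        by (auto intro!: derivative_eq_intros simp: scaleR_conv_of_real algebra_simps)
      show "(G has_derivative (\<lambda>v. ?q p * ?H v p)) (at p)"
        unfolding G H_eq
        by (rule has_derivative_eq_rhs[OF has_derivative_mult[OF 1 schwartz_has_derivative[OF F]]])
           (simp add: algebra_simps)
      show "(\<lambda>p. ?q p * ?H b p) \<in> cspan ?P" for b
        by (rule I[OF H])
    qed
  qed
qed

text \<open>A time-frequency shift has no decay in z by itself. The coefficient \<open>a\<close>
  supplies it, so that \<open>tempered_integral\<close> becomes applicable.\<close>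

lemma schwartz_tfs_tensor:
  fixes a :: "'a::euclidean_space \<times> 'a \<Rightarrow> complex" and g :: "'a \<Rightarrow> complex"
  assumes "a \<in> schwartz" "g \<in> schwartz"
  shows "(\<lambda>(x, z). a z * tfs z g x) \<in> schwartz"
proof -
  have "(\<lambda>p. a (fst p) * g (snd p)) \<in> schwartz" by (rule schwartz_tensor[OF assms])
  moreover have "linear (\<lambda>p::'a \<times> ('a \<times> 'a). (snd p, fst p - fst (snd p)))"
    "linear (\<lambda>p::('a \<times> 'a) \<times> 'a. (snd p + fst (fst p), fst p))"
    by (auto intro!: linearI simp: algebra_simps)
  ultimately have "(\<lambda>p. a (fst ((snd p, fst p - fst (snd p)) + 0)) * g (snd ((snd p, fst p - fst (snd p)) + 0))) \<in> schwartz"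
    by (rule schwartz_affine) simp
  from schwartz_quadratic_phase[OF this] show ?thesis
    by (simp add: case_prod_unfold tfs_def mult_ac)
qed

text \<open>The shifts are first multiplied by a Schwartz function of z that does not vanish at the
  given point, to make \<open>tempered_integral\<close> applicable; near that point the factor can
  be divided out again.\<close>

lemma tempered_tfs_continuous:
  fixes u :: "'a::euclidean_space distr"
  assumes u: "tempered u" and g: "g \<in> schwartz"
  shows "continuous_on UNIV (\<lambda>z. u (tfs z g))"
proof (cases "g = (\<lambda>_. 0)")
  case True
  then have "(\<lambda>z. u (tfs z g)) = (\<lambda>_. u (\<lambda>_. 0))" by (simp add: tfs_def)
  then show ?thesis by (simp only: continuous_on_const)
next
  case False
  show ?thesis
    unfolding continuous_on_eq_continuous_at[OF open_UNIV]
  proof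
    fix z0 :: "'a \<times> 'a"
    \<comment> \<open>A convenient localising factor: V_g g takes the value \<open>energy g\<close>
      at the origin, which is nonzero.\<close>
    define a where "a = (\<lambda>z. stf g g (z - z0))"
    have a: "a \<in> schwartz" unfolding a_def by (intro schwartz_translate stf_schwartz g)
    have "a z0 = energy g" by (simp add: a_def stf_def tfs_def energy_def)
    then have az: "cnj (a z0) \<noteq> 0" using energy_pos[OF g False] by simp
    have "u (\<lambda>x. a z * tfs z g x) = cnj (a z) * u (tfs z g)" for z
      by (rule tempered_scale[OF u tfs_schwartz[OF g]])
    then have 1: "isCont (\<lambda>z. cnj (a z) * u (tfs z g)) z0"
      using tempered_integral(1)[OF u schwartz_tfs_tensor[OF a g]]
      by (cases z0) (simp add: continuous_on_eq_continuous_at)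
    have 2: "isCont (\<lambda>z. cnj (a z)) z0"
      using schwartz_continuous[OF schwartz_cnj[OF a], of UNIV] by (cases z0) (simp add: continuous_on_eq_continuous_at)
    have "isCont (\<lambda>z. (cnj (a z) * u (tfs z g)) / cnj (a z)) z0"
      by (intro isCont_divide 1 2 az)
    moreover have "eventually (\<lambda>z. (cnj (a z) * u (tfs z g)) / cnj (a z) = u (tfs z g)) (nhds z0)"
    proof -
      have "open {z. cnj (a z) \<noteq> 0}"
        by (intro open_Collect_neq schwartz_continuous[OF schwartz_cnj[OF a]] continuous_intros)
      then have "eventually (\<lambda>z. z \<in> {z. cnj (a z) \<noteq> 0}) (nhds z0)"
        using az by (intro eventually_nhds_in_open) auto
      then show ?thesis by eventually_elim simp
    qed
    ultimately show "isCont (\<lambda>z. u (tfs z g)) z0"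
      by (subst (asm) isCont_cong)
  qed
qed

text \<open>The inversion formula for \<phi> is a superposition of shifts of g with coefficient V_g
  \<phi>; \<open>u\<close> is moved inside the integral, where its conjugate linearity conjugates
  the coefficient.\<close>

theorem tempered_reproducing:
  fixes u :: "'a::euclidean_space distr"
  assumes u: "tempered u" and g: "g \<in> schwartz" and \<phi>: "\<phi> \<in> schwartz"
  shows "integrable lborel (\<lambda>z. u (tfs z g) * cnj (stf g \<phi> z))"
    and "(LINT z|lborel. u (tfs z g) * cnj (stf g \<phi> z)) = u \<phi> * energy g"
proof -
  have a: "stf g \<phi> \<in> schwartz" by (rule stf_schwartz[OF g \<phi>])
  have e: "u (\<lambda>x. stf g \<phi> z * tfs z g x) = u (tfs z g) * cnj (stf g \<phi> z)" for z
    by (subst tempered_scale[OF u tfs_schwartz[OF g]]) simp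
  show "integrable lborel (\<lambda>z. u (tfs z g) * cnj (stf g \<phi> z))"
    using tempered_integral(2)[OF u schwartz_tfs_tensor[OF a g]] by (simp add: e)
  have "cnj (energy g) = energy g"
  proof -
    have "g t * cnj (g t) = of_real ((norm (g t))\<^sup>2)" for t by (rule complex_norm_square[symmetric])
    then show ?thesis by (simp only: energy_def integral_complex_of_real complex_cnj_complex_of_real)
  qed
  moreover have "u (\<lambda>x. LINT z|lborel. stf g \<phi> z * tfs z g x) = cnj (energy g) * u \<phi>"
    unfolding stf_inversion_schwartz[OF g \<phi>]
    using tempered_scale[OF u \<phi>, of "energy g"] by (simp add: mult.commute)
  ultimately show "(LINT z|lborel. u (tfs z g) * cnj (stf g \<phi> z)) = u \<phi> * energy g"
    using tempered_integral(3)[OF u schwartz_tfs_tensor[OF a g]] by (simp add: e mult.commute)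
qed

section \<open>The space \<open>M\<^sup>1\<close>\<close>

lemma integrable_pairI:
  fixes F :: "'a::euclidean_space \<Rightarrow> 'b::euclidean_space \<Rightarrow> complex"
  assumes [measurable]: "case_prod F \<in> borel_measurable (borel \<Otimes>\<^sub>M borel)"
    and fin: "(\<integral>\<^sup>+x. \<integral>\<^sup>+y. ennreal (norm (F x y)) \<partial>lborel \<partial>lborel) < \<infinity>"
  shows "integrable (lborel \<Otimes>\<^sub>M lborel) (case_prod F)"
proof (rule integrableI_bounded)
  have "(\<integral>\<^sup>+z. ennreal (norm (case_prod F z)) \<partial>(lborel \<Otimes>\<^sub>M lborel)) =
      (\<integral>\<^sup>+x. \<integral>\<^sup>+y. ennreal (norm (F x y)) \<partial>lborel \<partial>lborel)"
    by (subst lborel.nn_integral_fst[symmetric]) (auto simp: case_prod_unfold)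
  with fin show "(\<integral>\<^sup>+z. ennreal (norm (case_prod F z)) \<partial>(lborel \<Otimes>\<^sub>M lborel)) < \<infinity>" by simp
qed measurable

lemma integrable_norm_eq:
  fixes f :: "'a \<Rightarrow> complex"
  assumes "f \<in> borel_measurable M"
  shows "integrable M f \<longleftrightarrow> (\<integral>\<^sup>+x. ennreal (norm (f x)) \<partial>M) < \<infinity>"
  using assms by (auto simp: integrable_iff_bounded)

lemma stf_tfs:
  fixes G \<Phi> :: "'a::euclidean_space \<Rightarrow> complex"
  assumes [measurable]: "G \<in> borel_measurable borel" "\<Phi> \<in> borel_measurable borel"
  shows "stf G (tfs W \<Phi>) Z = cis (2 * pi * ((snd W - snd Z) \<bullet> fst W)) * stf G \<Phi> (Z - W)"
proof -
  let ?f = "\<lambda>t. tfs W \<Phi> t * cnj (tfs Z G t)"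
  have "stf G (tfs W \<Phi>) Z = (LINT t|lborel. ?f (t + fst W))"
    unfolding stf_def by (rule integral_translate(1)[symmetric]) measurable
  also have "\<dots> = (LINT t|lborel. cis (2 * pi * ((snd W - snd Z) \<bullet> fst W)) * (\<Phi> t * cnj (tfs (Z - W) G t)))"
  proof (intro Bochner_Integration.integral_cong refl)
    fix t
    have c: "cis (2 * pi * (snd W \<bullet> (t + fst W))) * cis (- (2 * pi * (snd Z \<bullet> (t + fst W)))) =
        cis (2 * pi * ((snd W - snd Z) \<bullet> fst W)) * cis (- (2 * pi * (snd (Z - W) \<bullet> t)))"
      by (simp add: cis_mult inner_add_right inner_diff_left algebra_simps)
    have "?f (t + fst W) = (cis (2 * pi * (snd W \<bullet> (t + fst W))) * cis (- (2 * pi * (snd Z \<bullet> (t + fst W))))) *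
        (\<Phi> t * cnj (G (t - fst (Z - W))))"
      by (simp add: tfs_def cis_cnj algebra_simps)
    also have "\<dots> = cis (2 * pi * ((snd W - snd Z) \<bullet> fst W)) * (\<Phi> t * cnj (tfs (Z - W) G t))"
      unfolding c by (simp add: tfs_def cis_cnj mult_ac)
    finally show "?f (t + fst W) = \<dots>" .
  qed
  finally show ?thesis by (simp add: stf_def)
qed

lemma norm_stf_tfs:
  assumes "G \<in> schwartz" "\<Phi> \<in> schwartz"
  shows "norm (stf G (tfs W \<Phi>) Z) = norm (stf G \<Phi> (Z - W))"
  using assms by (simp add: stf_tfs schwartz_measurable norm_mult)

lemma tempered_distr_of_fun:
  fixes f :: "'a::euclidean_space \<Rightarrow> complex"
  assumes f: "integrable lborel f"
  shows "tempered (distr_of_fun f)"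
proof -
  have i: "integrable lborel (\<lambda>t. f t * cnj (\<phi> t))" if "\<phi> \<in> schwartz" for \<phi>
    using stf_integrand_integrable[OF f that, of 0] by (simp add: tfs_def)
  show ?thesis
    unfolding tempered_def
  proof (intro conjI allI impI ballI exI)
    show "distr_of_fun f \<phi> = 0" if "\<phi> \<notin> schwartz" for \<phi>
      using that by (simp add: distr_of_fun_def)
  next
    fix \<phi> \<psi> :: "'a \<Rightarrow> complex" and a b assume *: "\<phi> \<in> schwartz" "\<psi> \<in> schwartz"
    have S: "(\<lambda>x. a * \<phi> x + b * \<psi> x) \<in> schwartz" by (intro schwartz_add schwartz_scale *)
    have "(LINT t|lborel. f t * cnj (a * \<phi> t + b * \<psi> t)) =
        (LINT t|lborel. cnj a * (f t * cnj (\<phi> t)) + cnj b * (f t * cnj (\<psi> t)))"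
      by (intro Bochner_Integration.integral_cong refl) (simp add: algebra_simps)
    also have "\<dots> = cnj a * (LINT t|lborel. f t * cnj (\<phi> t)) + cnj b * (LINT t|lborel. f t * cnj (\<psi> t))"
      using i[OF *(1)] i[OF *(2)] by (subst Bochner_Integration.integral_add) simp_all
    finally show "distr_of_fun f (\<lambda>x. a * \<phi> x + b * \<psi> x) = cnj a * distr_of_fun f \<phi> + cnj b * distr_of_fun f \<psi>"
      by (simp add: distr_of_fun_schwartz S *)
  next
    fix \<phi> :: "'a \<Rightarrow> complex" assume \<phi>: "\<phi> \<in> schwartz"
    have "norm (distr_of_fun f \<phi>) \<le> (LINT t|lborel. norm (f t) * schwartz_seminorm 0 \<phi>)"
      unfolding distr_of_fun_schwartz[OF \<phi>]
    proof (intro norm_integral_le integrable_mult_left integrable_norm f)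
      fix t
      have "norm (\<phi> t) \<le> schwartz_seminorm 0 \<phi>"
        using schwartz_seminorm_term[OF \<phi>, of 0 0 "[]" t] by simp
      then show "norm (f t * cnj (\<phi> t)) \<le> norm (f t) * schwartz_seminorm 0 \<phi>"
        by (simp add: norm_mult mult_left_mono)
    qed
    then show "norm (distr_of_fun f \<phi>) \<le> (LINT t|lborel. norm (f t)) * schwartz_seminorm 0 \<phi>" by simp
  qed
qed

lemma ennreal_powr_1: "ennreal_powr a 1 = a"
  by (cases a) (auto simp: ennreal_powr_def)

lemma Lp_norm_1: "Lp_norm 1 h = (\<integral>\<^sup>+x. h x \<partial>lborel)"
  by (simp add: Lp_norm_def ennreal_powr_1)

lemma modulation_norm_1:
  fixes g :: "'a::euclidean_space \<Rightarrow> complex"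
  assumes [measurable]: "(\<lambda>z. u (tfs z g)) \<in> borel_measurable borel"
  shows "modulation_norm g 1 1 u = (\<integral>\<^sup>+z. ennreal (norm (u (tfs z g))) \<partial>lborel)"
proof -
  have [measurable]: "(\<lambda>z. u (tfs z g)) \<in> borel_measurable (borel \<Otimes>\<^sub>M borel)"
    using assms by (simp add: borel_prod)
  have "modulation_norm g 1 1 u = (\<integral>\<^sup>+\<omega>. \<integral>\<^sup>+x. ennreal (norm (u (tfs (x, \<omega>) g))) \<partial>lborel \<partial>lborel)"
    by (simp add: modulation_norm_def Lp_norm_1 stft_tfs)
  also have "\<dots> = (\<integral>\<^sup>+z. ennreal (norm (u (tfs z g))) \<partial>(lborel \<Otimes>\<^sub>M lborel))"
    by (subst lborel_pair.nn_integral_snd[symmetric]) (auto simp: case_prod_unfold)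
  finally show ?thesis by (simp add: lborel_prod)
qed

lemma modulation_norm_1_fun:
  fixes g f :: "'a::euclidean_space \<Rightarrow> complex"
  assumes g: "g \<in> schwartz" and [measurable]: "f \<in> borel_measurable borel"
  shows "modulation_norm g 1 1 (distr_of_fun f) = (\<integral>\<^sup>+z. ennreal (norm (stf g f z)) \<partial>lborel)"
proof -
  have e: "distr_of_fun f (tfs z g) = stf g f z" for z
    by (simp add: distr_of_fun_schwartz tfs_schwartz g stf_def)
  show ?thesis
    using schwartz_measurable[OF g] by (subst modulation_norm_1) (simp_all add: e)
qed

text \<open>An integrable function is automatically a tempered distribution, and finiteness of its
  norm is integrability of its transform on phase space.\<close>

lemma M1_iff:
  fixes g f :: "'a::euclidean_space \<Rightarrow> complex"
  assumes g: "g \<in> schwartz"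
  shows "f \<in> M1 g \<longleftrightarrow> continuous_on UNIV f \<and> integrable lborel f \<and> integrable lborel (stf g f)"
proof -
  have "distr_of_fun f \<in> modulation_space g 1 1 \<longleftrightarrow> integrable lborel (stf g f)" if "integrable lborel f"
  proof -
    have [measurable]: "f \<in> borel_measurable borel" using that by auto
    have "integrable lborel (stf g f) \<longleftrightarrow> (\<integral>\<^sup>+z. ennreal (norm (stf g f z)) \<partial>lborel) < \<infinity>"
      using schwartz_measurable[OF g] by (intro integrable_norm_eq) simp
    then show ?thesis
      using that by (simp add: modulation_space_def tempered_distr_of_fun modulation_norm_1_fun[OF g])
  qed
  then show ?thesis by (auto simp: M1_def)
qed

lemma schwartz_M1: "g \<in> schwartz \<Longrightarrow> \<phi> \<in> schwartz \<Longrightarrow> \<phi> \<in> M1 g"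
  by (simp add: M1_iff schwartz_continuous schwartz_integrable stf_schwartz)

subsection \<open>Superpositions of time-frequency shifts\<close>

text \<open>The map \<open>L\<close> leaves open which shift belongs to a parameter. The identity
  gives the synthesis in the inversion formula; \<open>cohen_shift\<close> gives the expansion of a
  matrix-Wigner distribution, whose parameter is a pair of phase-space points.\<close>

definition synth :: "('v::euclidean_space \<Rightarrow> complex) \<Rightarrow> ('v \<Rightarrow> 'a::euclidean_space \<times> 'a) \<Rightarrow> ('a \<Rightarrow> complex) \<Rightarrow> 'a \<Rightarrow> complex" where
  "synth a L \<Phi> t = (LINT v|lborel. a v * tfs (L v) \<Phi> t)"

locale superposition =
  fixes a :: "'v::euclidean_space \<Rightarrow> complex" and L :: "'v \<Rightarrow> 'a::euclidean_space \<times> 'a"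
    and \<Phi> G :: "'a \<Rightarrow> complex"
  assumes a: "integrable lborel a" and L: "L \<in> borel_measurable borel"
    and \<Phi>: "\<Phi> \<in> schwartz" and G: "G \<in> schwartz"
begin

lemma measurable_assms [measurable]:
  "a \<in> borel_measurable borel" "\<Phi> \<in> borel_measurable borel" "G \<in> borel_measurable borel"
  using a \<Phi> G by (auto simp: schwartz_measurable)

lemma synth_integrand: "integrable lborel (\<lambda>v. a v * tfs (L v) \<Phi> t)"
proof -
  note [measurable] = L
  obtain B where "\<And>x. norm (\<Phi> x) \<le> B" using schwartz_sup[OF \<Phi>] by metis
  then show ?thesis by (intro integrable_mult_bounded[OF a, where B = B]) (auto simp: norm_tfs)
qed

lemma synth_continuous: "continuous_on UNIV (synth a L \<Phi>)"
proof -
  note [measurable] = L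
  obtain B where B: "\<And>x. norm (\<Phi> x) \<le> B" using schwartz_sup[OF \<Phi>] by metis
  show ?thesis
    unfolding continuous_on_sequentially
  proof (intro ballI allI impI)
    fix X :: "nat \<Rightarrow> 'a" and x assume "(\<forall>n. X n \<in> UNIV) \<and> X \<longlonglongrightarrow> x"
    then have X: "X \<longlonglongrightarrow> x" by simp
    show "(synth a L \<Phi> \<circ> X) \<longlonglongrightarrow> synth a L \<Phi> x"
      unfolding synth_def comp_def
    proof (rule integral_dominated_convergence[where w = "\<lambda>v. norm (a v) * B"])
      show "AE v in lborel. (\<lambda>n. a v * tfs (L v) \<Phi> (X n)) \<longlonglongrightarrow> a v * tfs (L v) \<Phi> x"
      proof (rule AE_I2)
        fix v
        have "isCont (tfs (L v) \<Phi>) x"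
          using schwartz_continuous[OF tfs_schwartz[OF \<Phi>], of UNIV] by (simp add: continuous_on_eq_continuous_at)
        from isCont_tendsto_compose[OF this X]
        show "(\<lambda>n. a v * tfs (L v) \<Phi> (X n)) \<longlonglongrightarrow> a v * tfs (L v) \<Phi> x"
          by (intro tendsto_intros)
      qed
      show "AE v in lborel. norm (a v * tfs (L v) \<Phi> (X n)) \<le> norm (a v) * B" for n
        using B by (intro AE_I2) (auto simp: norm_mult norm_tfs intro: mult_left_mono)
      show "integrable lborel (\<lambda>v. norm (a v) * B)" using a by simp
      show "(\<lambda>v. a v * tfs (L v) \<Phi> (X n)) \<in> borel_measurable lborel" for n by measurable
      show "(\<lambda>v. a v * tfs (L v) \<Phi> x) \<in> borel_measurable lborel" by measurable
    qed
  qed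
qed

lemma nn_integral_tfs:
  "(\<integral>\<^sup>+t. ennreal (norm (tfs z \<Phi> t)) \<partial>lborel) = (\<integral>\<^sup>+t. ennreal (norm (\<Phi> t)) \<partial>lborel)"
  unfolding norm_tfs by (rule nn_integral_translate(2)) measurable

lemma \<Phi>_finite: "(\<integral>\<^sup>+t. ennreal (norm (\<Phi> t)) \<partial>lborel) < \<infinity>"
  and a_finite: "(\<integral>\<^sup>+v. ennreal (norm (a v)) \<partial>lborel) < \<infinity>"
  using schwartz_integrable[OF \<Phi>] a by (simp_all add: integrable_iff_bounded)

lemma synth_pair_integrable:
  assumes [measurable]: "h \<in> borel_measurable borel" and h: "\<And>t. norm (h t) \<le> B"
  shows "integrable (lborel \<Otimes>\<^sub>M lborel) (\<lambda>(v, t). a v * tfs (L v) \<Phi> t * h t)"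
proof (rule integrable_pairI)
  note [measurable] = L
  have "(\<integral>\<^sup>+v. \<integral>\<^sup>+t. ennreal (norm (a v * tfs (L v) \<Phi> t * h t)) \<partial>lborel \<partial>lborel) \<le>
      (\<integral>\<^sup>+v. \<integral>\<^sup>+t. ennreal (norm (a v)) * (ennreal (norm (tfs (L v) \<Phi> t)) * ennreal B) \<partial>lborel \<partial>lborel)"
  proof (intro nn_integral_mono)
    fix v t
    have B: "B \<ge> 0" using order_trans[OF norm_ge_zero h] .
    have "norm (a v * tfs (L v) \<Phi> t * h t) \<le> norm (a v) * (norm (tfs (L v) \<Phi> t) * B)"
      unfolding norm_mult mult.assoc by (intro mult_left_mono h) auto
    then show "ennreal (norm (a v * tfs (L v) \<Phi> t * h t)) \<le> ennreal (norm (a v)) * (ennreal (norm (tfs (L v) \<Phi> t)) * ennreal B)"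
      using B by (simp add: ennreal_mult[symmetric] ennreal_leI)
  qed
  also have "\<dots> = (\<integral>\<^sup>+v. ennreal (norm (a v)) \<partial>lborel) * ((\<integral>\<^sup>+t. ennreal (norm (\<Phi> t)) \<partial>lborel) * ennreal B)"
    by (simp add: nn_integral_cmult nn_integral_multc nn_integral_tfs)
  also have "\<dots> < \<infinity>" using \<Phi>_finite a_finite by (simp add: ennreal_mult_less_top)
  finally show "(\<integral>\<^sup>+v. \<integral>\<^sup>+t. ennreal (norm (a v * tfs (L v) \<Phi> t * h t)) \<partial>lborel \<partial>lborel) < \<infinity>" .
  show "(\<lambda>(v, t). a v * tfs (L v) \<Phi> t * h t) \<in> borel_measurable (borel \<Otimes>\<^sub>M borel)"
    by measurable
qed

lemma synth_integrable: "integrable lborel (synth a L \<Phi>)"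
  unfolding synth_def[abs_def]
  using lborel_pair.integrable_snd[OF synth_pair_integrable[of "\<lambda>_. 1" 1]] by simp

lemma synth_measurable [measurable]: "synth a L \<Phi> \<in> borel_measurable borel"
  using synth_integrable by auto

lemma stf_synth: "stf G (synth a L \<Phi>) Z = (LINT v|lborel. a v * stf G (tfs (L v) \<Phi>) Z)"
proof -
  note [measurable] = L
  obtain B where B: "\<And>x. norm (G x) \<le> B" using schwartz_sup[OF G] by metis
  have "stf G (synth a L \<Phi>) Z = (LINT t|lborel. LINT v|lborel. a v * tfs (L v) \<Phi> t * cnj (tfs Z G t))"
    by (simp add: stf_def synth_def)
  also have "\<dots> = (LINT v|lborel. LINT t|lborel. a v * tfs (L v) \<Phi> t * cnj (tfs Z G t))"
    by (rule lborel_pair.Fubini_integral, rule synth_pair_integrable[where B = B]) (auto simp: norm_tfs B)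
  also have "\<dots> = (LINT v|lborel. a v * stf G (tfs (L v) \<Phi>) Z)"
    by (simp add: stf_def mult.assoc)
  finally show ?thesis .
qed

lemma stf_shift_measurable [measurable]:
  "(\<lambda>p. stf G (tfs (L (fst p)) \<Phi>) (snd p)) \<in> borel_measurable (borel \<Otimes>\<^sub>M borel)"
  unfolding stf_tfs[OF measurable_assms(3,2)] using L by measurable

text \<open>The triangle inequality and Fubini reduce to single shifts, and a shift of \<Phi> only
  translates the modulus of its transform. No assumption relates different values of
  \<open>L\<close>.\<close>

lemma stf_synth_nn_integral:
  "(\<integral>\<^sup>+Z. ennreal (norm (stf G (synth a L \<Phi>) Z)) \<partial>lborel) \<le>
     (\<integral>\<^sup>+v. ennreal (norm (a v)) \<partial>lborel) * (\<integral>\<^sup>+Z. ennreal (norm (stf G \<Phi> Z)) \<partial>lborel)"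
proof -
  note [measurable] = L
  have [measurable]: "(\<lambda>x. stf G (tfs (L v) \<Phi>) x) \<in> borel_measurable borel" for v
    by (rule stf_measurable) measurable
  have "(\<integral>\<^sup>+Z. ennreal (norm (stf G (synth a L \<Phi>) Z)) \<partial>lborel) \<le>
      (\<integral>\<^sup>+Z. \<integral>\<^sup>+v. ennreal (norm (a v)) * ennreal (norm (stf G (tfs (L v) \<Phi>) Z)) \<partial>lborel \<partial>lborel)"
  proof (rule nn_integral_mono)
    fix Z
    show "ennreal (norm (stf G (synth a L \<Phi>) Z)) \<le> (\<integral>\<^sup>+v. ennreal (norm (a v)) * ennreal (norm (stf G (tfs (L v) \<Phi>) Z)) \<partial>lborel)"
    proof (cases "integrable lborel (\<lambda>v. a v * stf G (tfs (L v) \<Phi>) Z)")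
      case True
      from integral_norm_bound_ennreal[OF this] show ?thesis
        by (simp add: stf_synth norm_mult ennreal_mult)
    next
      case False
      then show ?thesis by (simp add: stf_synth not_integrable_integral_eq)
    qed
  qed
  also have "\<dots> = (\<integral>\<^sup>+v. \<integral>\<^sup>+Z. ennreal (norm (a v)) * ennreal (norm (stf G (tfs (L v) \<Phi>) Z)) \<partial>lborel \<partial>lborel)"
    by (rule lborel_pair.Fubini') (simp add: case_prod_unfold)
  also have "\<dots> = (\<integral>\<^sup>+v. ennreal (norm (a v)) * (\<integral>\<^sup>+Z. ennreal (norm (stf G \<Phi> Z)) \<partial>lborel) \<partial>lborel)"
  proof (rule nn_integral_cong)
    fix v
    have "(\<integral>\<^sup>+Z. ennreal (norm (stf G (tfs (L v) \<Phi>) Z)) \<partial>lborel) = (\<integral>\<^sup>+Z. ennreal (norm (stf G \<Phi> Z)) \<partial>lborel)"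
      unfolding norm_stf_tfs[OF G \<Phi>] by (rule nn_integral_translate(2)) measurable
    then show "(\<integral>\<^sup>+Z. ennreal (norm (a v)) * ennreal (norm (stf G (tfs (L v) \<Phi>) Z)) \<partial>lborel) =
        ennreal (norm (a v)) * (\<integral>\<^sup>+Z. ennreal (norm (stf G \<Phi> Z)) \<partial>lborel)"
      by (subst nn_integral_cmult) simp_all
  qed
  also have "\<dots> = (\<integral>\<^sup>+v. ennreal (norm (a v)) \<partial>lborel) * (\<integral>\<^sup>+Z. ennreal (norm (stf G \<Phi> Z)) \<partial>lborel)"
    by (rule nn_integral_multc) measurable
  finally show ?thesis .
qed

lemma synth_M1: "synth a L \<Phi> \<in> M1 G"
proof -
  have "(\<integral>\<^sup>+Z. ennreal (norm (stf G \<Phi> Z)) \<partial>lborel) < \<infinity>"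
    using schwartz_integrable[OF stf_schwartz[OF G \<Phi>]] by (simp add: integrable_iff_bounded)
  then have "(\<integral>\<^sup>+Z. ennreal (norm (stf G (synth a L \<Phi>) Z)) \<partial>lborel) < \<infinity>"
    using a_finite by (intro le_less_trans[OF stf_synth_nn_integral]) (simp add: ennreal_mult_less_top)
  then have "integrable lborel (stf G (synth a L \<Phi>))"
    by (subst integrable_norm_eq) simp_all
  then show ?thesis by (simp add: M1_iff[OF G] synth_continuous synth_integrable)
qed

end

text \<open>The coefficient is merely integrable, but on a bounded set polynomial factors in z are
  harmless. A derivative produces a frequency factor, and a coordinate of t splits as a coordinate
  of the position plus one of t minus the position; each factor is absorbed by the coefficient or by
  the window.\<close>

lemma schwartz_synth_bounded_support:
  fixes a :: "'a::euclidean_space \<times> 'a \<Rightarrow> complex" and g :: "'a \<Rightarrow> complex"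
  assumes "integrable lborel a" "\<And>z. norm z > R \<Longrightarrow> a z = 0" "g \<in> schwartz"
  shows "synth a (\<lambda>z. z) g \<in> schwartz"
proof -
  define bs where "bs a \<longleftrightarrow> integrable lborel a \<and> (\<exists>R. \<forall>z. norm z > R \<longrightarrow> a z = 0)" for a :: "'a \<times> 'a \<Rightarrow> complex"
  let ?P = "{synth a (\<lambda>z. z) g | a g. bs a \<and> g \<in> schwartz} :: ('a \<Rightarrow> complex) set"
  have I: "(\<lambda>t. synth a (\<lambda>z. z) g t) \<in> cspan ?P" if "bs a" "g \<in> schwartz" for a g
    using that by (intro cspan_base) blast
  have sup: "superposition a (\<lambda>z. z) g g" if "bs a" "g \<in> schwartz" for a g
    using that by unfold_locales (auto simp: bs_def)
  have mult: "bs (\<lambda>z. m z * a z)" if a: "bs a" and m: "continuous_on UNIV m" for a m :: "'a \<times> 'a \<Rightarrow> complex"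
  proof -
    from a obtain R where R: "\<And>z. norm z > R \<Longrightarrow> a z = 0" and ai: "integrable lborel a" unfolding bs_def by blast
    have "compact (m ` cball 0 R)" by (intro compact_continuous_image continuous_on_subset[OF m]) auto
    from compact_imp_bounded[OF this] obtain B where B: "\<And>z. z \<in> cball 0 R \<Longrightarrow> norm (m z) \<le> B"
      unfolding bounded_iff by blast
    have [measurable]: "m \<in> borel_measurable borel" "a \<in> borel_measurable borel"
      using m ai by (auto intro: borel_measurable_continuous_onI)
    have "integrable lborel (\<lambda>z. m z * a z)"
    proof (rule Bochner_Integration.integrable_bound[OF integrable_mult_right[OF integrable_norm[OF ai], of B]])
      have "norm (m z * a z) \<le> norm (B * norm (a z))" for z
      proof (cases "norm z > R")
        case False
        then have "norm (m z) * norm (a z) \<le> B * norm (a z)" by (intro mult_right_mono B) auto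
        then show ?thesis by (simp add: norm_mult abs_mult) (meson abs_ge_self mult_right_mono norm_ge_zero order_trans)
      qed (simp add: R)
      then show "AE z in lborel. norm (m z * a z) \<le> norm (B * norm (a z))" by simp
    qed measurable
    moreover have "\<forall>z. norm z > R \<longrightarrow> m z * a z = 0" using R by simp
    ultimately show ?thesis unfolding bs_def by blast
  qed
  have ag: "bs a" "g \<in> schwartz" using assms by (auto simp: bs_def)
  have "(\<lambda>t. synth a (\<lambda>z. z) g t) \<in> schwartz"
  proof (rule schwartz_coinduct[OF _ _ _ I[OF ag]])
    fix F assume "F \<in> ?P"
    then obtain a g where F: "F = synth a (\<lambda>z. z) g" and a: "bs a" and g: "g \<in> schwartz" by blast
    interpret S: superposition a "\<lambda>z. z" g g by (rule sup[OF a g])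
    obtain R where R: "\<And>z. norm z > R \<Longrightarrow> a z = 0" and ai: "integrable lborel a" using a unfolding bs_def by blast
    obtain B where B: "B > 0" "\<And>x. norm (g x) \<le> B" using schwartz_sup[OF g] by metis
    have "norm (F t) \<le> (LINT z|lborel. norm (a z) * B)" for t
      unfolding F synth_def using B
      by (intro norm_integral_le integrable_mult_left integrable_norm ai) (auto simp: norm_mult norm_tfs intro: mult_left_mono)
    then show "bounded (range F)" unfolding bounded_iff by auto
    show "(\<lambda>t. of_real (t \<bullet> b) * F t) \<in> cspan ?P" if b: "b \<in> Basis" for b
    proof -
      have a': "bs (\<lambda>z. of_real (fst z \<bullet> b) * a z)" by (intro mult a continuous_intros)
      have g': "(\<lambda>x. of_real (x \<bullet> b) * g x) \<in> schwartz" by (rule schwartz_coord[OF g b])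
      have "of_real (t \<bullet> b) * F t = synth (\<lambda>z. of_real (fst z \<bullet> b) * a z) (\<lambda>z. z) g t +
          synth a (\<lambda>z. z) (\<lambda>x. of_real (x \<bullet> b) * g x) t" for t
      proof -
        have "of_real (t \<bullet> b) * (a z * tfs z g t) = of_real (fst z \<bullet> b) * a z * tfs z g t +
            a z * tfs z (\<lambda>x. of_real (x \<bullet> b) * g x) t" for z
          by (simp add: tfs_def inner_diff_left left_diff_distrib right_diff_distrib mult_ac)
        then show ?thesis
          unfolding F synth_def integral_mult_right_zero[symmetric]
          by (simp only: Bochner_Integration.integral_add[OF superposition.synth_integrand[OF sup[OF a' g]] superposition.synth_integrand[OF sup[OF a g']]])
      qed
      then show ?thesis using cspan_add[OF I[OF a' g] I[OF a g']] by presburger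
    qed
    let ?D = "\<lambda>h x. \<Sum>c\<in>Basis. of_real (h \<bullet> c) * dird c g x"
    have D: "?D h \<in> schwartz" for h by (intro schwartz_sum schwartz_dird g) auto
    let ?F' = "\<lambda>t z h. a z * (of_real (snd z \<bullet> h) * (2 * pi * \<i>) * tfs z g t + tfs z (?D h) t)"
    show "\<exists>F'. (\<forall>t. (F has_derivative F' t) (at t)) \<and> (\<forall>b\<in>Basis. (\<lambda>t. F' t b) \<in> cspan ?P)"
    proof (intro exI conjI allI ballI)
      fix t :: 'a
      have "\<forall>c\<in>Basis. \<exists>E\<ge>0. \<forall>x. norm (dird c g x) \<le> E"
      proof
        fix c :: 'a assume "c \<in> Basis"
        then obtain E where "E > 0" "\<And>x. norm (dird c g x) \<le> E"
          using schwartz_sup[OF schwartz_dird[OF g]] by blast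
        then show "\<exists>E\<ge>0. \<forall>x. norm (dird c g x) \<le> E" by (intro exI[of _ E]) auto
      qed
      then obtain E where E: "\<And>c. c \<in> Basis \<Longrightarrow> E c \<ge> 0" "\<And>c x. c \<in> Basis \<Longrightarrow> norm (dird c g x) \<le> E c" by metis
      have DE: "norm (?D h x) \<le> (\<Sum>c\<in>Basis. E c) * norm h" for h x
        unfolding sum_distrib_right
      proof (intro order_trans[OF norm_sum] sum_mono)
        fix c :: 'a assume c: "c \<in> Basis"
        show "norm (of_real (h \<bullet> c) * dird c g x) \<le> E c * norm h"
          using mult_mono[OF E(2)[OF c, of x] Basis_le_norm[OF c, of h]] E(1)[OF c] by (simp add: norm_mult mult.commute)
      qed
      show "(F has_derivative (\<lambda>h. LINT z|lborel. ?F' t z h)) (at t)"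
        unfolding F synth_def[abs_def]
      proof (rule has_derivative_integral[where r = 1 and w = "\<lambda>z. norm (a z) * (\<bar>R\<bar> * (2 * pi) * B + (\<Sum>c\<in>Basis. E c))"])
        fix t :: 'a and z :: "'a \<times> 'a"
        show "integrable lborel (\<lambda>z. a z * tfs z g t)" by (rule S.synth_integrand)
        have 1: "((\<lambda>t. t - fst z) has_derivative (\<lambda>h. h)) (at t)" by (auto intro!: derivative_eq_intros)
        have 2: "(tfs z g has_derivative (\<lambda>h. of_real (snd z \<bullet> h) * (2 * pi * \<i>) * tfs z g t + tfs z (?D h) t)) (at t)"
          unfolding tfs_def
          by (rule has_derivative_eq_rhs[OF has_derivative_mult[OF cis_inner_has_derivative[of "2 * pi" "snd z"]
                has_derivative_compose[OF 1 schwartz_has_derivative[OF g]]]])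
             (auto simp: algebra_simps)
        then show "((\<lambda>t. a z * tfs z g t) has_derivative ?F' t z) (at t)"
          by (rule has_derivative_mult_right)
        fix h :: 'a
        show "norm (?F' t z h) \<le> norm (a z) * (\<bar>R\<bar> * (2 * pi) * B + (\<Sum>c\<in>Basis. E c)) * norm h"
        proof (cases "norm z > R")
          case False
          have "\<bar>snd z \<bullet> h\<bar> \<le> norm (snd z) * norm h" by (rule Cauchy_Schwarz_ineq2)
          also have "\<dots> \<le> \<bar>R\<bar> * norm h"
            using False norm_snd_le[of "snd z" "fst z"] by (intro mult_right_mono) auto
          finally have "\<bar>snd z \<bullet> h\<bar> * (2 * pi) * norm (g (t - fst z)) \<le> \<bar>R\<bar> * norm h * (2 * pi) * B"
            using B by (intro mult_mono) auto
          then have "norm (of_real (snd z \<bullet> h) * (2 * pi * \<i>) * tfs z g t) \<le> \<bar>R\<bar> * (2 * pi) * B * norm h"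
            by (simp add: norm_mult norm_tfs mult_ac)
          moreover have "norm (tfs z (?D h) t) \<le> (\<Sum>c\<in>Basis. E c) * norm h"
            unfolding norm_tfs by (rule DE)
          ultimately have "norm (of_real (snd z \<bullet> h) * (2 * pi * \<i>) * tfs z g t + tfs z (?D h) t) \<le>
              (\<bar>R\<bar> * (2 * pi) * B + (\<Sum>c\<in>Basis. E c)) * norm h"
            unfolding distrib_right by (intro order_trans[OF norm_triangle_ineq] add_mono)
          then show ?thesis unfolding norm_mult[of "a z"] mult.assoc[of "norm (a z)"] by (intro mult_left_mono) auto
        qed (simp add: R)
      next
        show "integrable lborel (\<lambda>z. norm (a z) * (\<bar>R\<bar> * (2 * pi) * B + (\<Sum>c\<in>Basis. E c)))"
          by (intro integrable_mult_left integrable_norm ai)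
        show "(\<lambda>z. ?F' t z h) \<in> borel_measurable lborel" for h
        proof -
          define W where "W z = tfs z (?D h) t" for z
          have [measurable]: "W \<in> borel_measurable borel"
            unfolding W_def[abs_def] by (rule tfs_measurable[OF schwartz_measurable[OF D]]) auto
          have "(\<lambda>z. a z * (of_real (snd z \<bullet> h) * (2 * pi * \<i>) * tfs z g t + W z)) \<in> borel_measurable lborel"
            by measurable
          then show ?thesis by (simp only: W_def)
        qed
      qed simp
    next
      fix h
      have a': "bs (\<lambda>z. of_real (snd z \<bullet> h) * (2 * pi * \<i>) * a z)" by (intro mult a continuous_intros)
      have "(LINT z|lborel. ?F' t z h) = synth (\<lambda>z. of_real (snd z \<bullet> h) * (2 * pi * \<i>) * a z) (\<lambda>z. z) g t + synth a (\<lambda>z. z) (?D h) t" for t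
      proof -
        have "?F' t z h = of_real (snd z \<bullet> h) * (2 * pi * \<i>) * a z * tfs z g t + a z * tfs z (?D h) t" for z
          by (simp only: distrib_left mult_ac)
        then show ?thesis
          unfolding synth_def
          by (simp only: Bochner_Integration.integral_add[OF superposition.synth_integrand[OF sup[OF a' g]] superposition.synth_integrand[OF sup[OF a D]]])
      qed
      then show "(\<lambda>t. LINT z|lborel. ?F' t z h) \<in> cspan ?P"
        using cspan_add[OF I[OF a' g] I[OF a D, of h]] by presburger
    qed
  qed
  then show ?thesis by simp
qed

text \<open>The inversion formula is truncated to a ball of radius n. The truncation is Schwartz by
  \<open>schwartz_synth_bounded_support\<close>, and the discarded part is small because the
  \<open>M1\<close> norm of a superposition is at most the L^1 norm of its coefficients times that
  of V_G G.\<close>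

theorem schwartz_dense_M1:
  fixes G F :: "'a::euclidean_space \<Rightarrow> complex"
  assumes G: "G \<in> schwartz" "G \<noteq> (\<lambda>_. 0)" and F: "F \<in> M1 G"
  obtains \<phi> where "\<And>n::nat. \<phi> n \<in> schwartz"
    "(\<lambda>n. modulation_norm G 1 1 (distr_of_fun (\<lambda>t. \<phi> n t - F t))) \<longlonglongrightarrow> 0"
proof -
  have F': "continuous_on UNIV F" "integrable lborel F" "integrable lborel (stf G F)"
    using F G by (auto simp: M1_iff)
  let ?c = "1 / energy G"
  define A where "A n z = (if norm z \<le> real n then ?c * stf G F z else 0)" for n and z :: "'a \<times> 'a"
  \<comment> \<open>The sign is chosen so that \<open>A n\<close> minus \<open>A' n\<close> is the
    full coefficient, and the approximation error itself is the superposition with coefficient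
    \<open>A' n\<close>.\<close>
  define A' where "A' n z = (if norm z \<le> real n then 0 else - ?c * stf G F z)" for n and z :: "'a \<times> 'a"
  have [measurable]: "stf G F \<in> borel_measurable borel" using F' by auto
  have bnd: "integrable lborel (\<lambda>z. norm (?c * stf G F z))"
    using F' by (intro integrable_norm integrable_mult_right)
  have [measurable]: "A n \<in> borel_measurable borel" "A' n \<in> borel_measurable borel" for n
    unfolding A_def[abs_def] A'_def[abs_def] by measurable
  have A: "integrable lborel (A n)" for n
    by (rule Bochner_Integration.integrable_bound[OF bnd]) (auto simp: A_def)
  have A': "integrable lborel (A' n)" for n
    by (rule Bochner_Integration.integrable_bound[OF bnd]) (auto simp: A'_def norm_mult norm_divide)
  interpret A: superposition "A n" "\<lambda>z. z" G G for n by unfold_locales (auto simp: A G)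
  interpret A': superposition "A' n" "\<lambda>z. z" G G for n by unfold_locales (auto simp: A' G)
  have F_eq: "F t = (LINT z|lborel. (?c * stf G F z) * tfs z G t)" for t
  proof -
    have "(LINT z|lborel. (?c * stf G F z) * tfs z G t) = ?c * (LINT z|lborel. stf G F z * tfs z G t)"
      by (simp add: mult.assoc)
    then show ?thesis using stf_inversion[OF G(1) F', of t] energy_pos[OF G] by simp
  qed
  have diff: "synth (A n) (\<lambda>z. z) G t - F t = synth (A' n) (\<lambda>z. z) G t" for n t
  proof -
    have "synth (A n) (\<lambda>z. z) G t - synth (A' n) (\<lambda>z. z) G t = F t"
    proof -
      have i: "integrable lborel (\<lambda>z. A n z * tfs z G t)" "integrable lborel (\<lambda>z. A' n z * tfs z G t)"
        by (rule A.synth_integrand A'.synth_integrand)+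
      have "(LINT z|lborel. A n z * tfs z G t - A' n z * tfs z G t) = (LINT z|lborel. (?c * stf G F z) * tfs z G t)"
        by (intro Bochner_Integration.integral_cong refl) (simp add: A_def A'_def)
      also have "\<dots> = F t" by (rule F_eq[symmetric])
      finally show ?thesis
        unfolding synth_def Bochner_Integration.integral_diff[OF i] .
    qed
    then show ?thesis by (simp add: algebra_simps)
  qed
  let ?K = "\<integral>\<^sup>+Z. ennreal (norm (stf G G Z)) \<partial>lborel"
  show ?thesis
  proof (rule that[of "\<lambda>n. synth (A n) (\<lambda>z. z) G"])
    show "synth (A n) (\<lambda>z. z) G \<in> schwartz" for n
      by (rule schwartz_synth_bounded_support[OF A _ G(1), of "real n"]) (simp add: A_def)
    have K: "?K < \<infinity>"
      using schwartz_integrable[OF stf_schwartz[OF G(1) G(1)]] by (simp add: integrable_iff_bounded)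
    have "(\<lambda>n. LINT z|lborel. norm (A' n z)) \<longlonglongrightarrow> (LINT z|(lborel :: ('a \<times> 'a) measure). 0)"
    proof (rule integral_dominated_convergence[OF _ _ bnd])
      show "AE z in lborel. (\<lambda>n. norm (A' n z)) \<longlonglongrightarrow> 0"
      proof (rule AE_I2)
        fix z :: "'a \<times> 'a"
        obtain N :: nat where "norm z \<le> real N" using real_arch_simple by blast
        then show "(\<lambda>n. norm (A' n z)) \<longlonglongrightarrow> 0"
          by (intro tendsto_eventually eventually_sequentiallyI[of N]) (auto simp: A'_def)
      qed
      show "AE z in lborel. norm (norm (A' n z)) \<le> norm (?c * stf G F z)" for n
        by (auto simp: A'_def norm_mult norm_divide)
      show "(\<lambda>z. norm (A' n z)) \<in> borel_measurable lborel" for n using A' by auto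
    qed simp
    then have "(\<lambda>n. ennreal (LINT z|lborel. norm (A' n z)) * ?K) \<longlonglongrightarrow> ennreal 0 * ?K"
      using K by (intro tendsto_intros ennreal_tendsto_cmult) (auto intro!: tendsto_mult_ennreal tendsto_ennrealI)
    then have lim: "(\<lambda>n. (\<integral>\<^sup>+z. ennreal (norm (A' n z)) \<partial>lborel) * ?K) \<longlonglongrightarrow> 0"
      using A' by (simp add: nn_integral_eq_integral)
    show "(\<lambda>n. modulation_norm G 1 1 (distr_of_fun (\<lambda>t. synth (A n) (\<lambda>z. z) G t - F t))) \<longlonglongrightarrow> 0"
    proof (rule tendsto_sandwich[OF _ _ tendsto_const lim])
      show "\<forall>\<^sub>F n in sequentially. modulation_norm G 1 1 (distr_of_fun (\<lambda>t. synth (A n) (\<lambda>z. z) G t - F t)) \<le>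
          (\<integral>\<^sup>+z. ennreal (norm (A' n z)) \<partial>lborel) * ?K"
        unfolding diff using A'.stf_synth_nn_integral by (intro always_eventually allI) (simp add: modulation_norm_1_fun[OF G(1)])
    qed simp
  qed
qed

subsection \<open>The duality pairing as an integral\<close>

text \<open>Convergence in \<open>M1\<close> is L^1 convergence of the transforms, so any formula on
  Schwartz functions that is Lipschitz in this sense determines the limit in \<open>duality\<close>.
  Density supplies an approximating sequence, without which the description would not single out a
  value. The functional is left abstract because both the pairing with a symbol and the pairing with
  the extended operator are of this type.\<close>

theorem duality_extension:
  fixes u :: "'a::euclidean_space distr" and J :: "('a \<times> 'a \<Rightarrow> complex) \<Rightarrow> complex"
  assumes G: "G \<in> schwartz" "G \<noteq> (\<lambda>_. 0)" and F: "F \<in> M1 G"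
    and u: "\<And>\<phi>. \<phi> \<in> schwartz \<Longrightarrow> u \<phi> = J (stf G \<phi>)"
    and J: "\<And>k l. integrable lborel k \<Longrightarrow> integrable lborel l \<Longrightarrow>
      norm (J k - J l) \<le> K * (LINT z|lborel. norm (k z - l z))"
  shows "duality G u F = J (stf G F)"
proof -
  have F': "continuous_on UNIV F" "integrable lborel F" "integrable lborel (stf G F)"
    using F G by (auto simp: M1_iff)
  have Gm [measurable]: "G \<in> borel_measurable borel" by (rule schwartz_measurable[OF G(1)])
  have lim: "(\<lambda>n. u (\<phi> n)) \<longlonglongrightarrow> J (stf G F)"
    if \<phi>: "\<And>n::nat. \<phi> n \<in> schwartz"
      and conv: "(\<lambda>n. modulation_norm G 1 1 (distr_of_fun (\<lambda>t. \<phi> n t - F t))) \<longlonglongrightarrow> 0" for \<phi>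
  proof -
    have S: "integrable lborel (stf G (\<phi> n))" for n
      by (intro schwartz_integrable stf_schwartz G \<phi>)
    have stf_eq: "stf G (\<lambda>t. \<phi> n t - F t) z = stf G (\<phi> n) z - stf G F z" for n z
      by (rule stf_diff[OF schwartz_integrable[OF \<phi>] F'(2) G(1)])
    have D: "integrable lborel (\<lambda>z. stf G (\<phi> n) z - stf G F z)" for n
      using S F' by simp
    have [measurable]: "\<phi> n \<in> borel_measurable borel" "F \<in> borel_measurable borel" for n
      using \<phi> F' by (auto simp: schwartz_measurable)
    have "modulation_norm G 1 1 (distr_of_fun (\<lambda>t. \<phi> n t - F t)) = ennreal (LINT z|lborel. norm (stf G (\<phi> n) z - stf G F z))" for n
      using D[of n] by (subst modulation_norm_1_fun[OF G(1)]) (simp_all add: stf_eq nn_integral_eq_integral)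
    with conv have "(\<lambda>n. ennreal (LINT z|lborel. norm (stf G (\<phi> n) z - stf G F z))) \<longlonglongrightarrow> ennreal 0" by simp
    then have l0: "(\<lambda>n. LINT z|lborel. norm (stf G (\<phi> n) z - stf G F z)) \<longlonglongrightarrow> 0"
      by (subst (asm) tendsto_ennreal_iff) (auto intro!: always_eventually Bochner_Integration.integral_nonneg)
    have "norm (u (\<phi> n) - J (stf G F)) \<le> K * (LINT z|lborel. norm (stf G (\<phi> n) z - stf G F z))" for n
      unfolding u[OF \<phi>] by (rule J[OF S F'(3)])
    then have ev: "eventually (\<lambda>n. norm (u (\<phi> n) - J (stf G F)) \<le> K * (LINT z|lborel. norm (stf G (\<phi> n) z - stf G F z))) sequentially"
      by (intro always_eventually allI)
    have "(\<lambda>n. K * (LINT z|lborel. norm (stf G (\<phi> n) z - stf G F z))) \<longlonglongrightarrow> 0"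
      using tendsto_mult_left[OF l0, of K] unfolding mult_zero_right .
    then have "(\<lambda>n. u (\<phi> n) - J (stf G F)) \<longlonglongrightarrow> 0"
      by (rule Lim_null_comparison[OF ev])
    then show ?thesis by (rule LIM_zero_cancel)
  qed
  obtain \<phi> where \<phi>: "\<And>n::nat. \<phi> n \<in> schwartz"
    "(\<lambda>n. modulation_norm G 1 1 (distr_of_fun (\<lambda>t. \<phi> n t - F t))) \<longlonglongrightarrow> 0"
    using schwartz_dense_M1[OF G F] by metis
  show ?thesis
    unfolding duality_def
  proof (rule the_equality)
    show "\<forall>\<phi>. (\<forall>n::nat. \<phi> n \<in> schwartz) \<and>
        (\<lambda>n. modulation_norm G 1 1 (distr_of_fun (\<lambda>t. \<phi> n t - F t))) \<longlonglongrightarrow> 0 \<longrightarrow> (\<lambda>n. u (\<phi> n)) \<longlonglongrightarrow> J (stf G F)"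
      using lim by blast
    fix c assume "\<forall>\<phi>. (\<forall>n::nat. \<phi> n \<in> schwartz) \<and>
        (\<lambda>n. modulation_norm G 1 1 (distr_of_fun (\<lambda>t. \<phi> n t - F t))) \<longlonglongrightarrow> 0 \<longrightarrow> (\<lambda>n. u (\<phi> n)) \<longlonglongrightarrow> c"
    with \<phi> have "(\<lambda>n. u (\<phi> n)) \<longlonglongrightarrow> c" by blast
    with lim[OF \<phi>] show "c = J (stf G F)" by (rule LIMSEQ_unique[rotated])
  qed
qed

text \<open>The reproducing formula gives the value on Schwartz functions, and boundedness of the
  transform of \<open>u\<close> makes it Lipschitz for the L^1 norm.\<close>

theorem duality_eq:
  fixes u :: "'a::euclidean_space distr"
  assumes u: "tempered u" and bnd: "\<And>z. norm (u (tfs z G)) \<le> M"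
    and G: "G \<in> schwartz" "G \<noteq> (\<lambda>_. 0)" and F: "F \<in> M1 G"
  shows "duality G u F = (1 / energy G) * (LINT z|lborel. u (tfs z G) * cnj (stf G F z))"
proof (rule duality_extension[OF G F])
  let ?c = "1 / energy G"
  show "u \<phi> = ?c * (LINT z|lborel. u (tfs z G) * cnj (stf G \<phi> z))" if "\<phi> \<in> schwartz" for \<phi>
    using tempered_reproducing(2)[OF u G(1) that] energy_pos[OF G] by simp
  have [measurable]: "(\<lambda>z. u (tfs z G)) \<in> borel_measurable borel"
    by (rule borel_measurable_continuous_onI[OF tempered_tfs_continuous[OF u G(1)]])
  have i: "integrable lborel (\<lambda>z. u (tfs z G) * cnj (k z))" if "integrable lborel k" for k
    using integrable_mult_bounded[OF integrable_cnj[OF that], of "\<lambda>z. u (tfs z G)" M] bnd by (simp add: mult.commute)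
  fix k l :: "'a \<times> 'a \<Rightarrow> complex" assume kl: "integrable lborel k" "integrable lborel l"
  have "(LINT z|lborel. u (tfs z G) * cnj (k z - l z)) =
      (LINT z|lborel. u (tfs z G) * cnj (k z)) - (LINT z|lborel. u (tfs z G) * cnj (l z))"
    by (subst Bochner_Integration.integral_diff[OF i[OF kl(1)] i[OF kl(2)], symmetric]) (simp add: right_diff_distrib)
  then have "?c * (LINT z|lborel. u (tfs z G) * cnj (k z)) - ?c * (LINT z|lborel. u (tfs z G) * cnj (l z)) =
      ?c * (LINT z|lborel. u (tfs z G) * cnj (k z - l z))"
    by (simp only: right_diff_distrib)
  also have "norm \<dots> \<le> norm ?c * (LINT z|lborel. M * norm (k z - l z))"
    unfolding norm_mult[of ?c] using kl
    by (intro mult_left_mono norm_integral_le integrable_mult_right integrable_norm Bochner_Integration.integrable_diff)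
       (auto simp: norm_mult simp del: complex_cnj_diff intro: mult_right_mono bnd)
  finally show "norm (?c * (LINT z|lborel. u (tfs z G) * cnj (k z)) - ?c * (LINT z|lborel. u (tfs z G) * cnj (l z))) \<le>
      (norm ?c * M) * (LINT z|lborel. norm (k z - l z))" by (simp add: mult.assoc)
qed

lemma duality_schwartz:
  fixes u :: "'a::euclidean_space distr"
  assumes u: "tempered u" and bnd: "\<And>z. norm (u (tfs z G)) \<le> M"
    and G: "G \<in> schwartz" "G \<noteq> (\<lambda>_. 0)" and \<phi>: "\<phi> \<in> schwartz"
  shows "duality G u \<phi> = u \<phi>"
  using tempered_reproducing(2)[OF u G(1) \<phi>] energy_pos[OF G]
  by (subst duality_eq[OF u bnd G schwartz_M1[OF G(1) \<phi>]]) simp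

section \<open>Mixed-norm inequalities\<close>

lemma ennreal_powr_ennreal: "0 \<le> x \<Longrightarrow> ennreal_powr (ennreal x) r = ennreal (x powr r)"
  by (simp add: ennreal_powr_def)

lemma ennreal_powr_top: "ennreal_powr top r = top"
  by (simp add: ennreal_powr_def)

lemma ennreal_powr_0: "ennreal_powr 0 r = 0"
  by (simp add: ennreal_powr_def)

lemma ennreal_powr_eq_0: "ennreal_powr a r = 0 \<longleftrightarrow> a = 0"
  by (cases a) (auto simp: ennreal_powr_def)

lemma ennreal_powr_mono: "a \<le> b \<Longrightarrow> 0 \<le> r \<Longrightarrow> ennreal_powr a r \<le> ennreal_powr b r"
  by (cases a; cases b) (auto simp: ennreal_powr_def powr_mono2 ennreal_leI top_unique)

lemma ennreal_powr_mult:
  assumes "0 < r" shows "ennreal_powr (a * b) r = ennreal_powr a r * ennreal_powr b r"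
proof (cases "a = 0 \<or> b = 0")
  case True then show ?thesis by (auto simp: ennreal_powr_0)
next
  case False
  show ?thesis
  proof (cases a)
    case (real x)
    show ?thesis
    proof (cases b)
      case (real y)
      with \<open>a = ennreal x\<close> \<open>0 \<le> x\<close> show ?thesis
        by (simp add: ennreal_mult[symmetric] ennreal_powr_ennreal powr_mult)
    next
      case top
      with False show ?thesis by (simp add: ennreal_mult_top ennreal_powr_top ennreal_powr_eq_0)
    qed
  next
    case top
    with False show ?thesis by (simp add: ennreal_top_mult ennreal_powr_top ennreal_powr_eq_0)
  qed
qed

lemma ennreal_powr_inverse:
  assumes "0 < r" shows "ennreal_powr (ennreal_powr a r) (1 / r) = a" "ennreal_powr (ennreal_powr a (1 / r)) r = a"
  using assms by (cases a; simp add: ennreal_powr_def powr_powr)+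

lemma ennreal_powr_measurable [measurable (raw)]:
  assumes [measurable]: "f \<in> borel_measurable M" shows "(\<lambda>x. ennreal_powr (f x) r) \<in> borel_measurable M"
  unfolding ennreal_powr_def by measurable

text \<open>The tangent inequality for the convex function x^r at the point t, divided by the slope
  r t^(r-1). Since t is free, it can be chosen after integration, which yields Jensen and Hoelder
  type bounds.\<close>

lemma powr_young:
  fixes x t r :: real
  assumes "0 \<le> x" "0 < t" "1 \<le> r"
  shows "x \<le> t powr (1 - r) / r * x powr r + (1 - 1 / r) * t"
proof (cases "x = 0")
  case True with assms show ?thesis by simp
next
  case False
  with assms have x: "x > 0" by simp
  let ?a = "x powr r * t powr (1 - r)"
  have "?a powr (1 / r) * t powr (1 - 1 / r) \<le> 1 / r * ?a + (1 - 1 / r) * t"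
    using assms x by (intro Youngs_inequality_0) auto
  also have "?a powr (1 / r) * t powr (1 - 1 / r) = x"
  proof -
    have "?a powr (1 / r) = x * t powr ((1 - r) / r)"
      using assms x by (simp add: powr_mult powr_powr)
    moreover have "t powr ((1 - r) / r) * t powr (1 - 1 / r) = 1"
      using assms by (simp add: powr_add[symmetric] field_simps)
    ultimately show ?thesis by (simp add: mult.assoc)
  qed
  finally show ?thesis by (simp add: field_simps)
qed

lemma ennreal_powr_young:
  assumes "0 < t" "1 \<le> r"
  shows "a \<le> ennreal (t powr (1 - r) / r) * ennreal_powr a r + ennreal ((1 - 1 / r) * t)"
proof (cases a)
  case (real x)
  have "ennreal x \<le> ennreal (t powr (1 - r) / r * x powr r + (1 - 1 / r) * t)"
    using powr_young[of x t r] real assms by (intro ennreal_leI) auto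
  also have "\<dots> = ennreal (t powr (1 - r) / r * x powr r) + ennreal ((1 - 1 / r) * t)"
    using assms by (intro ennreal_plus) (auto simp: field_simps)
  also have "ennreal (t powr (1 - r) / r * x powr r) = ennreal (t powr (1 - r) / r) * ennreal (x powr r)"
    using assms by (intro ennreal_mult) auto
  finally show ?thesis using real by (simp only: ennreal_powr_ennreal)
next
  case top
  then show ?thesis using assms by (simp add: ennreal_powr_def ennreal_mult_top)
qed

text \<open>The tangent inequality is integrated against the weight and optimised in t. The cases
  where the right-hand integral is infinite or zero are separate, as they admit no such t.\<close>

lemma weighted_jensen:
  fixes f :: "'a \<Rightarrow> ennreal" and b :: "'a \<Rightarrow> real"
  assumes [measurable]: "f \<in> borel_measurable M" "b \<in> borel_measurable M"
    and r: "1 \<le> r" and B: "(\<integral>\<^sup>+z. ennreal (b z) \<partial>M) = ennreal B" "B > 0"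
  shows "ennreal_powr (\<integral>\<^sup>+z. f z * ennreal (b z) \<partial>M) r \<le>
    ennreal (B powr (r - 1)) * (\<integral>\<^sup>+z. ennreal_powr (f z) r * ennreal (b z) \<partial>M)"
proof -
  define D where "D = (\<integral>\<^sup>+z. ennreal_powr (f z) r * ennreal (b z) \<partial>M)"
  show ?thesis
  proof (cases D)
    case top
    then show ?thesis using B by (simp add: D_def[symmetric] ennreal_mult_top)
  next
    case (real d)
    show ?thesis
    proof (cases "d = 0")
      case True
      then have "AE z in M. ennreal_powr (f z) r * ennreal (b z) = 0"
        using real by (simp add: D_def nn_integral_0_iff_AE)
      then have "AE z in M. f z * ennreal (b z) = 0"
        by eventually_elim (auto simp: ennreal_powr_eq_0)
      then have "(\<integral>\<^sup>+z. f z * ennreal (b z) \<partial>M) = 0" by (simp add: nn_integral_0_iff_AE)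
      then show ?thesis by (simp add: ennreal_powr_0)
    next
      case False
      with real have d: "d > 0" by simp
      \<comment> \<open>The r-th power of t is the weighted mean of f^r; with this choice the two
        terms add up to exactly t B.\<close>
      define t where "t = (d / B) powr (1 / r)"
      have t: "t > 0" unfolding t_def using d B by simp
      have tr: "t powr r = d / B" unfolding t_def using d B r by (simp add: powr_powr)
      let ?c = "t powr (1 - r) / r" and ?e = "(1 - 1 / r) * t"
      have "(\<integral>\<^sup>+z. f z * ennreal (b z) \<partial>M) \<le>
          (\<integral>\<^sup>+z. ennreal ?c * (ennreal_powr (f z) r * ennreal (b z)) + ennreal ?e * ennreal (b z) \<partial>M)"
        using mult_right_mono[OF ennreal_powr_young[OF t r]]
        by (intro nn_integral_mono) (simp add: distrib_right mult.assoc)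
      also have "\<dots> = ennreal ?c * D + ennreal ?e * ennreal B"
        unfolding D_def B(1)[symmetric] by (subst nn_integral_add) (auto simp: nn_integral_cmult)
      also have "\<dots> = ennreal (?c * d + ?e * B)"
        using real d B r t by (simp add: ennreal_mult[symmetric] ennreal_plus[symmetric] divide_le_eq del: ennreal_plus)
      also have "?c * d + ?e * B = t * B"
      proof -
        have "t powr (1 - r) * t powr r = t" using t by (simp add: powr_add[symmetric])
        then have "t powr (1 - r) * d = t * B" unfolding tr using B by (simp add: field_simps)
        then show ?thesis using r by (simp add: field_simps)
      qed
      finally have "ennreal_powr (\<integral>\<^sup>+z. f z * ennreal (b z) \<partial>M) r \<le> ennreal_powr (ennreal (t * B)) r"
        using r by (intro ennreal_powr_mono) auto
      also have "\<dots> = ennreal (B powr (r - 1) * d)"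
      proof -
        have "(t * B) powr r = d / B * B powr r" using t B by (simp add: powr_mult tr)
        also have "\<dots> = B powr (r - 1) * d" using B by (simp add: powr_diff field_simps)
        finally show ?thesis using t B by (simp add: ennreal_powr_ennreal)
      qed
      also have "\<dots> = ennreal (B powr (r - 1)) * D" using real by (simp add: ennreal_mult)
      finally show ?thesis by (simp add: D_def)
    qed
  qed
qed

section \<open>Norms with a single exponent and the integral inequality of Minkowski\<close>

lemma exponent_cases:
  assumes "1 \<le> (p :: ennreal)"
  obtains "p = \<infinity>" | r where "p = ennreal r" "1 \<le> r" "enn2real p = r" "p \<noteq> \<infinity>"
  using assms by (cases p) (auto simp: ennreal_1[symmetric] ennreal_le_iff simp del: ennreal_1)

lemma Lp_norm_finite_exponent:
  "p \<noteq> \<infinity> \<Longrightarrow> enn2real p = r \<Longrightarrow> Lp_norm p h = ennreal_powr (\<integral>\<^sup>+x. ennreal_powr (h x) r \<partial>lborel) (1 / r)"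
  by (simp add: Lp_norm_def)

lemma Lp_norm_powr:
  "p \<noteq> \<infinity> \<Longrightarrow> enn2real p = r \<Longrightarrow> 1 \<le> r \<Longrightarrow>
     ennreal_powr (Lp_norm p h) r = (\<integral>\<^sup>+x. ennreal_powr (h x) r \<partial>lborel)"
  by (simp add: Lp_norm_finite_exponent ennreal_powr_inverse)

lemma Lp_norm_mono:
  assumes p: "1 \<le> p" and [measurable]: "h \<in> borel_measurable borel" and le: "AE x in lborel. h x \<le> h' x"
  shows "Lp_norm p h \<le> Lp_norm p h'"
  using p
proof (cases rule: exponent_cases)
  case 1
  then show ?thesis using le by (simp add: Lp_norm_def esssup_AE_mono)
next
  case (2 r)
  have "(\<integral>\<^sup>+x. ennreal_powr (h x) r \<partial>lborel) \<le> (\<integral>\<^sup>+x. ennreal_powr (h' x) r \<partial>lborel)"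
    by (rule nn_integral_mono_AE, use le in eventually_elim) (use 2 in \<open>auto intro: ennreal_powr_mono\<close>)
  then show ?thesis using 2 by (simp add: Lp_norm_finite_exponent ennreal_powr_mono)
qed

lemma Lp_norm_cmult:
  assumes p: "1 \<le> p" and [measurable]: "h \<in> borel_measurable borel"
  shows "Lp_norm p (\<lambda>x. c * h x) \<le> c * Lp_norm p h"
  using p
proof (cases rule: exponent_cases)
  case 1
  have "esssup lborel (\<lambda>x. c * h x) \<le> c * esssup lborel h"
    using esssup_AE[of h lborel] by (intro esssup_I) (auto elim!: eventually_mono intro: mult_left_mono)
  with 1 show ?thesis by (simp add: Lp_norm_def)
next
  case (2 r)
  then show ?thesis
    by (simp add: Lp_norm_finite_exponent ennreal_powr_mult nn_integral_cmult ennreal_powr_inverse)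
qed

lemma AE_lborel_translate:
  assumes "AE x in lborel. P x" and [measurable]: "Measurable.pred borel P"
  shows "AE x in lborel. P (x - a :: 'a::euclidean_space)"
proof -
  have "AE x in distr lborel borel (\<lambda>x. x + - a). P x"
    using assms(1) by (simp only: lborel_distr_translate)
  then show ?thesis by (subst (asm) AE_distr_iff) auto
qed

lemma Lp_norm_translate:
  fixes h :: "'a::euclidean_space \<Rightarrow> ennreal"
  assumes p: "1 \<le> p" and [measurable]: "h \<in> borel_measurable borel"
  shows "Lp_norm p (\<lambda>x. h (x - a)) \<le> Lp_norm p h"
  using p
proof (cases rule: exponent_cases)
  case 1
  have "AE x in lborel. h (x - a) \<le> esssup lborel h"
    by (rule AE_lborel_translate[OF esssup_AE]) measurable
  then have "esssup lborel (\<lambda>x. h (x - a)) \<le> esssup lborel h" by (intro esssup_I) auto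
  with 1 show ?thesis by (simp add: Lp_norm_def)
next
  case (2 r)
  have "(\<integral>\<^sup>+x. ennreal_powr (h (x - a)) r \<partial>lborel) = (\<integral>\<^sup>+x. ennreal_powr (h x) r \<partial>lborel)"
    by (rule nn_integral_translate(2)) measurable
  then show ?thesis using 2 by (simp add: Lp_norm_finite_exponent)
qed

text \<open>For an infinite exponent, the essential supremum exceeds c exactly when the superlevel
  set has positive measure, and measures of sections are measurable.\<close>

lemma Lp_norm_measurable:
  fixes F :: "'b \<Rightarrow> 'a::euclidean_space \<Rightarrow> ennreal"
  assumes p: "1 \<le> p" and F [measurable]: "(\<lambda>(x, y). F x y) \<in> borel_measurable (M \<Otimes>\<^sub>M borel)"
  shows "(\<lambda>x. Lp_norm p (F x)) \<in> borel_measurable M"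
  using p
proof (cases rule: exponent_cases)
  case 1
  have "(\<lambda>x. esssup lborel (F x)) \<in> borel_measurable M"
  proof (rule borel_measurableI_greater)
    fix c
    have Fx: "F x \<in> borel_measurable lborel" if "x \<in> space M" for x
      using measurable_Pair2[OF F that] by simp
    have "c < esssup lborel (F x) \<longleftrightarrow> 0 < emeasure lborel {y \<in> space lborel. c < F x y}" if x: "x \<in> space M" for x
    proof
      assume "c < esssup lborel (F x)"
      then show "0 < emeasure lborel {y \<in> space lborel. c < F x y}"
        by (intro esssup_pos_measure Fx x)
    next
      assume pos: "0 < emeasure lborel {y \<in> space lborel. c < F x y}"
      show "c < esssup lborel (F x)"
      proof (rule ccontr)
        assume "\<not> c < esssup lborel (F x)"
        then have "AE y in lborel. \<not> c < F x y"
          using esssup_AE[of "F x" lborel] by (auto elim!: eventually_mono)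
        then have "emeasure lborel {y \<in> space lborel. c < F x y} = 0"
          using Fx[OF x] by (subst (asm) AE_iff_measurable[OF _ refl]) auto
        with pos show False by simp
      qed
    qed
    then have "{x \<in> space M. c < esssup lborel (F x)} = {x \<in> space M. 0 < emeasure lborel {y \<in> space lborel. c < F x y}}"
      by auto
    also have "\<dots> \<in> sets M" by measurable
    finally show "{x \<in> space M. c < esssup lborel (F x)} \<in> sets M" .
  qed
  with 1 show ?thesis by (simp add: Lp_norm_def)
next
  case (2 r)
  show ?thesis
    unfolding Lp_norm_finite_exponent[OF 2(4,3)] by measurable
qed

text \<open>The integrand is written as (F / b) b and Jensen is applied for each x with weight b.
  After Fubini, F (., z) / b z has norm at most 1, so the remaining integral is at most that of
  b.\<close>

lemma minkowski_weighted:
  fixes F :: "'a::euclidean_space \<Rightarrow> 'b::euclidean_space \<Rightarrow> ennreal" and b :: "'b \<Rightarrow> real"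
  assumes p: "p \<noteq> \<infinity>" "enn2real p = r" "1 \<le> r"
    and [measurable]: "(\<lambda>(x, z). F x z) \<in> borel_measurable (borel \<Otimes>\<^sub>M borel)" "b \<in> borel_measurable borel"
    and b: "\<And>z. b z > 0" "AE z in lborel. Lp_norm p (\<lambda>x. F x z) \<le> ennreal (b z)"
    and B: "(\<integral>\<^sup>+z. ennreal (b z) \<partial>lborel) = ennreal B" "B > 0"
  shows "Lp_norm p (\<lambda>x. \<integral>\<^sup>+z. F x z \<partial>lborel) \<le> ennreal B"
proof -
  have F_eq: "F x z = F x z * ennreal (1 / b z) * ennreal (b z)" for x z
    using b(1)[of z] by (simp add: mult.assoc ennreal_mult[symmetric])
  have "(\<integral>\<^sup>+x. ennreal_powr (\<integral>\<^sup>+z. F x z \<partial>lborel) r \<partial>lborel) \<le>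
      (\<integral>\<^sup>+x. ennreal (B powr (r - 1)) * (\<integral>\<^sup>+z. ennreal_powr (F x z * ennreal (1 / b z)) r * ennreal (b z) \<partial>lborel) \<partial>lborel)"
  proof (rule nn_integral_mono)
    fix x
    show "ennreal_powr (\<integral>\<^sup>+z. F x z \<partial>lborel) r \<le>
        ennreal (B powr (r - 1)) * (\<integral>\<^sup>+z. ennreal_powr (F x z * ennreal (1 / b z)) r * ennreal (b z) \<partial>lborel)"
      by (subst F_eq) (rule weighted_jensen[OF _ _ p(3) B]; measurable)
  qed
  also have "\<dots> = ennreal (B powr (r - 1)) * (\<integral>\<^sup>+x. \<integral>\<^sup>+z. ennreal_powr (F x z * ennreal (1 / b z)) r * ennreal (b z) \<partial>lborel \<partial>lborel)"
    by (rule nn_integral_cmult) measurable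
  also have "(\<integral>\<^sup>+x. \<integral>\<^sup>+z. ennreal_powr (F x z * ennreal (1 / b z)) r * ennreal (b z) \<partial>lborel \<partial>lborel) =
      (\<integral>\<^sup>+z. \<integral>\<^sup>+x. ennreal_powr (F x z * ennreal (1 / b z)) r * ennreal (b z) \<partial>lborel \<partial>lborel)"
    by (rule lborel_pair.Fubini'[symmetric]) (simp add: case_prod_unfold)
  also have "\<dots> \<le> (\<integral>\<^sup>+z. ennreal (b z) \<partial>lborel)"
  proof (rule nn_integral_mono_AE, use b(2) in eventually_elim)
    fix z assume z: "Lp_norm p (\<lambda>x. F x z) \<le> ennreal (b z)"
    have "(\<integral>\<^sup>+x. ennreal_powr (F x z * ennreal (1 / b z)) r * ennreal (b z) \<partial>lborel) =
        (\<integral>\<^sup>+x. ennreal_powr (F x z) r \<partial>lborel) * (ennreal_powr (ennreal (1 / b z)) r * ennreal (b z))"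
      using p by (simp add: ennreal_powr_mult mult.assoc nn_integral_multc)
    also have "(\<integral>\<^sup>+x. ennreal_powr (F x z) r \<partial>lborel) = ennreal_powr (Lp_norm p (\<lambda>x. F x z)) r"
      by (rule Lp_norm_powr[OF p, symmetric])
    also have "\<dots> * (ennreal_powr (ennreal (1 / b z)) r * ennreal (b z)) \<le>
        ennreal_powr (ennreal (b z)) r * (ennreal_powr (ennreal (1 / b z)) r * ennreal (b z))"
      using p by (intro mult_right_mono ennreal_powr_mono z) auto
    also have "\<dots> = ennreal_powr (ennreal (b z) * ennreal (1 / b z)) r * ennreal (b z)"
      using p by (simp add: ennreal_powr_mult mult.assoc)
    also have "\<dots> = ennreal (b z)"
      using b(1)[of z] by (simp add: ennreal_mult[symmetric] ennreal_powr_def)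
    finally show "(\<integral>\<^sup>+x. ennreal_powr (F x z * ennreal (1 / b z)) r * ennreal (b z) \<partial>lborel) \<le> ennreal (b z)" .
  qed
  finally have "(\<integral>\<^sup>+x. ennreal_powr (\<integral>\<^sup>+z. F x z \<partial>lborel) r \<partial>lborel) \<le> ennreal (B powr (r - 1)) * ennreal B"
    unfolding B(1) by (simp add: mult_left_mono)
  also have "\<dots> = ennreal_powr (ennreal B) r"
  proof -
    have "B powr (r - 1) * B = B powr r" using B by (simp add: powr_diff)
    then show ?thesis using B by (simp add: ennreal_powr_ennreal ennreal_mult[symmetric])
  qed
  finally have "ennreal_powr (\<integral>\<^sup>+x. ennreal_powr (\<integral>\<^sup>+z. F x z \<partial>lborel) r \<partial>lborel) (1 / r) \<le> ennreal_powr (ennreal_powr (ennreal B) r) (1 / r)"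
    using p by (intro ennreal_powr_mono) auto
  then show ?thesis using p by (simp add: Lp_norm_finite_exponent ennreal_powr_inverse)
qed

text \<open>For \<open>p < \<infinity>\<close> Jensen's inequality is applied to the weight \<open>z \<mapsto> \<parallel>F(\<cdot>, z)\<parallel>\<^sub>p + \<epsilon> wgt z\<close>,
  which is strictly positive, so that no division by zero occurs.\<close>

theorem minkowski_integral:
  fixes F :: "'a::euclidean_space \<Rightarrow> 'b::euclidean_space \<Rightarrow> ennreal"
  assumes p: "1 \<le> p" and F [measurable]: "(\<lambda>(x, z). F x z) \<in> borel_measurable (borel \<Otimes>\<^sub>M borel)"
  shows "Lp_norm p (\<lambda>x. \<integral>\<^sup>+z. F x z \<partial>lborel) \<le> (\<integral>\<^sup>+z. Lp_norm p (\<lambda>x. F x z) \<partial>lborel)"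
proof -
  define a where "a z = Lp_norm p (\<lambda>x. F x z)" for z
  have [measurable]: "a \<in> borel_measurable borel"
    unfolding a_def[abs_def] by (rule Lp_norm_measurable[OF p]) measurable
  from p show ?thesis
  proof (cases rule: exponent_cases)
    case 1
    have "AE x in lborel. F x z \<le> a z" for z
      using esssup_AE[of "\<lambda>x. F x z" lborel] 1 by (simp add: a_def Lp_norm_def)
    then have "AE z in lborel. AE x in lborel. F x z \<le> a z" by (rule AE_I2)
    \<comment> \<open>The null set of bad x depends on z; exchanging the two quantifiers gives, for
      almost every x, an inequality that can be integrated over z.\<close>
    then have "AE x in lborel. AE z in lborel. F x z \<le> a z"
      by (subst lborel_pair.AE_commute) measurable
    then have "AE x in lborel. (\<integral>\<^sup>+z. F x z \<partial>lborel) \<le> (\<integral>\<^sup>+z. a z \<partial>lborel)"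
      by eventually_elim (rule nn_integral_mono_AE)
    then have "esssup lborel (\<lambda>x. \<integral>\<^sup>+z. F x z \<partial>lborel) \<le> (\<integral>\<^sup>+z. a z \<partial>lborel)"
      by (intro esssup_I) auto
    with 1 show ?thesis by (simp add: Lp_norm_def a_def)
  next
    case (2 r)
    show ?thesis
      unfolding a_def[symmetric]
    proof (rule ennreal_le_epsilon)
      fix e :: real assume fin: "(\<integral>\<^sup>+z. a z \<partial>lborel) < top" and e: "0 < e"
      define W where "W = (LINT z|lborel. wgt (z :: 'b))"
      have W: "(\<integral>\<^sup>+z. ennreal (wgt (z :: 'b)) \<partial>lborel) = ennreal W"
        unfolding W_def by (rule nn_integral_eq_integral[OF wgt_integrable]) (simp add: wgt_nonneg)
      have W0: "W > 0"
      proof -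
        have "W \<ge> 0" unfolding W_def by (intro Bochner_Integration.integral_nonneg) (simp add: wgt_nonneg)
        moreover have "W \<noteq> 0"
        proof
          assume "W = 0"
          then have "AE z in lborel. ennreal (wgt (z :: 'b)) = 0"
            using W by (simp add: nn_integral_0_iff_AE)
          then have "AE z in (lborel :: 'b measure). False"
            by eventually_elim (metis ennreal_eq_0_iff wgt_pos not_le)
          then show False using AE_iff_measurable[of UNIV "lborel :: 'b measure" "\<lambda>z. False"] by simp
        qed
        ultimately show ?thesis by simp
      qed
      obtain A where A: "(\<integral>\<^sup>+z. a z \<partial>lborel) = ennreal A" "A \<ge> 0"
        using fin by (cases "\<integral>\<^sup>+z. a z \<partial>lborel") auto
      have a_fin: "AE z in lborel. a z \<noteq> \<infinity>"
        using fin by (intro nn_integral_PInf_AE) auto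
      \<comment> \<open>The added term has integral exactly e, so the total mass of the weight is A
        + e.\<close>
      define b where "b z = enn2real (a z) + e / W * wgt z" for z
      have b0: "b z > 0" for z
        unfolding b_def using e W0 wgt_pos[of z] by (intro add_nonneg_pos) auto
      have "Lp_norm p (\<lambda>x. \<integral>\<^sup>+z. F x z \<partial>lborel) \<le> ennreal (A + e)"
      proof (rule minkowski_weighted[OF 2(4,3,2)])
        show "AE z in lborel. Lp_norm p (\<lambda>x. F x z) \<le> ennreal (b z)"
          unfolding a_def[symmetric] using a_fin
        proof eventually_elim
          case (elim z)
          then have "a z = ennreal (enn2real (a z))" by (simp add: less_top)
          also have "\<dots> \<le> ennreal (b z)"
            unfolding b_def using e W0 wgt_nonneg[of z] by (intro ennreal_leI) auto
          finally show ?case .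
        qed
        have "(\<integral>\<^sup>+z. ennreal (b z) \<partial>lborel) = (\<integral>\<^sup>+z. ennreal (enn2real (a z)) + ennreal (e / W) * ennreal (wgt z) \<partial>lborel)"
        proof (rule nn_integral_cong)
          fix z
          have "ennreal (b z) = ennreal (enn2real (a z)) + ennreal (e / W * wgt z)"
            unfolding b_def using e W0 wgt_nonneg[of z] by (intro ennreal_plus) auto
          also have "ennreal (e / W * wgt z) = ennreal (e / W) * ennreal (wgt z)"
            using e W0 wgt_nonneg[of z] by (intro ennreal_mult) auto
          finally show "ennreal (b z) = ennreal (enn2real (a z)) + ennreal (e / W) * ennreal (wgt z)" .
        qed
        also have "\<dots> = (\<integral>\<^sup>+z. ennreal (enn2real (a z)) \<partial>lborel) + ennreal (e / W) * ennreal W"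
          by (subst nn_integral_add) (auto simp: nn_integral_cmult W)
        also have "(\<integral>\<^sup>+z. ennreal (enn2real (a z)) \<partial>lborel) = (\<integral>\<^sup>+z. a z \<partial>lborel)"
          by (rule nn_integral_cong_AE, use a_fin in eventually_elim) (simp add: less_top)
        also have "\<dots> + ennreal (e / W) * ennreal W = ennreal (A + e)"
          using A e W0 by (simp add: ennreal_mult[symmetric] ennreal_plus)
        finally show "(\<integral>\<^sup>+z. ennreal (b z) \<partial>lborel) = ennreal (A + e)" .
        show "A + e > 0" using A e by simp
        show "b \<in> borel_measurable borel" unfolding b_def[abs_def] by measurable
      qed (use b0 in auto)
      also have "\<dots> = (\<integral>\<^sup>+z. a z \<partial>lborel) + ennreal e" using A e by (simp add: ennreal_plus)
      finally show "Lp_norm p (\<lambda>x. \<integral>\<^sup>+z. F x z \<partial>lborel) \<le> (\<integral>\<^sup>+z. a z \<partial>lborel) + ennreal e" .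
    qed
  qed
qed

section \<open>Mixed norms, convolutions and weighted integrals\<close>

definition mixed_norm :: "ennreal \<Rightarrow> ennreal \<Rightarrow> ('a::euclidean_space \<times> 'a \<Rightarrow> ennreal) \<Rightarrow> ennreal" where
  "mixed_norm p q F = Lp_norm q (\<lambda>x. Lp_norm p (\<lambda>\<omega>. F (x, \<omega>)))"

lemma slice_measurable:
  fixes F :: "'a::euclidean_space \<times> 'b::euclidean_space \<Rightarrow> ennreal"
  assumes p: "1 \<le> p" and [measurable]: "F \<in> borel_measurable borel"
  shows "(\<lambda>x. Lp_norm p (\<lambda>\<omega>. F (x, \<omega>))) \<in> borel_measurable borel"
    and "(\<lambda>\<omega>. F (x, \<omega>)) \<in> borel_measurable borel"
proof -
  have "F \<in> borel_measurable (borel \<Otimes>\<^sub>M borel)" using assms(2) by (simp add: borel_prod)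
  then have "(\<lambda>(x, \<omega>). F (x, \<omega>)) \<in> borel_measurable (borel \<Otimes>\<^sub>M borel)" by simp
  then show "(\<lambda>x. Lp_norm p (\<lambda>\<omega>. F (x, \<omega>))) \<in> borel_measurable borel" by (rule Lp_norm_measurable[OF p])
  show "(\<lambda>\<omega>. F (x, \<omega>)) \<in> borel_measurable borel" by measurable
qed

lemma mixed_norm_mono:
  assumes "1 \<le> p" "1 \<le> q" "F \<in> borel_measurable borel" "\<And>z. F z \<le> F' z"
  shows "mixed_norm p q F \<le> mixed_norm p q F'"
  unfolding mixed_norm_def using assms by (intro Lp_norm_mono slice_measurable AE_I2)

lemma mixed_norm_cmult:
  assumes "1 \<le> p" "1 \<le> q" and [measurable]: "F \<in> borel_measurable borel"
  shows "mixed_norm p q (\<lambda>z. c * F z) \<le> c * mixed_norm p q F"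
proof -
  have "mixed_norm p q (\<lambda>z. c * F z) \<le> Lp_norm q (\<lambda>x. c * Lp_norm p (\<lambda>\<omega>. F (x, \<omega>)))"
    unfolding mixed_norm_def using assms
    by (intro Lp_norm_mono slice_measurable AE_I2 Lp_norm_cmult) auto
  also have "\<dots> \<le> c * mixed_norm p q F"
    unfolding mixed_norm_def using assms by (intro Lp_norm_cmult slice_measurable)
  finally show ?thesis .
qed

text \<open>Minkowski is applied in the frequency variable and then in the position variable. A
  translation in phase space acts on the two variables separately, and each norm is invariant under
  its own translation.\<close>

theorem mixed_norm_convolution:
  fixes F k :: "'a::euclidean_space \<times> 'a \<Rightarrow> ennreal"
  assumes p: "1 \<le> p" and q: "1 \<le> q"
    and [measurable]: "F \<in> borel_measurable borel" "k \<in> borel_measurable borel"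
  shows "mixed_norm p q (\<lambda>z. \<integral>\<^sup>+v. F (z - v) * k v \<partial>lborel) \<le> (\<integral>\<^sup>+v. k v \<partial>lborel) * mixed_norm p q F"
proof -
  define n where "n x = Lp_norm p (\<lambda>\<omega>. F (x, \<omega>))" for x
  have [measurable]: "n \<in> borel_measurable borel" unfolding n_def[abs_def] by (rule slice_measurable[OF p]) measurable
  have inner: "Lp_norm p (\<lambda>\<omega>. \<integral>\<^sup>+v. F ((x, \<omega>) - v) * k v \<partial>lborel) \<le> (\<integral>\<^sup>+v. k v * n (x - fst v) \<partial>lborel)" for x
  proof -
    have "Lp_norm p (\<lambda>\<omega>. \<integral>\<^sup>+v. F ((x, \<omega>) - v) * k v \<partial>lborel) \<le>
        (\<integral>\<^sup>+v. Lp_norm p (\<lambda>\<omega>. F ((x, \<omega>) - v) * k v) \<partial>lborel)"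
      by (rule minkowski_integral[OF p]) measurable
    also have "\<dots> \<le> (\<integral>\<^sup>+v. k v * n (x - fst v) \<partial>lborel)"
    proof (rule nn_integral_mono)
      fix v :: "'a \<times> 'a"
      have "Lp_norm p (\<lambda>\<omega>. F ((x, \<omega>) - v) * k v) = Lp_norm p (\<lambda>\<omega>. k v * F (x - fst v, \<omega> - snd v))"
        by (simp add: mult.commute minus_prod_def)
      also have "\<dots> \<le> k v * Lp_norm p (\<lambda>\<omega>. F (x - fst v, \<omega> - snd v))"
        by (rule Lp_norm_cmult[OF p]) measurable
      also have "\<dots> \<le> k v * n (x - fst v)"
        unfolding n_def by (intro mult_left_mono Lp_norm_translate[OF p, of "\<lambda>\<omega>. F (x - fst v, \<omega>)"]) auto
      finally show "Lp_norm p (\<lambda>\<omega>. F ((x, \<omega>) - v) * k v) \<le> k v * n (x - fst v)" .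
    qed
    finally show ?thesis .
  qed
  have m: "(\<lambda>z. \<integral>\<^sup>+v. F (z - v) * k v \<partial>lborel) \<in> borel_measurable borel" by measurable
  have "mixed_norm p q (\<lambda>z. \<integral>\<^sup>+v. F (z - v) * k v \<partial>lborel) \<le> Lp_norm q (\<lambda>x. \<integral>\<^sup>+v. k v * n (x - fst v) \<partial>lborel)"
    unfolding mixed_norm_def
    by (intro Lp_norm_mono[OF q] slice_measurable(1)[OF p m] AE_I2 inner)
  also have "\<dots> \<le> (\<integral>\<^sup>+v. Lp_norm q (\<lambda>x. k v * n (x - fst v)) \<partial>lborel)"
    by (rule minkowski_integral[OF q]) measurable
  also have "\<dots> \<le> (\<integral>\<^sup>+v. k v * mixed_norm p q F \<partial>lborel)"
  proof (rule nn_integral_mono)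
    fix v :: "'a \<times> 'a"
    have "Lp_norm q (\<lambda>x. k v * n (x - fst v)) \<le> k v * Lp_norm q (\<lambda>x. n (x - fst v))"
      by (rule Lp_norm_cmult[OF q]) measurable
    also have "\<dots> \<le> k v * Lp_norm q n"
      by (intro mult_left_mono Lp_norm_translate[OF q]) auto
    finally show "Lp_norm q (\<lambda>x. k v * n (x - fst v)) \<le> k v * mixed_norm p q F"
      by (simp add: mixed_norm_def n_def[abs_def])
  qed
  also have "\<dots> = (\<integral>\<^sup>+v. k v \<partial>lborel) * mixed_norm p q F" by (rule nn_integral_multc) measurable
  finally show ?thesis .
qed

text \<open>The summand 1 absorbs the part of the bound in \<open>Lp_norm_wgt\<close> that does not
  come from the mass of the weight, and it keeps the factor nonzero in front of an infinite
  norm.\<close>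

definition wgt_mass :: "'a::euclidean_space itself \<Rightarrow> ennreal" where
  "wgt_mass _ = 1 + (\<integral>\<^sup>+x. ennreal (wgt (x :: 'a)) \<partial>lborel)"

lemma wgt_mass_finite: "wgt_mass t < \<infinity>"
  using wgt_integrable unfolding integrable_iff_bounded wgt_mass_def by (auto simp: wgt_nonneg)

text \<open>A crude form of Hoelder's inequality: the tangent inequality is used at t equal to the
  norm of h. The first term loses its weight through wgt <= 1 and contributes at most t; the second
  contributes at most t times the mass of the weight. The constant is the same for all
  exponents.\<close>

lemma Lp_norm_wgt:
  fixes h :: "'a::euclidean_space \<Rightarrow> ennreal"
  assumes p: "1 \<le> p" and [measurable]: "h \<in> borel_measurable borel"
  shows "(\<integral>\<^sup>+x. h x * ennreal (wgt x) \<partial>lborel) \<le> wgt_mass TYPE('a) * Lp_norm p h"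
proof -
  let ?W = "\<integral>\<^sup>+x. ennreal (wgt (x :: 'a)) \<partial>lborel"
  from p show ?thesis
  proof (cases rule: exponent_cases)
    case 1
    have "AE x in lborel. h x \<le> esssup lborel h" by (rule esssup_AE)
    then have "AE x in lborel. h x * ennreal (wgt x) \<le> esssup lborel h * ennreal (wgt x)"
      by eventually_elim (rule mult_right_mono, auto)
    then have "(\<integral>\<^sup>+x. h x * ennreal (wgt x) \<partial>lborel) \<le> (\<integral>\<^sup>+x. esssup lborel h * ennreal (wgt (x :: 'a)) \<partial>lborel)"
      by (rule nn_integral_mono_AE)
    also have "\<dots> = ?W * esssup lborel h" by (simp add: nn_integral_cmult mult.commute)
    also have "\<dots> \<le> wgt_mass TYPE('a) * esssup lborel h"
      unfolding wgt_mass_def by (intro mult_right_mono) auto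
    finally show ?thesis using 1 by (simp add: Lp_norm_def)
  next
    case (2 r)
    define D where "D = Lp_norm p h"
    have D: "ennreal_powr D r = (\<integral>\<^sup>+x. ennreal_powr (h x) r \<partial>lborel)"
      unfolding D_def by (rule Lp_norm_powr[OF 2(4,3,2)])
    show ?thesis
    proof (cases D)
      case top
      have "wgt_mass TYPE('a) \<noteq> 0" by (simp add: wgt_mass_def)
      with top show ?thesis by (simp add: D_def[symmetric] ennreal_mult_top)
    next
      case (real t)
      show ?thesis
      proof (cases "t = 0")
        case True
        then have "AE x in lborel. ennreal_powr (h x) r = 0"
          using D real by (simp add: ennreal_powr_0 nn_integral_0_iff_AE)
        then have "AE x in lborel. h x * ennreal (wgt x) = 0"
          by eventually_elim (simp add: ennreal_powr_eq_0)
        then have "(\<integral>\<^sup>+x. h x * ennreal (wgt x) \<partial>lborel) = 0" by (simp add: nn_integral_0_iff_AE)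
        then show ?thesis by simp
      next
        case False
        with real have t: "t > 0" by simp
        let ?c = "t powr (1 - r) / r" and ?e = "(1 - 1 / r) * t"
        have "(\<integral>\<^sup>+x. h x * ennreal (wgt x) \<partial>lborel) \<le>
            (\<integral>\<^sup>+x. ennreal ?c * ennreal_powr (h x) r + ennreal ?e * ennreal (wgt x) \<partial>lborel)"
        proof (rule nn_integral_mono)
          fix x
          have "h x * ennreal (wgt x) \<le> (ennreal ?c * ennreal_powr (h x) r + ennreal ?e) * ennreal (wgt x)"
            by (intro mult_right_mono ennreal_powr_young t 2) auto
          also have "\<dots> \<le> ennreal ?c * ennreal_powr (h x) r + ennreal ?e * ennreal (wgt x)"
            unfolding distrib_right
            using mult_left_mono[of "ennreal (wgt x)" 1 "ennreal ?c * ennreal_powr (h x) r"] wgt_le_1[of x]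
            by (intro add_right_mono) simp
          finally show "h x * ennreal (wgt x) \<le> ennreal ?c * ennreal_powr (h x) r + ennreal ?e * ennreal (wgt x)" .
        qed
        also have "\<dots> = ennreal ?c * ennreal_powr D r + ennreal ?e * ?W"
          unfolding D by (subst nn_integral_add) (auto simp: nn_integral_cmult)
        also have "\<dots> \<le> ennreal t + ennreal t * ?W"
        proof (intro add_mono mult_right_mono ennreal_leI)
          have "?c * t powr r = t / r" using t by (simp add: powr_add[symmetric])
          also have "\<dots> \<le> t" using t 2 by (simp add: field_simps)
          finally show "ennreal ?c * ennreal_powr D r \<le> ennreal t"
            using real t 2 by (simp add: ennreal_powr_ennreal ennreal_mult[symmetric] ennreal_leI)
          show "?e \<le> t" using t 2 by (simp add: field_simps)
        qed auto
        also have "\<dots> = wgt_mass TYPE('a) * D" using real by (simp add: wgt_mass_def distrib_left distrib_right mult.commute)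
        finally show ?thesis by (simp add: D_def)
      qed
    qed
  qed
qed

text \<open>The one-variable bound is applied in frequency and then in position. It turns a finite
  mixed norm into weighted integrability on phase space.\<close>

theorem mixed_norm_wgt:
  fixes F :: "'a::euclidean_space \<times> 'a \<Rightarrow> ennreal"
  assumes p: "1 \<le> p" and q: "1 \<le> q" and [measurable]: "F \<in> borel_measurable borel"
  shows "(\<integral>\<^sup>+z. F z * ennreal (wgt (fst z) * wgt (snd z)) \<partial>lborel) \<le> wgt_mass TYPE('a) * (wgt_mass TYPE('a) * mixed_norm p q F)"
proof -
  define n where "n x = Lp_norm p (\<lambda>\<omega>. F (x, \<omega>))" for x
  have [measurable]: "n \<in> borel_measurable borel" unfolding n_def[abs_def] by (rule slice_measurable[OF p]) measurable
  have [measurable]: "F \<in> borel_measurable (borel \<Otimes>\<^sub>M borel)" using assms(3) by (simp add: borel_prod)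
  have "(\<integral>\<^sup>+z. F z * ennreal (wgt (fst z) * wgt (snd z)) \<partial>lborel) =
      (\<integral>\<^sup>+z. F z * ennreal (wgt (fst z) * wgt (snd z)) \<partial>(lborel \<Otimes>\<^sub>M lborel))"
    by (simp add: lborel_prod)
  also have "\<dots> = (\<integral>\<^sup>+x. \<integral>\<^sup>+\<omega>. (F (x, \<omega>) * ennreal (wgt \<omega>)) * ennreal (wgt x) \<partial>lborel \<partial>lborel)"
    by (subst lborel.nn_integral_fst[symmetric]) (auto simp: ennreal_mult wgt_nonneg mult_ac)
  also have "\<dots> = (\<integral>\<^sup>+x. (\<integral>\<^sup>+\<omega>. F (x, \<omega>) * ennreal (wgt \<omega>) \<partial>lborel) * ennreal (wgt x) \<partial>lborel)"
    by (intro nn_integral_cong nn_integral_multc) measurable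
  also have "\<dots> \<le> (\<integral>\<^sup>+x. wgt_mass TYPE('a) * (n x * ennreal (wgt x)) \<partial>lborel)"
    unfolding n_def mult.assoc[symmetric] by (intro nn_integral_mono mult_right_mono Lp_norm_wgt p) measurable
  also have "\<dots> = wgt_mass TYPE('a) * (\<integral>\<^sup>+x. n x * ennreal (wgt x) \<partial>lborel)"
    by (rule nn_integral_cmult) measurable
  also have "\<dots> \<le> wgt_mass TYPE('a) * (wgt_mass TYPE('a) * mixed_norm p q F)"
    unfolding mixed_norm_def n_def[symmetric] by (intro mult_left_mono Lp_norm_wgt q) auto
  finally show ?thesis .
qed

text \<open>Fubini in the integral formula for the pairing leaves, for each parameter, the
  reproducing formula for a single shift of \<Phi>. Thus pairings with superpositions are read off
  from the values of \<open>u\<close> on shifts.\<close>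

lemma (in superposition) duality_synth:
  fixes u :: "'a distr"
  assumes u: "tempered u" and bnd: "\<And>z. norm (u (tfs z G)) \<le> M" and G0: "G \<noteq> (\<lambda>_. 0)"
  shows "duality G u (synth a L \<Phi>) = (LINT v|lborel. cnj (a v) * u (tfs (L v) \<Phi>))"
proof -
  have [measurable]: "(\<lambda>z. u (tfs z G)) \<in> borel_measurable borel"
    by (rule borel_measurable_continuous_onI[OF tempered_tfs_continuous[OF u G]])
  have M: "M \<ge> 0" using order_trans[OF norm_ge_zero bnd] .
  let ?f = "\<lambda>v Z. u (tfs Z G) * cnj (a v * stf G (tfs (L v) \<Phi>) Z)"
  have K: "(\<integral>\<^sup>+Z. ennreal (norm (stf G \<Phi> Z)) \<partial>lborel) < \<infinity>"
    using schwartz_integrable[OF stf_schwartz[OF G \<Phi>]] by (simp add: integrable_iff_bounded)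
  have sm [measurable]: "stf G (tfs (L v) \<Phi>) \<in> borel_measurable borel" for v
    by (rule stf_measurable) measurable
  have i: "integrable (lborel \<Otimes>\<^sub>M lborel) (case_prod ?f)"
  proof (rule integrable_pairI)
    show "case_prod ?f \<in> borel_measurable (borel \<Otimes>\<^sub>M borel)"
      unfolding case_prod_unfold by measurable
    have "(\<integral>\<^sup>+v. \<integral>\<^sup>+Z. ennreal (norm (?f v Z)) \<partial>lborel \<partial>lborel) \<le>
        (\<integral>\<^sup>+v. \<integral>\<^sup>+Z. ennreal (M * norm (a v)) * ennreal (norm (stf G (tfs (L v) \<Phi>) Z)) \<partial>lborel \<partial>lborel)"
    proof (intro nn_integral_mono)
      fix v Z
      have "norm (?f v Z) \<le> M * norm (a v) * norm (stf G (tfs (L v) \<Phi>) Z)"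
        unfolding norm_mult complex_mod_cnj mult.assoc by (intro mult_right_mono bnd) auto
      then show "ennreal (norm (?f v Z)) \<le> ennreal (M * norm (a v)) * ennreal (norm (stf G (tfs (L v) \<Phi>) Z))"
        using M by (simp add: ennreal_mult[symmetric] ennreal_leI)
    qed
    also have "\<dots> = (\<integral>\<^sup>+v. ennreal (M * norm (a v)) * (\<integral>\<^sup>+Z. ennreal (norm (stf G \<Phi> Z)) \<partial>lborel) \<partial>lborel)"
    proof (rule nn_integral_cong)
      fix v
      have "(\<integral>\<^sup>+Z. ennreal (norm (stf G (tfs (L v) \<Phi>) Z)) \<partial>lborel) = (\<integral>\<^sup>+Z. ennreal (norm (stf G \<Phi> Z)) \<partial>lborel)"
        unfolding norm_stf_tfs[OF G \<Phi>] by (rule nn_integral_translate(2)) measurable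
      then show "(\<integral>\<^sup>+Z. ennreal (M * norm (a v)) * ennreal (norm (stf G (tfs (L v) \<Phi>) Z)) \<partial>lborel) =
          ennreal (M * norm (a v)) * (\<integral>\<^sup>+Z. ennreal (norm (stf G \<Phi> Z)) \<partial>lborel)"
        by (subst nn_integral_cmult) simp_all
    qed
    also have "\<dots> = ennreal M * (\<integral>\<^sup>+v. ennreal (norm (a v)) \<partial>lborel) * (\<integral>\<^sup>+Z. ennreal (norm (stf G \<Phi> Z)) \<partial>lborel)"
      using M by (simp add: nn_integral_multc nn_integral_cmult ennreal_mult)
    also have "\<dots> < \<infinity>" using K a_finite by (simp add: ennreal_mult_less_top)
    finally show "(\<integral>\<^sup>+v. \<integral>\<^sup>+Z. ennreal (norm (?f v Z)) \<partial>lborel \<partial>lborel) < \<infinity>" .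
  qed
  have inner: "(LINT Z|lborel. ?f v Z) = cnj (a v) * u (tfs (L v) \<Phi>) * energy G" for v
  proof -
    have "(LINT Z|lborel. ?f v Z) = cnj (a v) * (LINT Z|lborel. u (tfs Z G) * cnj (stf G (tfs (L v) \<Phi>) Z))"
      unfolding integral_mult_right_zero[symmetric]
      by (intro Bochner_Integration.integral_cong refl) (simp add: mult_ac)
    then show ?thesis by (simp add: tempered_reproducing(2)[OF u G tfs_schwartz[OF \<Phi>]] mult.assoc)
  qed
  have "duality G u (synth a L \<Phi>) = (1 / energy G) * (LINT Z|lborel. u (tfs Z G) * cnj (stf G (synth a L \<Phi>) Z))"
    by (rule duality_eq[OF u bnd G G0 synth_M1])
  also have "(LINT Z|lborel. u (tfs Z G) * cnj (stf G (synth a L \<Phi>) Z)) = (LINT Z|lborel. LINT v|lborel. ?f v Z)"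
  proof (intro Bochner_Integration.integral_cong refl)
    fix Z
    have "cnj (stf G (synth a L \<Phi>) Z) = (LINT v|lborel. cnj (a v * stf G (tfs (L v) \<Phi>) Z))"
      unfolding stf_synth by (rule Bochner_Integration.integral_cnj[symmetric])
    then show "u (tfs Z G) * cnj (stf G (synth a L \<Phi>) Z) = (LINT v|lborel. ?f v Z)"
      by (simp only: integral_mult_right_zero)
  qed
  also have "\<dots> = (LINT v|lborel. LINT Z|lborel. ?f v Z)"
    by (rule lborel_pair.Fubini_integral[OF i])
  also have "\<dots> = (LINT v|lborel. cnj (a v) * u (tfs (L v) \<Phi>)) * energy G"
    unfolding inner by simp
  finally show ?thesis using energy_pos[OF G G0] by simp
qed

section \<open>Time-frequency analysis of matrix-Wigner distributions\<close>

lemma matrix_vector_measurable [measurable (raw)]: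
  fixes B :: "real^'m^'n"
  assumes "f \<in> borel_measurable M" shows "(\<lambda>x. B *v f x) \<in> borel_measurable M"
  using measurable_compose[OF assms borel_measurable_continuous_onI[OF linear_continuous_on[OF matrix_vector_mul_bounded_linear]]] .

definition cohen_tensor :: "real^'d^'d \<Rightarrow> (real^'d \<Rightarrow> complex) \<Rightarrow> (real^'d \<Rightarrow> complex) \<Rightarrow> (real^'d) \<times> (real^'d) \<Rightarrow> complex" where
  "cohen_tensor T f h p = f (fst p + T *v snd p) * cnj (h (fst p - (mat 1 - T) *v snd p))"

lemma matrix_wigner_tensor:
  "matrix_wigner (cohen_matrix T) f h (x, \<omega>) = (LINT y|lborel. cis (- 2 * pi * (\<omega> \<bullet> y)) * cohen_tensor T f h (x, y))"
  by (simp add: matrix_wigner_cohen cohen_tensor_def mult.assoc)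

text \<open>The change of variables (x, y) -> (x + T y, x - (I - T) y) = (s, r) is inverted by y = s
  - r and x = s - T (s - r), whatever T is.\<close>

lemma cohen_tensor_schwartz:
  assumes f: "f \<in> schwartz" and h: "h \<in> schwartz"
  shows "cohen_tensor T f h \<in> schwartz"
proof -
  have "(\<lambda>p. f (fst p) * cnj (h (snd p))) \<in> schwartz" by (rule schwartz_tensor[OF f schwartz_cnj[OF h]])
  moreover have "linear (\<lambda>p. (fst p + T *v snd p, fst p - (mat 1 - T) *v snd p))"
    by (auto intro!: linearI simp: matrix_vector_mult_diff_rdistrib matrix_vector_right_distrib matrix_vector_mult_scaleR scaleR_right_diff_distrib algebra_simps)
  moreover have "linear (\<lambda>p. (fst p - T *v (fst p - snd p), fst p - snd p))"
    by (auto intro!: linearI simp: matrix_vector_mult_diff_distrib matrix_vector_right_distrib matrix_vector_mult_scaleR scaleR_right_diff_distrib algebra_simps)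
  ultimately have "(\<lambda>p. f (fst ((fst p + T *v snd p, fst p - (mat 1 - T) *v snd p) + 0)) *
      cnj (h (snd ((fst p + T *v snd p, fst p - (mat 1 - T) *v snd p) + 0)))) \<in> schwartz"
    by (rule schwartz_affine) (simp add: matrix_vector_mult_diff_rdistrib algebra_simps)
  then show ?thesis by (simp add: cohen_tensor_def[abs_def])
qed

lemma matrix_wigner_schwartz:
  assumes "f \<in> schwartz" "h \<in> schwartz"
  shows "matrix_wigner (cohen_matrix T) f h \<in> schwartz"
proof -
  have "matrix_wigner (cohen_matrix T) f h = (\<lambda>(x, \<omega>). LINT y|lborel. cis (- 2 * pi * (\<omega> \<bullet> y)) * cohen_tensor T f h (x, y))"
    by (auto simp: matrix_wigner_tensor)
  then show ?thesis using schwartz_partial_fourier[OF cohen_tensor_schwartz[OF assms]] by simp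
qed

text \<open>For \<open>v = (w, z)\<close>, the distribution of \<open>(\<pi>(w) g, \<pi>(z) g)\<close> is a time-frequency shift
  of the distribution of \<open>(g, g)\<close> by \<open>cohen_shift T v\<close>.\<close>

definition cohen_shift :: "real^'d^'d \<Rightarrow> ((real^'d) \<times> (real^'d)) \<times> ((real^'d) \<times> (real^'d)) \<Rightarrow>
    ((real^'d) \<times> (real^'d)) \<times> ((real^'d) \<times> (real^'d))" where
  "cohen_shift T v =
     ((fst (fst v) - T *v (fst (fst v) - fst (snd v)), transpose T *v snd (fst v) + transpose (mat 1 - T) *v snd (snd v)),
      (snd (fst v) - snd (snd v), fst (snd v) - fst (fst v)))"

text \<open>The constant left over when the integration variable y is recentred at the difference of
  the two positions.\<close>

definition cohen_phase :: "real^'d^'d \<Rightarrow> ((real^'d) \<times> (real^'d)) \<times> ((real^'d) \<times> (real^'d)) \<Rightarrow> complex" where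
  "cohen_phase T v = cis (2 * pi * (snd (fst (cohen_shift T v)) \<bullet> (fst (fst v) - fst (snd v))))"

lemma norm_cohen_phase: "norm (cohen_phase T v) = 1"
  by (simp add: cohen_phase_def)

lemma cohen_shift_measurable [measurable]: "cohen_shift T \<in> borel_measurable borel"
  unfolding cohen_shift_def[abs_def] by measurable

lemma cohen_phase_measurable [measurable]: "cohen_phase T \<in> borel_measurable borel"
  unfolding cohen_phase_def[abs_def] by measurable

lemma transpose_inner: "(transpose B *v x) \<bullet> y = x \<bullet> (B *v y)" for B :: "real^'n^'m"
  by (simp add: dot_lmul_matrix)

text \<open>Substituting y + a, with a the difference of the positions, makes both arguments those
  of the unshifted tensor at the same translated point x - u. All remaining exponents are affine in
  y, x and \<omega>, and collect into a phase, a modulation and a shift of the frequency.\<close>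

lemma cohen_tensor_shift:
  fixes g :: "real^'d \<Rightarrow> complex"
  shows "cis (- 2 * pi * (\<omega> \<bullet> (y + (fst w - fst z)))) * cohen_tensor T (tfs w g) (tfs z g) (x, y + (fst w - fst z)) =
    cohen_phase T (w, z) * cis (2 * pi * (snd (cohen_shift T (w, z)) \<bullet> (x, \<omega>))) *
      (cis (- 2 * pi * ((\<omega> - snd (fst (cohen_shift T (w, z)))) \<bullet> y)) *
       cohen_tensor T g g (x - fst (fst (cohen_shift T (w, z))), y))"
proof -
  let ?a = "fst w - fst z" and ?u = "fst (fst (cohen_shift T (w, z)))" and ?s = "snd (fst (cohen_shift T (w, z)))"
  have arg1: "x + T *v (y + ?a) - fst w = (x - ?u) + T *v y"
    by (simp add: cohen_shift_def matrix_vector_right_distrib)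
  have arg2: "x - (mat 1 - T) *v (y + ?a) - fst z = (x - ?u) - (mat 1 - T) *v y"
    by (simp add: cohen_shift_def matrix_vector_right_distrib matrix_vector_mult_diff_rdistrib)
  have s: "?s \<bullet> t = snd w \<bullet> (T *v t) + snd z \<bullet> ((mat 1 - T) *v t)" for t
    by (simp only: cohen_shift_def fst_conv snd_conv inner_add_left transpose_inner)
  \<comment> \<open>Comparison of the exponents: the terms in y shift the frequency, those in x and
    \<omega> form the modulation, and the constant ones form \<open>cohen_phase\<close>.\<close>
  have phase: "- 2 * pi * (\<omega> \<bullet> (y + ?a)) + 2 * pi * (snd w \<bullet> (x + T *v (y + ?a))) - 2 * pi * (snd z \<bullet> (x - (mat 1 - T) *v (y + ?a))) =
      2 * pi * (?s \<bullet> ?a) + 2 * pi * (snd (cohen_shift T (w, z)) \<bullet> (x, \<omega>)) + (- 2 * pi * ((\<omega> - ?s) \<bullet> y))"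
  proof -
    have "snd (cohen_shift T (w, z)) \<bullet> (x, \<omega>) = snd w \<bullet> x - snd z \<bullet> x - ?a \<bullet> \<omega>"
      by (simp add: cohen_shift_def inner_diff_left)
    moreover have "snd w \<bullet> (x + T *v (y + ?a)) = snd w \<bullet> x + snd w \<bullet> (T *v y) + snd w \<bullet> (T *v ?a)"
      by (simp only: matrix_vector_right_distrib inner_add_right add.assoc)
    moreover have "snd z \<bullet> (x - (mat 1 - T) *v (y + ?a)) = snd z \<bullet> x - snd z \<bullet> ((mat 1 - T) *v y) - snd z \<bullet> ((mat 1 - T) *v ?a)"
      by (simp only: matrix_vector_right_distrib inner_add_right inner_diff_right diff_diff_eq)
    moreover have "(\<omega> - ?s) \<bullet> y = \<omega> \<bullet> y - (snd w \<bullet> (T *v y) + snd z \<bullet> ((mat 1 - T) *v y))"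
      by (simp only: inner_diff_left s)
    moreover have "\<omega> \<bullet> (y + ?a) = \<omega> \<bullet> y + ?a \<bullet> \<omega>" by (simp only: inner_add_right inner_commute[of \<omega> ?a])
    ultimately show ?thesis unfolding s[of ?a] by (simp only: algebra_simps) algebra
  qed
  have "cis (- 2 * pi * (\<omega> \<bullet> (y + ?a))) * cohen_tensor T (tfs w g) (tfs z g) (x, y + ?a) =
      cis (- 2 * pi * (\<omega> \<bullet> (y + ?a)) + 2 * pi * (snd w \<bullet> (x + T *v (y + ?a))) - 2 * pi * (snd z \<bullet> (x - (mat 1 - T) *v (y + ?a)))) *
      (g (x + T *v (y + ?a) - fst w) * cnj (g (x - (mat 1 - T) *v (y + ?a) - fst z)))"
    unfolding cohen_tensor_def tfs_def fst_conv snd_conv complex_cnj_mult cis_cnj diff_conv_add_uminus[of _ "2 * pi * (snd z \<bullet> (x - (mat 1 - T) *v (y + ?a)))"] cis_mult[symmetric]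
    by (simp only: mult_ac)
  also have "\<dots> = cohen_phase T (w, z) * cis (2 * pi * (snd (cohen_shift T (w, z)) \<bullet> (x, \<omega>))) *
      (cis (- 2 * pi * ((\<omega> - ?s) \<bullet> y)) * cohen_tensor T g g (x - ?u, y))"
    unfolding phase arg1 arg2 cohen_tensor_def cohen_phase_def fst_conv snd_conv cis_mult[symmetric]
    by (simp only: mult_ac)
  finally show ?thesis .
qed

lemma cohen_tensor_measurable [measurable]:
  assumes [measurable]: "f \<in> borel_measurable borel" "h \<in> borel_measurable borel"
  shows "cohen_tensor T f h \<in> borel_measurable borel"
  unfolding cohen_tensor_def[abs_def] by measurable

theorem matrix_wigner_tfs:
  fixes g :: "real^'d \<Rightarrow> complex"
  assumes [measurable]: "g \<in> borel_measurable borel"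
  shows "matrix_wigner (cohen_matrix T) (tfs w g) (tfs z g) X =
    cohen_phase T (w, z) * tfs (cohen_shift T (w, z)) (matrix_wigner (cohen_matrix T) g g) X"
proof -
  obtain x \<omega> where X: "X = (x, \<omega>)" by (cases X)
  let ?a = "fst w - fst z"
  let ?f = "\<lambda>y. cis (- 2 * pi * (\<omega> \<bullet> y)) * cohen_tensor T (tfs w g) (tfs z g) (x, y)"
  have [measurable]: "tfs w g \<in> borel_measurable borel" "tfs z g \<in> borel_measurable borel" by measurable
  have "matrix_wigner (cohen_matrix T) (tfs w g) (tfs z g) X = (LINT y|lborel. ?f (y + ?a))"
    unfolding X matrix_wigner_tensor by (rule integral_translate(1)[symmetric]) measurable
  also have "\<dots> = cohen_phase T (w, z) * cis (2 * pi * (snd (cohen_shift T (w, z)) \<bullet> (x, \<omega>))) *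
      matrix_wigner (cohen_matrix T) g g (x - fst (fst (cohen_shift T (w, z))), \<omega> - snd (fst (cohen_shift T (w, z))))"
    unfolding cohen_tensor_shift matrix_wigner_tensor by simp
  also have "\<dots> = cohen_phase T (w, z) * tfs (cohen_shift T (w, z)) (matrix_wigner (cohen_matrix T) g g) X"
    by (simp add: X tfs_def minus_prod_def mult.assoc)
  finally show ?thesis .
qed

text \<open>Taking frequency 0 and moduli removes all phases. What remains, a translate of one fixed
  Schwartz function, supplies the majorant for Fubini in \<open>matrix_wigner_M1\<close>.\<close>

lemma norm_cohen_tensor_shift:
  fixes g :: "real^'d \<Rightarrow> complex"
  shows "norm (cohen_tensor T (tfs w g) (tfs z g) (x, y)) =
    norm (cohen_tensor T g g (x - fst (fst (cohen_shift T (w, z))), y - (fst w - fst z)))"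
proof -
  have "norm (cis (- 2 * pi * (0 \<bullet> y)) * cohen_tensor T (tfs w g) (tfs z g) (x, y)) =
    norm (cohen_tensor T g g (x - fst (fst (cohen_shift T (w, z))), y - (fst w - fst z)))"
    using arg_cong[OF cohen_tensor_shift[of 0 "y - (fst w - fst z)" w z T g x], of norm]
    by (simp add: norm_mult norm_cohen_phase)
  then show ?thesis by (simp add: norm_mult)
qed

lemma lborel_integral_pair_mult:
  fixes p :: "'a::euclidean_space \<Rightarrow> complex" and q :: "'b::euclidean_space \<Rightarrow> complex"
  assumes p: "integrable lborel p" and q: "integrable lborel q"
  shows "integrable lborel (\<lambda>v. p (fst v) * q (snd v))"
    and "(LINT v|lborel. p (fst v) * q (snd v)) = (LINT w|lborel. p w) * (LINT z|lborel. q z)"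
proof -
  have [measurable]: "p \<in> borel_measurable borel" "q \<in> borel_measurable borel" using p q by auto
  have i: "integrable (lborel \<Otimes>\<^sub>M lborel) (\<lambda>(w, z). p w * q z)"
    by (rule integrable_pair_bound[OF _ integrable_norm[OF p] integrable_norm[OF q]]) (auto simp: norm_mult)
  then show "integrable lborel (\<lambda>v. p (fst v) * q (snd v))" by (simp add: lborel_prod case_prod_unfold)
  have "(LINT w|lborel. LINT z|lborel. p w * q z) = (LINT v|lborel. p (fst v) * q (snd v))"
    using lborel_pair.integral_fst[OF i] by (simp add: lborel_prod case_prod_unfold)
  then show "(LINT v|lborel. p (fst v) * q (snd v)) = (LINT w|lborel. p w) * (LINT z|lborel. q z)" by simp
qed

text \<open>The two inverse energies come from inverting the transforms of the two functions, the
  second one conjugated, and the phase from the covariance of the distribution.\<close>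

definition wigner_coeff :: "real^'d^'d \<Rightarrow> (real^'d \<Rightarrow> complex) \<Rightarrow> ((real^'d) \<times> (real^'d) \<Rightarrow> complex) \<Rightarrow>
    ((real^'d) \<times> (real^'d) \<Rightarrow> complex) \<Rightarrow> ((real^'d) \<times> (real^'d)) \<times> ((real^'d) \<times> (real^'d)) \<Rightarrow> complex" where
  "wigner_coeff T g k l v = (1 / energy g * cnj (1 / energy g)) * (k (fst v) * cnj (l (snd v))) * cohen_phase T v"

lemma wigner_coeff_integrable:
  assumes k: "integrable lborel k" and l: "integrable lborel l"
  shows "integrable lborel (wigner_coeff T g k l)"
  unfolding wigner_coeff_def[abs_def]
  by (intro integrable_mult_bounded[where B = 1] integrable_mult_right lborel_integral_pair_mult(1) k integrable_cnj l)
     (auto simp: norm_cohen_phase)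

text \<open>Both functions are expanded by the inversion formula. The distribution is sesquilinear,
  so it becomes a superposition of shifts of the single window \<Phi>. This places it in
  \<open>M1\<close> and makes its pairing with a symbol computable by
  \<open>duality_synth\<close>.\<close>

theorem matrix_wigner_M1:
  fixes g \<phi> f :: "real^'d \<Rightarrow> complex"
  assumes g: "g \<in> schwartz" "g \<noteq> (\<lambda>_. 0)" and \<phi>: "\<phi> \<in> M1 g" and f: "f \<in> M1 g"
  shows "matrix_wigner (cohen_matrix T) \<phi> f =
    synth (wigner_coeff T g (stf g \<phi>) (stf g f)) (cohen_shift T) (matrix_wigner (cohen_matrix T) g g)"
proof
  fix X :: "(real^'d) \<times> (real^'d)"
  obtain x \<omega> where X: "X = (x, \<omega>)" by (cases X)
  have \<phi>': "continuous_on UNIV \<phi>" "integrable lborel \<phi>" "integrable lborel (stf g \<phi>)"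
    and f': "continuous_on UNIV f" "integrable lborel f" "integrable lborel (stf g f)"
    using \<phi> f g by (auto simp: M1_iff)
  have gm [measurable]: "g \<in> borel_measurable borel" by (rule schwartz_measurable[OF g(1)])
  have [measurable]: "stf g \<phi> \<in> borel_measurable borel" "stf g f \<in> borel_measurable borel" using \<phi>' f' by auto
  obtain B where B: "\<And>x. norm (g x) \<le> B" using schwartz_sup[OF g(1)] by metis
  let ?e = "energy g" and ?a = "\<lambda>v. stf g \<phi> (fst v) * cnj (stf g f (snd v))"
  let ?t = "\<lambda>v y. cohen_tensor T (tfs (fst v) g) (tfs (snd v) g) (x, y)"
  have ai: "integrable lborel ?a" by (intro lborel_integral_pair_mult(1) \<phi>' integrable_cnj f')
  have tensor: "cohen_tensor T \<phi> f (x, y) * (?e * cnj ?e) = (LINT v|lborel. ?a v * ?t v y)" for y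
  proof -
    let ?s = "x + T *v y" and ?r = "x - (mat 1 - T) *v y"
    have "(LINT v|lborel. ?a v * ?t v y) =
        (LINT v|lborel. (stf g \<phi> (fst v) * tfs (fst v) g ?s) * cnj (stf g f (snd v) * tfs (snd v) g ?r))"
      by (intro Bochner_Integration.integral_cong refl) (simp add: cohen_tensor_def mult_ac)
    also have "\<dots> = (LINT w|lborel. stf g \<phi> w * tfs w g ?s) * (LINT z|lborel. cnj (stf g f z * tfs z g ?r))"
      by (intro lborel_integral_pair_mult(2) integrable_cnj integrable_mult_bounded[OF \<phi>'(3), where B = B]
            integrable_mult_bounded[OF f'(3), where B = B]) (auto simp: norm_tfs B)
    also have "(LINT z|lborel. cnj (stf g f z * tfs z g ?r)) = cnj (LINT z|lborel. stf g f z * tfs z g ?r)"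
      by (rule Bochner_Integration.integral_cnj)
    also have "(LINT w|lborel. stf g \<phi> w * tfs w g ?s) = \<phi> ?s * ?e" by (rule stf_inversion[OF g(1) \<phi>'])
    also have "(LINT z|lborel. stf g f z * tfs z g ?r) = f ?r * ?e" by (rule stf_inversion[OF g(1) f'])
    finally show ?thesis by (simp add: cohen_tensor_def mult_ac)
  qed
  let ?F = "\<lambda>v y. cis (- 2 * pi * (\<omega> \<bullet> y)) * (?a v * ?t v y)"
  have tm: "(\<lambda>p. ?t (fst p) (snd p)) \<in> borel_measurable (borel \<Otimes>\<^sub>M borel)"
    unfolding cohen_tensor_def fst_conv snd_conv by measurable
  have i: "integrable (lborel \<Otimes>\<^sub>M lborel) (case_prod ?F)"
  proof (rule integrable_pairI)
    show "case_prod ?F \<in> borel_measurable (borel \<Otimes>\<^sub>M borel)"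
      unfolding case_prod_unfold using tm by measurable
    obtain C where C: "C \<ge> 0" "\<And>x y. (1 + norm x) ^ 0 * (1 + norm y) ^ 0 * norm (cohen_tensor T g g (x, y)) \<le> C * wgt x * wgt y"
      using schwartz_wgt_prod[OF cohen_tensor_schwartz[OF g(1) g(1)]] by metis
    have C': "norm (cohen_tensor T g g (x, y)) \<le> C * wgt y" for x y
    proof -
      have "norm (cohen_tensor T g g (x, y)) \<le> C * wgt x * wgt y" using C(2)[of x y] by simp
      also have "\<dots> \<le> C * 1 * wgt y" by (intro mult_right_mono mult_left_mono wgt_le_1 wgt_nonneg C)
      finally show ?thesis by simp
    qed
    let ?W = "\<integral>\<^sup>+y. ennreal (C * wgt (y :: real^'d)) \<partial>lborel"
    have W: "?W < \<infinity>"
    proof -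
      have n: "norm (C * wgt y) = C * wgt y" for y :: "real^'d"
        using C(1) wgt_nonneg[of y] by simp
      have "integrable lborel (\<lambda>y :: real^'d. C * wgt y)" by (intro integrable_mult_right wgt_integrable)
      then show ?thesis unfolding integrable_iff_bounded n by blast
    qed
    \<comment> \<open>The majorant in y is translated by an amount depending on v, but its integral
      does not see the translation, so the double integral factors.\<close>
    have "(\<integral>\<^sup>+v. \<integral>\<^sup>+y. ennreal (norm (?F v y)) \<partial>lborel \<partial>lborel) \<le>
        (\<integral>\<^sup>+v. \<integral>\<^sup>+y. ennreal (norm (?a v)) * ennreal (C * wgt (y - (fst (fst v) - fst (snd v)))) \<partial>lborel \<partial>lborel)"
    proof (intro nn_integral_mono)
      fix v :: "((real^'d) \<times> (real^'d)) \<times> ((real^'d) \<times> (real^'d))" and y :: "real^'d"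
      have "norm (?F v y) \<le> norm (?a v) * (C * wgt (y - (fst (fst v) - fst (snd v))))"
        unfolding norm_mult[of "cis _"] norm_cis mult_1 norm_mult[of "?a v"] norm_cohen_tensor_shift
        by (intro mult_left_mono C') auto
      then show "ennreal (norm (?F v y)) \<le> ennreal (norm (?a v)) * ennreal (C * wgt (y - (fst (fst v) - fst (snd v))))"
        using C(1) by (simp add: ennreal_mult[symmetric] wgt_nonneg ennreal_leI)
    qed
    also have "\<dots> = (\<integral>\<^sup>+v. ennreal (norm (?a v)) * ?W \<partial>lborel)"
    proof (rule nn_integral_cong)
      fix v :: "((real^'d) \<times> (real^'d)) \<times> ((real^'d) \<times> (real^'d))"
      have "(\<integral>\<^sup>+y. ennreal (C * wgt (y - (fst (fst v) - fst (snd v)))) \<partial>lborel) = ?W"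
        by (rule nn_integral_translate(2)) measurable
      then show "(\<integral>\<^sup>+y. ennreal (norm (?a v)) * ennreal (C * wgt (y - (fst (fst v) - fst (snd v)))) \<partial>lborel) = ennreal (norm (?a v)) * ?W"
        by (subst nn_integral_cmult) simp_all
    qed
    also have "\<dots> = (\<integral>\<^sup>+v. ennreal (norm (?a v)) \<partial>lborel) * ?W"
      by (rule nn_integral_multc) measurable
    also have "\<dots> < \<infinity>"
      using W ai by (simp add: integrable_iff_bounded ennreal_mult_less_top)
    finally show "(\<integral>\<^sup>+v. \<integral>\<^sup>+y. ennreal (norm (?F v y)) \<partial>lborel \<partial>lborel) < \<infinity>" .
  qed
  have "matrix_wigner (cohen_matrix T) \<phi> f X * (?e * cnj ?e) = (LINT y|lborel. LINT v|lborel. ?F v y)"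
    unfolding X matrix_wigner_tensor integral_mult_left_zero[symmetric] mult.assoc tensor integral_mult_right_zero ..
  also have "\<dots> = (LINT v|lborel. LINT y|lborel. ?F v y)"
    by (rule lborel_pair.Fubini_integral[OF i])
  also have "\<dots> = (LINT v|lborel. ?a v * matrix_wigner (cohen_matrix T) (tfs (fst v) g) (tfs (snd v) g) X)"
    unfolding X matrix_wigner_tensor mult.left_commute[of "cis _"] integral_mult_right_zero ..
  also have "\<dots> = (LINT v|lborel. ?a v * (cohen_phase T v * tfs (cohen_shift T v) (matrix_wigner (cohen_matrix T) g g) X))"
    unfolding matrix_wigner_tfs[OF gm] by simp
  finally have "(1 / ?e * cnj (1 / ?e)) * (matrix_wigner (cohen_matrix T) \<phi> f X * (?e * cnj ?e)) =
      synth (wigner_coeff T g (stf g \<phi>) (stf g f)) (cohen_shift T) (matrix_wigner (cohen_matrix T) g g) X"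
    unfolding synth_def wigner_coeff_def by (simp only: integral_mult_right_zero[symmetric] mult.assoc)
  then show "matrix_wigner (cohen_matrix T) \<phi> f X =
      synth (wigner_coeff T g (stf g \<phi>) (stf g f)) (cohen_shift T) (matrix_wigner (cohen_matrix T) g g) X"
    using energy_pos[OF g] by simp
qed

section \<open>Change of window\<close>

text \<open>The inner norm of the Sjostrand class: the essential supremum over positions at one
  frequency.\<close>

definition profile :: "('a::euclidean_space \<Rightarrow> complex) \<Rightarrow> 'a distr \<Rightarrow> 'a \<Rightarrow> ennreal" where
  "profile G u \<eta> = Lp_norm \<infinity> (\<lambda>Y. ennreal (norm (u (tfs (Y, \<eta>) G))))"

definition window_kernel :: "('a::euclidean_space \<Rightarrow> complex) \<Rightarrow> ('a \<Rightarrow> complex) \<Rightarrow> 'a \<Rightarrow> ennreal" where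
  "window_kernel G \<Phi> \<eta> = (\<integral>\<^sup>+Y. ennreal (norm (stf G \<Phi> (Y, \<eta>))) \<partial>lborel)"

text \<open>A convolution in the frequency variable alone, with reflected kernel. It majorises the
  transform of \<open>u\<close> with window \<Phi> at every position, although \<open>u\<close> is
  measured with window G.\<close>

definition envelope :: "('a::euclidean_space \<Rightarrow> complex) \<Rightarrow> ('a \<Rightarrow> complex) \<Rightarrow> 'a distr \<Rightarrow> 'a \<Rightarrow> ennreal" where
  "envelope G \<Phi> u \<zeta> = ennreal (norm (1 / energy G)) * (\<integral>\<^sup>+\<eta>. profile G u \<eta> * window_kernel G \<Phi> (\<eta> - \<zeta>) \<partial>lborel)"

definition stf_mass :: "('a::euclidean_space \<Rightarrow> complex) \<Rightarrow> ('a \<Rightarrow> complex) \<Rightarrow> ennreal" where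
  "stf_mass G \<Phi> = (\<integral>\<^sup>+Z. ennreal (norm (stf G \<Phi> Z)) \<partial>lborel)"

lemma stf_mass_finite: "G \<in> schwartz \<Longrightarrow> \<Phi> \<in> schwartz \<Longrightarrow> stf_mass G \<Phi> < \<infinity>"
  using schwartz_integrable[OF stf_schwartz] by (auto simp: integrable_iff_bounded stf_mass_def)

lemma nn_integral_pair_swap:
  fixes F :: "'a::euclidean_space \<times> 'b::euclidean_space \<Rightarrow> ennreal"
  assumes "F \<in> borel_measurable borel"
  shows "(\<integral>\<^sup>+z. F z \<partial>lborel) = (\<integral>\<^sup>+x. \<integral>\<^sup>+y. F (x, y) \<partial>lborel \<partial>lborel)"
    and "(\<integral>\<^sup>+z. F z \<partial>lborel) = (\<integral>\<^sup>+y. \<integral>\<^sup>+x. F (x, y) \<partial>lborel \<partial>lborel)"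
proof -
  have m: "F \<in> borel_measurable (lborel \<Otimes>\<^sub>M lborel)" using assms by (simp add: lborel_prod)
  show "(\<integral>\<^sup>+z. F z \<partial>lborel) = (\<integral>\<^sup>+x. \<integral>\<^sup>+y. F (x, y) \<partial>lborel \<partial>lborel)"
    using lborel.nn_integral_fst[OF m] by (simp add: lborel_prod)
  show "(\<integral>\<^sup>+z. F z \<partial>lborel) = (\<integral>\<^sup>+y. \<integral>\<^sup>+x. F (x, y) \<partial>lborel \<partial>lborel)"
    using lborel_pair.nn_integral_snd[OF m] by (simp add: lborel_prod)
qed

lemma borel_pair_measurable:
  fixes F :: "'a::euclidean_space \<times> 'b::euclidean_space \<Rightarrow> 'c::topological_space"
  assumes "F \<in> borel_measurable borel"
  shows "(\<lambda>(x, y). F (x, y)) \<in> borel_measurable (borel \<Otimes>\<^sub>M borel)"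
    and "(\<lambda>(y, x). F (x, y)) \<in> borel_measurable (borel \<Otimes>\<^sub>M borel)"
    and "(\<lambda>y. F (x, y)) \<in> borel_measurable borel" "(\<lambda>x. F (x, y)) \<in> borel_measurable borel"
proof -
  have F: "F \<in> borel_measurable (borel \<Otimes>\<^sub>M borel)" using assms by (simp add: borel_prod)
  then show "(\<lambda>(x, y). F (x, y)) \<in> borel_measurable (borel \<Otimes>\<^sub>M borel)" by simp
  show "(\<lambda>(y, x). F (x, y)) \<in> borel_measurable (borel \<Otimes>\<^sub>M borel)"
    by (rule measurable_pair_swap[of "\<lambda>p. F p", simplified]) (rule F)
  show "(\<lambda>y. F (x, y)) \<in> borel_measurable borel"
    using measurable_Pair2[OF F, of x] by simp
  show "(\<lambda>x. F (x, y)) \<in> borel_measurable borel"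
    using measurable_Pair1[OF F, of y] by simp
qed

context
  fixes u :: "'a::euclidean_space distr" and G \<Phi> :: "'a \<Rightarrow> complex"
  assumes u: "tempered u" and G: "G \<in> schwartz" "G \<noteq> (\<lambda>_. 0)" and \<Phi>: "\<Phi> \<in> schwartz"
begin

lemma tempered_tfs_measurable: "(\<lambda>z. u (tfs z G)) \<in> borel_measurable borel"
  by (rule borel_measurable_continuous_onI[OF tempered_tfs_continuous[OF u G(1)]])

lemma tempered_norm_measurable: "(\<lambda>z. ennreal (norm (u (tfs z G)))) \<in> borel_measurable borel"
  using tempered_tfs_measurable by measurable

lemma stf_norm_measurable: "(\<lambda>z. ennreal (norm (stf G \<Phi> z))) \<in> borel_measurable borel"
  using schwartz_measurable[OF stf_schwartz[OF G(1) \<Phi>]] by measurable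

lemma profile_measurable: "profile G u \<in> borel_measurable borel"
  unfolding profile_def[abs_def]
  by (rule Lp_norm_measurable[OF _ borel_pair_measurable(2)[OF tempered_norm_measurable]]) simp

lemma window_kernel_measurable: "window_kernel G \<Phi> \<in> borel_measurable borel"
  unfolding window_kernel_def[abs_def]
  by (rule lborel.borel_measurable_nn_integral) (use borel_pair_measurable(2)[OF stf_norm_measurable] in simp)

text \<open>The reproducing formula with window G is applied to a shift of \<Phi>; covariance turns
  the modulus of the kernel into a translate of that of V_G \<Phi>.\<close>

lemma tempered_window_bound:
  "ennreal (norm (u (tfs W \<Phi>))) \<le>
     ennreal (norm (1 / energy G)) * (\<integral>\<^sup>+Z. ennreal (norm (u (tfs Z G))) * ennreal (norm (stf G \<Phi> (Z - W))) \<partial>lborel)"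
proof -
  have i: "integrable lborel (\<lambda>Z. u (tfs Z G) * cnj (stf G (tfs W \<Phi>) Z))"
    by (rule tempered_reproducing(1)[OF u G(1) tfs_schwartz[OF \<Phi>]])
  have "u (tfs W \<Phi>) = (1 / energy G) * (LINT Z|lborel. u (tfs Z G) * cnj (stf G (tfs W \<Phi>) Z))"
    using tempered_reproducing(2)[OF u G(1) tfs_schwartz[OF \<Phi>]] energy_pos[OF G] by simp
  from arg_cong[OF this, of "\<lambda>x. ennreal (norm x)"]
  have "ennreal (norm (u (tfs W \<Phi>))) = ennreal (norm (1 / energy G)) * ennreal (norm (LINT Z|lborel. u (tfs Z G) * cnj (stf G (tfs W \<Phi>) Z)))"
    unfolding norm_mult[of "1 / energy G"] ennreal_mult[OF norm_ge_zero norm_ge_zero] .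
  also have "\<dots> \<le> ennreal (norm (1 / energy G)) * (\<integral>\<^sup>+Z. ennreal (norm (u (tfs Z G) * cnj (stf G (tfs W \<Phi>) Z))) \<partial>lborel)"
    by (intro mult_left_mono integral_norm_bound_ennreal i) simp
  finally show ?thesis
    by (simp only: norm_mult complex_mod_cnj norm_stf_tfs[OF G(1) \<Phi>] ennreal_mult[OF norm_ge_zero norm_ge_zero])
qed

text \<open>At each frequency the transform of \<open>u\<close> is replaced by its supremum over
  positions; the position integral of the kernel is then invariant under translation, which removes
  \<open>Y0\<close>.\<close>

theorem envelope_bound: "ennreal (norm (u (tfs (Y0, \<zeta>) \<Phi>))) \<le> envelope G \<Phi> u \<zeta>"
proof -
  note [measurable] = tempered_norm_measurable stf_norm_measurable
  let ?V = "\<lambda>Z. ennreal (norm (u (tfs Z G)))" and ?k = "\<lambda>Z. ennreal (norm (stf G \<Phi> Z))"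
  have km: "(\<lambda>Z. ?k (Z - W)) \<in> borel_measurable borel" for W
    by (rule measurable_compose[OF _ stf_norm_measurable]) measurable
  then have [measurable]: "(\<lambda>Z. ?V Z * ?k (Z - W)) \<in> borel_measurable borel" for W
    using tempered_norm_measurable by measurable
  have "(\<integral>\<^sup>+Z. ?V Z * ?k (Z - (Y0, \<zeta>)) \<partial>lborel) = (\<integral>\<^sup>+\<eta>. \<integral>\<^sup>+Y. ?V (Y, \<eta>) * ?k (Y - Y0, \<eta> - \<zeta>) \<partial>lborel \<partial>lborel)"
    by (subst nn_integral_pair_swap(2)) (simp_all add: minus_prod_def)
  also have "\<dots> \<le> (\<integral>\<^sup>+\<eta>. profile G u \<eta> * window_kernel G \<Phi> (\<eta> - \<zeta>) \<partial>lborel)"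
  proof (rule nn_integral_mono)
    fix \<eta>
    have sl: "(\<lambda>Y. ?k (Y, \<eta> - \<zeta>)) \<in> borel_measurable borel"
      by (rule borel_pair_measurable(4)[OF stf_norm_measurable])
    have "AE Y in lborel. ?V (Y, \<eta>) \<le> profile G u \<eta>"
      unfolding profile_def Lp_norm_def using esssup_AE[of "\<lambda>Y. ?V (Y, \<eta>)" lborel] by simp
    then have "AE Y in lborel. ?V (Y, \<eta>) * ?k (Y - Y0, \<eta> - \<zeta>) \<le> profile G u \<eta> * ?k (Y - Y0, \<eta> - \<zeta>)"
      by eventually_elim (rule mult_right_mono, auto)
    then have "(\<integral>\<^sup>+Y. ?V (Y, \<eta>) * ?k (Y - Y0, \<eta> - \<zeta>) \<partial>lborel) \<le> (\<integral>\<^sup>+Y. profile G u \<eta> * ?k (Y - Y0, \<eta> - \<zeta>) \<partial>lborel)"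
      by (rule nn_integral_mono_AE)
    also have "\<dots> = profile G u \<eta> * (\<integral>\<^sup>+Y. ?k (Y - Y0, \<eta> - \<zeta>) \<partial>lborel)"
      by (rule nn_integral_cmult) (use measurable_compose[OF _ sl, of "\<lambda>Y. Y - Y0" borel] in simp)
    also have "(\<integral>\<^sup>+Y. ?k (Y - Y0, \<eta> - \<zeta>) \<partial>lborel) = window_kernel G \<Phi> (\<eta> - \<zeta>)"
      unfolding window_kernel_def by (rule nn_integral_translate(2)[OF sl])
    finally show "(\<integral>\<^sup>+Y. ?V (Y, \<eta>) * ?k (Y - Y0, \<eta> - \<zeta>) \<partial>lborel) \<le> profile G u \<eta> * window_kernel G \<Phi> (\<eta> - \<zeta>)" .
  qed
  finally show ?thesis
    unfolding envelope_def by (intro order_trans[OF tempered_window_bound] mult_left_mono) auto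
qed

lemma envelope_measurable: "envelope G \<Phi> u \<in> borel_measurable borel"
proof -
  note [measurable] = profile_measurable window_kernel_measurable
  show ?thesis unfolding envelope_def[abs_def] by measurable
qed

lemma modulation_norm_profile: "modulation_norm G \<infinity> 1 u = (\<integral>\<^sup>+\<eta>. profile G u \<eta> \<partial>lborel)"
  by (simp add: modulation_norm_def profile_def Lp_norm_1 stft_tfs)

text \<open>Fubini separates the mass of the profile, which is the Sjostrand norm, from the mass of
  the kernel, which is the L^1 norm of V_G \<Phi>.\<close>

theorem envelope_mass:
  "(\<integral>\<^sup>+\<zeta>. envelope G \<Phi> u \<zeta> \<partial>lborel) = ennreal (norm (1 / energy G)) * (modulation_norm G \<infinity> 1 u * stf_mass G \<Phi>)"
proof -
  note [measurable] = profile_measurable window_kernel_measurable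
  have k: "(\<integral>\<^sup>+\<zeta>. window_kernel G \<Phi> (\<eta> - \<zeta>) \<partial>lborel) = stf_mass G \<Phi>" for \<eta>
  proof -
    have "(\<integral>\<^sup>+\<zeta>. window_kernel G \<Phi> (\<eta> - \<zeta>) \<partial>lborel) = (\<integral>\<^sup>+\<zeta>. window_kernel G \<Phi> \<zeta> \<partial>lborel)"
      by (rule nn_integral_translate(3)) measurable
    then show ?thesis
      unfolding window_kernel_def stf_mass_def nn_integral_pair_swap(2)[OF stf_norm_measurable] .
  qed
  have "(\<integral>\<^sup>+\<zeta>. \<integral>\<^sup>+\<eta>. profile G u \<eta> * window_kernel G \<Phi> (\<eta> - \<zeta>) \<partial>lborel \<partial>lborel) =
      (\<integral>\<^sup>+\<eta>. \<integral>\<^sup>+\<zeta>. profile G u \<eta> * window_kernel G \<Phi> (\<eta> - \<zeta>) \<partial>lborel \<partial>lborel)"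
    by (rule lborel_pair.Fubini'[symmetric]) measurable
  also have "\<dots> = (\<integral>\<^sup>+\<eta>. profile G u \<eta> * stf_mass G \<Phi> \<partial>lborel)"
    by (intro nn_integral_cong) (simp add: nn_integral_cmult k)
  also have "\<dots> = modulation_norm G \<infinity> 1 u * stf_mass G \<Phi>"
    unfolding modulation_norm_profile by (rule nn_integral_multc) measurable
  finally show ?thesis unfolding envelope_def by (simp add: nn_integral_cmult)
qed

end

section \<open>Pointwise bounds for short-time Fourier transforms\<close>

lemma bounded_of_ennreal_bound:
  fixes f :: "'i \<Rightarrow> complex"
  assumes "C < \<infinity>" "\<And>z. ennreal (norm (f z)) \<le> C" obtains M where "M \<ge> 0" "\<And>z. norm (f z) \<le> M"
proof (rule that[of "enn2real C"])
  show "norm (f z) \<le> enn2real C" for z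
    using enn2real_mono[OF assms(2)[of z]] assms(1) by simp
qed simp

lemma window_kernel_bounded:
  fixes G \<Phi> :: "'a::euclidean_space \<Rightarrow> complex"
  assumes "G \<in> schwartz" "\<Phi> \<in> schwartz"
  obtains K where "K < \<infinity>" "\<And>\<eta>. window_kernel G \<Phi> \<eta> \<le> K"
proof -
  obtain C where C: "C \<ge> 0" "\<And>x y. (1 + norm x) ^ 0 * (1 + norm y) ^ 0 * norm (stf G \<Phi> (x, y)) \<le> C * wgt x * wgt y"
    using schwartz_wgt_prod[OF stf_schwartz[OF assms]] by metis
  let ?K = "\<integral>\<^sup>+Y. ennreal (C * wgt (Y :: 'a)) \<partial>lborel"
  show ?thesis
  proof (rule that[of ?K])
    have n: "norm (C * wgt y) = C * wgt y" for y :: 'a using C(1) wgt_nonneg[of y] by simp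
    have "integrable lborel (\<lambda>y :: 'a. C * wgt y)" by (intro integrable_mult_right wgt_integrable)
    then show "?K < \<infinity>" unfolding integrable_iff_bounded n by blast
    show "window_kernel G \<Phi> \<eta> \<le> ?K" for \<eta>
      unfolding window_kernel_def
    proof (intro nn_integral_mono ennreal_leI)
      fix Y
      have "norm (stf G \<Phi> (Y, \<eta>)) \<le> C * wgt Y * wgt \<eta>" using C(2)[of Y \<eta>] by simp
      also have "\<dots> \<le> C * wgt Y * 1"
        using C(1) wgt_nonneg[of Y] by (intro mult_left_mono wgt_le_1) auto
      finally show "norm (stf G \<Phi> (Y, \<eta>)) \<le> C * wgt Y" by simp
    qed
  qed
qed

text \<open>The case \<Phi> = G of the change of window: V_G G is integrable in position uniformly
  in frequency, so integrability of the profile bounds every single value.\<close>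

lemma sjostrand_bounded:
  fixes u :: "'a::euclidean_space distr"
  assumes u: "tempered u" and G: "G \<in> schwartz" "G \<noteq> (\<lambda>_. 0)" and fin: "modulation_norm G \<infinity> 1 u < \<infinity>"
  obtains M where "M \<ge> 0" "\<And>z. norm (u (tfs z G)) \<le> M"
proof -
  obtain K where K: "K < \<infinity>" "\<And>\<eta>. window_kernel G G \<eta> \<le> K" using window_kernel_bounded[OF G(1) G(1)] by metis
  note [measurable] = profile_measurable[OF u G G(1)]
  let ?C = "ennreal (norm (1 / energy G)) * (modulation_norm G \<infinity> 1 u * K)"
  have "ennreal (norm (u (tfs z G))) \<le> ?C" for z
  proof -
    obtain Y0 \<zeta> where z: "z = (Y0, \<zeta>)" by (cases z)
    have "(\<integral>\<^sup>+\<eta>. profile G u \<eta> * window_kernel G G (\<eta> - \<zeta>) \<partial>lborel) \<le> (\<integral>\<^sup>+\<eta>. profile G u \<eta> * K \<partial>lborel)"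
      by (intro nn_integral_mono mult_left_mono K) auto
    also have "\<dots> = modulation_norm G \<infinity> 1 u * K"
      unfolding modulation_norm_profile[OF u G G(1)] by (rule nn_integral_multc) measurable
    finally show ?thesis
      unfolding z by (intro order_trans[OF envelope_bound[OF u G G(1)]]) (auto simp: envelope_def intro: mult_left_mono)
  qed
  moreover have "?C < \<infinity>" using fin K by (simp add: ennreal_mult_less_top)
  ultimately show ?thesis using bounded_of_ennreal_bound[of ?C "\<lambda>z. u (tfs z G)"] that by blast
qed

text \<open>The norm only gives nested essential suprema. Averaging against V_G G by the reproducing
  formula turns them into a bound at every point.\<close>

lemma modulation_infinity_bounded:
  fixes u :: "'a::euclidean_space distr"
  assumes u: "tempered u" and G: "G \<in> schwartz" "G \<noteq> (\<lambda>_. 0)" and fin: "modulation_norm G \<infinity> \<infinity> u < \<infinity>"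
  obtains M where "M \<ge> 0" "\<And>z. norm (u (tfs z G)) \<le> M"
proof -
  let ?N = "modulation_norm G \<infinity> \<infinity> u"
  note [measurable] = window_kernel_measurable[OF u G G(1)]
  have N: "?N = esssup lborel (profile G u)"
    by (simp add: modulation_norm_def profile_def[abs_def] Lp_norm_def stft_tfs)
  let ?C = "ennreal (norm (1 / energy G)) * (?N * stf_mass G G)"
  have "ennreal (norm (u (tfs z G))) \<le> ?C" for z
  proof -
    obtain Y0 \<zeta> where z: "z = (Y0, \<zeta>)" by (cases z)
    have "AE \<eta> in lborel. profile G u \<eta> \<le> ?N" unfolding N by (rule esssup_AE)
    then have "AE \<eta> in lborel. profile G u \<eta> * window_kernel G G (\<eta> - \<zeta>) \<le> ?N * window_kernel G G (\<eta> - \<zeta>)"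
      by eventually_elim (rule mult_right_mono, auto)
    then have "(\<integral>\<^sup>+\<eta>. profile G u \<eta> * window_kernel G G (\<eta> - \<zeta>) \<partial>lborel) \<le> (\<integral>\<^sup>+\<eta>. ?N * window_kernel G G (\<eta> - \<zeta>) \<partial>lborel)"
      by (rule nn_integral_mono_AE)
    also have "\<dots> = ?N * (\<integral>\<^sup>+\<eta>. window_kernel G G (\<eta> - \<zeta>) \<partial>lborel)"
      by (rule nn_integral_cmult) measurable
    also have "(\<integral>\<^sup>+\<eta>. window_kernel G G (\<eta> - \<zeta>) \<partial>lborel) = (\<integral>\<^sup>+\<eta>. window_kernel G G \<eta> \<partial>lborel)"
      by (rule nn_integral_translate(2)) measurable
    also have "\<dots> = stf_mass G G"
      unfolding window_kernel_def stf_mass_def nn_integral_pair_swap(2)[OF stf_norm_measurable[OF u G G(1)]] ..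
    finally show ?thesis
      unfolding z by (intro order_trans[OF envelope_bound[OF u G G(1)]]) (auto simp: envelope_def intro: mult_left_mono)
  qed
  moreover have "?C < \<infinity>" using fin stf_mass_finite[OF G(1) G(1)] by (simp add: ennreal_mult_less_top)
  ultimately show ?thesis using bounded_of_ennreal_bound[of ?C "\<lambda>z. u (tfs z G)"] that by blast
qed

lemma bounded_modulation_infinity:
  fixes u :: "'a::euclidean_space distr"
  assumes u: "tempered u" and G: "G \<in> schwartz" "G \<noteq> (\<lambda>_. 0)" and M: "\<And>z. norm (u (tfs z G)) \<le> M"
  shows "u \<in> modulation_space G \<infinity> \<infinity>"
proof -
  note [measurable] = profile_measurable[OF u G G(1)]
  have "(\<lambda>Y. ennreal (norm (u (tfs (Y, \<eta>) G)))) \<in> borel_measurable lborel" for \<eta>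
    using borel_pair_measurable(4)[OF tempered_norm_measurable[OF u G G(1)], of \<eta>] by simp
  then have "profile G u \<eta> \<le> ennreal M" for \<eta>
    unfolding profile_def Lp_norm_def using M by (auto intro!: esssup_I ennreal_leI)
  then have "esssup lborel (profile G u) \<le> ennreal M" by (intro esssup_I) auto
  moreover have "modulation_norm G \<infinity> \<infinity> u = esssup lborel (profile G u)"
    by (simp add: modulation_norm_def profile_def[abs_def] Lp_norm_def stft_tfs)
  ultimately have "modulation_norm G \<infinity> \<infinity> u < \<infinity>"
    by (metis ennreal_less_top infinity_ennreal_def le_less_trans)
  with u show ?thesis by (simp add: modulation_space_def)
qed

lemma wiener_norm_eq: "wiener_norm g p q u = mixed_norm p q (\<lambda>z. ennreal (norm (u (tfs z g))))"
  by (simp add: wiener_norm_def mixed_norm_def stft_tfs)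

lemma mixed_norm_translate:
  fixes F :: "'a::euclidean_space \<times> 'a \<Rightarrow> ennreal"
  assumes p: "1 \<le> p" and q: "1 \<le> q" and F: "F \<in> borel_measurable borel"
  shows "mixed_norm p q (\<lambda>z. F (z - v)) \<le> mixed_norm p q F"
proof -
  define n where "n x = Lp_norm p (\<lambda>\<omega>. F (x, \<omega>))" for x
  have n: "n \<in> borel_measurable borel" unfolding n_def[abs_def] by (rule slice_measurable(1)[OF p F])
  have m: "(\<lambda>z. F (z - v)) \<in> borel_measurable borel"
    by (rule measurable_compose[OF _ F]) measurable
  have "Lp_norm p (\<lambda>\<omega>. F ((x, \<omega>) - v)) \<le> n (x - fst v)" for x
    using Lp_norm_translate[OF p slice_measurable(2)[OF p F, of "x - fst v"], of "snd v"]
    by (simp add: n_def minus_prod_def)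
  then have "mixed_norm p q (\<lambda>z. F (z - v)) \<le> Lp_norm q (\<lambda>x. n (x - fst v))"
    unfolding mixed_norm_def by (intro Lp_norm_mono[OF q slice_measurable(1)[OF p m]] AE_I2)
  also have "\<dots> \<le> Lp_norm q n" by (rule Lp_norm_translate[OF q n])
  finally show ?thesis by (simp add: mixed_norm_def n_def[abs_def])
qed

text \<open>The reproducing formula bounds each value by an integral of the transform against a
  translate of V_g g, which decays like the product weight; \<open>mixed_norm_wgt\<close> estimates
  this integral. A bounded transform is what makes the integral in \<open>extension\<close> converge
  on the whole space.\<close>

lemma wiener_bounded:
  fixes u :: "'a::euclidean_space distr"
  assumes u: "tempered u" and g: "g \<in> schwartz" "g \<noteq> (\<lambda>_. 0)" and pq: "1 \<le> p" "1 \<le> q"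
    and fin: "wiener_norm g p q u < \<infinity>"
  obtains M where "M \<ge> 0" "\<And>z. norm (u (tfs z g)) \<le> M"
proof -
  let ?V = "\<lambda>z. ennreal (norm (u (tfs z g)))"
  have Vm: "?V \<in> borel_measurable borel" by (rule tempered_norm_measurable[OF u g g(1)])
  obtain C where C: "C \<ge> 0" "\<And>x y. (1 + norm x) ^ 0 * (1 + norm y) ^ 0 * norm (stf g g (x, y)) \<le> C * wgt x * wgt y"
    using schwartz_wgt_prod[OF stf_schwartz[OF g(1) g(1)]] by metis
  let ?m = "wgt_mass TYPE('a)"
  let ?C = "ennreal (norm (1 / energy g)) * (ennreal C * (?m * (?m * wiener_norm g p q u)))"
  have "?V W \<le> ?C" for W
  proof -
    \<comment> \<open>The double minus puts Z + W into the form of a translation by -W, to which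
      \<open>mixed_norm_translate\<close> applies.\<close>
    have Vs: "(\<lambda>Z. ?V (Z - - W)) \<in> borel_measurable borel"
      by (rule measurable_compose[OF _ Vm]) measurable
    have sm: "(\<lambda>Z. ennreal (norm (stf g g Z))) \<in> borel_measurable borel" by (rule stf_norm_measurable[OF u g g(1)])
    have prodm: "(\<lambda>Z. ?V Z * ennreal (norm (stf g g (Z - W)))) \<in> borel_measurable borel"
      using Vm measurable_compose[OF _ sm, of "\<lambda>Z. Z - W" borel] by simp
    have "(\<integral>\<^sup>+Z. ?V Z * ennreal (norm (stf g g (Z - W))) \<partial>lborel) = (\<integral>\<^sup>+Z. ?V (Z + W) * ennreal (norm (stf g g Z)) \<partial>lborel)"
      using nn_integral_translate(1)[OF prodm, of W] by simp
    also have "\<dots> \<le> (\<integral>\<^sup>+Z. ennreal C * (?V (Z - - W) * ennreal (wgt (fst Z) * wgt (snd Z))) \<partial>lborel)"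
    proof (rule nn_integral_mono)
      fix Z :: "'a \<times> 'a"
      have "ennreal (norm (stf g g Z)) \<le> ennreal (C * (wgt (fst Z) * wgt (snd Z)))"
        using C(2)[of "fst Z" "snd Z"] by (intro ennreal_leI) (simp add: mult.assoc)
      also have "\<dots> = ennreal C * ennreal (wgt (fst Z) * wgt (snd Z))"
        using C(1) by (intro ennreal_mult) (auto simp: wgt_nonneg)
      finally have "?V (Z + W) * ennreal (norm (stf g g Z)) \<le> ?V (Z + W) * (ennreal C * ennreal (wgt (fst Z) * wgt (snd Z)))"
        by (intro mult_left_mono) auto
      then show "?V (Z + W) * ennreal (norm (stf g g Z)) \<le> ennreal C * (?V (Z - - W) * ennreal (wgt (fst Z) * wgt (snd Z)))"
        by (simp only: diff_minus_eq_add mult_ac)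
    qed
    also have "\<dots> = ennreal C * (\<integral>\<^sup>+Z. ?V (Z - - W) * ennreal (wgt (fst Z) * wgt (snd Z)) \<partial>lborel)"
    proof (rule nn_integral_cmult)
      have wm: "(\<lambda>Z::'a \<times> 'a. ennreal (wgt (fst Z) * wgt (snd Z))) \<in> borel_measurable borel" by measurable
      have "(\<lambda>Z. X Z * Y Z) \<in> borel_measurable borel"
        if [measurable]: "X \<in> borel_measurable borel" "Y \<in> borel_measurable borel" for X Y :: "'a \<times> 'a \<Rightarrow> ennreal"
        by measurable
      from this[OF Vs wm] show "(\<lambda>Z. ?V (Z - - W) * ennreal (wgt (fst Z) * wgt (snd Z))) \<in> borel_measurable lborel"
        by simp
    qed
    also have "\<dots> \<le> ennreal C * (?m * (?m * mixed_norm p q (\<lambda>Z. ?V (Z - - W))))"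
      by (intro mult_left_mono mixed_norm_wgt pq Vs) auto
    also have "\<dots> \<le> ennreal C * (?m * (?m * wiener_norm g p q u))"
      unfolding wiener_norm_eq by (intro mult_left_mono mixed_norm_translate pq Vm) auto
    finally show ?thesis
      by (intro order_trans[OF tempered_window_bound[OF u g g(1)]] mult_left_mono) auto
  qed
  moreover have "?C < \<infinity>" using fin wgt_mass_finite[of "TYPE('a)"] by (simp add: ennreal_mult_less_top)
  ultimately show ?thesis using bounded_of_ennreal_bound[of ?C "\<lambda>z. u (tfs z g)"] that by blast
qed

section \<open>The extended operator\<close>

locale cohen_operator =
  fixes g :: "real^'d \<Rightarrow> complex" and G :: "(real^'d) \<times> (real^'d) \<Rightarrow> complex"
    and T :: "real^'d^'d" and \<sigma> :: "((real^'d) \<times> (real^'d)) distr"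
  assumes g: "g \<in> schwartz" "g \<noteq> (\<lambda>_. 0)" and G: "G \<in> schwartz" "G \<noteq> (\<lambda>_. 0)"
    and \<sigma>: "\<sigma> \<in> modulation_space G \<infinity> 1"
begin

abbreviation "\<Phi> \<equiv> matrix_wigner (cohen_matrix T) g g"

text \<open>Up to a conjugated phase this is the matrix entry of the operator: for v = (w, z) the
  source is the shift of g by z, and the test function is the shift by w.\<close>

definition symbol_entry :: "((real^'d) \<times> (real^'d)) \<times> ((real^'d) \<times> (real^'d)) \<Rightarrow> complex" where
  "symbol_entry v = \<sigma> (tfs (cohen_shift T v) \<Phi>)"

text \<open>The matrix between coefficient functions: with k = V_g u and l = V_g \<phi> it stands
  for the pairing of the image of u with \<phi>. The arguments trade places in
  \<open>wigner_coeff\<close> because the test function comes first in the distribution and is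
  conjugated by the pairing.\<close>

definition form :: "((real^'d) \<times> (real^'d) \<Rightarrow> complex) \<Rightarrow> ((real^'d) \<times> (real^'d) \<Rightarrow> complex) \<Rightarrow> complex" where
  "form k l = (LINT v|lborel. cnj (wigner_coeff T g l k v) * symbol_entry v)"

definition extension :: "(real^'d) distr \<Rightarrow> (real^'d) distr" where
  "extension u = (\<lambda>\<phi>. if \<phi> \<in> schwartz then form (\<lambda>z. u (tfs z g)) (stf g \<phi>) else 0)"

text \<open>The rotated argument is the frequency part of \<open>cohen_shift\<close>: the frequency
  difference, followed by the negative position difference.\<close>

definition majorant :: "(real^'d) \<times> (real^'d) \<Rightarrow> ennreal" where
  "majorant d = envelope G \<Phi> \<sigma> (snd d, - fst d)"

definition majorant_mass :: ennreal where
  "majorant_mass = (\<integral>\<^sup>+d. majorant d \<partial>lborel)"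

definition coeff :: real where
  "coeff = norm (1 / energy g * cnj (1 / energy g))"

lemma \<Phi>: "\<Phi> \<in> schwartz"
  by (rule matrix_wigner_schwartz[OF g(1) g(1)])

lemma \<sigma>_tempered: "tempered \<sigma>" and \<sigma>_finite: "modulation_norm G \<infinity> 1 \<sigma> < \<infinity>"
  using \<sigma> by (auto simp: modulation_space_def)

lemma symbol_entry_measurable [measurable]: "symbol_entry \<in> borel_measurable borel"
proof -
  have "(\<lambda>z. \<sigma> (tfs z \<Phi>)) \<in> borel_measurable borel"
    by (rule borel_measurable_continuous_onI[OF tempered_tfs_continuous[OF \<sigma>_tempered \<Phi>]])
  from measurable_compose[OF cohen_shift_measurable this] show ?thesis
    unfolding symbol_entry_def[abs_def] .
qed

lemma majorant_measurable [measurable]: "majorant \<in> borel_measurable borel"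
  unfolding majorant_def[abs_def]
  by (rule measurable_compose[OF _ envelope_measurable[OF \<sigma>_tempered G \<Phi>]]) measurable

text \<open>The envelope holds at all positions at once, so the position part of
  \<open>cohen_shift\<close>, which is not a function of w - z, leaves no trace.\<close>

lemma symbol_entry_bound: "ennreal (norm (symbol_entry (w, z))) \<le> majorant (w - z)"
proof -
  have e: "snd (cohen_shift T (w, z)) = (snd (w - z), - fst (w - z))" by (simp add: cohen_shift_def)
  show ?thesis
    unfolding symbol_entry_def majorant_def e[symmetric]
    using envelope_bound[OF \<sigma>_tempered G \<Phi>, of "fst (cohen_shift T (w, z))" "snd (cohen_shift T (w, z))"]
    by (simp only: prod.collapse)
qed

text \<open>The rotation in the argument of the envelope is a reflection followed by an exchange of
  variables, so it preserves the mass.\<close>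

lemma majorant_mass_eq:
  "majorant_mass = ennreal (norm (1 / energy G)) * (modulation_norm G \<infinity> 1 \<sigma> * stf_mass G \<Phi>)"
proof -
  let ?E = "envelope G \<Phi> \<sigma>"
  have E: "?E \<in> borel_measurable borel" by (rule envelope_measurable[OF \<sigma>_tempered G \<Phi>])
  have "majorant_mass = (\<integral>\<^sup>+\<omega>. \<integral>\<^sup>+x. ?E (\<omega>, 0 - x) \<partial>lborel \<partial>lborel)"
    unfolding majorant_mass_def by (subst nn_integral_pair_swap(2)[OF majorant_measurable]) (simp add: majorant_def)
  also have "\<dots> = (\<integral>\<^sup>+\<omega>. \<integral>\<^sup>+x. ?E (\<omega>, x) \<partial>lborel \<partial>lborel)"
    by (intro nn_integral_cong nn_integral_translate(3) borel_pair_measurable(3)[OF E])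
  also have "\<dots> = (\<integral>\<^sup>+\<zeta>. ?E \<zeta> \<partial>lborel)" by (rule nn_integral_pair_swap(1)[OF E, symmetric])
  also have "\<dots> = ennreal (norm (1 / energy G)) * (modulation_norm G \<infinity> 1 \<sigma> * stf_mass G \<Phi>)"
    by (rule envelope_mass[OF \<sigma>_tempered G \<Phi>])
  finally show ?thesis .
qed

lemma majorant_mass_finite: "majorant_mass < \<infinity>"
  using \<sigma>_finite stf_mass_finite[OF G(1) \<Phi>] by (simp add: majorant_mass_eq ennreal_mult_less_top)

lemma norm_form_integrand:
  "norm (cnj (wigner_coeff T g l k v) * symbol_entry v) = coeff * (norm (l (fst v)) * norm (k (snd v))) * norm (symbol_entry v)"
  by (simp only: wigner_coeff_def coeff_def norm_mult complex_mod_cnj norm_cohen_phase mult_1_right)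

lemma coeff_nonneg: "coeff \<ge> 0"
  by (simp add: coeff_def)

lemma form_integrand_measurable:
  assumes [measurable]: "k \<in> borel_measurable borel" "l \<in> borel_measurable borel"
  shows "(\<lambda>v. cnj (wigner_coeff T g l k v) * symbol_entry v) \<in> borel_measurable borel"
  unfolding wigner_coeff_def by measurable

text \<open>Stated for arbitrary measurable coefficients and in extended reals, so that it serves
  both for the absolute convergence of \<open>form\<close> and for the estimate in the mixed norm.
  The substitution z = w - d creates the convolution.\<close>

lemma form_integrand_le:
  assumes k [measurable]: "k \<in> borel_measurable borel" and l [measurable]: "l \<in> borel_measurable borel"
  shows "(\<integral>\<^sup>+v. ennreal (norm (cnj (wigner_coeff T g l k v) * symbol_entry v)) \<partial>lborel) \<le>
    ennreal coeff * (\<integral>\<^sup>+w. ennreal (norm (l w)) * (\<integral>\<^sup>+d. ennreal (norm (k (w - d))) * majorant d \<partial>lborel) \<partial>lborel)"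
proof -
  let ?I = "\<lambda>v. ennreal (norm (cnj (wigner_coeff T g l k v) * symbol_entry v))"
  have m: "?I \<in> borel_measurable borel"
    using form_integrand_measurable[OF k l] by measurable
  have "(\<integral>\<^sup>+v. ?I v \<partial>lborel) = (\<integral>\<^sup>+w. \<integral>\<^sup>+z. ?I (w, z) \<partial>lborel \<partial>lborel)"
    by (rule nn_integral_pair_swap(1)[OF m])
  also have "\<dots> \<le> (\<integral>\<^sup>+w. ennreal coeff * (ennreal (norm (l w)) * (\<integral>\<^sup>+d. ennreal (norm (k (w - d))) * majorant d \<partial>lborel)) \<partial>lborel)"
  proof (rule nn_integral_mono)
    fix w :: "(real^'d) \<times> (real^'d)"
    have "(\<integral>\<^sup>+z. ?I (w, z) \<partial>lborel) \<le>
        (\<integral>\<^sup>+z. (ennreal coeff * ennreal (norm (l w))) * (ennreal (norm (k z)) * majorant (w - z)) \<partial>lborel)"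
    proof (rule nn_integral_mono)
      fix z :: "(real^'d) \<times> (real^'d)"
      have "?I (w, z) = (ennreal coeff * ennreal (norm (l w))) * (ennreal (norm (k z)) * ennreal (norm (symbol_entry (w, z))))"
        unfolding norm_form_integrand fst_conv snd_conv
        by (simp add: ennreal_mult coeff_nonneg mult_ac)
      also have "\<dots> \<le> (ennreal coeff * ennreal (norm (l w))) * (ennreal (norm (k z)) * majorant (w - z))"
        by (intro mult_left_mono symbol_entry_bound) auto
      finally show "?I (w, z) \<le> (ennreal coeff * ennreal (norm (l w))) * (ennreal (norm (k z)) * majorant (w - z))" .
    qed
    also have "\<dots> = (ennreal coeff * ennreal (norm (l w))) * (\<integral>\<^sup>+z. ennreal (norm (k z)) * majorant (w - z) \<partial>lborel)"
      by (rule nn_integral_cmult) measurable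
    also have "(\<integral>\<^sup>+z. ennreal (norm (k z)) * majorant (w - z) \<partial>lborel) = (\<integral>\<^sup>+d. ennreal (norm (k (w - d))) * majorant d \<partial>lborel)"
      using nn_integral_translate(3)[of "\<lambda>z. ennreal (norm (k z)) * majorant (w - z)" w] by simp
    finally show "(\<integral>\<^sup>+z. ?I (w, z) \<partial>lborel) \<le>
        ennreal coeff * (ennreal (norm (l w)) * (\<integral>\<^sup>+d. ennreal (norm (k (w - d))) * majorant d \<partial>lborel))"
      by (simp add: mult.assoc)
  qed
  also have "\<dots> = ennreal coeff * (\<integral>\<^sup>+w. ennreal (norm (l w)) * (\<integral>\<^sup>+d. ennreal (norm (k (w - d))) * majorant d \<partial>lborel) \<partial>lborel)"
    by (rule nn_integral_cmult) measurable
  finally show ?thesis .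
qed

definition form_const :: real where
  "form_const = coeff * enn2real majorant_mass"

lemma form_const_nonneg: "form_const \<ge> 0"
  by (simp add: form_const_def coeff_nonneg)

text \<open>For a bounded k, the convolution with the majorant is at most M times its mass,
  uniformly in w, so integrability of l is all that remains to be used.\<close>

lemma form_bound:
  assumes k [measurable]: "k \<in> borel_measurable borel" and M: "\<And>z. norm (k z) \<le> M" and l: "integrable lborel l"
  shows "integrable lborel (\<lambda>v. cnj (wigner_coeff T g l k v) * symbol_entry v)"
    and "norm (form k l) \<le> form_const * M * (LINT w|lborel. norm (l w))"
proof -
  have lm [measurable]: "l \<in> borel_measurable borel" using l by auto
  have M0: "M \<ge> 0" using order_trans[OF norm_ge_zero M] .
  have "(\<integral>\<^sup>+v. ennreal (norm (cnj (wigner_coeff T g l k v) * symbol_entry v)) \<partial>lborel) \<le>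
    ennreal coeff * (\<integral>\<^sup>+w. ennreal (norm (l w)) * (\<integral>\<^sup>+d. ennreal (norm (k (w - d))) * majorant d \<partial>lborel) \<partial>lborel)"
    by (rule form_integrand_le) measurable
  also have "\<dots> \<le> ennreal coeff * (\<integral>\<^sup>+w. ennreal (norm (l w)) * (\<integral>\<^sup>+d. ennreal M * majorant d \<partial>lborel) \<partial>lborel)"
    by (intro mult_left_mono nn_integral_mono mult_right_mono ennreal_leI M) auto
  also have "\<dots> = ennreal coeff * ((\<integral>\<^sup>+w. ennreal (norm (l w)) \<partial>lborel) * (ennreal M * majorant_mass))"
    by (simp add: nn_integral_cmult nn_integral_multc majorant_mass_def)
  also have "(\<integral>\<^sup>+w. ennreal (norm (l w)) \<partial>lborel) = ennreal (LINT w|lborel. norm (l w))"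
    using l by (intro nn_integral_eq_integral) auto
  also have "majorant_mass = ennreal (enn2real majorant_mass)" using majorant_mass_finite by simp
  also have "ennreal coeff * (ennreal (LINT w|lborel. norm (l w)) * (ennreal M * ennreal (enn2real majorant_mass))) =
      ennreal (form_const * M * (LINT w|lborel. norm (l w)))"
    using M0 coeff_nonneg by (simp add: ennreal_mult[symmetric] form_const_def mult_ac)
  finally have le: "(\<integral>\<^sup>+v. ennreal (norm (cnj (wigner_coeff T g l k v) * symbol_entry v)) \<partial>lborel) \<le>
      ennreal (form_const * M * (LINT w|lborel. norm (l w)))" .
  show i: "integrable lborel (\<lambda>v. cnj (wigner_coeff T g l k v) * symbol_entry v)"
    by (rule integrableI_bounded) (use form_integrand_measurable[OF k lm] le_less_trans[OF le ennreal_less_top] in auto)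
  from order_trans[OF integral_norm_bound_ennreal[OF i] le]
  show "norm (form k l) \<le> form_const * M * (LINT w|lborel. norm (l w))"
    unfolding form_def
    by (subst (asm) ennreal_le_iff) (intro mult_nonneg_nonneg form_const_nonneg M0 Bochner_Integration.integral_nonneg, auto)
qed

lemma form_linear_snd:
  assumes k: "k \<in> borel_measurable borel" "\<And>z. norm (k z) \<le> M" and l: "integrable lborel l" "integrable lborel l'"
  shows "form k (\<lambda>w. a * l w + b * l' w) = cnj a * form k l + cnj b * form k l'"
proof -
  have "form k (\<lambda>w. a * l w + b * l' w) = (LINT v|lborel. cnj a * (cnj (wigner_coeff T g l k v) * symbol_entry v) +
      cnj b * (cnj (wigner_coeff T g l' k v) * symbol_entry v))"
    unfolding form_def by (intro Bochner_Integration.integral_cong refl) (simp add: wigner_coeff_def algebra_simps)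
  also have "\<dots> = cnj a * form k l + cnj b * form k l'"
    unfolding form_def integral_mult_right_zero[symmetric]
    by (intro Bochner_Integration.integral_add integrable_mult_right form_bound(1)[OF k] l)
  finally show ?thesis .
qed

lemma form_linear_fst:
  assumes k: "k \<in> borel_measurable borel" "\<And>z. norm (k z) \<le> M" and k': "k' \<in> borel_measurable borel" "\<And>z. norm (k' z) \<le> M'"
    and l: "integrable lborel l"
  shows "form (\<lambda>z. a * k z + b * k' z) l = a * form k l + b * form k' l"
proof -
  have "form (\<lambda>z. a * k z + b * k' z) l = (LINT v|lborel. a * (cnj (wigner_coeff T g l k v) * symbol_entry v) +
      b * (cnj (wigner_coeff T g l k' v) * symbol_entry v))"
    unfolding form_def by (intro Bochner_Integration.integral_cong refl) (simp add: wigner_coeff_def algebra_simps)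
  also have "\<dots> = a * form k l + b * form k' l"
    unfolding form_def integral_mult_right_zero[symmetric]
    by (intro Bochner_Integration.integral_add integrable_mult_right form_bound(1)[OF k l] form_bound(1)[OF k' l])
  finally show ?thesis .
qed

lemma form_lipschitz:
  assumes k: "k \<in> borel_measurable borel" "\<And>z. norm (k z) \<le> M" and l: "integrable lborel l" "integrable lborel l'"
  shows "norm (form k l - form k l') \<le> (form_const * M) * (LINT w|lborel. norm (l w - l' w))"
  using form_linear_snd[OF k l, of 1 "-1"] form_bound(2)[OF k Bochner_Integration.integrable_diff[OF l]] by simp

lemma stf_linear:
  assumes "\<phi> \<in> schwartz" "\<psi> \<in> schwartz"
  shows "stf g (\<lambda>x. a * \<phi> x + b * \<psi> x) = (\<lambda>z. a * stf g \<phi> z + b * stf g \<psi> z)"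
proof
  fix z
  have i: "integrable lborel (\<lambda>t. \<phi> t * cnj (tfs z g t))" "integrable lborel (\<lambda>t. \<psi> t * cnj (tfs z g t))"
    by (intro stf_integrand_integrable schwartz_integrable assms g)+
  have "stf g (\<lambda>x. a * \<phi> x + b * \<psi> x) z = (LINT t|lborel. a * (\<phi> t * cnj (tfs z g t)) + b * (\<psi> t * cnj (tfs z g t)))"
    unfolding stf_def by (intro Bochner_Integration.integral_cong refl) (simp add: algebra_simps)
  also have "\<dots> = a * stf g \<phi> z + b * stf g \<psi> z"
    unfolding stf_def integral_mult_right_zero[symmetric]
    by (intro Bochner_Integration.integral_add integrable_mult_right i)
  finally show "stf g (\<lambda>x. a * \<phi> x + b * \<psi> x) z = a * stf g \<phi> z + b * stf g \<psi> z" .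
qed

lemma stf_integrable: "\<phi> \<in> schwartz \<Longrightarrow> integrable lborel (stf g \<phi>)"
  by (intro schwartz_integrable stf_schwartz g)

lemma extension_eq: "\<phi> \<in> schwartz \<Longrightarrow> extension u \<phi> = form (\<lambda>z. u (tfs z g)) (stf g \<phi>)"
  by (simp add: extension_def)

lemma stft_measurable: "tempered u \<Longrightarrow> (\<lambda>z. u (tfs z g)) \<in> borel_measurable borel"
  by (rule borel_measurable_continuous_onI[OF tempered_tfs_continuous[OF _ g(1)]])

text \<open>Continuity comes from \<open>stf_wgt_bound\<close>: the L^1 norm of V_g \<phi> is at
  most a constant times a Schwartz seminorm of \<phi>.\<close>

lemma extension_tempered:
  assumes u: "tempered u" and M: "\<And>z. norm (u (tfs z g)) \<le> M"
  shows "tempered (extension u)"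
  unfolding tempered_def
proof (intro conjI allI impI ballI)
  show "extension u \<phi> = 0" if "\<phi> \<notin> schwartz" for \<phi> using that by (simp add: extension_def)
next
  fix \<phi> \<psi> :: "real^'d \<Rightarrow> complex" and a b assume *: "\<phi> \<in> schwartz" "\<psi> \<in> schwartz"
  have "(\<lambda>x. a * \<phi> x + b * \<psi> x) \<in> schwartz" by (intro schwartz_add schwartz_scale *)
  then show "extension u (\<lambda>x. a * \<phi> x + b * \<psi> x) = cnj a * extension u \<phi> + cnj b * extension u \<psi>"
    by (simp add: extension_eq * stf_linear form_linear_snd[OF stft_measurable[OF u] M stf_integrable stf_integrable])
next
  obtain N C where C: "C \<ge> 0" "\<And>\<phi> x \<omega>. \<phi> \<in> schwartz \<Longrightarrow> norm (stf g \<phi> (x, \<omega>)) \<le> C * schwartz_seminorm N \<phi> * (wgt x * wgt \<omega>)"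
    using stf_wgt_bound[OF g(1)] by metis
  let ?W = "\<lambda>z :: (real^'d) \<times> (real^'d). wgt (fst z) * wgt (snd z)"
  have "integrable lborel (\<lambda>z :: (real^'d) \<times> (real^'d). complex_of_real (wgt (fst z)) * complex_of_real (wgt (snd z)))"
    by (intro lborel_integral_pair_mult(1) integrable_of_real wgt_integrable)
  then have W: "integrable lborel ?W"
    unfolding of_real_mult[symmetric] complex_of_real_integrable_eq .
  have M0: "M \<ge> 0" using order_trans[OF norm_ge_zero M] .
  have "norm (extension u \<phi>) \<le> (form_const * M * (C * (LINT z|lborel. ?W z))) * schwartz_seminorm N \<phi>" if \<phi>: "\<phi> \<in> schwartz" for \<phi>
  proof -
    have "norm (extension u \<phi>) \<le> form_const * M * (LINT w|lborel. norm (stf g \<phi> w))"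
      unfolding extension_eq[OF \<phi>] by (rule form_bound(2)[OF stft_measurable[OF u] M stf_integrable[OF \<phi>]])
    also have "\<dots> \<le> form_const * M * (LINT w|lborel. C * schwartz_seminorm N \<phi> * ?W w)"
    proof (intro mult_left_mono mult_nonneg_nonneg form_const_nonneg M0 integral_mono)
      show "norm (stf g \<phi> w) \<le> C * schwartz_seminorm N \<phi> * ?W w" for w
        using C(2)[OF \<phi>, of "fst w" "snd w"] by simp
    qed (use stf_integrable[OF \<phi>] W in auto)
    also have "\<dots> = (form_const * M * (C * (LINT z|lborel. ?W z))) * schwartz_seminorm N \<phi>" by simp
    finally show ?thesis .
  qed
  then show "\<exists>N C. \<forall>\<phi>\<in>schwartz. norm (extension u \<phi>) \<le> C * schwartz_seminorm N \<phi>" by blast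
qed

text \<open>The L^1 norm of the transform of a shifted window does not depend on the shift, so the
  bound is uniform in \<open>W\<close>.\<close>

theorem extension_bounded:
  assumes u: "tempered u" and M: "\<And>z. norm (u (tfs z g)) \<le> M"
  shows "norm (extension u (tfs W g)) \<le> form_const * M * (LINT w|lborel. norm (stf g g w))"
proof -
  have S: "tfs W g \<in> schwartz" by (rule tfs_schwartz[OF g(1)])
  have "norm (extension u (tfs W g)) \<le> form_const * M * (LINT w|lborel. norm (stf g (tfs W g) w))"
    unfolding extension_eq[OF S] by (rule form_bound(2)[OF stft_measurable[OF u] M stf_integrable[OF S]])
  also have "(LINT w|lborel. norm (stf g (tfs W g) w)) = (LINT w|lborel. norm (stf g g (w - W)))"
    by (simp add: norm_stf_tfs[OF g(1) g(1)])
  also have "\<dots> = (LINT w|lborel. norm (stf g g w))"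
    using integral_translate(2)[of "\<lambda>w. complex_of_real (norm (stf g g w))" W]
      schwartz_measurable[OF stf_schwartz[OF g(1) g(1)]] by simp
  finally show ?thesis .
qed

text \<open>Two convolutions occur: one with the majorant of the matrix, and one with |V_g g|,
  because the transform of the test function \<open>tfs W g\<close> is a translate of V_g g up to a
  phase and not concentrated at one point. Each costs the L^1 norm of its kernel.\<close>

theorem extension_wiener:
  assumes u: "tempered u" and M: "\<And>z. norm (u (tfs z g)) \<le> M" and pq: "1 \<le> p" "1 \<le> q"
  shows "wiener_norm g p q (extension u) \<le> ennreal coeff * (stf_mass g g * (majorant_mass * wiener_norm g p q u))"
proof -
  let ?V = "\<lambda>z. ennreal (norm (u (tfs z g)))"
  have Vm0: "(\<lambda>z. u (tfs z g)) \<in> borel_measurable borel" by (rule stft_measurable[OF u])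
  define V where "V z = ?V z" for z
  have [measurable]: "V \<in> borel_measurable borel" unfolding V_def[abs_def] using Vm0 by measurable
  \<comment> \<open>The reflection makes the integral against the translate of |V_g g| a
    convolution.\<close>
  define \<kappa> where "\<kappa> v = ennreal (norm (stf g g (0 - v)))" for v
  have sg: "stf g g \<in> borel_measurable borel" by (rule schwartz_measurable[OF stf_schwartz[OF g(1) g(1)]])
  have [measurable]: "\<kappa> \<in> borel_measurable borel"
    unfolding \<kappa>_def[abs_def] using measurable_compose[OF _ sg, of "\<lambda>v. 0 - v" borel] by simp
  define F where "F w = (\<integral>\<^sup>+d. V (w - d) * majorant d \<partial>lborel)" for w
  have [measurable]: "F \<in> borel_measurable borel" unfolding F_def[abs_def] by measurable
  define F2 where "F2 W = (\<integral>\<^sup>+v. F (W - v) * \<kappa> v \<partial>lborel)" for W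
  have [measurable]: "F2 \<in> borel_measurable borel" unfolding F2_def[abs_def] by measurable
  have pointwise: "ennreal (norm (extension u (tfs W g))) \<le> ennreal coeff * F2 W" for W
  proof -
    have S: "tfs W g \<in> schwartz" by (rule tfs_schwartz[OF g(1)])
    have sW: "stf g (tfs W g) \<in> borel_measurable borel" by (rule schwartz_measurable[OF stf_schwartz[OF g(1) S]])
    let ?I = "\<lambda>v. cnj (wigner_coeff T g (stf g (tfs W g)) (\<lambda>z. u (tfs z g)) v) * symbol_entry v"
    have "ennreal (norm (extension u (tfs W g))) \<le> (\<integral>\<^sup>+v. ennreal (norm (?I v)) \<partial>lborel)"
    proof (cases "integrable lborel ?I")
      case True
      from integral_norm_bound_ennreal[OF this] show ?thesis by (simp add: extension_eq[OF S] form_def)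
    next
      case False
      then show ?thesis by (simp add: extension_eq[OF S] form_def not_integrable_integral_eq)
    qed
    also have "\<dots> \<le> ennreal coeff * (\<integral>\<^sup>+w. ennreal (norm (stf g (tfs W g) w)) * F w \<partial>lborel)"
      using form_integrand_le[OF Vm0 sW] unfolding F_def V_def .
    also have "(\<integral>\<^sup>+w. ennreal (norm (stf g (tfs W g) w)) * F w \<partial>lborel) = (\<integral>\<^sup>+w. F w * \<kappa> (W - w) \<partial>lborel)"
      by (simp add: norm_stf_tfs[OF g(1) g(1)] \<kappa>_def mult.commute)
    also have "\<dots> = F2 W"
      using nn_integral_translate(3)[of "\<lambda>w. F w * \<kappa> (W - w)" W] by (simp add: F2_def)
    finally show ?thesis .
  qed
  have "wiener_norm g p q (extension u) = mixed_norm p q (\<lambda>W. ennreal (norm (extension u (tfs W g))))"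
    by (rule wiener_norm_eq)
  also have "\<dots> \<le> mixed_norm p q (\<lambda>W. ennreal coeff * F2 W)"
    by (intro mixed_norm_mono pq pointwise tempered_norm_measurable[OF extension_tempered[OF u M] g g(1)])
  also have "\<dots> \<le> ennreal coeff * mixed_norm p q F2" by (intro mixed_norm_cmult pq) measurable
  also have "mixed_norm p q F2 \<le> (\<integral>\<^sup>+v. \<kappa> v \<partial>lborel) * mixed_norm p q F"
    unfolding F2_def[abs_def] by (intro mixed_norm_convolution pq) measurable
  also have "mixed_norm p q F \<le> majorant_mass * mixed_norm p q V"
    unfolding F_def[abs_def] majorant_mass_def by (intro mixed_norm_convolution pq) measurable
  also have "(\<integral>\<^sup>+v. \<kappa> v \<partial>lborel) = stf_mass g g"
    unfolding \<kappa>_def stf_mass_def by (rule nn_integral_translate(3)) (use sg in measurable)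
  finally show ?thesis
    unfolding wiener_norm_eq[of _ _ _ u] V_def[abs_def] by (simp add: mult_left_mono)
qed

end

section \<open>Agreement with \<open>op_A\<close>, linearity and the operator norm\<close>

context cohen_operator
begin

text \<open>The extension solves the identity that describes \<open>op_A\<close>, since both
  pairings are equal to the same \<open>form\<close>. A second solution has the same pairings with
  Schwartz functions, and these are its values.\<close>

lemma extension_M1:
  assumes f: "f \<in> M1 g"
  shows "extension (distr_of_fun f) = op_A g G (cohen_matrix T) \<sigma> f"
proof -
  have f': "continuous_on UNIV f" "integrable lborel f" "integrable lborel (stf g f)"
    using f g by (auto simp: M1_iff)
  let ?u = "distr_of_fun f" and ?A = "cohen_matrix T"
  have u: "tempered ?u" by (rule tempered_distr_of_fun[OF f'(2)])
  have V: "(\<lambda>z. ?u (tfs z g)) = stf g f"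
    by (auto simp: distr_of_fun_schwartz tfs_schwartz g stf_def)
  obtain M where M: "\<And>z. norm (stf g f z) \<le> M" using stf_bounded[OF f'(2) g(1)] by metis
  have uM: "norm (?u (tfs z g)) \<le> M" for z using M[of z] fun_cong[OF V, of z] by simp
  have fm: "stf g f \<in> borel_measurable borel" using f' by auto
  obtain M\<sigma> where M\<sigma>: "\<And>z. norm (\<sigma> (tfs z G)) \<le> M\<sigma>"
    using sjostrand_bounded[OF \<sigma>_tempered G \<sigma>_finite] by metis
  have h: "extension ?u \<in> modulation_space g \<infinity> \<infinity>"
    by (rule bounded_modulation_infinity[OF extension_tempered[OF u uM] g extension_bounded[OF u uM]])
  have dual: "duality g (extension ?u) \<phi> = duality G \<sigma> (matrix_wigner ?A \<phi> f)" if \<phi>: "\<phi> \<in> M1 g" for \<phi>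
  proof -
    have \<phi>': "integrable lborel (stf g \<phi>)" using \<phi> g by (auto simp: M1_iff)
    have "duality g (extension ?u) \<phi> = form (stf g f) (stf g \<phi>)"
    proof (rule duality_extension[OF g \<phi>])
      show "extension ?u \<psi> = form (stf g f) (stf g \<psi>)" if "\<psi> \<in> schwartz" for \<psi>
        using extension_eq[OF that, of ?u] unfolding V .
    qed (rule form_lipschitz[OF fm M])
    \<comment> \<open>The right-hand pairing is evaluated through the expansion of the matrix-Wigner
      distribution in shifts of \<Phi>.\<close>
    moreover have "superposition (wigner_coeff T g (stf g \<phi>) (stf g f)) (cohen_shift T) \<Phi> G"
      by unfold_locales (auto intro: wigner_coeff_integrable \<phi>' f' \<Phi> G)
    from superposition.duality_synth[OF this \<sigma>_tempered M\<sigma> G(2)]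
    have "duality G \<sigma> (matrix_wigner ?A \<phi> f) = form (stf g f) (stf g \<phi>)"
      unfolding matrix_wigner_M1[OF g \<phi> f] form_def symbol_entry_def .
    ultimately show ?thesis by simp
  qed
  show ?thesis
    unfolding op_A_def
  proof (rule the_equality[symmetric])
    show "extension ?u \<in> modulation_space g \<infinity> \<infinity> \<and> (\<forall>\<phi>\<in>M1 g. duality g (extension ?u) \<phi> = duality G \<sigma> (matrix_wigner ?A \<phi> f))"
      using h dual by blast
    fix k assume k: "k \<in> modulation_space g \<infinity> \<infinity> \<and> (\<forall>\<phi>\<in>M1 g. duality g k \<phi> = duality G \<sigma> (matrix_wigner ?A \<phi> f))"
    then have kt: "tempered k" and kf: "modulation_norm g \<infinity> \<infinity> k < \<infinity>" by (auto simp: modulation_space_def)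
    obtain Mk where Mk: "\<And>z. norm (k (tfs z g)) \<le> Mk"
      using modulation_infinity_bounded[OF kt g kf] by metis
    \<comment> \<open>Outside the Schwartz space both distributions are 0 by the encoding, so
      equality on Schwartz functions is equality.\<close>
    have "k \<phi> = extension ?u \<phi>" for \<phi>
    proof (cases "\<phi> \<in> schwartz")
      case True
      have \<phi>: "\<phi> \<in> M1 g" by (rule schwartz_M1[OF g(1) True])
      have "k \<phi> = duality g k \<phi>" by (rule duality_schwartz[OF kt Mk g True, symmetric])
      also have "\<dots> = duality g (extension ?u) \<phi>" using k \<phi> dual by simp
      also have "\<dots> = extension ?u \<phi>"
        by (rule duality_schwartz[OF extension_tempered[OF u uM] extension_bounded[OF u uM] g True])
      finally show ?thesis .
    next
      case False
      then show ?thesis using tempered_outside[OF kt] by (simp add: extension_def)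
    qed
    then show "k = extension ?u" by (rule ext)
  qed
qed

lemma extension_linear_map:
  assumes pq: "1 \<le> p" "1 \<le> q"
  shows "linear_map_on (wiener_space g p q) extension"
  unfolding linear_map_on_def
proof (intro conjI ballI allI)
  have bounded: "\<exists>M. \<forall>z. norm (u (tfs z g)) \<le> M" if "u \<in> wiener_space g p q" for u
  proof -
    from that have "tempered u" "wiener_norm g p q u < \<infinity>" by (auto simp: wiener_space_def)
    from wiener_bounded[OF this(1) g pq this(2)] show ?thesis by blast
  qed
  fix u assume u: "u \<in> wiener_space g p q"
  then have ut: "tempered u" and uf: "wiener_norm g p q u < \<infinity>" by (auto simp: wiener_space_def)
  from bounded[OF u] obtain M where M: "\<And>z. norm (u (tfs z g)) \<le> M" by blast
  have "ennreal coeff * (stf_mass g g * (majorant_mass * wiener_norm g p q u)) < \<infinity>"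
    using uf stf_mass_finite[OF g(1) g(1)] majorant_mass_finite by (simp add: ennreal_mult_less_top)
  then have "wiener_norm g p q (extension u) < \<infinity>" by (rule le_less_trans[OF extension_wiener[OF ut M pq]])
  then show "extension u \<in> wiener_space g p q"
    using extension_tempered[OF ut M] by (simp add: wiener_space_def)
  fix v a b assume v: "v \<in> wiener_space g p q"
  then have vt: "tempered v" by (simp add: wiener_space_def)
  from bounded[OF v] obtain M' where M': "\<And>z. norm (v (tfs z g)) \<le> M'" by blast
  show "extension (\<lambda>\<phi>. a * u \<phi> + b * v \<phi>) = (\<lambda>\<phi>. a * extension u \<phi> + b * extension v \<phi>)"
  proof (rule ext)
    fix \<phi>
    show "extension (\<lambda>\<phi>. a * u \<phi> + b * v \<phi>) \<phi> = a * extension u \<phi> + b * extension v \<phi>"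
    proof (cases "\<phi> \<in> schwartz")
      case True
      show ?thesis
        unfolding extension_eq[OF True]
        by (rule form_linear_fst[OF stft_measurable[OF ut] M stft_measurable[OF vt] M' stf_integrable[OF True]])
    qed (simp add: extension_def)
  qed
qed

lemma extension_op_norm:
  assumes pq: "1 \<le> p" "1 \<le> q"
  shows "wiener_op_norm g p q extension \<le> ennreal coeff * (stf_mass g g * majorant_mass)"
  unfolding wiener_op_norm_def
proof (rule SUP_least)
  fix u assume "u \<in> {u \<in> wiener_space g p q. wiener_norm g p q u \<le> 1}"
  then have u: "tempered u" "wiener_norm g p q u < \<infinity>" "wiener_norm g p q u \<le> 1"
    by (auto simp: wiener_space_def)
  obtain M where M: "\<And>z. norm (u (tfs z g)) \<le> M" using wiener_bounded[OF u(1) g pq u(2)] by blast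
  have "wiener_norm g p q (extension u) \<le> ennreal coeff * (stf_mass g g * (majorant_mass * wiener_norm g p q u))"
    by (rule extension_wiener[OF u(1) M pq])
  also have "\<dots> \<le> ennreal coeff * (stf_mass g g * (majorant_mass * 1))"
    by (intro mult_left_mono u) auto
  finally show "wiener_norm g p q (extension u) \<le> ennreal coeff * (stf_mass g g * majorant_mass)" by simp
qed

end

theorem theorem21:
  fixes p q :: ennreal
    and g :: "real^'d \<Rightarrow> complex"
    and G :: "(real^'d) \<times> (real^'d) \<Rightarrow> complex"
    and T :: "real^'d^'d"
    and A :: "real^('d + 'd)^('d + 'd)"
  assumes "1 \<le> p" and "1 \<le> q"
    and "g \<in> schwartz" and "g \<noteq> (\<lambda>_. 0)"
    and "G \<in> schwartz" and "G \<noteq> (\<lambda>_. 0)"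
    and "A = cohen_matrix T"
  shows "\<exists>C::real. C > 0 \<and>
    (\<forall>\<sigma> \<in> modulation_space G \<infinity> 1.
      \<exists>S. linear_map_on (wiener_space g p q) S \<and>
          (\<forall>f \<in> M1 g. S (distr_of_fun f) = op_A g G A \<sigma> f) \<and>
          wiener_op_norm g p q S \<le> ennreal C * modulation_norm G \<infinity> 1 \<sigma>)"
proof -
  let ?\<Phi> = "matrix_wigner (cohen_matrix T) g g"
  \<comment> \<open>The norm of the symbol is factored out of the operator bound; what is left
    depends only on the two windows and T.\<close>
  define C0 where "C0 = ennreal (norm (1 / energy g * cnj (1 / energy g))) *
    (stf_mass g g * (ennreal (norm (1 / energy G)) * stf_mass G ?\<Phi>))"
  have "stf_mass g g < \<infinity>" "stf_mass G ?\<Phi> < \<infinity>"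
    using stf_mass_finite[OF assms(3) assms(3)] stf_mass_finite[OF assms(5) matrix_wigner_schwartz[OF assms(3) assms(3)]]
    by simp_all
  then have C0: "C0 < \<infinity>" by (simp add: C0_def ennreal_mult_less_top)
  show ?thesis
  proof (intro exI[of _ "enn2real C0 + 1"] conjI ballI)
    \<comment> \<open>Adding 1 makes the real constant positive without a lower bound for
      \<open>C0\<close>.\<close>
    show "enn2real C0 + 1 > 0" by (simp add: add_nonneg_pos)
    fix \<sigma> assume \<sigma>: "\<sigma> \<in> modulation_space G \<infinity> 1"
    interpret cohen_operator g G T \<sigma> by unfold_locales (use assms \<sigma> in auto)
    show "\<exists>S. linear_map_on (wiener_space g p q) S \<and>
          (\<forall>f \<in> M1 g. S (distr_of_fun f) = op_A g G A \<sigma> f) \<and>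
          wiener_op_norm g p q S \<le> ennreal (enn2real C0 + 1) * modulation_norm G \<infinity> 1 \<sigma>"
    proof (intro exI[of _ extension] conjI ballI)
      show "linear_map_on (wiener_space g p q) extension" by (rule extension_linear_map[OF assms(1,2)])
      show "extension (distr_of_fun f) = op_A g G A \<sigma> f" if "f \<in> M1 g" for f
        using extension_M1[OF that] assms(7) by simp
      have "wiener_op_norm g p q extension \<le> ennreal coeff * (stf_mass g g * majorant_mass)"
        by (rule extension_op_norm[OF assms(1,2)])
      also have "\<dots> = C0 * modulation_norm G \<infinity> 1 \<sigma>"
        unfolding majorant_mass_eq C0_def coeff_def by (simp only: mult_ac)
      also have "C0 \<le> ennreal (enn2real C0 + 1)"
      proof -
        have "C0 = ennreal (enn2real C0)" using C0 by simp
        also have "\<dots> \<le> ennreal (enn2real C0 + 1)" by (intro ennreal_leI) simp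
        finally show ?thesis .
      qed
      finally show "wiener_op_norm g p q extension \<le> ennreal (enn2real C0 + 1) * modulation_norm G \<infinity> 1 \<sigma>"
        by (simp add: mult_right_mono)
    qed
  qed
qed

end
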